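(* There exist a triangulated category $HP(A)$ (the one defined in the context) whose Grothendieck group is $\mathbf{U}_T$, and an exact bifunctor $$\mathcal{M}: HP(A)\times HP(A)\to HP(A)$$ whose induced map $K_0(\mathcal{M}):\mathbf{U}_T\times\mathbf{U}_T\to\mathbf{U}_T$ on the Grothendieck groups agrees with the multiplication on $\mathbf{U}_T$.
   Context: **The algebra $\mathbf{U}_T$.** $\mathbf{U}_T=\mathbf{U}_T(\mathfrak{sl}(1|1))$ is the associative unital $\mathbb{Z}$-algebra with unit $I$, generators $E,F,T,T^{-1}$ and relations $E^2=F^2=0$, $EF+FE=I-T$, $ET=TE$, $FT=TF$, $TT^{-1}=T^{-1}T=I$. Since $T$ is central, $\mathbf{U}_T$ is a free $\mathbb{Z}[T^{\pm1}]$-module with basis $\mathcal{B}=\{F,I,EF,E\}$. **The $t$-graded DG algebra $A$.** $A$ is the $\mathbb{F}_2$-algebra with idempotents $e(\Gamma)$ for $\Gamma\in\mathcal{B}$ (with $1=\sum_\Gamma e(\Gamma)$), generators $\rho(I,EF)$, $\rho(EF,I)$ and relations $e(\Gamma)e(\Gamma')=\delta_{\Gamma,\Gamma'}e(\Gamma)$; $e(I)\rho(I,EF)=\rho(I,EF)e(EF)=\rho(I,EF)$; $e(EF)\rho(EF,I)=\rho(EF,I)e(I)=\rho(EF,I)$; $\rho(I,EF)\rho(EF,I)=0$. The differential is zero. The grading $\deg=(\deg_h,\deg_t)\in\mathbb{Z}^2$ ($\deg_h$ cohomological, $\deg_t$ the $t$-grading) is $(1,1)$ on $\rho(EF,I)$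 and $(0,0)$ on the other generators. **Categories.** For a $t$-graded DG algebra $R$, $DG(R)$ is the DG category of $t$-graded left DG $R$-modules (morphism complexes consist of $R$-module maps preserving the $t$-degree, of arbitrary cohomological degree). $[1]$ and $\{1\}$ denote the shifts of the cohomological grading and of the $t$-grading, with the convention that the degree-$(0,0)$ generator of a module $P$ has degree $(-k,-m)$ in $P\{m\}[k]$. Let $P(\Gamma)=A\cdot e(\Gamma)$ for $\Gamma\in\mathcal{B}$. $DGP(A)$ is the smallest full subcategory of $DG(A)$ containing all $P(\Gamma)$ and closed under $[1]$, $\{1\}$ (and their inverses) and mapping cones. $HP(A)$ is its $0$th homology category: the same objects, with morphisms the $0$th cohomology of the morphism complexes; it is triangulated. **Grothendieck group.** $K_0(HP(A))$ is a $\mathbb{Z}[T^{\pm1}]$-module via $[M\{1\}]=T[M]$, and the identification $K_0(HP(A))\cong\mathbf{U}_T$ is the isomorphism of free $\mathbb{Z}[T^{\pm1}]$-modules sending $[P(\Gamma)]$ to $\Gamma$ for $\Gamma\in\mathcal{B}$. An exact bifunctor is a bifunctor that is exact (triangulated) in each variable. *)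

theory Defs
  imports "HOL-Library.Z2" "HOL-Computational_Algebra.Formal_Power_Series"
    "HOL-Algebra.Module" "HOL-Algebra.Generated_Groups" "HOL-Algebra.Free_Abelian_Groups"
begin

section \<open>Unital associative algebras given by generators and relations\<close>

text \<open>
  The unital associative ring with generators \<open>'g\<close> and relations \<open>R\<close> is the set of ring
  expressions in the generators modulo the least congruence that contains \<open>R\<close> and the axioms
  of a unital ring.  An \<open>\<bbbF>\<^sub>2\<close>-algebra is the same thing as a ring satisfying \<open>1 + 1 = 0\<close>.
\<close>

datatype 'g expr =
    EZero | EOne | EGen 'g | ENeg "'g expr"
  | EAdd "'g expr" "'g expr" | EMul "'g expr" "'g expr"

inductive pres_eq :: "('g expr \<Rightarrow> 'g expr \<Rightarrow> bool) \<Rightarrow> 'g expr \<Rightarrow> 'g expr \<Rightarrow> bool" for R where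
  pe_rel: "R s t \<Longrightarrow> pres_eq R s t"
| pe_refl: "pres_eq R s s"
| pe_sym: "pres_eq R s t \<Longrightarrow> pres_eq R t s"
| pe_trans: "pres_eq R s t \<Longrightarrow> pres_eq R t u \<Longrightarrow> pres_eq R s u"
| pe_neg_cong: "pres_eq R s s' \<Longrightarrow> pres_eq R (ENeg s) (ENeg s')"
| pe_add_cong: "pres_eq R s s' \<Longrightarrow> pres_eq R t t' \<Longrightarrow> pres_eq R (EAdd s t) (EAdd s' t')"
| pe_mul_cong: "pres_eq R s s' \<Longrightarrow> pres_eq R t t' \<Longrightarrow> pres_eq R (EMul s t) (EMul s' t')"
| pe_add_assoc: "pres_eq R (EAdd (EAdd s t) u) (EAdd s (EAdd t u))"
| pe_add_comm: "pres_eq R (EAdd s t) (EAdd t s)"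
| pe_add_zero: "pres_eq R (EAdd EZero s) s"
| pe_add_neg: "pres_eq R (EAdd (ENeg s) s) EZero"
| pe_mul_assoc: "pres_eq R (EMul (EMul s t) u) (EMul s (EMul t u))"
| pe_one_mul: "pres_eq R (EMul EOne s) s"
| pe_mul_one: "pres_eq R (EMul s EOne) s"
| pe_distrib_right: "pres_eq R (EMul (EAdd s t) u) (EAdd (EMul s u) (EMul t u))"
| pe_distrib_left: "pres_eq R (EMul u (EAdd s t)) (EAdd (EMul u s) (EMul u t))"

lemma equivp_pres_eq: "equivp (pres_eq R)"
  by (rule equivpI)
    (auto intro!: reflpI sympI transpI intro: pe_refl pe_sym pe_trans)

primrec expr_eval :: "('g \<Rightarrow> 'b::ring_1) \<Rightarrow> 'g expr \<Rightarrow> 'b" where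
  "expr_eval v EZero = 0"
| "expr_eval v EOne = 1"
| "expr_eval v (EGen g) = v g"
| "expr_eval v (ENeg s) = - expr_eval v s"
| "expr_eval v (EAdd s t) = expr_eval v s + expr_eval v t"
| "expr_eval v (EMul s t) = expr_eval v s * expr_eval v t"

lemma pres_eq_eval:
  assumes "pres_eq R s t" and "\<And>s t. R s t \<Longrightarrow> expr_eval v s = expr_eval v t"
  shows "expr_eval v s = expr_eval v t"
  using assms(1) by induction (auto simp: assms(2) algebra_simps)

section \<open>The algebra \<open>U\<^sub>T\<close>\<close>

datatype ut_gen = GE | GF | GT | GTinv

inductive ut_rel :: "ut_gen expr \<Rightarrow> ut_gen expr \<Rightarrow> bool" where
  "ut_rel (EMul (EGen GE) (EGen GE)) EZero"
| "ut_rel (EMul (EGen GF) (EGen GF)) EZero"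
| "ut_rel (EAdd (EMul (EGen GE) (EGen GF)) (EMul (EGen GF) (EGen GE)))
     (EAdd EOne (ENeg (EGen GT)))"
| "ut_rel (EMul (EGen GE) (EGen GT)) (EMul (EGen GT) (EGen GE))"
| "ut_rel (EMul (EGen GF) (EGen GT)) (EMul (EGen GT) (EGen GF))"
| "ut_rel (EMul (EGen GT) (EGen GTinv)) EOne"
| "ut_rel (EMul (EGen GTinv) (EGen GT)) EOne"

quotient_type ut = "ut_gen expr" / "pres_eq ut_rel"
  by (rule equivp_pres_eq)

instantiation ut :: ring_1
begin
lift_definition zero_ut :: ut is EZero .
lift_definition one_ut :: ut is EOne .
lift_definition uminus_ut :: "ut \<Rightarrow> ut" is ENeg by (rule pe_neg_cong)
lift_definition plus_ut :: "ut \<Rightarrow> ut \<Rightarrow> ut" is EAdd by (rule pe_add_cong)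
lift_definition minus_ut :: "ut \<Rightarrow> ut \<Rightarrow> ut" is "\<lambda>s t. EAdd s (ENeg t)"
  by (intro pe_add_cong pe_neg_cong)
lift_definition times_ut :: "ut \<Rightarrow> ut \<Rightarrow> ut" is EMul by (rule pe_mul_cong)
instance
proof
  show "(0::ut) \<noteq> 1"
  proof (transfer, rule notI)
    assume "pres_eq ut_rel EZero EOne"
    then have "expr_eval (\<lambda>g. if g = GE \<or> g = GF then 0 else (1::int)) EZero
        = expr_eval (\<lambda>g. if g = GE \<or> g = GF then 0 else 1) EOne"
      by (rule pres_eq_eval) (auto elim: ut_rel.cases)
    then show False by simp
  qed
qed (transfer; blast intro: pres_eq.intros)+
end

lift_definition ut_of :: "ut_gen \<Rightarrow> ut" is EGen .

abbreviation "utE \<equiv> ut_of GE"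
abbreviation "utF \<equiv> ut_of GF"
abbreviation "utT \<equiv> ut_of GT"

datatype idx = IxF | IxI | IxEF | IxE

primrec ut_basis :: "idx \<Rightarrow> ut" where
  "ut_basis IxF = utF"
| "ut_basis IxI = 1"
| "ut_basis IxEF = utE * utF"
| "ut_basis IxE = utE"

definition ut_add_group :: "ut monoid" where
  "ut_add_group = \<lparr>carrier = UNIV, monoid.mult = (+), one = 0\<rparr>"

section \<open>The \<open>t\<close>-graded DG algebra \<open>A\<close>\<close>

text \<open>\<open>GRho1\<close> is \<open>\<rho>(I,EF)\<close> and \<open>GRho2\<close> is \<open>\<rho>(EF,I)\<close>.\<close>

datatype alg_gen = GId idx | GRho1 | GRho2

inductive alg_rel :: "alg_gen expr \<Rightarrow> alg_gen expr \<Rightarrow> bool" where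
  "alg_rel (EAdd EOne EOne) EZero"
| "alg_rel EOne (EAdd (EAdd (EGen (GId IxF)) (EGen (GId IxI)))
                      (EAdd (EGen (GId IxEF)) (EGen (GId IxE))))"
| "alg_rel (EMul (EGen (GId x)) (EGen (GId y))) (if x = y then EGen (GId x) else EZero)"
| "alg_rel (EMul (EGen (GId IxI)) (EGen GRho1)) (EGen GRho1)"
| "alg_rel (EMul (EGen GRho1) (EGen (GId IxEF))) (EGen GRho1)"
| "alg_rel (EMul (EGen (GId IxEF)) (EGen GRho2)) (EGen GRho2)"
| "alg_rel (EMul (EGen GRho2) (EGen (GId IxI))) (EGen GRho2)"
| "alg_rel (EMul (EGen GRho1) (EGen GRho2)) EZero"

quotient_type alg = "alg_gen expr" / "pres_eq alg_rel"
  by (rule equivp_pres_eq)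

instantiation alg :: ring_1
begin
lift_definition zero_alg :: alg is EZero .
lift_definition one_alg :: alg is EOne .
lift_definition uminus_alg :: "alg \<Rightarrow> alg" is ENeg by (rule pe_neg_cong)
lift_definition plus_alg :: "alg \<Rightarrow> alg \<Rightarrow> alg" is EAdd by (rule pe_add_cong)
lift_definition minus_alg :: "alg \<Rightarrow> alg \<Rightarrow> alg" is "\<lambda>s t. EAdd s (ENeg t)"
  by (intro pe_add_cong pe_neg_cong)
lift_definition times_alg :: "alg \<Rightarrow> alg \<Rightarrow> alg" is EMul by (rule pe_mul_cong)
instance
proof
  show "(0::alg) \<noteq> 1"
  proof (transfer, rule notI)
    assume "pres_eq alg_rel EZero EOne"
    then have "expr_eval (\<lambda>g. if g = GId IxF then (1::bit) else 0) EZero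
        = expr_eval (\<lambda>g. if g = GId IxF then 1 else 0) EOne"
      by (rule pres_eq_eval) (auto elim!: alg_rel.cases)
    then show False by simp
  qed
qed (transfer; blast intro: pres_eq.intros)+
end

lift_definition alg_of :: "alg_gen \<Rightarrow> alg" is EGen .

fun gen_deg :: "alg_gen \<Rightarrow> int \<times> int" where
  "gen_deg GRho2 = (1, 1)"
| "gen_deg _ = (0, 0)"

text \<open>
  Bidegrees are pairs \<open>(cohomological degree, t-degree)\<close>.  The grading of \<open>A\<close> determined by the
  degrees of the generators: \<open>alg_homog\<close> is the least family of additive subgroups for which the
  generators are homogeneous of the given degrees and the multiplication is additive on degrees.
\<close>

inductive_set alg_homog_rel :: "((int \<times> int) \<times> alg) set" where
  ah_zero: "(d, 0) \<in> alg_homog_rel"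
| ah_one: "((0, 0), 1) \<in> alg_homog_rel"
| ah_gen: "(gen_deg g, alg_of g) \<in> alg_homog_rel"
| ah_neg: "(d, a) \<in> alg_homog_rel \<Longrightarrow> (d, - a) \<in> alg_homog_rel"
| ah_add: "(d, a) \<in> alg_homog_rel \<Longrightarrow> (d, b) \<in> alg_homog_rel \<Longrightarrow> (d, a + b) \<in> alg_homog_rel"
| ah_mul: "((i, j), a) \<in> alg_homog_rel \<Longrightarrow> ((i', j'), b) \<in> alg_homog_rel
    \<Longrightarrow> ((i + i', j + j'), a * b) \<in> alg_homog_rel"

definition alg_homog :: "int \<times> int \<Rightarrow> alg set" where
  "alg_homog d = {a. (d, a) \<in> alg_homog_rel}"

record 'r dg_algebra =
  dga_homog :: "int \<times> int \<Rightarrow> 'r set"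
  dga_diff :: "'r \<Rightarrow> 'r"

definition dgA :: "alg dg_algebra" where
  "dgA = \<lparr>dga_homog = alg_homog, dga_diff = (\<lambda>_. 0)\<rparr>"

section \<open>\<open>t\<close>-graded left DG modules\<close>

text \<open>
  Everything is over \<open>\<bbbF>\<^sub>2\<close> (the base ring satisfies \<open>1 + 1 = 0\<close>), so no signs appear in the
  Leibniz rule, the morphism complexes, the shift and the cone.  The fields \<^const>\<open>monoid.mult\<close> and
  \<^const>\<open>one\<close> inherited from the module record of HOL-Algebra carry no meaning.
\<close>

record ('r, 'm) dg_mod = "('r, 'm) module" +
  homog :: "int \<times> int \<Rightarrow> 'm set"
  diff :: "'m \<Rightarrow> 'm"

definition direct_sum_grading :: "('m, 'x) ring_scheme \<Rightarrow> ('d \<Rightarrow> 'm set) \<Rightarrow> bool" where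
  "direct_sum_grading M H \<longleftrightarrow>
     (\<forall>d. subgroup (H d) (add_monoid M)) \<and>
     (\<forall>x \<in> carrier M. \<exists>!c. (\<forall>d. c d \<in> H d) \<and> finite {d. c d \<noteq> \<zero>\<^bsub>M\<^esub>} \<and>
        finsum M c {d. c d \<noteq> \<zero>\<^bsub>M\<^esub>} = x)"

definition dg_module :: "'r::ring_1 dg_algebra \<Rightarrow> ('r, 'm) dg_mod \<Rightarrow> bool" where
  "dg_module R M \<longleftrightarrow>
     abelian_group M \<and>
     (\<forall>r. \<forall>x \<in> carrier M. r \<odot>\<^bsub>M\<^esub> x \<in> carrier M) \<and>
     (\<forall>x \<in> carrier M. 1 \<odot>\<^bsub>M\<^esub> x = x) \<and>
     (\<forall>r s. \<forall>x \<in> carrier M. (r * s) \<odot>\<^bsub>M\<^esub> x = r \<odot>\<^bsub>M\<^esub> (s \<odot>\<^bsub>M\<^esub> x)) \<and>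
     (\<forall>r s. \<forall>x \<in> carrier M. (r + s) \<odot>\<^bsub>M\<^esub> x = (r \<odot>\<^bsub>M\<^esub> x) \<oplus>\<^bsub>M\<^esub> (s \<odot>\<^bsub>M\<^esub> x)) \<and>
     (\<forall>r. \<forall>x \<in> carrier M. \<forall>y \<in> carrier M.
        r \<odot>\<^bsub>M\<^esub> (x \<oplus>\<^bsub>M\<^esub> y) = (r \<odot>\<^bsub>M\<^esub> x) \<oplus>\<^bsub>M\<^esub> (r \<odot>\<^bsub>M\<^esub> y)) \<and>
     direct_sum_grading M (homog M) \<and>
     (\<forall>i j i' j'. \<forall>r \<in> dga_homog R (i, j). \<forall>x \<in> homog M (i', j').
        r \<odot>\<^bsub>M\<^esub> x \<in> homog M (i + i', j + j')) \<and>
     (\<forall>x \<in> carrier M. diff M x \<in> carrier M) \<and>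
     (\<forall>x \<in> carrier M. \<forall>y \<in> carrier M. diff M (x \<oplus>\<^bsub>M\<^esub> y) = diff M x \<oplus>\<^bsub>M\<^esub> diff M y) \<and>
     (\<forall>i j. \<forall>x \<in> homog M (i, j). diff M x \<in> homog M (i + 1, j)) \<and>
     (\<forall>x \<in> carrier M. diff M (diff M x) = \<zero>\<^bsub>M\<^esub>) \<and>
     (\<forall>r. \<forall>x \<in> carrier M.
        diff M (r \<odot>\<^bsub>M\<^esub> x) = (dga_diff R r \<odot>\<^bsub>M\<^esub> x) \<oplus>\<^bsub>M\<^esub> (r \<odot>\<^bsub>M\<^esub> diff M x))"

text \<open>
  The degree \<open>k\<close> part of the morphism complex of the DG category of DG modules, as an abelian group
  (written multiplicatively, as is usual in HOL-Algebra), and its differential.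
\<close>

definition dg_hom :: "int \<Rightarrow> ('r, 'm) dg_mod \<Rightarrow> ('r, 'n) dg_mod \<Rightarrow> ('m \<Rightarrow> 'n) monoid" where
  "dg_hom k M N =
     \<lparr>carrier = {f \<in> carrier M \<rightarrow>\<^sub>E carrier N.
         (\<forall>x \<in> carrier M. \<forall>y \<in> carrier M. f (x \<oplus>\<^bsub>M\<^esub> y) = f x \<oplus>\<^bsub>N\<^esub> f y) \<and>
         (\<forall>r. \<forall>x \<in> carrier M. f (r \<odot>\<^bsub>M\<^esub> x) = r \<odot>\<^bsub>N\<^esub> f x) \<and>
         (\<forall>i j. \<forall>x \<in> homog M (i, j). f x \<in> homog N (i + k, j))},
      monoid.mult = (\<lambda>f g. \<lambda>x \<in> carrier M. f x \<oplus>\<^bsub>N\<^esub> g x),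
      one = (\<lambda>x \<in> carrier M. \<zero>\<^bsub>N\<^esub>)\<rparr>"

definition dg_hom_diff :: "('r, 'm) dg_mod \<Rightarrow> ('r, 'n) dg_mod \<Rightarrow> ('m \<Rightarrow> 'n) \<Rightarrow> 'm \<Rightarrow> 'n" where
  "dg_hom_diff M N f = (\<lambda>x \<in> carrier M. diff N (f x) \<oplus>\<^bsub>N\<^esub> f (diff M x))"

definition cocycles0 :: "('r, 'm) dg_mod \<Rightarrow> ('r, 'n) dg_mod \<Rightarrow> ('m \<Rightarrow> 'n) set" where
  "cocycles0 M N = {f \<in> carrier (dg_hom 0 M N). dg_hom_diff M N f = (\<lambda>x \<in> carrier M. \<zero>\<^bsub>N\<^esub>)}"

definition coboundaries0 :: "('r, 'm) dg_mod \<Rightarrow> ('r, 'n) dg_mod \<Rightarrow> ('m \<Rightarrow> 'n) set" where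
  "coboundaries0 M N = dg_hom_diff M N ` carrier (dg_hom (-1) M N)"

definition hom_H0 :: "('r, 'm) dg_mod \<Rightarrow> ('r, 'n) dg_mod \<Rightarrow> ('m \<Rightarrow> 'n) set monoid" where
  "hom_H0 M N = (dg_hom 0 M N)\<lparr>carrier := cocycles0 M N\<rparr> Mod coboundaries0 M N"

definition hclass :: "('r, 'm) dg_mod \<Rightarrow> ('r, 'n) dg_mod \<Rightarrow> ('m \<Rightarrow> 'n) \<Rightarrow> ('m \<Rightarrow> 'n) set" where
  "hclass M N f = coboundaries0 M N #>\<^bsub>dg_hom 0 M N\<^esub> f"

text \<open>\<open>M{m}[k]\<close>: a generator of degree \<open>(0,0)\<close> of \<open>M\<close> has degree \<open>(-k,-m)\<close> in the shifted module.\<close>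

definition dg_shift :: "int \<Rightarrow> int \<Rightarrow> ('r, 'm) dg_mod \<Rightarrow> ('r, 'm) dg_mod" where
  "dg_shift k m M = M\<lparr>homog := (\<lambda>(i, j). homog M (i + k, j + m))\<rparr>"

section \<open>The categories \<open>DGP(A)\<close> and \<open>HP(A)\<close>\<close>

text \<open>
  HOL has no type of all modules.  The type \<open>elt\<close> of possible elements contains \<open>A\<close> and is closed
  under pairing, so that modules with carrier in \<open>elt\<close> contain the \<open>P(\<Gamma>)\<close> and are closed under
  shifts and mapping cones; hence \<open>DGP(A)\<close> may be formed inside them.
\<close>

datatype elt = Elt (the_alg: alg) | Pr (pr1: elt) (pr2: elt)

type_synonym amod = "(alg, elt) dg_mod"

definition DG_A :: "amod set" where
  "DG_A = {M. dg_module dgA M}"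

definition projA :: "idx \<Rightarrow> amod" where
  "projA \<Gamma> =
     \<lparr>carrier = {Elt (a * alg_of (GId \<Gamma>)) | a. True},
      monoid.mult = undefined, one = undefined,
      ring.zero = Elt 0,
      add = (\<lambda>x y. Elt (the_alg x + the_alg y)),
      smult = (\<lambda>a x. Elt (a * the_alg x)),
      homog = (\<lambda>d. {Elt (a * alg_of (GId \<Gamma>)) | a. a * alg_of (GId \<Gamma>) \<in> alg_homog d}),
      diff = (\<lambda>_. Elt 0)\<rparr>"

text \<open>The mapping cone \<open>M[1] \<oplus> N\<close> of \<open>f: M \<rightarrow> N\<close>.\<close>

definition mcone :: "amod \<Rightarrow> amod \<Rightarrow> (elt \<Rightarrow> elt) \<Rightarrow> amod" where
  "mcone M N f =
     \<lparr>carrier = {Pr x y | x y. x \<in> carrier M \<and> y \<in> carrier N},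
      monoid.mult = undefined, one = undefined,
      ring.zero = Pr \<zero>\<^bsub>M\<^esub> \<zero>\<^bsub>N\<^esub>,
      add = (\<lambda>p q. Pr (pr1 p \<oplus>\<^bsub>M\<^esub> pr1 q) (pr2 p \<oplus>\<^bsub>N\<^esub> pr2 q)),
      smult = (\<lambda>a p. Pr (a \<odot>\<^bsub>M\<^esub> pr1 p) (a \<odot>\<^bsub>N\<^esub> pr2 p)),
      homog = (\<lambda>(i, j). {Pr x y | x y. x \<in> homog M (i + 1, j) \<and> y \<in> homog N (i, j)}),
      diff = (\<lambda>p. Pr (diff M (pr1 p)) (f (pr1 p) \<oplus>\<^bsub>N\<^esub> diff N (pr2 p)))\<rparr>"

inductive_set DGP :: "amod set" where
  DGP_proj: "projA \<Gamma> \<in> DGP"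
| DGP_shift: "M \<in> DGP \<Longrightarrow> dg_shift k m M \<in> DGP"
| DGP_cone: "M \<in> DGP \<Longrightarrow> N \<in> DGP \<Longrightarrow> f \<in> cocycles0 M N \<Longrightarrow> mcone M N f \<in> DGP"

text \<open>
  A category whose hom-sets are abelian groups (multiplicative notation), with a shift.
  Hom-sets need not be disjoint, so composition takes the three objects as arguments:
  \<open>Comp C X Y Z g f\<close> is \<open>g \<circ> f\<close> for \<open>f: X \<rightarrow> Y\<close> and \<open>g: Y \<rightarrow> Z\<close>.
\<close>

record ('o, 'm) shift_cat =
  Obj :: "'o set"
  Hom :: "'o \<Rightarrow> 'o \<Rightarrow> 'm monoid"
  Comp :: "'o \<Rightarrow> 'o \<Rightarrow> 'o \<Rightarrow> 'm \<Rightarrow> 'm \<Rightarrow> 'm"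
  Ident :: "'o \<Rightarrow> 'm"
  Sh :: "'o \<Rightarrow> 'o"
  ShMor :: "'o \<Rightarrow> 'o \<Rightarrow> 'm \<Rightarrow> 'm"

type_synonym ('o, 'm) tri = "'o \<times> 'o \<times> 'o \<times> 'm \<times> 'm \<times> 'm"

record ('o, 'm) tri_cat = "('o, 'm) shift_cat" +
  Dist :: "('o, 'm) tri set"

abbreviation mor :: "('o, 'm, 'x) shift_cat_scheme \<Rightarrow> 'o \<Rightarrow> 'o \<Rightarrow> 'm set" where
  "mor C X Y \<equiv> carrier (Hom C X Y)"

definition iso_mor :: "('o, 'm, 'x) shift_cat_scheme \<Rightarrow> 'o \<Rightarrow> 'o \<Rightarrow> 'm \<Rightarrow> bool" where
  "iso_mor C X Y f \<longleftrightarrow> f \<in> mor C X Y \<and>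
     (\<exists>g \<in> mor C Y X. Comp C X Y X g f = Ident C X \<and> Comp C Y X Y f g = Ident C Y)"

text \<open>A triangle \<open>X \<rightarrow> Y \<rightarrow> Z \<rightarrow> X[1]\<close> with maps \<open>u, v, w\<close>.\<close>

fun is_triangle :: "('o, 'm, 'x) shift_cat_scheme \<Rightarrow> ('o, 'm) tri \<Rightarrow> bool" where
  "is_triangle C (X, Y, Z, u, v, w) \<longleftrightarrow>
     X \<in> Obj C \<and> Y \<in> Obj C \<and> Z \<in> Obj C \<and>
     u \<in> mor C X Y \<and> v \<in> mor C Y Z \<and> w \<in> mor C Z (Sh C X)"

fun tri_morphism ::
    "('o, 'm, 'x) shift_cat_scheme \<Rightarrow> ('o, 'm) tri \<Rightarrow> ('o, 'm) tri \<Rightarrow> 'm \<Rightarrow> 'm \<Rightarrow> 'm \<Rightarrow> bool" where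
  "tri_morphism C (X, Y, Z, u, v, w) (X', Y', Z', u', v', w') a b c \<longleftrightarrow>
     a \<in> mor C X X' \<and> b \<in> mor C Y Y' \<and> c \<in> mor C Z Z' \<and>
     Comp C X Y Y' b u = Comp C X X' Y' u' a \<and>
     Comp C Y Z Z' c v = Comp C Y Y' Z' v' b \<and>
     Comp C Z (Sh C X) (Sh C X') (ShMor C X X' a) w = Comp C Z Z' (Sh C X') w' c"

fun tri_iso :: "('o, 'm, 'x) shift_cat_scheme \<Rightarrow> ('o, 'm) tri \<Rightarrow> ('o, 'm) tri \<Rightarrow> bool" where
  "tri_iso C (X, Y, Z, u, v, w) (X', Y', Z', u', v', w') \<longleftrightarrow>
     (\<exists>a b c. tri_morphism C (X, Y, Z, u, v, w) (X', Y', Z', u', v', w') a b c \<and>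
        iso_mor C X X' a \<and> iso_mor C Y Y' b \<and> iso_mor C Z Z' c)"

text \<open>
  Composition is induced by composition of representatives.  Since the shift does not
  change the underlying maps and there are no signs, a class in \<open>Hom(M,N)\<close> and its shift
  in \<open>Hom(M[1],N[1])\<close> are the same set of maps.
\<close>

definition HP_cat :: "(amod, (elt \<Rightarrow> elt) set) shift_cat" where
  "HP_cat =
     \<lparr>Obj = DGP,
      Hom = hom_H0,
      Comp = (\<lambda>X Y Z G F. \<Union>g \<in> G. \<Union>f \<in> F. hclass X Z (compose (carrier X) g f)),
      Ident = (\<lambda>X. hclass X X (\<lambda>x \<in> carrier X. x)),
      Sh = dg_shift 1 0,
      ShMor = (\<lambda>X Y F. F)\<rparr>"

definition cone_triangle ::
    "amod \<Rightarrow> amod \<Rightarrow> (elt \<Rightarrow> elt) \<Rightarrow> (amod, (elt \<Rightarrow> elt) set) tri" where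
  "cone_triangle M N f =
     (M, N, mcone M N f,
      hclass M N f,
      hclass N (mcone M N f) (\<lambda>y \<in> carrier N. Pr \<zero>\<^bsub>M\<^esub> y),
      hclass (mcone M N f) (dg_shift 1 0 M) (\<lambda>p \<in> carrier (mcone M N f). pr1 p))"

definition HP :: "(amod, (elt \<Rightarrow> elt) set) tri_cat" where
  "HP = shift_cat.extend HP_cat
     \<lparr>Dist = {t. is_triangle HP_cat t \<and>
        (\<exists>M \<in> DGP. \<exists>N \<in> DGP. \<exists>f \<in> cocycles0 M N. tri_iso HP_cat t (cone_triangle M N f))}\<rparr>"

section \<open>Triangulated categories\<close>

locale additive_category =
  fixes C :: "('o, 'm, 'x) shift_cat_scheme"
  assumes hom_group: "X \<in> Obj C \<Longrightarrow> Y \<in> Obj C \<Longrightarrow> comm_group (Hom C X Y)"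
    and comp_closed: "X \<in> Obj C \<Longrightarrow> Y \<in> Obj C \<Longrightarrow> Z \<in> Obj C \<Longrightarrow>
      f \<in> mor C X Y \<Longrightarrow> g \<in> mor C Y Z \<Longrightarrow> Comp C X Y Z g f \<in> mor C X Z"
    and ident_closed: "X \<in> Obj C \<Longrightarrow> Ident C X \<in> mor C X X"
    and comp_ident: "X \<in> Obj C \<Longrightarrow> Y \<in> Obj C \<Longrightarrow> f \<in> mor C X Y \<Longrightarrow>
      Comp C X X Y f (Ident C X) = f"
    and ident_comp: "X \<in> Obj C \<Longrightarrow> Y \<in> Obj C \<Longrightarrow> f \<in> mor C X Y \<Longrightarrow>
      Comp C X Y Y (Ident C Y) f = f"
    and comp_assoc: "W \<in> Obj C \<Longrightarrow> X \<in> Obj C \<Longrightarrow> Y \<in> Obj C \<Longrightarrow> Z \<in> Obj C \<Longrightarrow>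
      f \<in> mor C W X \<Longrightarrow> g \<in> mor C X Y \<Longrightarrow> h \<in> mor C Y Z \<Longrightarrow>
      Comp C W X Z (Comp C X Y Z h g) f = Comp C W Y Z h (Comp C W X Y g f)"
    and comp_add_left: "X \<in> Obj C \<Longrightarrow> Y \<in> Obj C \<Longrightarrow> Z \<in> Obj C \<Longrightarrow>
      f \<in> mor C X Y \<Longrightarrow> g \<in> mor C Y Z \<Longrightarrow> g' \<in> mor C Y Z \<Longrightarrow>
      Comp C X Y Z (g \<otimes>\<^bsub>Hom C Y Z\<^esub> g') f
        = Comp C X Y Z g f \<otimes>\<^bsub>Hom C X Z\<^esub> Comp C X Y Z g' f"
    and comp_add_right: "X \<in> Obj C \<Longrightarrow> Y \<in> Obj C \<Longrightarrow> Z \<in> Obj C \<Longrightarrow>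
      f \<in> mor C X Y \<Longrightarrow> f' \<in> mor C X Y \<Longrightarrow> g \<in> mor C Y Z \<Longrightarrow>
      Comp C X Y Z g (f \<otimes>\<^bsub>Hom C X Y\<^esub> f')
        = Comp C X Y Z g f \<otimes>\<^bsub>Hom C X Z\<^esub> Comp C X Y Z g f'"
    and zero_object: "\<exists>Z \<in> Obj C. Ident C Z = \<one>\<^bsub>Hom C Z Z\<^esub>"
    and biproduct: "X \<in> Obj C \<Longrightarrow> Y \<in> Obj C \<Longrightarrow>
      \<exists>S \<in> Obj C. \<exists>i \<in> mor C X S. \<exists>j \<in> mor C Y S. \<exists>p \<in> mor C S X. \<exists>q \<in> mor C S Y.
        Comp C X S X p i = Ident C X \<and> Comp C Y S Y q j = Ident C Y \<and>
        Comp C Y S X p j = \<one>\<^bsub>Hom C Y X\<^esub> \<and> Comp C X S Y q i = \<one>\<^bsub>Hom C X Y\<^esub> \<and>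
        Comp C S X S i p \<otimes>\<^bsub>Hom C S S\<^esub> Comp C S Y S j q = Ident C S"

text \<open>
  The shift is an additive automorphism; distinguished triangles satisfy Verdier's axioms.
\<close>

locale triangulated_category = additive_category C
  for C :: "('o, 'm, 'x) tri_cat_scheme" +
  assumes shift_obj: "bij_betw (Sh C) (Obj C) (Obj C)"
    and shift_mor: "X \<in> Obj C \<Longrightarrow> Y \<in> Obj C \<Longrightarrow>
      ShMor C X Y \<in> iso (Hom C X Y) (Hom C (Sh C X) (Sh C Y))"
    and shift_ident: "X \<in> Obj C \<Longrightarrow> ShMor C X X (Ident C X) = Ident C (Sh C X)"
    and shift_comp: "X \<in> Obj C \<Longrightarrow> Y \<in> Obj C \<Longrightarrow> Z \<in> Obj C \<Longrightarrow>
      f \<in> mor C X Y \<Longrightarrow> g \<in> mor C Y Z \<Longrightarrow>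
      ShMor C X Z (Comp C X Y Z g f)
        = Comp C (Sh C X) (Sh C Y) (Sh C Z) (ShMor C Y Z g) (ShMor C X Y f)"
    and dist_triangle: "t \<in> Dist C \<Longrightarrow> is_triangle C t"
    and TR1_iso: "t \<in> Dist C \<Longrightarrow> is_triangle C t' \<Longrightarrow> tri_iso C t' t \<Longrightarrow> t' \<in> Dist C"
    and TR1_ident: "X \<in> Obj C \<Longrightarrow> Z \<in> Obj C \<Longrightarrow> Ident C Z = \<one>\<^bsub>Hom C Z Z\<^esub> \<Longrightarrow>
      (X, X, Z, Ident C X, \<one>\<^bsub>Hom C X Z\<^esub>, \<one>\<^bsub>Hom C Z (Sh C X)\<^esub>) \<in> Dist C"
    and TR1_complete: "X \<in> Obj C \<Longrightarrow> Y \<in> Obj C \<Longrightarrow> u \<in> mor C X Y \<Longrightarrow>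
      \<exists>Z v w. (X, Y, Z, u, v, w) \<in> Dist C"
    and TR2: "is_triangle C (X, Y, Z, u, v, w) \<Longrightarrow>
      (X, Y, Z, u, v, w) \<in> Dist C \<longleftrightarrow>
      (Y, Z, Sh C X, v, w, inv\<^bsub>Hom C (Sh C X) (Sh C Y)\<^esub> (ShMor C X Y u)) \<in> Dist C"
    and TR3: "(X, Y, Z, u, v, w) \<in> Dist C \<Longrightarrow> (X', Y', Z', u', v', w') \<in> Dist C \<Longrightarrow>
      a \<in> mor C X X' \<Longrightarrow> b \<in> mor C Y Y' \<Longrightarrow> Comp C X Y Y' b u = Comp C X X' Y' u' a \<Longrightarrow>
      \<exists>c. tri_morphism C (X, Y, Z, u, v, w) (X', Y', Z', u', v', w') a b c"
    and TR4: "(X, Y, Z', u, j, k) \<in> Dist C \<Longrightarrow> (Y, Z, X', v, l, i) \<in> Dist C \<Longrightarrow>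
      (X, Z, Y', Comp C X Y Z v u, m, n) \<in> Dist C \<Longrightarrow>
      \<exists>f g. (Z', Y', X', f, g, Comp C X' (Sh C Y) (Sh C Z') (ShMor C Y Z' j) i) \<in> Dist C \<and>
        l = Comp C Z Y' X' g m \<and>
        k = Comp C Z' Y' (Sh C X) n f \<and>
        Comp C Y' (Sh C X) (Sh C Y) (ShMor C X Y u) n = Comp C Y' X' (Sh C Y) i g \<and>
        Comp C Y Z Y' m v = Comp C Y Z' Y' f j"

section \<open>Exact functors and bifunctors\<close>

definition additive_functor ::
    "('o, 'm, 'x) tri_cat_scheme \<Rightarrow> ('p, 'n, 'y) tri_cat_scheme
      \<Rightarrow> ('o \<Rightarrow> 'p) \<Rightarrow> ('o \<Rightarrow> 'o \<Rightarrow> 'm \<Rightarrow> 'n) \<Rightarrow> bool" where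
  "additive_functor C D F Fm \<longleftrightarrow>
     (\<forall>X \<in> Obj C. F X \<in> Obj D) \<and>
     (\<forall>X \<in> Obj C. \<forall>Y \<in> Obj C. Fm X Y \<in> hom (Hom C X Y) (Hom D (F X) (F Y))) \<and>
     (\<forall>X \<in> Obj C. Fm X X (Ident C X) = Ident D (F X)) \<and>
     (\<forall>X \<in> Obj C. \<forall>Y \<in> Obj C. \<forall>Z \<in> Obj C. \<forall>f \<in> mor C X Y. \<forall>g \<in> mor C Y Z.
        Fm X Z (Comp C X Y Z g f) = Comp D (F X) (F Y) (F Z) (Fm Y Z g) (Fm X Y f))"

text \<open>\<open>\<theta>\<close> is a natural isomorphism \<open>F(X[1]) \<rightarrow> F(X)[1]\<close>.\<close>

definition exact_functor ::
    "('o, 'm, 'x) tri_cat_scheme \<Rightarrow> ('p, 'n, 'y) tri_cat_scheme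
      \<Rightarrow> ('o \<Rightarrow> 'p) \<Rightarrow> ('o \<Rightarrow> 'o \<Rightarrow> 'm \<Rightarrow> 'n) \<Rightarrow> bool" where
  "exact_functor C D F Fm \<longleftrightarrow>
     additive_functor C D F Fm \<and>
     (\<exists>\<theta>.
        (\<forall>X \<in> Obj C. iso_mor D (F (Sh C X)) (Sh D (F X)) (\<theta> X)) \<and>
        (\<forall>X \<in> Obj C. \<forall>Y \<in> Obj C. \<forall>f \<in> mor C X Y.
           Comp D (F (Sh C X)) (F (Sh C Y)) (Sh D (F Y)) (\<theta> Y) (Fm (Sh C X) (Sh C Y) (ShMor C X Y f))
           = Comp D (F (Sh C X)) (Sh D (F X)) (Sh D (F Y)) (ShMor D (F X) (F Y) (Fm X Y f)) (\<theta> X)) \<and>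
        (\<forall>X Y Z u v w. (X, Y, Z, u, v, w) \<in> Dist C \<longrightarrow>
           (F X, F Y, F Z, Fm X Y u, Fm Y Z v,
            Comp D (F Z) (F (Sh C X)) (Sh D (F X)) (\<theta> X) (Fm Z (Sh C X) w)) \<in> Dist D))"

definition bifunctor ::
    "('o, 'm, 'x) tri_cat_scheme \<Rightarrow> ('p, 'n, 'y) tri_cat_scheme \<Rightarrow> ('q, 'k, 'z) tri_cat_scheme
      \<Rightarrow> ('o \<Rightarrow> 'p \<Rightarrow> 'q) \<Rightarrow> ('o \<Rightarrow> 'o \<Rightarrow> 'p \<Rightarrow> 'p \<Rightarrow> 'm \<Rightarrow> 'n \<Rightarrow> 'k) \<Rightarrow> bool" where
  "bifunctor C D E B Bm \<longleftrightarrow>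
     (\<forall>X \<in> Obj C. \<forall>Y \<in> Obj D. B X Y \<in> Obj E) \<and>
     (\<forall>X \<in> Obj C. \<forall>X' \<in> Obj C. \<forall>Y \<in> Obj D. \<forall>Y' \<in> Obj D. \<forall>f \<in> mor C X X'. \<forall>g \<in> mor D Y Y'.
        Bm X X' Y Y' f g \<in> mor E (B X Y) (B X' Y')) \<and>
     (\<forall>X \<in> Obj C. \<forall>Y \<in> Obj D. Bm X X Y Y (Ident C X) (Ident D Y) = Ident E (B X Y)) \<and>
     (\<forall>X \<in> Obj C. \<forall>X' \<in> Obj C. \<forall>X'' \<in> Obj C. \<forall>Y \<in> Obj D. \<forall>Y' \<in> Obj D. \<forall>Y'' \<in> Obj D.
      \<forall>f \<in> mor C X X'. \<forall>f' \<in> mor C X' X''. \<forall>g \<in> mor D Y Y'. \<forall>g' \<in> mor D Y' Y''.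
        Bm X X'' Y Y'' (Comp C X X' X'' f' f) (Comp D Y Y' Y'' g' g)
        = Comp E (B X Y) (B X' Y') (B X'' Y'') (Bm X' X'' Y' Y'' f' g') (Bm X X' Y Y' f g))"

definition exact_bifunctor ::
    "('o, 'm, 'x) tri_cat_scheme \<Rightarrow> ('p, 'n, 'y) tri_cat_scheme \<Rightarrow> ('q, 'k, 'z) tri_cat_scheme
      \<Rightarrow> ('o \<Rightarrow> 'p \<Rightarrow> 'q) \<Rightarrow> ('o \<Rightarrow> 'o \<Rightarrow> 'p \<Rightarrow> 'p \<Rightarrow> 'm \<Rightarrow> 'n \<Rightarrow> 'k) \<Rightarrow> bool" where
  "exact_bifunctor C D E B Bm \<longleftrightarrow>
     bifunctor C D E B Bm \<and>
     (\<forall>Y \<in> Obj D. exact_functor C E (\<lambda>X. B X Y) (\<lambda>X X' f. Bm X X' Y Y f (Ident D Y))) \<and>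
     (\<forall>X \<in> Obj C. exact_functor D E (\<lambda>Y. B X Y) (\<lambda>Y Y' g. Bm X X Y Y' (Ident C X) g))"

section \<open>Grothendieck groups\<close>

definition K0_rel :: "('o, 'm, 'x) tri_cat_scheme \<Rightarrow> ('o \<Rightarrow>\<^sub>0 int) set" where
  "K0_rel C = generate (free_Abelian_group (Obj C))
     {frag_of Y - frag_of X - frag_of Z | X Y Z u v w. (X, Y, Z, u, v, w) \<in> Dist C}"

definition K0 :: "('o, 'm, 'x) tri_cat_scheme \<Rightarrow> ('o \<Rightarrow>\<^sub>0 int) set monoid" where
  "K0 C = free_Abelian_group (Obj C) Mod K0_rel C"

definition K0_coset :: "('o, 'm, 'x) tri_cat_scheme \<Rightarrow> ('o \<Rightarrow>\<^sub>0 int) \<Rightarrow> ('o \<Rightarrow>\<^sub>0 int) set" where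
  "K0_coset C c = K0_rel C #>\<^bsub>free_Abelian_group (Obj C)\<^esub> c"

definition K0_class :: "('o, 'm, 'x) tri_cat_scheme \<Rightarrow> 'o \<Rightarrow> ('o \<Rightarrow>\<^sub>0 int) set" where
  "K0_class C X = K0_coset C (frag_of X)"

text \<open>
  The maps induced by an exact functor and an exact bifunctor: extend the map on objects
  (bi)additively to formal combinations and pass to cosets.  The unions range over all
  representatives; for exact (bi)functors they all give the same coset.
\<close>

definition K0_map ::
    "('o, 'm, 'x) tri_cat_scheme \<Rightarrow> ('p, 'n, 'y) tri_cat_scheme \<Rightarrow> ('o \<Rightarrow> 'p)
      \<Rightarrow> ('o \<Rightarrow>\<^sub>0 int) set \<Rightarrow> ('p \<Rightarrow>\<^sub>0 int) set" where
  "K0_map C D F x = (\<Union>c \<in> x. K0_coset D (frag_extend (\<lambda>X. frag_of (F X)) c))"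

definition K0_bimap ::
    "('o, 'm, 'x) tri_cat_scheme \<Rightarrow> ('p, 'n, 'y) tri_cat_scheme \<Rightarrow> ('q, 'k, 'z) tri_cat_scheme
      \<Rightarrow> ('o \<Rightarrow> 'p \<Rightarrow> 'q) \<Rightarrow> ('o \<Rightarrow>\<^sub>0 int) set \<Rightarrow> ('p \<Rightarrow>\<^sub>0 int) set \<Rightarrow> ('q \<Rightarrow>\<^sub>0 int) set" where
  "K0_bimap C D E B x y =
     (\<Union>c \<in> x. \<Union>d \<in> y. K0_coset E (frag_extend (\<lambda>X. frag_extend (\<lambda>Y. frag_of (B X Y)) d) c))"

text \<open>
  An isomorphism of \<open>\<int>[T\<^sup>\<plusminus>\<^sup>1]\<close>-modules \<open>K\<^sub>0(HP(A)) \<cong> U\<^sub>T\<close> sending \<open>[P(\<Gamma>)]\<close> to \<open>\<Gamma>\<close>.  An additive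
  isomorphism is \<open>\<int>[T\<^sup>\<plusminus>\<^sup>1]\<close>-linear iff it commutes with \<open>T\<close>, which acts on \<open>K\<^sub>0\<close> by \<open>[M] \<mapsto> [M{1}]\<close>
  and on \<open>U\<^sub>T\<close> by multiplication with the central element \<open>T\<close>.
\<close>

definition K0_identification :: "((amod \<Rightarrow>\<^sub>0 int) set \<Rightarrow> ut) \<Rightarrow> bool" where
  "K0_identification \<phi> \<longleftrightarrow>
     \<phi> \<in> iso (K0 HP) ut_add_group \<and>
     (\<forall>x \<in> carrier (K0 HP). \<phi> (K0_map HP HP (dg_shift 0 1) x) = utT * \<phi> x) \<and>
     (\<forall>\<Gamma>. \<phi> (K0_class HP (projA \<Gamma>)) = ut_basis \<Gamma>)"

section \<open>\<open>DGP(A)\<close> is a full subcategory of \<open>DG(A)\<close>\<close>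

lemma alg_rel_eq: "alg_rel s t \<Longrightarrow> abs_alg s = abs_alg t"
  by (simp add: alg.abs_eq_iff pe_rel)

lemma alg_two: "(1::alg) + 1 = 0"
  by transfer (intro pe_rel alg_rel.intros)

lemma alg_add_self [simp]: "(a::alg) + a = 0"
proof -
  have "a + a = (1 + 1) * a" by (simp only: distrib_right mult_1_left)
  also have "\<dots> = 0" by (simp only: alg_two mult_zero_left)
  finally show ?thesis .
qed

lemma alg_neg [simp]: "- (a::alg) = a"
  by (rule minus_unique) (rule alg_add_self)

lemma idem_mult: "alg_of (GId x) * alg_of (GId y) = (if x = y then alg_of (GId x) else 0)"
  using alg_rel_eq[OF alg_rel.intros(3)[of x y]]
  by (auto simp: alg_of_def times_alg.abs_eq[symmetric] zero_alg_def split: if_splits)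

lemma idem_right: "x = a * alg_of (GId \<Gamma>) \<Longrightarrow> x * alg_of (GId \<Gamma>) = x"
  by (simp add: mult.assoc idem_mult)

text \<open>The grading of \<open>A\<close>, read off from the homomorphism \<open>A \<rightarrow> A[[t]]\<close> with \<open>a \<mapsto> a t\<^sup>n\<close> for \<open>a\<close> of
  degree \<open>(n,n)\<close>.\<close>


lemma rho_rels:
  "alg_of (GId IxI) * alg_of GRho1 = alg_of GRho1"
  "alg_of GRho1 * alg_of (GId IxEF) = alg_of GRho1"
  "alg_of (GId IxEF) * alg_of GRho2 = alg_of GRho2"
  "alg_of GRho2 * alg_of (GId IxI) = alg_of GRho2"
  "alg_of GRho1 * alg_of GRho2 = 0"
  by (transfer, intro pe_rel alg_rel.intros)+

lemma idem_sum:
  "1 = alg_of (GId IxF) + alg_of (GId IxI) + (alg_of (GId IxEF) + alg_of (GId IxE))"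
  by transfer (intro pe_rel alg_rel.intros)

definition gen_fps :: "alg_gen \<Rightarrow> alg fps" where
  "gen_fps g = (if g = GRho2 then fps_const (alg_of g) * fps_X else fps_const (alg_of g))"

lift_definition deg_map :: "alg \<Rightarrow> alg fps" is "expr_eval gen_fps"
proof -
  fix s t assume "pres_eq alg_rel s t"
  then show "expr_eval gen_fps s = expr_eval gen_fps t"
  proof (rule pres_eq_eval)
    fix s t assume "alg_rel s t"
    then show "expr_eval gen_fps s = expr_eval gen_fps t"
    proof cases
      case 1
      have "(1::alg fps) + 1 = fps_const (1 + 1)" by (simp only: fps_const_add[symmetric] fps_const_1_eq_1)
      also have "\<dots> = 0" by (simp only: alg_two) simp
      finally show ?thesis using 1 by simp
    next
      case 2
      have "(1::alg fps) = fps_const 1" by simp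
      with 2 show ?thesis unfolding idem_sum by (simp add: gen_fps_def)
    next
      case (7)
      have "fps_const (alg_of GRho2) * fps_X * fps_const (alg_of (GId IxI))
        = fps_const (alg_of GRho2 * alg_of (GId IxI)) * fps_X"
        by (simp only: mult.assoc fps_mult_fps_X_commute fps_const_mult[symmetric])
      with 7 show ?thesis by (simp add: gen_fps_def rho_rels)
    qed (simp_all add: gen_fps_def idem_mult rho_rels mult.assoc[symmetric])
  qed
qed

lemma deg_map_simps:
  "deg_map 0 = 0" "deg_map 1 = 1" "deg_map (a + b) = deg_map a + deg_map b"
  "deg_map (- a) = - deg_map a" "deg_map (a * b) = deg_map a * deg_map b"
  "deg_map (alg_of g) = gen_fps g"
  by (transfer, simp)+

lemma homog_deg_map:
  assumes "(d, a) \<in> alg_homog_rel"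
  shows "a = 0 \<or> (\<exists>n. d = (int n, int n) \<and> deg_map a = fps_const a * fps_X ^ n)"
  using assms
proof induction
  case (ah_gen g)
  show ?case
    by (cases g; intro disjI2 exI[of _ "if g = GRho2 then 1 else 0"])
      (simp_all add: deg_map_simps gen_fps_def)
next
  case (ah_neg d a)
  then show ?case by simp
next
  case (ah_add d a b)
  then show ?case
    by (auto simp: deg_map_simps distrib_right simp flip: fps_const_add)
next
  case (ah_mul i j a i' j' b)
  show ?case
  proof (cases "a = 0 \<or> b = 0")
    case False
    with ah_mul obtain n m where n: "i = int n" "j = int n" "deg_map a = fps_const a * fps_X ^ n"
      and m: "i' = int m" "j' = int m" "deg_map b = fps_const b * fps_X ^ m" by auto
    have "deg_map (a * b) = fps_const a * (fps_X ^ n * fps_const b) * fps_X ^ m"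
      by (simp add: deg_map_simps n m mult.assoc)
    also have "\<dots> = fps_const (a * b) * fps_X ^ (n + m)"
      by (subst fps_mult_fps_X_power_commute) (simp add: mult.assoc power_add flip: fps_const_mult)
    finally have "deg_map (a * b) = fps_const (a * b) * fps_X ^ (n + m)" .
    then show ?thesis using n m by (intro disjI2 exI[of _ "n + m"]) simp
  qed auto
qed (auto simp: deg_map_simps)

definition alg_comp :: "alg \<Rightarrow> int \<times> int \<Rightarrow> alg" where
  "alg_comp a d = (if fst d = snd d \<and> fst d \<ge> 0 then fps_nth (deg_map a) (nat (fst d)) else 0)"

lemma alg_comp_add: "alg_comp (a + b) d = alg_comp a d + alg_comp b d"
  by (simp add: alg_comp_def deg_map_simps)

lemma alg_comp_homog:
  assumes "a \<in> alg_homog d" shows "alg_comp a d' = (if d' = d then a else 0)"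
proof -
  from assms have "(d, a) \<in> alg_homog_rel" by (simp add: alg_homog_def)
  from homog_deg_map[OF this] show ?thesis
    by (auto simp: alg_comp_def deg_map_simps fps_X_power_mult_right_nth prod_eq_iff)
qed

lemma alg_comp_sum: "finite S \<Longrightarrow> alg_comp (sum c S) d = (\<Sum>s\<in>S. alg_comp (c s) d)"
proof (induction S rule: finite_induct)
  case empty
  show ?case by (simp add: alg_comp_def deg_map_simps)
qed (simp add: alg_comp_add)

lemma alg_homog_0: "0 \<in> alg_homog d"
  and alg_homog_add: "a \<in> alg_homog d \<Longrightarrow> b \<in> alg_homog d \<Longrightarrow> a + b \<in> alg_homog d"
  and alg_homog_mul: "a \<in> alg_homog (i, j) \<Longrightarrow> b \<in> alg_homog (i', j') \<Longrightarrow> a * b \<in> alg_homog (i + i', j + j')"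
  and alg_homog_gen: "alg_of g \<in> alg_homog (gen_deg g)"
  by (auto simp: alg_homog_def intro: alg_homog_rel.intros)

definition alg_good :: "alg \<Rightarrow> bool" where
  "alg_good a \<longleftrightarrow> (\<forall>d. alg_comp a d \<in> alg_homog d) \<and> finite {d. alg_comp a d \<noteq> 0} \<and>
     (\<Sum>d | alg_comp a d \<noteq> 0. alg_comp a d) = a"

lemma alg_good_homog: "a \<in> alg_homog d \<Longrightarrow> alg_good a"
proof -
  assume a: "a \<in> alg_homog d"
  have "{d'. alg_comp a d' \<noteq> 0} = (if a = 0 then {} else {d})"
    by (auto simp: alg_comp_homog[OF a])
  then show ?thesis
    using a by (auto simp: alg_good_def alg_comp_homog[OF a] alg_homog_0)
qed

lemma alg_good_add: assumes "alg_good a" "alg_good b" shows "alg_good (a + b)"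
proof -
  let ?S = "{d. alg_comp a d \<noteq> 0} \<union> {d. alg_comp b d \<noteq> 0}"
  have f: "finite ?S" using assms by (simp add: alg_good_def)
  have sub: "{d. alg_comp (a + b) d \<noteq> 0} \<subseteq> ?S" by (auto simp: alg_comp_add)
  have "(\<Sum>d | alg_comp (a + b) d \<noteq> 0. alg_comp (a + b) d) = (\<Sum>d\<in>?S. alg_comp (a + b) d)"
    by (rule sum.mono_neutral_left[OF f sub]) auto
  also have "\<dots> = (\<Sum>d\<in>?S. alg_comp a d) + (\<Sum>d\<in>?S. alg_comp b d)"
    by (simp add: alg_comp_add sum.distrib)
  also have "(\<Sum>d\<in>?S. alg_comp a d) = (\<Sum>d | alg_comp a d \<noteq> 0. alg_comp a d)"
    by (rule sum.mono_neutral_right[OF f]) auto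
  also have "(\<Sum>d\<in>?S. alg_comp b d) = (\<Sum>d | alg_comp b d \<noteq> 0. alg_comp b d)"
    by (rule sum.mono_neutral_right[OF f]) auto
  finally show ?thesis
    using assms finite_subset[OF sub f]
    by (auto simp: alg_good_def alg_comp_add intro: alg_homog_add)
qed

lemma alg_good_sum: "finite S \<Longrightarrow> (\<And>s. s \<in> S \<Longrightarrow> alg_good (c s)) \<Longrightarrow> alg_good (sum c S)"
  by (induction S rule: finite_induct) (simp_all add: alg_good_add alg_good_homog[OF alg_homog_0])

lemma alg_good_mul: assumes "alg_good a" "alg_good b" shows "alg_good (a * b)"
proof -
  have "a * b = (\<Sum>d | alg_comp a d \<noteq> 0. \<Sum>d' | alg_comp b d' \<noteq> 0. alg_comp a d * alg_comp b d')"
    using assms by (simp add: alg_good_def flip: sum_product)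
  moreover have "alg_good (alg_comp a d * alg_comp b d')" for d d'
  proof -
    have "alg_comp a (fst d, snd d) \<in> alg_homog (fst d, snd d)"
      "alg_comp b (fst d', snd d') \<in> alg_homog (fst d', snd d')"
      using assms by (auto simp only: alg_good_def prod.collapse)
    from alg_homog_mul[OF this] show ?thesis by (simp add: alg_good_homog)
  qed
  ultimately show ?thesis
    using assms by (auto simp: alg_good_def[of a] alg_good_def[of b] intro!: alg_good_sum)
qed

lemma alg_good: "alg_good a"
proof -
  have "alg_good (abs_alg t)" for t
  proof (induction t)
    case EZero
    show ?case by (metis alg_good_homog alg_homog_0 zero_alg_def)
  next
    case EOne
    have "1 \<in> alg_homog (0, 0)" by (simp add: alg_homog_def ah_one)
    then show ?case by (metis alg_good_homog one_alg_def)
  next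
    case (EGen g)
    show ?case using alg_good_homog[OF alg_homog_gen[of g]] by (simp add: alg_of_def)
  next
    case (ENeg t)
    have "abs_alg (ENeg t) = abs_alg t" using alg_neg[of "abs_alg t"] unfolding uminus_alg.abs_eq .
    with ENeg show ?case by simp
  next
    case (EAdd s t)
    then show ?case using alg_good_add by (metis plus_alg.abs_eq)
  next
    case (EMul s t)
    then show ?case using alg_good_mul by (metis times_alg.abs_eq)
  qed
  then show ?thesis by (rule alg.abs_induct)
qed

lemma alg_comp_unique:
  assumes "\<forall>d. c d \<in> alg_homog d" "finite {d. c d \<noteq> 0}" "(\<Sum>d | c d \<noteq> 0. c d) = a"
  shows "c = alg_comp a"
proof
  fix d
  have "alg_comp a d = (\<Sum>d' | c d' \<noteq> 0. alg_comp (c d') d)"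
    using assms(2,3) alg_comp_sum by blast
  also have "\<dots> = (\<Sum>d' | c d' \<noteq> 0. if d = d' then c d' else 0)"
    by (intro sum.cong refl) (rule alg_comp_homog[OF assms(1)[rule_format]])
  also have "\<dots> = c d" using assms(2) by (simp add: sum.delta)
  finally show "c d = alg_comp a d" by simp
qed

lemma alg_comp_idem:
  assumes "a * alg_of (GId \<Gamma>) = a" shows "alg_comp a d * alg_of (GId \<Gamma>) = alg_comp a d"
proof -
  have "deg_map a = deg_map a * fps_const (alg_of (GId \<Gamma>))"
    using arg_cong[OF assms, of deg_map] by (simp add: deg_map_simps gen_fps_def)
  then have "fps_nth (deg_map a) n = fps_nth (deg_map a) n * alg_of (GId \<Gamma>)" for n
    using fps_mult_right_const_nth[of "deg_map a" "alg_of (GId \<Gamma>)" n] by simp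
  then show ?thesis by (simp add: alg_comp_def)
qed

lemma projA_sel [simp]:
  "carrier (projA \<Gamma>) = {Elt (a * alg_of (GId \<Gamma>)) | a. True}"
  "\<zero>\<^bsub>projA \<Gamma>\<^esub> = Elt 0"
  "x \<oplus>\<^bsub>projA \<Gamma>\<^esub> y = Elt (the_alg x + the_alg y)"
  "a \<odot>\<^bsub>projA \<Gamma>\<^esub> x = Elt (a * the_alg x)"
  "diff (projA \<Gamma>) x = Elt 0"
  by (simp_all add: projA_def)

lemma proj_carrier: "x \<in> carrier (projA \<Gamma>) \<longleftrightarrow> (\<exists>a. x = Elt a \<and> a * alg_of (GId \<Gamma>) = a)"
  by (auto simp: mult.assoc idem_mult) metis

lemma proj_homog: "x \<in> homog (projA \<Gamma>) d \<longleftrightarrow>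
    (\<exists>a. x = Elt a \<and> a * alg_of (GId \<Gamma>) = a \<and> a \<in> alg_homog d)"
  by (auto simp: projA_def mult.assoc idem_mult) metis

lemma proj_homog_carrier: "x \<in> homog (projA \<Gamma>) d \<Longrightarrow> x \<in> carrier (projA \<Gamma>)"
  unfolding proj_homog proj_carrier by blast

lemma proj_abelian: "abelian_group (projA \<Gamma>)"
proof (rule abelian_groupI)
  fix x assume "x \<in> carrier (projA \<Gamma>)"
  then show "\<exists>y\<in>carrier (projA \<Gamma>). y \<oplus>\<^bsub>projA \<Gamma>\<^esub> x = \<zero>\<^bsub>projA \<Gamma>\<^esub>"
    by (intro bexI[of _ x]) auto
next
  fix x y assume "x \<in> carrier (projA \<Gamma>)" "y \<in> carrier (projA \<Gamma>)"
  then show "x \<oplus>\<^bsub>projA \<Gamma>\<^esub> y \<in> carrier (projA \<Gamma>)"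
    by (auto simp flip: distrib_right)
next
  show "\<zero>\<^bsub>projA \<Gamma>\<^esub> \<in> carrier (projA \<Gamma>)"
    by (auto intro: exI[of _ 0])
qed (auto simp: add_ac)

lemma proj_finsum:
  assumes "finite S" "\<And>s. s \<in> S \<Longrightarrow> c s * alg_of (GId \<Gamma>) = c s"
  shows "finsum (projA \<Gamma>) (\<lambda>s. Elt (c s)) S = Elt (sum c S)"
  using assms
proof (induction S rule: finite_induct)
  case empty
  interpret abelian_group "projA \<Gamma>" by (rule proj_abelian)
  show ?case using finsum_empty by simp
next
  case (insert s S)
  interpret abelian_group "projA \<Gamma>" by (rule proj_abelian)
  have "finsum (projA \<Gamma>) (\<lambda>s. Elt (c s)) (insert s S)
    = Elt (c s) \<oplus>\<^bsub>projA \<Gamma>\<^esub> finsum (projA \<Gamma>) (\<lambda>s. Elt (c s)) S"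
    using insert.prems by (intro finsum_insert insert.hyps Pi_I; subst proj_carrier) auto
  then show ?case using insert by simp
qed

lemma proj_subgroup: "subgroup (homog (projA \<Gamma>) d) (add_monoid (projA \<Gamma>))"
proof -
  interpret abelian_group "projA \<Gamma>" by (rule proj_abelian)
  show ?thesis
  proof (rule group.subgroupI[OF a_group])
    show "homog (projA \<Gamma>) d \<subseteq> carrier (add_monoid (projA \<Gamma>))"
      using proj_homog_carrier[of _ \<Gamma> d] by (auto simp del: projA_sel)
    have "Elt 0 \<in> homog (projA \<Gamma>) d" by (simp add: proj_homog alg_homog_0)
    then show "homog (projA \<Gamma>) d \<noteq> {}" by blast
  next
    fix x assume x: "x \<in> homog (projA \<Gamma>) d"
    then have "x \<in> carrier (projA \<Gamma>)" by (rule proj_homog_carrier)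
    moreover have "x \<oplus>\<^bsub>projA \<Gamma>\<^esub> x = \<zero>\<^bsub>projA \<Gamma>\<^esub>" by simp
    ultimately have "\<ominus>\<^bsub>projA \<Gamma>\<^esub> x = x" by (metis minus_equality)
    with x show "inv\<^bsub>add_monoid (projA \<Gamma>)\<^esub> x \<in> homog (projA \<Gamma>) d" by (simp add: a_inv_def)
  next
    fix x y assume "x \<in> homog (projA \<Gamma>) d" "y \<in> homog (projA \<Gamma>) d"
    then show "x \<otimes>\<^bsub>add_monoid (projA \<Gamma>)\<^esub> y \<in> homog (projA \<Gamma>) d"
      by (auto simp: proj_homog distrib_right intro: alg_homog_add)
  qed
qed

lemma proj_grading: "direct_sum_grading (projA \<Gamma>) (homog (projA \<Gamma>))"
  unfolding direct_sum_grading_def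
proof (intro conjI allI ballI proj_subgroup)
  let ?M = "projA \<Gamma>"
  fix x assume "x \<in> carrier ?M"
  then obtain a where x: "x = Elt a" and a: "a * alg_of (GId \<Gamma>) = a"
    using proj_carrier by blast
  have g: "\<forall>d. alg_comp a d \<in> alg_homog d" "finite {d. alg_comp a d \<noteq> 0}"
    "(\<Sum>d | alg_comp a d \<noteq> 0. alg_comp a d) = a"
    using alg_good[of a] by (auto simp: alg_good_def)
  show "\<exists>!c. (\<forall>d. c d \<in> homog ?M d) \<and> finite {d. c d \<noteq> \<zero>\<^bsub>?M\<^esub>} \<and>
      finsum ?M c {d. c d \<noteq> \<zero>\<^bsub>?M\<^esub>} = x"
  proof (rule ex1I[of _ "\<lambda>d. Elt (alg_comp a d)"])
    show "(\<forall>d. Elt (alg_comp a d) \<in> homog ?M d) \<and> finite {d. Elt (alg_comp a d) \<noteq> \<zero>\<^bsub>?M\<^esub>} \<and>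
      finsum ?M (\<lambda>d. Elt (alg_comp a d)) {d. Elt (alg_comp a d) \<noteq> \<zero>\<^bsub>?M\<^esub>} = x"
      using g alg_comp_idem[OF a] by (simp add: proj_homog proj_finsum x)
  next
    fix c assume c: "(\<forall>d. c d \<in> homog ?M d) \<and> finite {d. c d \<noteq> \<zero>\<^bsub>?M\<^esub>} \<and>
      finsum ?M c {d. c d \<noteq> \<zero>\<^bsub>?M\<^esub>} = x"
    define b where "b d = the_alg (c d)" for d
    have b: "c d = Elt (b d)" "b d * alg_of (GId \<Gamma>) = b d" "b d \<in> alg_homog d" for d
    proof -
      from c have "c d \<in> homog ?M d" by blast
      then show "c d = Elt (b d)" "b d * alg_of (GId \<Gamma>) = b d" "b d \<in> alg_homog d"
        unfolding proj_homog b_def by auto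
    qed
    then have "c = (\<lambda>d. Elt (b d))" by auto
    with c have "finite {d. b d \<noteq> 0}" "(\<Sum>d | b d \<noteq> 0. b d) = a"
      using proj_finsum[of "{d. b d \<noteq> 0}" b \<Gamma>] b(2) by (auto simp: x)
    then show "c = (\<lambda>d. Elt (alg_comp a d))"
      using alg_comp_unique[of b a] b by auto
  qed
qed

lemma proj_dg_module: "dg_module dgA (projA \<Gamma>)"
  unfolding dg_module_def
proof (intro conjI proj_abelian proj_grading)
  show "\<forall>i j i' j'. \<forall>r\<in>dga_homog dgA (i, j). \<forall>x\<in>homog (projA \<Gamma>) (i', j').
     r \<odot>\<^bsub>projA \<Gamma>\<^esub> x \<in> homog (projA \<Gamma>) (i + i', j + j')"
    by (auto simp: proj_homog dgA_def mult.assoc alg_homog_mul)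
  show "\<forall>i j. \<forall>x\<in>homog (projA \<Gamma>) (i, j). diff (projA \<Gamma>) x \<in> homog (projA \<Gamma>) (i + 1, j)"
    by (auto simp: proj_homog alg_homog_0)
  show "\<forall>r. \<forall>x\<in>carrier (projA \<Gamma>). r \<odot>\<^bsub>projA \<Gamma>\<^esub> x \<in> carrier (projA \<Gamma>)"
    by (auto simp flip: mult.assoc)
  show "\<forall>x\<in>carrier (projA \<Gamma>). diff (projA \<Gamma>) x \<in> carrier (projA \<Gamma>)"
    by (auto intro: exI[of _ 0])
qed (auto simp: dgA_def algebra_simps)

lemma grading_reindex:
  assumes "bij \<sigma>" "abelian_group M" "direct_sum_grading M H"
  shows "direct_sum_grading M (H \<circ> \<sigma>)"
  unfolding direct_sum_grading_def
proof (intro conjI allI ballI)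
  interpret abelian_group M by fact
  fix d show "subgroup ((H \<circ> \<sigma>) d) (add_monoid M)"
    using assms(3) by (simp add: direct_sum_grading_def)
  have H: "H d \<subseteq> carrier M" for d
    using assms(3) subgroup.subset[of "H d" "add_monoid M"] by (simp add: direct_sum_grading_def)
  have key: "(\<forall>d. c (\<sigma> d) \<in> H (\<sigma> d)) \<and> finite {d. c (\<sigma> d) \<noteq> \<zero>\<^bsub>M\<^esub>} \<and>
      finsum M (\<lambda>d. c (\<sigma> d)) {d. c (\<sigma> d) \<noteq> \<zero>\<^bsub>M\<^esub>} = x \<longleftrightarrow>
     (\<forall>d. c d \<in> H d) \<and> finite {d. c d \<noteq> \<zero>\<^bsub>M\<^esub>} \<and> finsum M c {d. c d \<noteq> \<zero>\<^bsub>M\<^esub>} = x"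
    (is "?L \<longleftrightarrow> ?R") for c x
  proof -
    have "range \<sigma> = UNIV" using assms(1) by (simp add: bij_def)
    then have pre: "\<exists>e. d = \<sigma> e" for d by (metis rangeE UNIV_I)
    have im: "\<sigma> ` {d. c (\<sigma> d) \<noteq> \<zero>\<^bsub>M\<^esub>} = {d. c d \<noteq> \<zero>\<^bsub>M\<^esub>}" (is "?A = ?B")
    proof (rule subset_antisym; rule subsetI)
      fix d assume "d \<in> ?B"
      moreover obtain e where "d = \<sigma> e" using pre by blast
      ultimately show "d \<in> ?A" by blast
    qed blast
    have inj: "inj_on \<sigma> S" for S using assms(1) by (auto simp: bij_def inj_on_def)
    have all: "(\<forall>d. c (\<sigma> d) \<in> H (\<sigma> d)) \<longleftrightarrow> (\<forall>d. c d \<in> H d)"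
      using assms(1) by (metis bij_pointE)
    have fin: "finite {d. c (\<sigma> d) \<noteq> \<zero>\<^bsub>M\<^esub>} \<longleftrightarrow> finite {d. c d \<noteq> \<zero>\<^bsub>M\<^esub>}"
      using finite_image_iff[OF inj, of "{d. c (\<sigma> d) \<noteq> \<zero>\<^bsub>M\<^esub>}"] im by simp
    have "finsum M c {d. c d \<noteq> \<zero>\<^bsub>M\<^esub>} = finsum M (\<lambda>d. c (\<sigma> d)) {d. c (\<sigma> d) \<noteq> \<zero>\<^bsub>M\<^esub>}"
      if "\<forall>d. c d \<in> H d"
      unfolding im[symmetric] by (rule finsum_reindex) (use that H inj in auto)
    with all fin show ?thesis by auto
  qed
  fix x assume "x \<in> carrier M"
  then obtain c where c: "(\<forall>d. c d \<in> H d) \<and> finite {d. c d \<noteq> \<zero>\<^bsub>M\<^esub>} \<and>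
        finsum M c {d. c d \<noteq> \<zero>\<^bsub>M\<^esub>} = x"
    and u: "\<And>c'. (\<forall>d. c' d \<in> H d) \<and> finite {d. c' d \<noteq> \<zero>\<^bsub>M\<^esub>} \<and>
        finsum M c' {d. c' d \<noteq> \<zero>\<^bsub>M\<^esub>} = x \<Longrightarrow> c' = c"
    using assms(3) unfolding direct_sum_grading_def by metis
  show "\<exists>!c. (\<forall>d. c d \<in> (H \<circ> \<sigma>) d) \<and> finite {d. c d \<noteq> \<zero>\<^bsub>M\<^esub>} \<and> finsum M c {d. c d \<noteq> \<zero>\<^bsub>M\<^esub>} = x"
  proof (rule ex1I[of _ "\<lambda>d. c (\<sigma> d)"])
    show "(\<forall>d. c (\<sigma> d) \<in> (H \<circ> \<sigma>) d) \<and> finite {d. c (\<sigma> d) \<noteq> \<zero>\<^bsub>M\<^esub>} \<and>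
       finsum M (\<lambda>d. c (\<sigma> d)) {d. c (\<sigma> d) \<noteq> \<zero>\<^bsub>M\<^esub>} = x"
      using key[of c x] c by simp
  next
    fix c' assume c': "(\<forall>d. c' d \<in> (H \<circ> \<sigma>) d) \<and> finite {d. c' d \<noteq> \<zero>\<^bsub>M\<^esub>} \<and>
       finsum M c' {d. c' d \<noteq> \<zero>\<^bsub>M\<^esub>} = x"
    have e: "c' = (\<lambda>d. (c' \<circ> inv_into UNIV \<sigma>) (\<sigma> d))"
      using assms(1) by (simp add: bij_is_inj)
    have "c' \<circ> inv_into UNIV \<sigma> = c"
      using key[of "c' \<circ> inv_into UNIV \<sigma>" x] c' assms(1) by (intro u) (simp add: bij_is_inj)
    then show "c' = (\<lambda>d. c (\<sigma> d))" using e by metis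
  qed
qed

lemma shift_grading:
  assumes "abelian_group M" "direct_sum_grading M H"
  shows "direct_sum_grading M (\<lambda>(i, j). H (i + k :: int, j + m :: int))"
proof -
  have "bij (\<lambda>(i, j). (i + k, j + m))"
    by (rule bij_betw_byWitness[where f' = "\<lambda>(i, j). (i - k, j - m)"]) auto
  from grading_reindex[OF this assms] show ?thesis by (simp add: comp_def case_prod_unfold)
qed

lemma shift_sel [simp]:
  "carrier (dg_shift k m M) = carrier M" "\<zero>\<^bsub>dg_shift k m M\<^esub> = \<zero>\<^bsub>M\<^esub>"
  "add (dg_shift k m M) = add M" "smult (dg_shift k m M) = smult M"
  "diff (dg_shift k m M) = diff M" "homog (dg_shift k m M) (i, j) = homog M (i + k, j + m)"
  "monoid.mult (dg_shift k m M) = monoid.mult M" "\<one>\<^bsub>dg_shift k m M\<^esub> = \<one>\<^bsub>M\<^esub>"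
  by (simp_all add: dg_shift_def)

lemma add_monoid_shift: "add_monoid (dg_shift k m M) = add_monoid M" by simp

lemma shift_dg_module:
  assumes "dg_module R M" shows "dg_module R (dg_shift k m M)"
proof -
  have ab: "abelian_group M" and gr: "direct_sum_grading M (homog M)"
    using assms by (auto simp: dg_module_def)
  have 1: "abelian_group (dg_shift k m M)"
    using ab unfolding abelian_group_def abelian_monoid_def abelian_group_axioms_def add_monoid_shift .
  have fs: "finsum (dg_shift k m M) = finsum M"
    unfolding finsum_def add_monoid_shift ..
  have 2: "direct_sum_grading (dg_shift k m M) (homog (dg_shift k m M))"
    using shift_grading[OF ab gr, of k m]
    unfolding direct_sum_grading_def add_monoid_shift fs by (simp add: dg_shift_def)
  have h: "r \<odot>\<^bsub>M\<^esub> x \<in> homog M (i + i' + k, j + j' + m)"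
    if "r \<in> dga_homog R (i, j)" "x \<in> homog M (i' + k, j' + m)" for r x i j i' j'
  proof -
    have "\<forall>i j i' j'. \<forall>r\<in>dga_homog R (i, j). \<forall>x\<in>homog M (i', j').
       r \<odot>\<^bsub>M\<^esub> x \<in> homog M (i + i', j + j')" using assms by (simp add: dg_module_def)
    then have "r \<odot>\<^bsub>M\<^esub> x \<in> homog M (i + (i' + k), j + (j' + m))" using that by blast
    then show ?thesis by (simp add: add.assoc)
  qed
  have d: "diff M x \<in> homog M (i + 1 + k, j + m)" if "x \<in> homog M (i + k, j + m)" for x i j
  proof -
    have "\<forall>i j. \<forall>x\<in>homog M (i, j). diff M x \<in> homog M (i + 1, j)"
      using assms by (simp add: dg_module_def)
    then have "diff M x \<in> homog M (i + k + 1, j + m)" using that by blast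
    then show ?thesis by (simp add: ac_simps)
  qed
  show ?thesis
    using assms 1 2 h d unfolding dg_module_def by simp
qed


lemma cone_sel [simp]:
  "p \<in> carrier (mcone M N f) \<longleftrightarrow> (\<exists>x y. p = Pr x y \<and> x \<in> carrier M \<and> y \<in> carrier N)"
  "\<zero>\<^bsub>mcone M N f\<^esub> = Pr \<zero>\<^bsub>M\<^esub> \<zero>\<^bsub>N\<^esub>"
  "p \<oplus>\<^bsub>mcone M N f\<^esub> q = Pr (pr1 p \<oplus>\<^bsub>M\<^esub> pr1 q) (pr2 p \<oplus>\<^bsub>N\<^esub> pr2 q)"
  "a \<odot>\<^bsub>mcone M N f\<^esub> p = Pr (a \<odot>\<^bsub>M\<^esub> pr1 p) (a \<odot>\<^bsub>N\<^esub> pr2 p)"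
  "diff (mcone M N f) p = Pr (diff M (pr1 p)) (f (pr1 p) \<oplus>\<^bsub>N\<^esub> diff N (pr2 p))"
  "homog (mcone M N f) = (\<lambda>(i, j). {Pr x y | x y. x \<in> homog M (i + 1, j) \<and> y \<in> homog N (i, j)})"
  by (simp_all add: mcone_def)

lemma cone_abelian:
  assumes "abelian_group M" "abelian_group N" shows "abelian_group (mcone M N f)"
proof -
  interpret M: abelian_group M by fact
  interpret N: abelian_group N by fact
  show ?thesis
  proof (rule abelian_groupI)
    fix p assume "p \<in> carrier (mcone M N f)"
    then obtain x y where p: "p = Pr x y" "x \<in> carrier M" "y \<in> carrier N" by auto
    then show "\<exists>q\<in>carrier (mcone M N f). q \<oplus>\<^bsub>mcone M N f\<^esub> p = \<zero>\<^bsub>mcone M N f\<^esub>"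
      by (intro bexI[of _ "Pr (\<ominus>\<^bsub>M\<^esub> x) (\<ominus>\<^bsub>N\<^esub> y)"]) (auto simp: M.l_neg N.l_neg)
  qed (auto simp: M.a_ac N.a_ac)
qed

lemma cone_finsum:
  assumes "abelian_group M" "abelian_group N" "finite S"
    "\<And>s. s \<in> S \<Longrightarrow> g s \<in> carrier M" "\<And>s. s \<in> S \<Longrightarrow> h s \<in> carrier N"
  shows "finsum (mcone M N f) (\<lambda>s. Pr (g s) (h s)) S = Pr (finsum M g S) (finsum N h S)"
proof -
  interpret M: abelian_group M by fact
  interpret N: abelian_group N by fact
  interpret C: abelian_group "mcone M N f" by (rule cone_abelian) fact+
  show ?thesis using assms(3-5)
  proof (induction S rule: finite_induct)
    case empty
    show ?case using C.finsum_empty by simp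
  next
    case (insert s S)
    have "finsum (mcone M N f) (\<lambda>s. Pr (g s) (h s)) (insert s S)
      = Pr (g s) (h s) \<oplus>\<^bsub>mcone M N f\<^esub> finsum (mcone M N f) (\<lambda>s. Pr (g s) (h s)) S"
      using insert.prems by (intro C.finsum_insert insert.hyps Pi_I) auto
    also have "\<dots> = Pr (g s \<oplus>\<^bsub>M\<^esub> finsum M g S) (h s \<oplus>\<^bsub>N\<^esub> finsum N h S)"
      using insert by simp
    also have "g s \<oplus>\<^bsub>M\<^esub> finsum M g S = finsum M g (insert s S)"
      by (rule M.finsum_insert[symmetric]) (use insert in auto)
    also have "h s \<oplus>\<^bsub>N\<^esub> finsum N h S = finsum N h (insert s S)"
      by (rule N.finsum_insert[symmetric]) (use insert in auto)
    finally show ?case .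
  qed
qed

lemma finsum_support:
  assumes "abelian_group M" "finite S" "{d. c d \<noteq> \<zero>\<^bsub>M\<^esub>} \<subseteq> S" "\<And>d. c d \<in> carrier M"
  shows "finsum M c S = finsum M c {d. c d \<noteq> \<zero>\<^bsub>M\<^esub>}"
proof -
  interpret abelian_group M by fact
  show ?thesis
    by (rule add.finprod_mono_neutral_cong_left[symmetric]) (use assms in auto)
qed

lemma cone_grading:
  assumes M: "abelian_group M" "direct_sum_grading M H" and N: "abelian_group N" "direct_sum_grading N K"
  shows "direct_sum_grading (mcone M N f) (\<lambda>d. {Pr x y | x y. x \<in> H d \<and> y \<in> K d})"
  unfolding direct_sum_grading_def
proof (intro conjI allI ballI)
  let ?C = "mcone M N f"
  interpret M: abelian_group M by fact
  interpret N: abelian_group N by fact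
  interpret C: abelian_group ?C by (rule cone_abelian) fact+
  have sH: "subgroup (H d) (add_monoid M)" and sK: "subgroup (K d) (add_monoid N)" for d
    using M(2) N(2) by (simp_all add: direct_sum_grading_def)
  have H: "x \<in> H d \<Longrightarrow> x \<in> carrier M" and K: "y \<in> K d \<Longrightarrow> y \<in> carrier N" for d x y
    using subgroup.mem_carrier[OF sH] subgroup.mem_carrier[OF sK] by auto
  fix d
  show "subgroup {Pr x y | x y. x \<in> H d \<and> y \<in> K d} (add_monoid ?C)"
  proof (rule group.subgroupI[OF C.a_group])
    show "{Pr x y | x y. x \<in> H d \<and> y \<in> K d} \<subseteq> carrier (add_monoid ?C)"
      using H K by auto
    show "{Pr x y | x y. x \<in> H d \<and> y \<in> K d} \<noteq> {}"
      using subgroup.one_closed[OF sH] subgroup.one_closed[OF sK] by blast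
  next
    fix p assume "p \<in> {Pr x y | x y. x \<in> H d \<and> y \<in> K d}"
    then obtain x y where p: "p = Pr x y" "x \<in> H d" "y \<in> K d" by auto
    have "\<ominus>\<^bsub>?C\<^esub> p = Pr (\<ominus>\<^bsub>M\<^esub> x) (\<ominus>\<^bsub>N\<^esub> y)"
      by (rule C.minus_equality) (use p H K in \<open>auto simp: M.l_neg N.l_neg\<close>)
    then show "inv\<^bsub>add_monoid ?C\<^esub> p \<in> {Pr x y | x y. x \<in> H d \<and> y \<in> K d}"
      using subgroup.m_inv_closed[OF sH p(2)] subgroup.m_inv_closed[OF sK p(3)]
      by (simp add: a_inv_def)
  next
    fix p q assume "p \<in> {Pr x y | x y. x \<in> H d \<and> y \<in> K d}" "q \<in> {Pr x y | x y. x \<in> H d \<and> y \<in> K d}"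
    then show "p \<otimes>\<^bsub>add_monoid ?C\<^esub> q \<in> {Pr x y | x y. x \<in> H d \<and> y \<in> K d}"
      using subgroup.m_closed[OF sH] subgroup.m_closed[OF sK] by auto
  qed
next
  let ?C = "mcone M N f"
  interpret M: abelian_group M by fact
  interpret N: abelian_group N by fact
  have sH: "subgroup (H d) (add_monoid M)" and sK: "subgroup (K d) (add_monoid N)" for d
    using M(2) N(2) by (simp_all add: direct_sum_grading_def)
  have H: "x \<in> H d \<Longrightarrow> x \<in> carrier M" and K: "y \<in> K d \<Longrightarrow> y \<in> carrier N" for d x y
    using subgroup.mem_carrier[OF sH] subgroup.mem_carrier[OF sK] by auto
  define good1 where "good1 c x \<longleftrightarrow> (\<forall>d. c d \<in> H d) \<and> finite {d. c d \<noteq> \<zero>\<^bsub>M\<^esub>} \<and>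
        finsum M c {d. c d \<noteq> \<zero>\<^bsub>M\<^esub>} = x" for c x
  define good2 where "good2 c x \<longleftrightarrow> (\<forall>d. c d \<in> K d) \<and> finite {d. c d \<noteq> \<zero>\<^bsub>N\<^esub>} \<and>
        finsum N c {d. c d \<noteq> \<zero>\<^bsub>N\<^esub>} = x" for c x
  define good where "good c x \<longleftrightarrow> (\<forall>d. c d \<in> {Pr x y | x y. x \<in> H d \<and> y \<in> K d}) \<and>
        finite {d. c d \<noteq> \<zero>\<^bsub>?C\<^esub>} \<and> finsum ?C c {d. c d \<noteq> \<zero>\<^bsub>?C\<^esub>} = x" for c x
  have good: "good (\<lambda>d. Pr (g d) (h d)) (Pr x y) \<longleftrightarrow> good1 g x \<and> good2 h y" for g h x y
  proof (cases "(\<forall>d. g d \<in> H d \<and> h d \<in> K d) \<and> finite {d. g d \<noteq> \<zero>\<^bsub>M\<^esub>} \<and> finite {d. h d \<noteq> \<zero>\<^bsub>N\<^esub>}")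
    case True
    then have c: "g d \<in> carrier M" "h d \<in> carrier N" for d using H K by blast+
    let ?S = "{d. Pr (g d) (h d) \<noteq> \<zero>\<^bsub>?C\<^esub>}"
    have S: "?S = {d. g d \<noteq> \<zero>\<^bsub>M\<^esub>} \<union> {d. h d \<noteq> \<zero>\<^bsub>N\<^esub>}" by auto
    with True have fin: "finite ?S" by simp
    have "finsum ?C (\<lambda>d. Pr (g d) (h d)) ?S = Pr (finsum M g ?S) (finsum N h ?S)"
      by (rule cone_finsum[OF M(1) N(1) fin]) (use c in auto)
    also have "finsum M g ?S = finsum M g {d. g d \<noteq> \<zero>\<^bsub>M\<^esub>}"
      by (rule finsum_support[OF M(1) fin]) (use c S in auto)
    also have "finsum N h ?S = finsum N h {d. h d \<noteq> \<zero>\<^bsub>N\<^esub>}"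
      by (rule finsum_support[OF N(1) fin]) (use c S in auto)
    finally show ?thesis using True fin unfolding good_def good1_def good2_def by auto
  next
    case False
    have "{d. Pr (g d) (h d) \<noteq> \<zero>\<^bsub>?C\<^esub>} = {d. g d \<noteq> \<zero>\<^bsub>M\<^esub>} \<union> {d. h d \<noteq> \<zero>\<^bsub>N\<^esub>}" by auto
    then show ?thesis using False unfolding good_def good1_def good2_def by (auto simp del: split_paired_All)
  qed
  fix p assume "p \<in> carrier ?C"
  then obtain x y where p: "p = Pr x y" "x \<in> carrier M" "y \<in> carrier N" by auto
  have "\<exists>!c. good1 c x" "\<exists>!c. good2 c y"
    using M(2) N(2) p unfolding direct_sum_grading_def good1_def good2_def by blast+
  then obtain g h where g: "good1 g x" "\<And>c. good1 c x \<Longrightarrow> c = g"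
    and h: "good2 h y" "\<And>c. good2 c y \<Longrightarrow> c = h" by metis
  have "\<exists>!c. good c p"
  proof (rule ex1I[of _ "\<lambda>d. Pr (g d) (h d)"])
    show "good (\<lambda>d. Pr (g d) (h d)) p" using good g h p by blast
  next
    fix c assume c: "good c p"
    then have cd: "\<And>d. c d \<in> {Pr x y | x y. x \<in> H d \<and> y \<in> K d}" unfolding good_def by blast
    have "Pr (pr1 (c d)) (pr2 (c d)) = c d" for d
    proof -
      from cd[of d] show ?thesis by auto
    qed
    then have e: "c = (\<lambda>d. Pr (pr1 (c d)) (pr2 (c d)))" by simp
    have "good (\<lambda>d. Pr (pr1 (c d)) (pr2 (c d))) (Pr x y)"
      using c unfolding p(1) e[symmetric] .
    then have gh: "good1 (\<lambda>d. pr1 (c d)) x" "good2 (\<lambda>d. pr2 (c d)) y" using good by auto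
    show "c = (\<lambda>d. Pr (g d) (h d))"
      unfolding g(2)[OF gh(1), symmetric] h(2)[OF gh(2), symmetric] by (rule e)
  qed
  then show "\<exists>!c. (\<forall>d. c d \<in> {Pr x y | x y. x \<in> H d \<and> y \<in> K d}) \<and>
        finite {d. c d \<noteq> \<zero>\<^bsub>?C\<^esub>} \<and> finsum ?C c {d. c d \<noteq> \<zero>\<^bsub>?C\<^esub>} = p"
    unfolding good_def .
qed

lemma cone_dg_module:
  assumes M: "dg_module dgA M" and N: "dg_module dgA N" and f: "f \<in> cocycles0 M N"
  shows "dg_module dgA (mcone M N f)"
proof -
  note m = M[unfolded dg_module_def] and n = N[unfolded dg_module_def]
  interpret M: abelian_group M using m by blast
  interpret N: abelian_group N using n by blast
  have f_closed: "f x \<in> carrier N" if "x \<in> carrier M" for x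
    using f that by (auto simp: cocycles0_def dg_hom_def)
  have f_add: "f (x \<oplus>\<^bsub>M\<^esub> y) = f x \<oplus>\<^bsub>N\<^esub> f y" if "x \<in> carrier M" "y \<in> carrier M" for x y
    using f that by (auto simp: cocycles0_def dg_hom_def)
  have f_lin: "f (r \<odot>\<^bsub>M\<^esub> x) = r \<odot>\<^bsub>N\<^esub> f x" if "x \<in> carrier M" for r x
    using f that by (auto simp: cocycles0_def dg_hom_def)
  have f_deg: "f x \<in> homog N (i, j)" if "x \<in> homog M (i, j)" for x i j
    using f that by (auto simp: cocycles0_def dg_hom_def)
  have f_d: "diff N (f x) \<oplus>\<^bsub>N\<^esub> f (diff M x) = \<zero>\<^bsub>N\<^esub>" if "x \<in> carrier M" for x
  proof -
    have "dg_hom_diff M N f x = (\<lambda>x \<in> carrier M. \<zero>\<^bsub>N\<^esub>) x" using f by (simp add: cocycles0_def)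
    with that show ?thesis by (simp add: dg_hom_diff_def)
  qed
  have gr: "direct_sum_grading M (homog M)" "direct_sum_grading N (homog N)" using m n by blast+
  have sN: "subgroup (homog N d) (add_monoid N)" for d
    using gr(2) unfolding direct_sum_grading_def by blast
  have N_add: "x \<oplus>\<^bsub>N\<^esub> y \<in> homog N d" if "x \<in> homog N d" "y \<in> homog N d" for x y d
    using subgroup.m_closed[OF sN that] by simp
  have mc: "r \<odot>\<^bsub>M\<^esub> x \<in> carrier M" "diff M x \<in> carrier M" if "x \<in> carrier M" for r x
    using m that by simp_all
  have nc: "r \<odot>\<^bsub>N\<^esub> x \<in> carrier N" "diff N x \<in> carrier N" if "x \<in> carrier N" for r x
    using n that by simp_all
  have nadd: "diff N (x \<oplus>\<^bsub>N\<^esub> y) = diff N x \<oplus>\<^bsub>N\<^esub> diff N y"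
    "r \<odot>\<^bsub>N\<^esub> (x \<oplus>\<^bsub>N\<^esub> y) = (r \<odot>\<^bsub>N\<^esub> x) \<oplus>\<^bsub>N\<^esub> (r \<odot>\<^bsub>N\<^esub> y)" if "x \<in> carrier N" "y \<in> carrier N" for x y r
    using n that by simp_all
  have nd: "diff N (diff N x) = \<zero>\<^bsub>N\<^esub>"
    "diff N (r \<odot>\<^bsub>N\<^esub> x) = (dga_diff dgA r \<odot>\<^bsub>N\<^esub> x) \<oplus>\<^bsub>N\<^esub> (r \<odot>\<^bsub>N\<^esub> diff N x)" if "x \<in> carrier N" for x r
    using n that by simp_all
  have n0: "0 \<odot>\<^bsub>N\<^esub> x = \<zero>\<^bsub>N\<^esub>" if "x \<in> carrier N" for x
  proof -
    have "\<forall>r s. \<forall>x\<in>carrier N. (r + s) \<odot>\<^bsub>N\<^esub> x = (r \<odot>\<^bsub>N\<^esub> x) \<oplus>\<^bsub>N\<^esub> (s \<odot>\<^bsub>N\<^esub> x)"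
      using n by (elim conjE)
    from this[rule_format, OF that, of 0 0]
    have "0 \<odot>\<^bsub>N\<^esub> x = (0 \<odot>\<^bsub>N\<^esub> x) \<oplus>\<^bsub>N\<^esub> (0 \<odot>\<^bsub>N\<^esub> x)" by simp
    then show ?thesis using nc(1)[OF that, of 0] N.add.l_cancel_one'[of "0 \<odot>\<^bsub>N\<^esub> x" "0 \<odot>\<^bsub>N\<^esub> x"] by simp
  qed
  have deg: "diff M x \<in> homog M (i + 1, j)" if "x \<in> homog M (i, j)" for x i j using m that by blast
  have degN: "diff N x \<in> homog N (i + 1, j)" if "x \<in> homog N (i, j)" for x i j using n that by blast
  have act: "r \<odot>\<^bsub>M\<^esub> x \<in> homog M (i + i', j + j')"
    if "r \<in> dga_homog dgA (i, j)" "x \<in> homog M (i', j')" for r x i j i' j' using m that by blast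
  have actN: "r \<odot>\<^bsub>N\<^esub> x \<in> homog N (i + i', j + j')"
    if "r \<in> dga_homog dgA (i, j)" "x \<in> homog N (i', j')" for r x i j i' j' using n that by blast
  have "direct_sum_grading M (\<lambda>(i, j). homog M (i + 1, j + 0))"
    by (rule shift_grading) (use m in blast)+
  from cone_grading[OF M.abelian_group_axioms this N.abelian_group_axioms gr(2), of f]
  have G: "direct_sum_grading (mcone M N f) (homog (mcone M N f))"
    by (simp add: case_prod_unfold)
  show ?thesis
    unfolding dg_module_def
  proof (intro conjI G cone_abelian M.abelian_group_axioms N.abelian_group_axioms)
    show "\<forall>i j i' j'. \<forall>r\<in>dga_homog dgA (i, j). \<forall>x\<in>homog (mcone M N f) (i', j').
       r \<odot>\<^bsub>mcone M N f\<^esub> x \<in> homog (mcone M N f) (i + i', j + j')"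
    proof (intro allI ballI)
      fix i j i' j' r p assume r: "r \<in> dga_homog dgA (i, j)" and "p \<in> homog (mcone M N f) (i', j')"
      then obtain x y where p: "p = Pr x y" "x \<in> homog M (i' + 1, j')" "y \<in> homog N (i', j')" by auto
      from act[OF r p(2)] actN[OF r p(3)]
      show "r \<odot>\<^bsub>mcone M N f\<^esub> p \<in> homog (mcone M N f) (i + i', j + j')"
        by (simp add: p(1) add.assoc)
    qed
    show "\<forall>i j. \<forall>x\<in>homog (mcone M N f) (i, j). diff (mcone M N f) x \<in> homog (mcone M N f) (i + 1, j)"
    proof (intro allI ballI)
      fix i j p assume "p \<in> homog (mcone M N f) (i, j)"
      then obtain x y where p: "p = Pr x y" "x \<in> homog M (i + 1, j)" "y \<in> homog N (i, j)" by auto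
      have "f x \<oplus>\<^bsub>N\<^esub> diff N y \<in> homog N (i + 1, j)"
        using f_deg[OF p(2)] degN[OF p(3)] by (rule N_add)
      with deg[OF p(2)] show "diff (mcone M N f) p \<in> homog (mcone M N f) (i + 1, j)"
        by (simp only: p(1) cone_sel elt.sel case_prod_conv mem_Collect_eq) blast
    qed
    show "\<forall>x\<in>carrier (mcone M N f). diff (mcone M N f) (diff (mcone M N f) x) = \<zero>\<^bsub>mcone M N f\<^esub>"
    proof
      fix p assume "p \<in> carrier (mcone M N f)"
      then obtain x y where p: "p = Pr x y" "x \<in> carrier M" "y \<in> carrier N" by auto
      have "f (diff M x) \<oplus>\<^bsub>N\<^esub> diff N (f x \<oplus>\<^bsub>N\<^esub> diff N y) = diff N (f x) \<oplus>\<^bsub>N\<^esub> f (diff M x)"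
        using p f_closed mc nc by (simp add: nadd nd N.a_comm)
      moreover have "diff M (diff M x) = \<zero>\<^bsub>M\<^esub>" using m p by blast
      ultimately show "diff (mcone M N f) (diff (mcone M N f) p) = \<zero>\<^bsub>mcone M N f\<^esub>"
        using f_d p by simp
    qed
    show "\<forall>r. \<forall>x\<in>carrier (mcone M N f). diff (mcone M N f) (r \<odot>\<^bsub>mcone M N f\<^esub> x) =
          (dga_diff dgA r \<odot>\<^bsub>mcone M N f\<^esub> x) \<oplus>\<^bsub>mcone M N f\<^esub> (r \<odot>\<^bsub>mcone M N f\<^esub> diff (mcone M N f) x)"
    proof (intro allI ballI)
      fix r p assume "p \<in> carrier (mcone M N f)"
      then obtain x y where p: "p = Pr x y" "x \<in> carrier M" "y \<in> carrier N" by auto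
      have "diff M (r \<odot>\<^bsub>M\<^esub> x) = (dga_diff dgA r \<odot>\<^bsub>M\<^esub> x) \<oplus>\<^bsub>M\<^esub> (r \<odot>\<^bsub>M\<^esub> diff M x)" using m p by blast
      then show "diff (mcone M N f) (r \<odot>\<^bsub>mcone M N f\<^esub> p) =
          (dga_diff dgA r \<odot>\<^bsub>mcone M N f\<^esub> p) \<oplus>\<^bsub>mcone M N f\<^esub> (r \<odot>\<^bsub>mcone M N f\<^esub> diff (mcone M N f) p)"
        using p f_closed nc by (simp add: f_lin nd nadd dgA_def n0)
    qed
    show "\<forall>x\<in>carrier (mcone M N f). \<forall>y\<in>carrier (mcone M N f).
       diff (mcone M N f) (x \<oplus>\<^bsub>mcone M N f\<^esub> y) = diff (mcone M N f) x \<oplus>\<^bsub>mcone M N f\<^esub> diff (mcone M N f) y"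
    proof (intro ballI)
      fix p q assume "p \<in> carrier (mcone M N f)" "q \<in> carrier (mcone M N f)"
      then obtain x y x' y' where p: "p = Pr x y" "x \<in> carrier M" "y \<in> carrier N"
        "q = Pr x' y'" "x' \<in> carrier M" "y' \<in> carrier N" by auto
      have "diff M (x \<oplus>\<^bsub>M\<^esub> x') = diff M x \<oplus>\<^bsub>M\<^esub> diff M x'" using m p by blast
      then show "diff (mcone M N f) (p \<oplus>\<^bsub>mcone M N f\<^esub> q) = diff (mcone M N f) p \<oplus>\<^bsub>mcone M N f\<^esub> diff (mcone M N f) q"
        using p f_closed nc by (simp add: f_add nadd N.a_ac)
    qed
    show "\<forall>x\<in>carrier (mcone M N f). 1 \<odot>\<^bsub>mcone M N f\<^esub> x = x"
      using m n by auto
    show "\<forall>r s. \<forall>x\<in>carrier (mcone M N f). (r * s) \<odot>\<^bsub>mcone M N f\<^esub> x = r \<odot>\<^bsub>mcone M N f\<^esub> (s \<odot>\<^bsub>mcone M N f\<^esub> x)"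
      using m n by auto
    show "\<forall>r s. \<forall>x\<in>carrier (mcone M N f). (r + s) \<odot>\<^bsub>mcone M N f\<^esub> x
        = (r \<odot>\<^bsub>mcone M N f\<^esub> x) \<oplus>\<^bsub>mcone M N f\<^esub> (s \<odot>\<^bsub>mcone M N f\<^esub> x)"
      using m n by auto
    show "\<forall>r. \<forall>x\<in>carrier (mcone M N f). \<forall>y\<in>carrier (mcone M N f). r \<odot>\<^bsub>mcone M N f\<^esub> (x \<oplus>\<^bsub>mcone M N f\<^esub> y)
        = (r \<odot>\<^bsub>mcone M N f\<^esub> x) \<oplus>\<^bsub>mcone M N f\<^esub> (r \<odot>\<^bsub>mcone M N f\<^esub> y)"
      using m n by auto
    show "\<forall>r. \<forall>x\<in>carrier (mcone M N f). r \<odot>\<^bsub>mcone M N f\<^esub> x \<in> carrier (mcone M N f)"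
      using mc nc by auto
    show "\<forall>x\<in>carrier (mcone M N f). diff (mcone M N f) x \<in> carrier (mcone M N f)"
      using mc nc f_closed by auto
  qed
qed

lemma DGP_subset_DG: "DGP \<subseteq> DG_A"
proof
  fix M assume "M \<in> DGP"
  then show "M \<in> DG_A"
    unfolding DG_A_def mem_Collect_eq
    by induction (auto intro: proj_dg_module shift_dg_module cone_dg_module)
qed

lemma HP_sel: "Obj HP = DGP" "Hom HP = hom_H0" "Sh HP = dg_shift 1 0" by (simp_all add: HP_def HP_cat_def tri_cat.defs shift_cat.defs)

declare alg_add_self [simp del] alg_neg [simp del] projA_sel [simp del] shift_sel [simp del]
  cone_sel [simp del]

end

theory Submission
  imports Defs "HOL-Computational_Algebra.Formal_Laurent_Series"
begin

text \<open>
  Over \<open>\<bbbF>\<^sub>2\<close> no signs occur, so all objects of \<open>DGP(A)\<close> and their additive maps fit into one ring,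
  the endomorphisms of the product of all objects: an object \<open>X\<close> becomes an idempotent \<open>e X\<close>, a
  morphism an element of \<open>e Y * R * e X\<close>, the differential of a morphism its commutator with the total
  differential \<open>D\<close>, and a cone is a splitting of an idempotent by inclusions and projections.  The axioms
  of a triangulated category then are computations in this ring and in its homology ring.

  Each \<open>\<Gamma>\<close> defines a character \<open>A \<rightarrow> \<bbbF>\<^sub>2\<close>, hence a simple right module \<open>S\<^sub>\<Gamma>\<close> and an Euler characteristic
  \<open>\<chi>\<^sub>\<Gamma> X \<in> \<int>[T\<^sup>\<plusminus>\<^sup>1]\<close> of \<open>S\<^sub>\<Gamma> \<otimes>\<^sub>A X\<close>.  It is additive on triangles, and \<open>X \<mapsto> \<Sum>\<^sub>\<Gamma> \<chi>\<^sub>\<Gamma> X \<cdot> \<Gamma>\<close> identifies \<open>K\<^sub>0\<close>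
  with \<open>U\<^sub>T\<close>, since the classes of the \<open>P(\<Gamma>){m}\<close> generate \<open>K\<^sub>0\<close> and have linearly independent images.

  For the bifunctor only its effect on classes is prescribed, so it can factor through the semisimple
  quotient of \<open>A\<close>: for objects \<open>Q \<Gamma> \<Gamma>'\<close> of class \<open>\<Gamma> \<cdot> \<Gamma>'\<close> put
  \<open>M(X, Y) = \<Oplus>\<^sub>\<Gamma>\<^sub>,\<^sub>\<Gamma>\<^sub>' (S\<^sub>\<Gamma> \<otimes>\<^sub>A X) \<otimes> (S\<^sub>\<Gamma>\<^sub>' \<otimes>\<^sub>A Y) \<otimes> Q \<Gamma> \<Gamma>'\<close>.
\<close>

section \<open>DG modules in \<open>DGP(A)\<close>\<close>

text \<open>The bifunctor must take values in \<open>DGP\<close> itself, so a tensor product formed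
  as a set of cosets would not be an object. It is built instead along the inductive construction of
  \<open>X\<close>, together with a pairing and a universal property. That property makes it a
  functor: existence gives the map induced by a pair of morphisms, and uniqueness gives additivity,
  composition and compatibility with differentials. The objects \<open>Q\<close> exist because every
  element of \<open>U_T\<close> is the class of an object: shifts realise powers of \<open>T\<close>
  and signs, cones realise sums. Signs do occur, since \<open>F E = 1 - T - E F\<close>. Additivity
  of the Euler characteristic on triangles requires its invariance under homotopy equivalence. It
  follows from additivity on cones, because the cone of an equivalence is contractible and a
  contraction makes the dimensions cancel in pairs. Linear independence comes from an action of
  \<open>U_T\<close> by 2 by 2 matrices over Laurent series.\<close>

lemma DGP_dg_module: "M \<in> DGP \<Longrightarrow> dg_module dgA M"
  using DGP_subset_DG by (auto simp: DG_A_def)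

locale dgmod =
  fixes M :: amod
  assumes dg_module: "dg_module dgA M"
begin

sublocale abelian_group M
  using dg_module by (simp add: dg_module_def)

lemma smult_closed [simp]: "x \<in> carrier M \<Longrightarrow> a \<odot>\<^bsub>M\<^esub> x \<in> carrier M"
  and smult_one: "x \<in> carrier M \<Longrightarrow> 1 \<odot>\<^bsub>M\<^esub> x = x"
  and smult_mult: "x \<in> carrier M \<Longrightarrow> (a * b) \<odot>\<^bsub>M\<^esub> x = a \<odot>\<^bsub>M\<^esub> (b \<odot>\<^bsub>M\<^esub> x)"
  and smult_add_left: "x \<in> carrier M \<Longrightarrow> (a + b) \<odot>\<^bsub>M\<^esub> x = a \<odot>\<^bsub>M\<^esub> x \<oplus>\<^bsub>M\<^esub> b \<odot>\<^bsub>M\<^esub> x"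
  and smult_add: "x \<in> carrier M \<Longrightarrow> y \<in> carrier M \<Longrightarrow> a \<odot>\<^bsub>M\<^esub> (x \<oplus>\<^bsub>M\<^esub> y) = a \<odot>\<^bsub>M\<^esub> x \<oplus>\<^bsub>M\<^esub> a \<odot>\<^bsub>M\<^esub> y"
  and diff_closed [simp]: "x \<in> carrier M \<Longrightarrow> diff M x \<in> carrier M"
  and diff_add: "x \<in> carrier M \<Longrightarrow> y \<in> carrier M \<Longrightarrow> diff M (x \<oplus>\<^bsub>M\<^esub> y) = diff M x \<oplus>\<^bsub>M\<^esub> diff M y"
  and diff_homog: "x \<in> homog M (i, j) \<Longrightarrow> diff M x \<in> homog M (i + 1, j)"
  and diff_diff: "x \<in> carrier M \<Longrightarrow> diff M (diff M x) = \<zero>\<^bsub>M\<^esub>"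
  and grading: "direct_sum_grading M (homog M)"
  using dg_module by (auto simp: dg_module_def)

lemma homog_subgroup: "subgroup (homog M d) (add_monoid M)"
  using grading unfolding direct_sum_grading_def by blast

lemma homog_closed: "x \<in> homog M d \<Longrightarrow> x \<in> carrier M"
  using subgroup.mem_carrier[OF homog_subgroup] by simp

lemma homog_zero [simp]: "\<zero>\<^bsub>M\<^esub> \<in> homog M d"
  using subgroup.one_closed[OF homog_subgroup] by simp

lemma homog_add: "x \<in> homog M d \<Longrightarrow> y \<in> homog M d \<Longrightarrow> x \<oplus>\<^bsub>M\<^esub> y \<in> homog M d"
  using subgroup.m_closed[OF homog_subgroup] by simp

lemma smult_zero [simp]: "a \<odot>\<^bsub>M\<^esub> \<zero>\<^bsub>M\<^esub> = \<zero>\<^bsub>M\<^esub>"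
  using smult_add[of "\<zero>\<^bsub>M\<^esub>" "\<zero>\<^bsub>M\<^esub>" a] by (simp add: add.l_cancel_one')

lemma zero_smult [simp]: "x \<in> carrier M \<Longrightarrow> 0 \<odot>\<^bsub>M\<^esub> x = \<zero>\<^bsub>M\<^esub>"
  using smult_add_left[of x 0 0] by (simp add: add.l_cancel_one')

lemma diff_zero [simp]: "diff M \<zero>\<^bsub>M\<^esub> = \<zero>\<^bsub>M\<^esub>"
  using diff_add[of "\<zero>\<^bsub>M\<^esub>" "\<zero>\<^bsub>M\<^esub>"] by (simp add: add.l_cancel_one')

lemma add_self [simp]: "x \<in> carrier M \<Longrightarrow> x \<oplus>\<^bsub>M\<^esub> x = \<zero>\<^bsub>M\<^esub>"
  using smult_add_left[of x 1 1] by (simp add: smult_one alg_two del: one_add_one)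

lemma add_self_left [simp]: "x \<in> carrier M \<Longrightarrow> y \<in> carrier M \<Longrightarrow> x \<oplus>\<^bsub>M\<^esub> (x \<oplus>\<^bsub>M\<^esub> y) = y"
  by (simp flip: a_assoc)

lemma diff_smult: "x \<in> carrier M \<Longrightarrow> diff M (a \<odot>\<^bsub>M\<^esub> x) = a \<odot>\<^bsub>M\<^esub> diff M x"
  using dg_module by (auto simp: dg_module_def dgA_def)

lemma add_eq_zero_iff: "x \<in> carrier M \<Longrightarrow> y \<in> carrier M \<Longrightarrow> x \<oplus>\<^bsub>M\<^esub> y = \<zero>\<^bsub>M\<^esub> \<longleftrightarrow> x = y"
  by (metis add_self add_self_left r_zero)

text \<open>Each element is a finite sum of homogeneous ones, so a property closed under addition
  need only be checked one bidegree at a time.\<close>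

lemma homog_induct [consumes 1, case_names zero add homog]:
  assumes "x \<in> carrier M" and "P \<zero>\<^bsub>M\<^esub>"
    and add: "\<And>x y. x \<in> carrier M \<Longrightarrow> y \<in> carrier M \<Longrightarrow> P x \<Longrightarrow> P y \<Longrightarrow> P (x \<oplus>\<^bsub>M\<^esub> y)"
    and h: "\<And>d x. x \<in> homog M d \<Longrightarrow> P x"
  shows "P x"
proof -
  obtain c where c: "\<And>d. c d \<in> homog M d" "finite {d. c d \<noteq> \<zero>\<^bsub>M\<^esub>}" "finsum M c {d. c d \<noteq> \<zero>\<^bsub>M\<^esub>} = x"
    using grading assms(1) unfolding direct_sum_grading_def by metis
  have "P (finsum M c S)" if "finite S" for S
    using that
  proof (induction S)
    case empty
    show ?case using assms(2) by simp
  next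
    case (insert d S)
    have "c d \<in> carrier M" for d using c(1) homog_closed by blast
    with insert show ?case by (simp add: add h[OF c(1)])
  qed
  with c show ?thesis by metis
qed

end

lemma dgmod_DGP: "M \<in> DGP \<Longrightarrow> dgmod M"
  by unfold_locales (rule DGP_dg_module)

text \<open>Neither linearity nor a degree is imposed, so morphisms of all degrees and their
  differentials lie in one set. Being extensional, they are determined by their values on the
  carrier.\<close>

definition addmap :: "amod \<Rightarrow> amod \<Rightarrow> (elt \<Rightarrow> elt) set" where
  "addmap M N = {f \<in> carrier M \<rightarrow>\<^sub>E carrier N.
     \<forall>x \<in> carrier M. \<forall>y \<in> carrier M. f (x \<oplus>\<^bsub>M\<^esub> y) = f x \<oplus>\<^bsub>N\<^esub> f y}"

lemma dg_hom_iff: "f \<in> carrier (dg_hom k M N) \<longleftrightarrow> f \<in> addmap M N \<and>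
    (\<forall>r. \<forall>x \<in> carrier M. f (r \<odot>\<^bsub>M\<^esub> x) = r \<odot>\<^bsub>N\<^esub> f x) \<and>
    (\<forall>i j. \<forall>x \<in> homog M (i, j). f x \<in> homog N (i + k, j))"
  by (auto simp: dg_hom_def addmap_def)

lemma addmap_closed: "f \<in> addmap M N \<Longrightarrow> x \<in> carrier M \<Longrightarrow> f x \<in> carrier N"
  and addmap_add: "f \<in> addmap M N \<Longrightarrow> x \<in> carrier M \<Longrightarrow> y \<in> carrier M \<Longrightarrow> f (x \<oplus>\<^bsub>M\<^esub> y) = f x \<oplus>\<^bsub>N\<^esub> f y"
  by (auto simp: addmap_def)

lemma addmap_zero:
  assumes "M \<in> DGP" "N \<in> DGP" "f \<in> addmap M N" shows "f \<zero>\<^bsub>M\<^esub> = \<zero>\<^bsub>N\<^esub>"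
proof -
  interpret M: dgmod M using assms dgmod_DGP by blast
  interpret N: dgmod N using assms dgmod_DGP by blast
  show ?thesis
    using addmap_add[OF assms(3), of "\<zero>\<^bsub>M\<^esub>" "\<zero>\<^bsub>M\<^esub>"] addmap_closed[OF assms(3), of "\<zero>\<^bsub>M\<^esub>"]
    by simp
qed

lemma addmap_eqI:
  assumes "f \<in> addmap M N" "g \<in> addmap M N" "\<And>x. x \<in> carrier M \<Longrightarrow> f x = g x" shows "f = g"
  using assms by (auto simp: addmap_def intro: PiE_ext)

lemma addmap_id: "(\<lambda>x \<in> carrier M. x) \<in> addmap M M" if "M \<in> DGP"
proof -
  interpret M: dgmod M using that dgmod_DGP by blast
  show ?thesis by (auto simp: addmap_def)
qed

text \<open>Killing both \<open>\<rho>\<close> generators and all idempotents but one respects the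
  relations: those with a \<open>\<rho>\<close> become \<open>0 = 0\<close>, and exactly one summand
  of the unit survives.\<close>

lift_definition eps :: "idx \<Rightarrow> alg \<Rightarrow> bit" is "\<lambda>\<Gamma>. expr_eval (\<lambda>g. if g = GId \<Gamma> then 1 else 0)"
proof -
  fix \<Gamma> s t assume "pres_eq alg_rel s t"
  then show "expr_eval (\<lambda>g. if g = GId \<Gamma> then 1 else (0::bit)) s = expr_eval (\<lambda>g. if g = GId \<Gamma> then 1 else 0) t"
    by (rule pres_eq_eval) (cases \<Gamma>; auto elim!: alg_rel.cases)
qed

lemma eps_simps [simp]:
  "eps \<Gamma> 0 = 0" "eps \<Gamma> 1 = 1" "eps \<Gamma> (a + b) = eps \<Gamma> a + eps \<Gamma> b" "eps \<Gamma> (- a) = - eps \<Gamma> a"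
  "eps \<Gamma> (a * b) = eps \<Gamma> a * eps \<Gamma> b" "eps \<Gamma> (alg_of g) = (if g = GId \<Gamma> then 1 else 0)"
  by (transfer, simp)+

section \<open>The endomorphism ring of the product of all modules in \<open>DGP(A)\<close>\<close>

text \<open>Outside \<open>DGP\<close>, \<open>nrm\<close> takes a junk value, so that the product below ranges over a whole type.\<close>

definition nrm :: "amod \<Rightarrow> amod" where
  "nrm M = (if M \<in> DGP then M else projA IxF)"

lemma nrm_DGP [simp]: "nrm M \<in> DGP" and nrm_id [simp]: "M \<in> DGP \<Longrightarrow> nrm M = M"
  by (auto simp: nrm_def DGP_proj)

interpretation nrm: dgmod "nrm M" for M
  by (rule dgmod_DGP) simp

lifting_forget alg.lifting

typedef vec = "{c :: amod \<Rightarrow> elt. \<forall>M. c M \<in> carrier (nrm M)}"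
  by (rule exI[of _ "\<lambda>M. \<zero>\<^bsub>nrm M\<^esub>"]) simp

setup_lifting type_definition_vec

instantiation vec :: ab_group_add
begin
lift_definition zero_vec :: vec is "\<lambda>M. \<zero>\<^bsub>nrm M\<^esub>" by simp
lift_definition plus_vec :: "vec \<Rightarrow> vec \<Rightarrow> vec" is "\<lambda>c c' M. c M \<oplus>\<^bsub>nrm M\<^esub> c' M" by simp
text \<open>In characteristic 2 subtraction is addition and negation is the identity.\<close>

lift_definition minus_vec :: "vec \<Rightarrow> vec \<Rightarrow> vec" is "\<lambda>c c' M. c M \<oplus>\<^bsub>nrm M\<^esub> c' M" by simp
lift_definition uminus_vec :: "vec \<Rightarrow> vec" is "\<lambda>c. c" .
instance
  by intro_classes (transfer; simp add: nrm.a_ac fun_eq_iff)+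
end

lift_definition vnth :: "vec \<Rightarrow> amod \<Rightarrow> elt" is "\<lambda>c. c" .
lift_definition vsmult :: "alg \<Rightarrow> vec \<Rightarrow> vec" is "\<lambda>a c M. a \<odot>\<^bsub>nrm M\<^esub> c M" by simp
lift_definition vdiff :: "vec \<Rightarrow> vec" is "\<lambda>c M. diff (nrm M) (c M)" by simp
lift_definition vsingle :: "amod \<Rightarrow> elt \<Rightarrow> vec" is
  "\<lambda>N x M. if M = N \<and> x \<in> carrier (nrm N) then x else \<zero>\<^bsub>nrm M\<^esub>" by auto

lemma vnth_closed [simp]: "vnth v M \<in> carrier (nrm M)"
  by transfer simp

lemma vec_eqI: "(\<And>M. vnth v M = vnth w M) \<Longrightarrow> v = w"
  by transfer auto

lemma vnth_simps [simp]:
  "vnth 0 M = \<zero>\<^bsub>nrm M\<^esub>"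
  "vnth (v + w) M = vnth v M \<oplus>\<^bsub>nrm M\<^esub> vnth w M"
  "vnth (vsmult a v) M = a \<odot>\<^bsub>nrm M\<^esub> vnth v M"
  "vnth (vdiff v) M = diff (nrm M) (vnth v M)"
  "vnth (vsingle N x) M = (if M = N \<and> x \<in> carrier (nrm N) then x else \<zero>\<^bsub>nrm M\<^esub>)"
  by (transfer; simp)+

lemma vec_add_self [simp]: "(v::vec) + v = 0"
  by (rule vec_eqI) simp

lemma vsingle_add: "M \<in> DGP \<Longrightarrow> x \<in> carrier M \<Longrightarrow> y \<in> carrier M \<Longrightarrow>
    vsingle M (x \<oplus>\<^bsub>M\<^esub> y) = vsingle M x + vsingle M y"
  using nrm.a_closed[of x M y] by (intro vec_eqI) auto

lemma vdiff_add: "vdiff (v + w) = vdiff v + vdiff w"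
  by (rule vec_eqI) (simp add: nrm.diff_add)

text \<open>The product of the degree \<open>d\<close> parts. An infinite product of graded modules
  need not be the direct sum of these, so degrees of ring elements are defined by how they move each
  \<open>vhomog d\<close>.\<close>

definition vhomog :: "int \<times> int \<Rightarrow> vec set" where
  "vhomog d = {v. \<forall>M. vnth v M \<in> homog (nrm M) d}"

lifting_forget vec.lifting

text \<open>Multiplication will be composition. The instance is a \<open>ring\<close>; the
  identities of the objects are the idempotents \<open>ve M\<close>.\<close>

typedef vend = "{r :: vec \<Rightarrow> vec. \<forall>v w. r (v + w) = r v + r w}"
  by (rule exI[of _ "\<lambda>_. 0"]) simp

setup_lifting type_definition_vend

instantiation vend :: ring
begin
lift_definition zero_vend :: vend is "\<lambda>_. 0" by simp
lift_definition plus_vend :: "vend \<Rightarrow> vend \<Rightarrow> vend" is "\<lambda>r s v. r v + s v" by (simp add: ac_simps)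
lift_definition minus_vend :: "vend \<Rightarrow> vend \<Rightarrow> vend" is "\<lambda>r s v. r v - s v" by (simp add: algebra_simps)
lift_definition uminus_vend :: "vend \<Rightarrow> vend" is "\<lambda>r v. - r v" by simp
lift_definition times_vend :: "vend \<Rightarrow> vend \<Rightarrow> vend" is "\<lambda>r s v. r (s v)" by simp
instance
  by intro_classes (transfer; simp add: ac_simps)+
end

lift_definition vapp :: "vend \<Rightarrow> vec \<Rightarrow> vec" is "\<lambda>r. r" .
lift_definition vD :: vend is vdiff by (simp add: vdiff_add)

lemma vend_eqI: "(\<And>v. vapp r v = vapp s v) \<Longrightarrow> r = s"
  by transfer auto

lemma vapp_simps [simp]:
  "vapp 0 v = 0" "vapp (r + s) v = vapp r v + vapp s v" "vapp (r * s) v = vapp r (vapp s v)"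
  "vapp vD v = vdiff v" "vapp r (v + w) = vapp r v + vapp r w"
  by (transfer; simp)+

lemma vend_add_self: "(r::vend) + r = 0"
  by (rule vend_eqI) simp

definition vdeg :: "int \<Rightarrow> vend set" where
  "vdeg k = {r. (\<forall>a v. vapp r (vsmult a v) = vsmult a (vapp r v)) \<and>
     (\<forall>i j. \<forall>v \<in> vhomog (i, j). vapp r v \<in> vhomog (i + k, j))}"

lemma vdeg_add: "r \<in> vdeg k \<Longrightarrow> s \<in> vdeg k \<Longrightarrow> r + s \<in> vdeg k"
proof -
  have "vsmult a (v + w) = vsmult a v + vsmult a w" for a v w
    by (rule vec_eqI) (simp add: nrm.smult_add)
  moreover have "v \<in> vhomog d \<Longrightarrow> w \<in> vhomog d \<Longrightarrow> v + w \<in> vhomog d" for v w d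
    by (simp add: vhomog_def nrm.homog_add)
  ultimately show "r \<in> vdeg k \<Longrightarrow> s \<in> vdeg k \<Longrightarrow> r + s \<in> vdeg k"
    by (auto simp: vdeg_def)
qed

lemma vdeg_mult: "r \<in> vdeg k \<Longrightarrow> s \<in> vdeg l \<Longrightarrow> r * s \<in> vdeg (k + l)"
  by (fastforce simp: vdeg_def ac_simps)

lemma vdeg_D: "vD \<in> vdeg 1"
proof -
  have "vdiff (vsmult a v) = vsmult a (vdiff v)" for a v
    by (rule vec_eqI) (simp add: nrm.diff_smult)
  then show ?thesis
    by (auto simp: vdeg_def vhomog_def nrm.diff_homog)
qed

lemma vD_square: "vD * vD = 0"
  by (rule vend_eqI, simp, rule vec_eqI) (simp add: nrm.diff_diff)

text \<open>\<open>emb\<close> extends a map by zero on all other factors of the product, and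
  \<open>fn\<close> reads the component off again. For objects \<open>M\<close> and \<open>N\<close>
  they are inverse to each other between \<open>addmap M N\<close> and the corner
  \<open>ve N * r * ve M\<close> of the ring.\<close>

definition emb :: "amod \<Rightarrow> amod \<Rightarrow> (elt \<Rightarrow> elt) \<Rightarrow> vend" where
  "emb M N f = Abs_vend (\<lambda>v. vsingle N (f (vnth v M)))"

definition fn :: "amod \<Rightarrow> amod \<Rightarrow> vend \<Rightarrow> elt \<Rightarrow> elt" where
  "fn M N r = (\<lambda>x \<in> carrier M. vnth (vapp r (vsingle M x)) N)"

lemma vapp_emb:
  assumes "M \<in> DGP" "N \<in> DGP" "f \<in> addmap M N"
  shows "vapp (emb M N f) v = vsingle N (f (vnth v M))"
proof -
  have c: "vnth v M \<in> carrier M" for v using vnth_closed[of v M] assms by simp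
  have "vsingle N (f (vnth (v + w) M)) = vsingle N (f (vnth v M)) + vsingle N (f (vnth w M))" for v w
    using assms c addmap_closed[OF assms(3)]
    by (simp add: addmap_add[OF assms(3)] vsingle_add)
  then show ?thesis
    by (simp add: emb_def vapp.rep_eq Abs_vend_inverse)
qed

lemma vnth_emb:
  assumes "M \<in> DGP" "N \<in> DGP" "f \<in> addmap M N"
  shows "vnth (vapp (emb M N f) v) L = (if L = N then f (vnth v M) else \<zero>\<^bsub>nrm L\<^esub>)"
  using addmap_closed[OF assms(3), of "vnth v M"] vnth_closed[of v M] assms
  by (simp add: vapp_emb)

lemma fn_emb:
  assumes "M \<in> DGP" "N \<in> DGP" "f \<in> addmap M N" shows "fn M N (emb M N f) = f"
proof -
  have "fn M N (emb M N f) x = f x" for x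
    using assms by (auto simp: fn_def vnth_emb addmap_def PiE_def extensional_def)
  then show ?thesis by auto
qed

lemma emb_inject:
  assumes "M \<in> DGP" "N \<in> DGP" "f \<in> addmap M N" "g \<in> addmap M N"
  shows "emb M N f = emb M N g \<longleftrightarrow> f = g"
  using fn_emb assms by metis

lemma addmap_plus:
  assumes "N \<in> DGP" "M \<in> DGP" "f \<in> addmap M N" "g \<in> addmap M N"
  shows "(\<lambda>x \<in> carrier M. f x \<oplus>\<^bsub>N\<^esub> g x) \<in> addmap M N"
proof -
  interpret N: dgmod N using assms dgmod_DGP by blast
  interpret M: dgmod M using assms dgmod_DGP by blast
  show ?thesis using assms(3,4) by (auto simp: addmap_def N.a_ac Pi_iff PiE_iff)
qed

lemma addmap_compose:
  assumes "M \<in> DGP" "f \<in> addmap M N" "g \<in> addmap N L"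
  shows "compose (carrier M) g f \<in> addmap M L"
proof -
  interpret M: dgmod M using assms dgmod_DGP by blast
  show ?thesis
    using assms by (auto simp: addmap_def compose_def Pi_iff PiE_iff)
qed

lemma addmap_diff:
  assumes "M \<in> DGP" "N \<in> DGP" "f \<in> addmap M N"
  shows "dg_hom_diff M N f \<in> addmap M N"
proof -
  interpret M: dgmod M using assms dgmod_DGP by blast
  interpret N: dgmod N using assms dgmod_DGP by blast
  show ?thesis
    using assms(3) by (auto simp: addmap_def dg_hom_diff_def Pi_iff PiE_iff N.diff_add M.diff_add N.a_ac)
qed

lemma emb_plus:
  assumes "M \<in> DGP" "N \<in> DGP" "f \<in> addmap M N" "g \<in> addmap M N"
  shows "emb M N (\<lambda>x \<in> carrier M. f x \<oplus>\<^bsub>N\<^esub> g x) = emb M N f + emb M N g"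
  using assms addmap_plus[of N M f g] vnth_closed[of _ M]
  by (intro vend_eqI vec_eqI) (auto simp: vnth_emb)

lemma emb_mult:
  assumes "M \<in> DGP" "N \<in> DGP" "L \<in> DGP" "f \<in> addmap M N" "g \<in> addmap N L"
  shows "emb N L g * emb M N f = emb M L (compose (carrier M) g f)"
  using assms addmap_compose[of M f N g L] vnth_closed[of _ M]
  by (intro vend_eqI vec_eqI) (auto simp: vnth_emb compose_def)

lemma emb_diff:
  assumes "M \<in> DGP" "N \<in> DGP" "f \<in> addmap M N"
  shows "emb M N (dg_hom_diff M N f) = vD * emb M N f + emb M N f * vD"
  using assms addmap_diff[of M N f] vnth_closed[of _ M]
  by (intro vend_eqI vec_eqI) (auto simp: vnth_emb dg_hom_diff_def)

lemma emb_zero: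
  assumes "M \<in> DGP" "N \<in> DGP"
  shows "emb M N (\<lambda>x \<in> carrier M. \<zero>\<^bsub>N\<^esub>) = 0" "(\<lambda>x \<in> carrier M. \<zero>\<^bsub>N\<^esub>) \<in> addmap M N"
proof -
  interpret M: dgmod M using assms dgmod_DGP by blast
  interpret N: dgmod N using assms dgmod_DGP by blast
  show *: "(\<lambda>x \<in> carrier M. \<zero>\<^bsub>N\<^esub>) \<in> addmap M N" by (auto simp: addmap_def)
  show "emb M N (\<lambda>x \<in> carrier M. \<zero>\<^bsub>N\<^esub>) = 0"
    using assms * vnth_closed[of _ M] by (intro vend_eqI vec_eqI) (auto simp: vnth_emb)
qed

text \<open>In one direction linearity and degree are tested on vectors supported in the single
  factor \<open>M\<close>; in the other they follow because \<open>emb\<close> sees no other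
  factor.\<close>

lemma emb_vdeg:
  assumes "M \<in> DGP" "N \<in> DGP" "f \<in> addmap M N"
  shows "emb M N f \<in> vdeg k \<longleftrightarrow> f \<in> carrier (dg_hom k M N)"
proof
  interpret M: dgmod M using assms dgmod_DGP by blast
  interpret N: dgmod N using assms dgmod_DGP by blast
  have e: "f x = vnth (vapp (emb M N f) (vsingle M x)) N" if "x \<in> carrier M" for x
    using assms that by (simp add: vnth_emb)
  {
    assume r: "emb M N f \<in> vdeg k"
    show "f \<in> carrier (dg_hom k M N)"
      unfolding dg_hom_iff
    proof (intro conjI allI ballI assms)
      fix a x assume x: "x \<in> carrier M"
      have "vsingle M (a \<odot>\<^bsub>M\<^esub> x) = vsmult a (vsingle M x)"
        using x assms by (intro vec_eqI) auto
      with x assms r show "f (a \<odot>\<^bsub>M\<^esub> x) = a \<odot>\<^bsub>N\<^esub> f x" by (simp add: e vdeg_def)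
    next
      fix i j x assume x: "x \<in> homog M (i, j)"
      then have "vsingle M x \<in> vhomog (i, j)"
        using assms by (auto simp: vhomog_def M.homog_closed)
      with r have "vapp (emb M N f) (vsingle M x) \<in> vhomog (i + k, j)" by (simp add: vdeg_def)
      with x assms show "f x \<in> homog N (i + k, j)"
        unfolding e[OF M.homog_closed[OF x]] vhomog_def by (metis (lifting) mem_Collect_eq nrm_id)
    qed
  next
    assume f: "f \<in> carrier (dg_hom k M N)"
    have c: "vnth v M \<in> carrier M" for v using vnth_closed[of v M] assms by simp
    show "emb M N f \<in> vdeg k"
      unfolding vdeg_def
    proof (intro CollectI conjI allI ballI)
      fix a v show "vapp (emb M N f) (vsmult a v) = vsmult a (vapp (emb M N f) v)"
        using assms f c by (intro vec_eqI) (auto simp: vnth_emb dg_hom_iff)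
    next
      fix i j v assume "v \<in> vhomog (i, j)"
      then have "vnth v M \<in> homog M (i, j)" using assms by (auto simp: vhomog_def dest: spec[of _ M])
      then show "vapp (emb M N f) v \<in> vhomog (i + k, j)"
        using assms f by (auto simp: vhomog_def vnth_emb dg_hom_iff)
    qed
  }
qed

definition ve :: "amod \<Rightarrow> vend" where
  "ve M = emb M M (\<lambda>x \<in> carrier M. x)"

lemma vapp_ve: "M \<in> DGP \<Longrightarrow> vapp (ve M) v = vsingle M (vnth v M)"
  using vnth_closed[of v M] by (simp add: ve_def vapp_emb addmap_id)

lemma dg_hom_id: assumes "M \<in> DGP" shows "(\<lambda>x \<in> carrier M. x) \<in> carrier (dg_hom 0 M M)"
proof -
  interpret M: dgmod M using assms dgmod_DGP by blast
  show ?thesis using addmap_id[OF assms] by (auto simp: dg_hom_iff M.homog_closed)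
qed

lemma ve_vdeg: "M \<in> DGP \<Longrightarrow> ve M \<in> vdeg 0"
  unfolding ve_def by (simp add: emb_vdeg addmap_id dg_hom_id)

lemma emb_corner:
  assumes "M \<in> DGP" "N \<in> DGP" "f \<in> addmap M N"
  shows "ve N * emb M N f = emb M N f" "emb M N f * ve M = emb M N f"
  using assms addmap_closed[OF assms(3)] vnth_closed[of _ M]
  by (auto intro!: vend_eqI vec_eqI simp: vapp_ve vnth_emb)

lemma corner_emb:
  assumes "M \<in> DGP" "N \<in> DGP" "ve N * r = r" "r * ve M = r"
  shows "emb M N (fn M N r) = r" "fn M N r \<in> addmap M N"
proof -
  interpret M: dgmod M using assms dgmod_DGP by blast
  interpret N: dgmod N using assms dgmod_DGP by blast
  have c: "vnth v M \<in> carrier M" "vnth v N \<in> carrier N" for v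
    using vnth_closed[of v M] vnth_closed[of v N] assms by simp_all
  have "vnth (vapp r (vsingle M (x \<oplus>\<^bsub>M\<^esub> y))) N =
     vnth (vapp r (vsingle M x)) N \<oplus>\<^bsub>N\<^esub> vnth (vapp r (vsingle M y)) N"
    if "x \<in> carrier M" "y \<in> carrier M" for x y
    using that assms by (simp add: vsingle_add)
  with c show *: "fn M N r \<in> addmap M N"
    by (auto simp: addmap_def fn_def)
  show "emb M N (fn M N r) = r"
  proof (intro vend_eqI)
    fix v
    have "vapp r v = vapp (ve N * r * ve M) v" using assms by simp
    also have "\<dots> = vsingle N (vnth (vapp r (vsingle M (vnth v M))) N)"
      by (simp only: vapp_simps vapp_ve assms(1,2))
    finally show "vapp (emb M N (fn M N r)) v = vapp r v"
      using * assms c by (simp add: vapp_emb fn_def)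
  qed
qed

lemma ve_D: "M \<in> DGP \<Longrightarrow> vD * ve M = ve M * vD"
  using vnth_closed[of _ M] nrm.diff_closed[of _ M]
  by (intro vend_eqI vec_eqI) (auto simp: vapp_ve)

lemma ve_idem: "M \<in> DGP \<Longrightarrow> ve M * ve M = ve M"
  unfolding ve_def by (rule emb_corner(1)[unfolded ve_def]) (simp_all add: addmap_id)

section \<open>The homology ring\<close>

definition vZ :: "vend set" where "vZ = {r \<in> vdeg 0. vD * r = r * vD}"
definition vB :: "vend set" where "vB = {vD * h + h * vD | h. h \<in> vdeg (-1)}"

lemma vdeg_zero: "0 \<in> vdeg k"
  by (auto simp: vdeg_def vhomog_def intro!: vec_eqI)

lemma vB_add: "r \<in> vB \<Longrightarrow> s \<in> vB \<Longrightarrow> r + s \<in> vB"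
  unfolding vB_def using vdeg_add by (force simp: algebra_simps)

lemma vB_zero: "0 \<in> vB"
  unfolding vB_def using vdeg_zero by force

lemma vZ_ring: "0 \<in> vZ" "r \<in> vZ \<Longrightarrow> s \<in> vZ \<Longrightarrow> r + s \<in> vZ" "r \<in> vZ \<Longrightarrow> s \<in> vZ \<Longrightarrow> r * s \<in> vZ"
proof -
  show "0 \<in> vZ" by (simp add: vZ_def vdeg_zero)
  show "r \<in> vZ \<Longrightarrow> s \<in> vZ \<Longrightarrow> r + s \<in> vZ" by (simp add: vZ_def vdeg_add algebra_simps)
  assume rs: "r \<in> vZ" "s \<in> vZ"
  then have "vD * r = r * vD" by (simp add: vZ_def)
  then have "vD * (r * s) = r * (vD * s)" by (simp flip: mult.assoc)
  with rs vdeg_mult[of r 0 s 0] show "r * s \<in> vZ" by (simp add: vZ_def mult.assoc)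
qed

text \<open>A cocycle commutes with \<open>vD\<close>, so multiplying a homotopy by it gives a
  homotopy for the product: coboundaries form an ideal in the cocycles.\<close>

lemma vB_mult: assumes "r \<in> vZ" "s \<in> vB" shows "r * s \<in> vB" "s * r \<in> vB"
proof -
  from assms obtain h where h: "h \<in> vdeg (-1)" "s = vD * h + h * vD" by (auto simp: vB_def)
  from assms have r: "r \<in> vdeg 0" "vD * r = r * vD" by (auto simp: vZ_def)
  have "r * s = vD * (r * h) + (r * h) * vD" using r(2) by (simp add: h algebra_simps flip: mult.assoc)
  with vdeg_mult[OF r(1) h(1)] show "r * s \<in> vB" by (auto simp: vB_def)
  have "s * r = vD * (h * r) + (h * r) * vD" using r(2) by (simp add: h algebra_simps)
  with vdeg_mult[OF h(1) r(1)] show "s * r \<in> vB" by (auto simp: vB_def)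
qed

\<comment> \<open>The homology ring \<open>vZ / vB\<close>. The quotient is partial because only
  cocycles have classes, and \<open>r + s\<close> stands for the difference.\<close>
quotient_type hring = vend / partial: "\<lambda>r s. r \<in> vZ \<and> s \<in> vZ \<and> r + s \<in> vB"
proof (rule part_equivpI)
  show "\<exists>r. r \<in> vZ \<and> r \<in> vZ \<and> r + r \<in> vB"
    using vZ_ring(1) vB_zero by (auto simp: vend_add_self)
  show "symp (\<lambda>r s. r \<in> vZ \<and> s \<in> vZ \<and> r + s \<in> vB)"
    by (auto intro: sympI simp: add.commute)
  show "transp (\<lambda>r s. r \<in> vZ \<and> s \<in> vZ \<and> r + s \<in> vB)"
  proof (rule transpI, intro conjI; elim conjE)
    fix r s u assume "r + s \<in> vB" "s + u \<in> vB"
    then have "(r + s) + (s + u) \<in> vB" by (rule vB_add)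
    moreover have "(r + s) + (s + u) = r + u + (s + s)" by (simp only: ac_simps)
    ultimately show "r + u \<in> vB" by (simp add: vend_add_self)
  qed
qed

instantiation hring :: ring
begin
lift_definition zero_hring :: hring is 0 by (simp add: vZ_ring vB_zero)
lift_definition plus_hring :: "hring \<Rightarrow> hring \<Rightarrow> hring" is "(+)"
  using vB_add by (fastforce simp: vZ_ring ac_simps)
lift_definition minus_hring :: "hring \<Rightarrow> hring \<Rightarrow> hring" is "(+)"
  using vB_add by (fastforce simp: vZ_ring ac_simps)
lift_definition uminus_hring :: "hring \<Rightarrow> hring" is "\<lambda>r. r" .
lift_definition times_hring :: "hring \<Rightarrow> hring \<Rightarrow> hring" is "(*)"
proof (elim conjE, intro conjI)
  fix r s u v assume a: "r \<in> vZ" "s \<in> vZ" "u \<in> vZ" "v \<in> vZ" and b: "r + s \<in> vB" "u + v \<in> vB"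
  have "(r + s) * u + s * (u + v) \<in> vB" by (intro vB_add vB_mult a b)
  moreover have "(r + s) * u + s * (u + v) = r * u + s * v + (s * u + s * u)"
    by (simp only: algebra_simps)
  ultimately show "r * u + s * v \<in> vB" by (simp add: vend_add_self)
qed (simp_all add: vZ_ring)
instance
  by intro_classes (transfer; simp add: vZ_ring vB_zero algebra_simps vend_add_self)+
end

text \<open>Made total by giving everything that is not a cocycle the class 0.\<close>

lift_definition vcls :: "vend \<Rightarrow> hring" is "\<lambda>r. if r \<in> vZ then r else 0"
  by (simp add: vZ_ring vend_add_self vB_zero)

lemma vcls_add: "r \<in> vZ \<Longrightarrow> s \<in> vZ \<Longrightarrow> vcls (r + s) = vcls r + vcls s"
  and vcls_mult: "r \<in> vZ \<Longrightarrow> s \<in> vZ \<Longrightarrow> vcls (r * s) = vcls r * vcls s"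
  and vcls_zero: "r \<in> vZ \<Longrightarrow> vcls r = 0 \<longleftrightarrow> r \<in> vB"
  by (transfer; simp add: vZ_ring vend_add_self vB_zero)+

lemma vcls_surj: "\<exists>r \<in> vZ. vcls r = \<eta>"
  by transfer (metis vend_add_self vB_zero)

section \<open>Triangles in a DG category presented inside a ring\<close>

text \<open>
  \<open>G k\<close> are the elements of degree \<open>k\<close>, \<open>e X\<close> is the identity of \<open>X\<close>, and \<open>s X\<close>, \<open>t X\<close> are the mutually inverse
  maps between \<open>X\<close> and its shift \<open>sh X\<close>.  The cone \<open>cn X Y f\<close> carries inclusions \<open>ci\<close> of \<open>X\<close> and \<open>cj\<close> of \<open>Y\<close>, with
  projections \<open>cp\<close> to \<open>X\<close> and \<open>cq\<close> to \<open>Y\<close>; \<open>cls\<close> is the map from the cocycles of degree 0 to homology.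
\<close>

locale dg_ring_base =
  fixes G :: "int \<Rightarrow> 'r::ring set" and D :: 'r and Ob :: "'o set" and e :: "'o \<Rightarrow> 'r"
    and sh :: "'o \<Rightarrow> 'o" and s t :: "'o \<Rightarrow> 'r"
    and cn :: "'o \<Rightarrow> 'o \<Rightarrow> 'r \<Rightarrow> 'o" and ci cp cj cq :: "'o \<Rightarrow> 'o \<Rightarrow> 'r \<Rightarrow> 'r"
    and cls :: "'r \<Rightarrow> 'h::ring"
begin

definition chain :: "int \<Rightarrow> 'o \<Rightarrow> 'o \<Rightarrow> 'r set" where
  "chain k X Y = {r \<in> G k. e Y * r = r \<and> r * e X = r}"

definition cyc :: "'o \<Rightarrow> 'o \<Rightarrow> 'r set" where
  "cyc X Y = {r \<in> chain 0 X Y. D * r = r * D}"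

end

text \<open>The axioms mention \<open>chain\<close> and \<open>cyc\<close>, which is why these come
  from a separate base locale. The cone axioms say that \<open>cn X Y f\<close> is
  \<open>X[1] + Y\<close> as a graded object; the rule for \<open>D * ci\<close> twists its
  differential by \<open>f\<close>, and the matching rule for \<open>cq\<close> is derived in
  \<open>cone_q_D\<close>.\<close>

locale dg_ring = dg_ring_base G D Ob e sh s t cn ci cp cj cq cls
  for G :: "int \<Rightarrow> 'r::ring set" and D :: 'r and Ob :: "'o set" and e :: "'o \<Rightarrow> 'r"
    and sh :: "'o \<Rightarrow> 'o" and s t :: "'o \<Rightarrow> 'r"
    and cn :: "'o \<Rightarrow> 'o \<Rightarrow> 'r \<Rightarrow> 'o" and ci cp cj cq :: "'o \<Rightarrow> 'o \<Rightarrow> 'r \<Rightarrow> 'r"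
    and cls :: "'r \<Rightarrow> 'h::ring" +
  assumes dbl: "r + r = (0::'r)"
    and G_add: "r \<in> G k \<Longrightarrow> r' \<in> G k \<Longrightarrow> r + r' \<in> G k"
    and G_mult: "r \<in> G k \<Longrightarrow> r' \<in> G l \<Longrightarrow> r * r' \<in> G (k + l)"
    and D_deg: "D \<in> G 1" and DD: "D * D = 0"
    and e_deg: "X \<in> Ob \<Longrightarrow> e X \<in> G 0" and e_idem: "X \<in> Ob \<Longrightarrow> e X * e X = e X"
    and e_D: "X \<in> Ob \<Longrightarrow> D * e X = e X * D"
    and Ob_nonempty: "Ob \<noteq> {}"
    and sh_Ob: "X \<in> Ob \<Longrightarrow> sh X \<in> Ob"
    and unshift: "X \<in> Ob \<Longrightarrow> \<exists>X' \<in> Ob. sh X' = X"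
    and s_chain: "X \<in> Ob \<Longrightarrow> s X \<in> chain (-1) X (sh X)"
    and t_chain: "X \<in> Ob \<Longrightarrow> t X \<in> chain 1 (sh X) X"
    and ts: "X \<in> Ob \<Longrightarrow> t X * s X = e X" and st: "X \<in> Ob \<Longrightarrow> s X * t X = e (sh X)"
    and s_D: "X \<in> Ob \<Longrightarrow> D * s X = s X * D" and t_D: "X \<in> Ob \<Longrightarrow> D * t X = t X * D"
    and cone: "X \<in> Ob \<Longrightarrow> Y \<in> Ob \<Longrightarrow> f \<in> cyc X Y \<Longrightarrow>
      cn X Y f \<in> Ob \<and>
      ci X Y f \<in> chain (-1) X (cn X Y f) \<and> cp X Y f \<in> chain 1 (cn X Y f) X \<and>
      cj X Y f \<in> chain 0 Y (cn X Y f) \<and> cq X Y f \<in> chain 0 (cn X Y f) Y \<and>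
      cp X Y f * ci X Y f = e X \<and> cq X Y f * cj X Y f = e Y \<and>
      cp X Y f * cj X Y f = 0 \<and> cq X Y f * ci X Y f = 0 \<and>
      ci X Y f * cp X Y f + cj X Y f * cq X Y f = e (cn X Y f) \<and>
      D * cj X Y f = cj X Y f * D \<and> D * cp X Y f = cp X Y f * D \<and>
      D * ci X Y f = ci X Y f * D + cj X Y f * f"
    and cls_add: "x \<in> G 0 \<Longrightarrow> D * x = x * D \<Longrightarrow> y \<in> G 0 \<Longrightarrow> D * y = y * D \<Longrightarrow>
      cls (x + y) = cls x + cls y"
    and cls_times: "x \<in> G 0 \<Longrightarrow> D * x = x * D \<Longrightarrow> y \<in> G 0 \<Longrightarrow> D * y = y * D \<Longrightarrow>
      cls (x * y) = cls x * cls y"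
    and cls_zero_iff: "x \<in> G 0 \<Longrightarrow> D * x = x * D \<Longrightarrow>
      cls x = 0 \<longleftrightarrow> (\<exists>h \<in> G (-1). x = D * h + h * D)"
    and cls_surj: "\<exists>x \<in> G 0. D * x = x * D \<and> cls x = \<eta>"
begin

section \<open>Cocycles, homotopies and homology classes\<close>

lemma dbl_left [simp]: "r + (r + r') = (r'::'r)"
  by (simp add: dbl flip: add.assoc)

lemma dbl_simp [simp]: "r + r = (0::'r)" by (rule dbl)

lemma add_zero_iff: "r + r' = (0::'r) \<longleftrightarrow> r = r'"
  by (metis add_0_right dbl dbl_left)

text \<open>Lets a rule for a product of two factors act at the head of a longer product bracketed
  to the right, the normal form of all ring computations below.\<close>

lemma rw2: "a * b = c \<Longrightarrow> a * (b * x) = c * x" for a b c x :: 'r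
  by (simp flip: mult.assoc)

lemma chain_add: "r \<in> chain k X Y \<Longrightarrow> r' \<in> chain k X Y \<Longrightarrow> r + r' \<in> chain k X Y"
  by (simp add: chain_def G_add algebra_simps)

lemma chain_mult: "r \<in> chain k Y Z \<Longrightarrow> r' \<in> chain l X Y \<Longrightarrow> r * r' \<in> chain (k + l) X Z"
  by (auto simp: chain_def G_mult mult.assoc) (metis mult.assoc)

lemma chain_e: "X \<in> Ob \<Longrightarrow> e X \<in> chain 0 X X"
  by (simp add: chain_def e_deg e_idem)

lemma cyc_chain: "f \<in> cyc X Y \<Longrightarrow> f \<in> chain 0 X Y"
  by (simp add: cyc_def)

lemma cycI: "f \<in> chain 0 X Y \<Longrightarrow> D * f = f * D \<Longrightarrow> f \<in> cyc X Y"
  by (simp add: cyc_def)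

lemma cyc_D: "f \<in> cyc X Y \<Longrightarrow> D * f = f * D"
  by (simp add: cyc_def)

lemma chain_left: "f \<in> chain k X Y \<Longrightarrow> e Y * f = f" and chain_right: "f \<in> chain k X Y \<Longrightarrow> f * e X = f"
  by (auto simp: chain_def)

lemmas cyc_left = chain_left[OF cyc_chain] and cyc_right = chain_right[OF cyc_chain]

lemma cyc_add: "r \<in> cyc X Y \<Longrightarrow> r' \<in> cyc X Y \<Longrightarrow> r + r' \<in> cyc X Y"
  by (simp add: cyc_def chain_add algebra_simps)

lemma cyc_mult: "r \<in> cyc Y Z \<Longrightarrow> r' \<in> cyc X Y \<Longrightarrow> r * r' \<in> cyc X Z"
  unfolding cyc_def using chain_mult[of r 0 Y Z r' 0 X] by simp (metis mult.assoc)

lemma cyc_e: "X \<in> Ob \<Longrightarrow> e X \<in> cyc X X"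
  by (simp add: cyc_def chain_e e_D)

lemma cyc_zero: "X \<in> Ob \<Longrightarrow> 0 \<in> cyc X Y"
  using G_add[OF e_deg e_deg, of X X] by (simp add: cyc_def chain_def)

lemma cls_plus: "x \<in> cyc X Y \<Longrightarrow> y \<in> cyc X Y \<Longrightarrow> cls (x + y) = cls x + cls y"
  and cls_mult: "g \<in> cyc Y Z \<Longrightarrow> f \<in> cyc X Y \<Longrightarrow> cls (g * f) = cls g * cls f"
  by (auto simp: cyc_def chain_def intro: cls_add cls_times)

lemma cls_0: "cls 0 = 0"
proof -
  obtain X where "X \<in> Ob" using Ob_nonempty by blast
  from cls_plus[OF cyc_zero[OF this] cyc_zero[OF this]] show ?thesis by simp
qed

lemma hdbl [simp]: "\<eta> + \<eta> = (0::'h)"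
proof -
  obtain x where "x \<in> G 0" "D * x = x * D" "cls x = \<eta>" using cls_surj by blast
  then show ?thesis using cls_add[of x x] by (simp add: cls_0)
qed

lemma hdbl_left [simp]: "\<eta> + (\<eta> + \<xi>) = (\<xi>::'h)"
  by (simp flip: add.assoc)

lemma hadd_zero_iff: "\<xi> + \<eta> = (0::'h) \<longleftrightarrow> \<xi> = \<eta>"
  by (metis add_0_right hdbl hdbl_left)

text \<open>The homotopy given by the ring need not run from \<open>X\<close> to \<open>Y\<close>.
  Since the idempotents commute with \<open>D\<close>, it can be cut down to the corner
  \<open>e Y * h * e X\<close>.\<close>

lemma cls_eq_0: assumes "X \<in> Ob" "Y \<in> Ob" "x \<in> cyc X Y"
  shows "cls x = 0 \<longleftrightarrow> (\<exists>h \<in> chain (-1) X Y. x = D * h + h * D)"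
proof
  assume "cls x = 0"
  then obtain h where h: "h \<in> G (-1)" "x = D * h + h * D"
    using cls_zero_iff assms(3) by (auto simp: cyc_def chain_def)
  have "e Y * h * e X \<in> chain (-1) X Y"
    using G_mult[OF G_mult[OF e_deg[OF assms(2)] h(1)] e_deg[OF assms(1)]] assms
    by (simp add: chain_def e_idem mult.assoc rw2[OF e_idem])
  moreover have "x = e Y * x * e X" using cyc_left cyc_right assms by metis
  then have "x = D * (e Y * h * e X) + (e Y * h * e X) * D"
    unfolding h(2) using assms
    by (simp add: algebra_simps e_D[symmetric]) (simp add: mult.assoc[symmetric] e_D)
  ultimately show "\<exists>h \<in> chain (-1) X Y. x = D * h + h * D" by blast
next
  show "\<exists>h \<in> chain (-1) X Y. x = D * h + h * D \<Longrightarrow> cls x = 0"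
    using cls_zero_iff assms(3) by (auto simp: cyc_def chain_def)
qed

lemma cls_eq: assumes "X \<in> Ob" "Y \<in> Ob" "x \<in> cyc X Y" "y \<in> cyc X Y"
  shows "cls x = cls y \<longleftrightarrow> (\<exists>h \<in> chain (-1) X Y. x + y = D * h + h * D)"
  using cls_eq_0[OF assms(1,2) cyc_add[OF assms(3,4)]] cls_plus[OF assms(3,4)] hadd_zero_iff by metis

definition E :: "'o \<Rightarrow> 'h" where "E X = cls (e X)"

definition hm :: "'o \<Rightarrow> 'o \<Rightarrow> 'h set" where
  "hm X Y = {\<eta>. E Y * \<eta> = \<eta> \<and> \<eta> * E X = \<eta>}"

lemma hm_left: "\<eta> \<in> hm X Y \<Longrightarrow> E Y * \<eta> = \<eta>" and hm_right: "\<eta> \<in> hm X Y \<Longrightarrow> \<eta> * E X = \<eta>"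
  by (auto simp: hm_def)

lemma hm_mult: "g \<in> hm Y Z \<Longrightarrow> f \<in> hm X Y \<Longrightarrow> g * f \<in> hm X Z"
  by (auto simp: hm_def mult.assoc) (simp flip: mult.assoc)

lemma hm_add: "g \<in> hm X Y \<Longrightarrow> f \<in> hm X Y \<Longrightarrow> g + f \<in> hm X Y"
  by (auto simp: hm_def algebra_simps)

lemma hm_zero [simp]: "0 \<in> hm X Y" by (simp add: hm_def)

lemma cls_hm: "X \<in> Ob \<Longrightarrow> Y \<in> Ob \<Longrightarrow> f \<in> cyc X Y \<Longrightarrow> cls f \<in> hm X Y"
  using cls_mult[OF cyc_e, of Y f X] cls_mult[OF _ cyc_e, of f X Y] by (simp add: hm_def E_def cyc_left cyc_right)

lemma hm_E: "X \<in> Ob \<Longrightarrow> E X \<in> hm X X"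
  by (simp add: E_def cls_hm cyc_e)

text \<open>Cutting an arbitrary representative to the corner changes its class to
  \<open>E Y * \<eta> * E X\<close>, which is \<open>\<eta>\<close> again.\<close>

lemma hm_rep: assumes "X \<in> Ob" "Y \<in> Ob" "\<eta> \<in> hm X Y" shows "\<exists>x \<in> cyc X Y. cls x = \<eta>"
proof -
  obtain x where x: "x \<in> G 0" "D * x = x * D" "cls x = \<eta>" using cls_surj by blast
  have d: "D * (e Y * x * e X) = (e Y * x * e X) * D"
  proof -
    have "D * (e Y * x * e X) = e Y * (D * x) * e X" by (simp add: e_D[OF assms(2)] flip: mult.assoc)
    also have "\<dots> = e Y * x * (D * e X)" by (simp add: x mult.assoc)
    also have "\<dots> = (e Y * x * e X) * D" by (simp add: e_D assms mult.assoc)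
    finally show ?thesis .
  qed
  have g: "e Y * x \<in> G 0" "e Y * x * e X \<in> G 0"
    using G_mult[OF e_deg[OF assms(2)] x(1)] G_mult[OF G_mult[OF e_deg[OF assms(2)] x(1)] e_deg[OF assms(1)]] by simp_all
  have d': "D * (e Y * x) = e Y * x * D"
    using e_D[OF assms(2)] x(2) by (metis mult.assoc)
  have "e Y * x * e X \<in> cyc X Y"
    using d g assms by (simp add: cyc_def chain_def mult.assoc e_idem rw2[OF e_idem])
  moreover have "cls (e Y * x * e X) = E Y * \<eta> * E X"
    using g x d' assms by (simp add: cls_times e_deg e_D E_def)
  ultimately show ?thesis using assms(3) by (metis hm_left hm_right)
qed

text \<open>The shift of a morphism is conjugation by the degree -1 and degree 1 maps
  \<open>s\<close> and \<open>t\<close>. By \<open>ShM_cls\<close> the chosen representative does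
  not matter.\<close>

definition ShM :: "'o \<Rightarrow> 'o \<Rightarrow> 'h \<Rightarrow> 'h" where
  "ShM X Y \<eta> = cls (s Y * (SOME x. x \<in> cyc X Y \<and> cls x = \<eta>) * t X)"

lemma shift_cyc: assumes "X \<in> Ob" "Y \<in> Ob" "x \<in> cyc X Y" shows "s Y * x * t X \<in> cyc (sh X) (sh Y)"
proof (rule cycI)
  show "s Y * x * t X \<in> chain 0 (sh X) (sh Y)"
    using chain_mult[OF chain_mult[OF s_chain cyc_chain] t_chain] assms by fastforce
  show "D * (s Y * x * t X) = s Y * x * t X * D"
    using assms by (simp add: mult.assoc rw2[OF s_D] rw2[OF cyc_D] t_D)
qed

lemma ShM_cls:
  assumes "X \<in> Ob" "Y \<in> Ob" "x \<in> cyc X Y"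
  shows "ShM X Y (cls x) = cls (s Y * x * t X)"
proof -
  define y where "y = (SOME y. y \<in> cyc X Y \<and> cls y = cls x)"
  have y: "y \<in> cyc X Y" "cls y = cls x"
    using someI[of "\<lambda>y. y \<in> cyc X Y \<and> cls y = cls x" x] assms by (auto simp: y_def)
  then obtain h where h: "h \<in> chain (-1) X Y" "y + x = D * h + h * D"
    using cls_eq assms by blast
  have "s Y * h * t X \<in> chain (-1) (sh X) (sh Y)"
    using chain_mult[OF chain_mult[OF s_chain h(1)] t_chain] assms by fastforce
  moreover have "s Y * y * t X + s Y * x * t X = D * (s Y * h * t X) + s Y * h * t X * D"
  proof -
    have "s Y * y * t X + s Y * x * t X = s Y * (y + x) * t X" by (simp add: algebra_simps)
    also have "\<dots> = D * (s Y * h * t X) + s Y * h * t X * D"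
      unfolding h(2) using assms by (simp add: algebra_simps rw2[OF s_D] t_D)
    finally show ?thesis .
  qed
  ultimately have "cls (s Y * y * t X) = cls (s Y * x * t X)"
    using cls_eq[OF sh_Ob[OF assms(1)] sh_Ob[OF assms(2)] shift_cyc[OF assms(1,2) y(1)] shift_cyc[OF assms]] by blast
  then show ?thesis unfolding ShM_def y_def[symmetric] .
qed

lemma ShM_hm: "X \<in> Ob \<Longrightarrow> Y \<in> Ob \<Longrightarrow> \<eta> \<in> hm X Y \<Longrightarrow> ShM X Y \<eta> \<in> hm (sh X) (sh Y)"
  by (metis hm_rep ShM_cls cls_hm shift_cyc sh_Ob)

lemma ShM_mult:
  assumes "X \<in> Ob" "Y \<in> Ob" "Z \<in> Ob" "f \<in> hm X Y" "g \<in> hm Y Z"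
  shows "ShM X Z (g * f) = ShM Y Z g * ShM X Y f"
proof -
  obtain x y where x: "x \<in> cyc X Y" "cls x = f" "y \<in> cyc Y Z" "cls y = g" using hm_rep assms by metis
  have "s Z * (y * x) * t X = (s Z * y * t Y) * (s Y * x * t X)"
    using x assms by (simp add: mult.assoc rw2[OF ts] rw2[OF cyc_left])
  then show ?thesis
    using x assms cls_mult[OF shift_cyc[OF assms(2,3) x(3)] shift_cyc[OF assms(1,2) x(1)]] ShM_cls[of X Z "y * x"]
    by (auto simp: ShM_cls cls_mult cyc_mult)
qed

lemma ShM_E: assumes "X \<in> Ob" shows "ShM X X (E X) = E (sh X)"
  using ShM_cls[OF assms assms cyc_e] assms chain_right[OF s_chain] by (simp add: E_def st)

lemma ShM_surj:
  assumes "X \<in> Ob" "Y \<in> Ob" "\<eta> \<in> hm (sh X) (sh Y)"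
  shows "\<exists>\<xi> \<in> hm X Y. ShM X Y \<xi> = \<eta>"
proof -
  obtain y where y: "y \<in> cyc (sh X) (sh Y)" "cls y = \<eta>" using hm_rep sh_Ob assms by metis
  have "t Y * y * s X \<in> cyc X Y"
  proof (rule cycI)
    show "t Y * y * s X \<in> chain 0 X Y"
      using chain_mult[OF chain_mult[OF t_chain cyc_chain] s_chain] assms y by fastforce
    show "D * (t Y * y * s X) = t Y * y * s X * D"
      using y assms by (simp add: mult.assoc rw2[OF t_D] rw2[OF cyc_D] s_D)
  qed
  moreover have "s Y * (t Y * y * s X) * t X = y"
    using assms y by (simp add: mult.assoc st rw2[OF st] cyc_left cyc_right)
  ultimately show ?thesis using ShM_cls assms y cls_hm by metis
qed

lemma ShM_inj:
  assumes "X \<in> Ob" "Y \<in> Ob" "\<eta> \<in> hm X Y" "\<xi> \<in> hm X Y" "ShM X Y \<eta> = ShM X Y \<xi>"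
  shows "\<eta> = \<xi>"
proof -
  obtain x y where x: "x \<in> cyc X Y" "cls x = \<eta>" "y \<in> cyc X Y" "cls y = \<xi>" using hm_rep assms by metis
  then obtain h where h: "h \<in> chain (-1) (sh X) (sh Y)" "s Y * x * t X + s Y * y * t X = D * h + h * D"
    using assms cls_eq[OF sh_Ob[OF assms(1)] sh_Ob[OF assms(2)] shift_cyc[OF assms(1,2) x(1)] shift_cyc[OF assms(1,2) x(3)]]
      ShM_cls by metis
  have "x + y = t Y * (s Y * x * t X + s Y * y * t X) * s X"
    using x assms by (simp add: algebra_simps ts rw2[OF ts] cyc_left cyc_right)
  also have "\<dots> = D * (t Y * h * s X) + t Y * h * s X * D"
    unfolding h(2) using assms by (simp add: algebra_simps rw2[OF t_D] s_D)
  finally have "x + y = D * (t Y * h * s X) + t Y * h * s X * D" .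
  moreover have "t Y * h * s X \<in> chain (-1) X Y"
    using chain_mult[OF chain_mult[OF t_chain h(1)] s_chain] assms by fastforce
  ultimately show ?thesis using x cls_eq assms by metis
qed

text \<open>The identity \<open>i p + j q\<close> of the cone commutes with \<open>D\<close>.
  Multiplying this equation by \<open>q\<close> from the left isolates the commutator of
  \<open>q\<close>.\<close>

lemma cone_q_D:
  assumes "X \<in> Ob" "Y \<in> Ob" "f \<in> cyc X Y"
  shows "D * cq X Y f = cq X Y f * D + f * cp X Y f"
proof -
  note c = cone[OF assms]
  let ?i = "ci X Y f" and ?p = "cp X Y f" and ?j = "cj X Y f" and ?q = "cq X Y f"
  have "D * (?i * ?p + ?j * ?q) = (?i * ?p + ?j * ?q) * D" using c e_D by simp
  then have "?q * (D * (?i * ?p + ?j * ?q)) = ?q * ((?i * ?p + ?j * ?q) * D)" by simp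
  moreover have qi: "?q * (?i * x) = 0" and qj: "?q * (?j * x) = e Y * x" for x
    using rw2[of ?q ?i 0 x] rw2[of ?q ?j "e Y" x] c by simp_all
  moreover have "?q * (D * (?i * ?p)) = f * ?p" "?q * (D * (?j * ?q)) = D * ?q"
    "?q * (?i * ?p * D) = 0" "?q * (?j * ?q * D) = ?q * D"
  proof -
    have "?q * (D * (?i * ?p)) = ?q * ?i * D * ?p + ?q * ?j * f * ?p"
      using c by (simp add: mult.assoc rw2[of D ?i "?i * D + ?j * f"] algebra_simps qi qj)
    then show "?q * (D * (?i * ?p)) = f * ?p"
      using c cyc_left[OF assms(3)] by (simp add: mult.assoc qi qj rw2[OF cyc_left[OF assms(3)]])
    have "?q * (D * (?j * ?q)) = ?q * (?j * (D * ?q))" using c by (metis mult.assoc)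
    also have "\<dots> = D * (e Y * ?q)" unfolding qj using e_D[OF assms(2)] by (simp flip: mult.assoc)
    finally show "?q * (D * (?j * ?q)) = D * ?q" using c by (simp add: chain_def)
    show "?q * (?i * ?p * D) = 0" using c by (simp flip: mult.assoc)
    have "?q * (?j * ?q * D) = ?q * ?j * ?q * D" by (simp add: mult.assoc)
    then show "?q * (?j * ?q * D) = ?q * D" using c by (simp add: chain_def)
  qed
  ultimately have "f * ?p + D * ?q = ?q * D" by (simp add: algebra_simps)
  then show ?thesis by (metis add.commute dbl_left)
qed

text \<open>These rules move \<open>D\<close> to the right and cancel projections against
  inclusions, with and without a trailing factor, so that identities between maps of cones become
  computations.\<close>

lemma cone_simps:
  assumes "X \<in> Ob" "Y \<in> Ob" "f \<in> cyc X Y"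
  defines "i \<equiv> ci X Y f" and "p \<equiv> cp X Y f" and "j \<equiv> cj X Y f" and "q \<equiv> cq X Y f"
  shows "p * i = e X" "p * (i * x) = e X * x" "q * j = e Y" "q * (j * x) = e Y * x"
    "p * j = 0" "p * (j * x) = 0" "q * i = 0" "q * (i * x) = 0"
    "D * i = i * D + j * f" "D * (i * x) = i * (D * x) + j * (f * x)"
    "D * j = j * D" "D * (j * x) = j * (D * x)" "D * p = p * D" "D * (p * x) = p * (D * x)"
    "D * q = q * D + f * p" "D * (q * x) = q * (D * x) + f * (p * x)"
    "D * f = f * D" "D * (f * x) = f * (D * x)"
    "e X * p = p" "e X * (p * x) = p * x" "i * e X = i" "i * (e X * x) = i * x"
    "e Y * q = q" "e Y * (q * x) = q * x" "j * e Y = j" "j * (e Y * x) = j * x"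
    "p * e (cn X Y f) = p" "q * e (cn X Y f) = q" "e (cn X Y f) * i = i" "e (cn X Y f) * j = j"
    "e (cn X Y f) * (i * x) = i * x" "e (cn X Y f) * (j * x) = j * x"
    "e Y * f = f" "e Y * (f * x) = f * x" "f * e X = f" "f * (e X * x) = f * x"
    "p * (e (cn X Y f) * x) = p * x" "q * (e (cn X Y f) * x) = q * x"
proof -
  note c = cone[OF assms(1-3), folded i_def p_def j_def q_def]
  show "p * i = e X" "q * j = e Y" "p * j = 0" "q * i = 0" "D * i = i * D + j * f"
    "D * j = j * D" "D * p = p * D" "D * f = f * D" "e Y * f = f" "f * e X = f"
    "e X * p = p" "i * e X = i" "e Y * q = q" "j * e Y = j"
    "p * e (cn X Y f) = p" "q * e (cn X Y f) = q" "e (cn X Y f) * i = i" "e (cn X Y f) * j = j"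
    using c assms(3) by (auto simp: chain_def cyc_def)
  moreover show "D * q = q * D + f * p" unfolding q_def p_def by (rule cone_q_D) fact+
  ultimately show "p * (i * x) = e X * x" "q * (j * x) = e Y * x" "p * (j * x) = 0" "q * (i * x) = 0"
    "D * (i * x) = i * (D * x) + j * (f * x)" "D * (j * x) = j * (D * x)" "D * (p * x) = p * (D * x)"
    "D * (q * x) = q * (D * x) + f * (p * x)" "D * (f * x) = f * (D * x)"
    "e X * (p * x) = p * x" "i * (e X * x) = i * x" "e Y * (q * x) = q * x" "j * (e Y * x) = j * x"
    "e (cn X Y f) * (i * x) = i * x" "e (cn X Y f) * (j * x) = j * x"
    "e Y * (f * x) = f * x" "f * (e X * x) = f * x"
    "p * (e (cn X Y f) * x) = p * x" "q * (e (cn X Y f) * x) = q * x"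
    by (simp_all add: algebra_simps flip: mult.assoc)
qed

lemma cone_ip:
  assumes "X \<in> Ob" "Y \<in> Ob" "f \<in> cyc X Y"
  shows "ci X Y f * cp X Y f = e (cn X Y f) + cj X Y f * cq X Y f"
    "ci X Y f * (cp X Y f * x) = e (cn X Y f) * x + cj X Y f * (cq X Y f * x)"
proof -
  have "ci X Y f * cp X Y f + cj X Y f * cq X Y f = e (cn X Y f)" using cone[OF assms] by blast
  then show *: "ci X Y f * cp X Y f = e (cn X Y f) + cj X Y f * cq X Y f"
    by (metis add.commute dbl_left)
  show "ci X Y f * (cp X Y f * x) = e (cn X Y f) * x + cj X Y f * (cq X Y f * x)"
    using arg_cong[OF *, of "\<lambda>r. r * x"] by (simp add: algebra_simps)
qed

text \<open>As \<open>i p + j q\<close> is the identity of the cone, a map out of the cone is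
  determined by its restrictions to the two summands.\<close>

lemma cone_ext:
  assumes "X \<in> Ob" "Y \<in> Ob" "f \<in> cyc X Y" "r * e (cn X Y f) = r" "r' * e (cn X Y f) = r'"
    "r * ci X Y f = r' * ci X Y f" "r * cj X Y f = r' * cj X Y f"
  shows "r = r'"
proof -
  have "r * (ci X Y f * cp X Y f + cj X Y f * cq X Y f) = r' * (ci X Y f * cp X Y f + cj X Y f * cq X Y f)"
    using assms(6,7) by (simp add: distrib_left flip: mult.assoc)
  then show ?thesis using cone[OF assms(1-3)] assms(4,5) by simp
qed

section \<open>Isomorphisms in homology and the comparison of cones\<close>

definition hiso :: "'o \<Rightarrow> 'o \<Rightarrow> 'h \<Rightarrow> bool" where
  "hiso X Y a \<longleftrightarrow> a \<in> hm X Y \<and> (\<exists>a' \<in> hm Y X. a' * a = E X \<and> a * a' = E Y)"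

lemma hiso_hm: "hiso X Y a \<Longrightarrow> a \<in> hm X Y" by (simp add: hiso_def)

lemma hiso_inv: "hiso X Y a \<Longrightarrow> \<exists>a'. hiso Y X a' \<and> a' * a = E X \<and> a * a' = E Y"
  by (auto simp: hiso_def)

lemma hiso_mult: "hiso Y Z b \<Longrightarrow> hiso X Y a \<Longrightarrow> hiso X Z (b * a)"
  unfolding hiso_def
proof (elim conjE bexE, intro conjI hm_mult)
  fix a' b' assume h: "a \<in> hm X Y" "b \<in> hm Y Z" "a' \<in> hm Y X" "a' * a = E X" "a * a' = E Y"
    "b' \<in> hm Z Y" "b' * b = E Y" "b * b' = E Z"
  have "a' * b' * (b * a) = a' * (b' * b) * a" "b * a * (a' * b') = b * (a * a') * b'"
    by (simp_all add: mult.assoc)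
  with h show "\<exists>a'\<in>hm Z X. a' * (b * a) = E X \<and> b * a * a' = E Z"
    by (intro bexI[of _ "a' * b'"]) (auto simp: hm_left hm_right intro: hm_mult)
qed

lemma hiso_E: "X \<in> Ob \<Longrightarrow> hiso X X (E X)"
  using hm_E hm_left by (auto simp: hiso_def)

lemma hiso_ShM:
  assumes "X \<in> Ob" "Y \<in> Ob" "hiso X Y a" shows "hiso (sh X) (sh Y) (ShM X Y a)"
proof -
  from assms(3) obtain a' where "a' \<in> hm Y X" "a' * a = E X" "a * a' = E Y" "a \<in> hm X Y"
    by (auto simp: hiso_def)
  with assms(1,2) show ?thesis unfolding hiso_def
    by (intro conjI bexI[of _ "ShM Y X a'"]) (auto simp: ShM_hm ShM_E simp flip: ShM_mult)
qed

text \<open>Invertibility of \<open>c' c\<close> gives \<open>c\<close> a left inverse, that of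
  \<open>c c'\<close> a right inverse, and the two must agree.\<close>

lemma hiso_two_sided:
  assumes "c \<in> hm X Y" "c' \<in> hm Y X" "hiso X X (c' * c)" "hiso Y Y (c * c')"
  shows "hiso X Y c"
proof -
  obtain k where k: "k \<in> hm X X" "k * (c' * c) = E X" using assms(3) by (auto simp: hiso_def)
  obtain l where l: "l \<in> hm Y Y" "c * c' * l = E Y" using assms(4) by (auto simp: hiso_def)
  have "k * c' = k * c' * (c * c' * l)"
    using l hm_right[OF hm_mult[OF k(1) assms(2)]] by simp
  also have "\<dots> = k * (c' * c) * (c' * l)" by (simp only: mult.assoc)
  also have "\<dots> = c' * l" using k hm_left[OF hm_mult[OF assms(2) l(1)]] by simp
  finally have "c * (k * c') = E Y" using l by (simp add: mult.assoc)
  with k show ?thesis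
    using assms(1) hm_mult[OF k(1) assms(2)] unfolding hiso_def
    by (intro conjI bexI[of _ "k * c'"]) (auto simp: mult.assoc)
qed

text \<open>The maps \<open>Y -> C(f) -> X[1]\<close> of the standard triangle. The projection to
  \<open>X\<close> has degree 1, and \<open>s\<close> turns it into a degree 0 map to the
  shift.\<close>

abbreviation J :: "'o \<Rightarrow> 'o \<Rightarrow> 'r \<Rightarrow> 'h" where "J X Y f \<equiv> cls (cj X Y f)"
abbreviation P :: "'o \<Rightarrow> 'o \<Rightarrow> 'r \<Rightarrow> 'h" where "P X Y f \<equiv> cls (s X * cp X Y f)"

lemma cone_cyc:
  assumes "X \<in> Ob" "Y \<in> Ob" "f \<in> cyc X Y"
  shows "cj X Y f \<in> cyc Y (cn X Y f)" "s X * cp X Y f \<in> cyc (cn X Y f) (sh X)"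
proof -
  note c = cone[OF assms]
  show "cj X Y f \<in> cyc Y (cn X Y f)" using c by (simp add: cyc_def)
  have "s X * cp X Y f \<in> chain 0 (cn X Y f) (sh X)"
    using chain_mult[OF s_chain, OF assms(1), of "cp X Y f" 1] c by simp
  then show "s X * cp X Y f \<in> cyc (cn X Y f) (sh X)"
    using c assms by (intro cycI) (simp_all add: mult.assoc rw2[OF s_D])
qed

lemma cone_hm:
  assumes "X \<in> Ob" "Y \<in> Ob" "f \<in> cyc X Y"
  shows "J X Y f \<in> hm Y (cn X Y f)" "P X Y f \<in> hm (cn X Y f) (sh X)"
  using cone_cyc[OF assms] cone[OF assms] assms sh_Ob by (auto intro!: cls_hm)

text \<open>The square commutes only up to homotopy. A choice of homotopy is the extra datum needed
  to define a strict map of cones.\<close>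

lemma cone_map:
  assumes X: "X \<in> Ob" "Y \<in> Ob" "f \<in> cyc X Y" and X': "X' \<in> Ob" "Y' \<in> Ob" "f' \<in> cyc X' Y'"
    and ab: "a \<in> hm X X'" "b \<in> hm Y Y'" "b * cls f = cls f' * a"
  shows "\<exists>c \<in> hm (cn X Y f) (cn X' Y' f'). c * J X Y f = J X' Y' f' * b \<and>
    P X' Y' f' * c = ShM X X' a * P X Y f"
proof -
  obtain \<alpha> \<beta> where \<alpha>: "\<alpha> \<in> cyc X X'" "cls \<alpha> = a" and \<beta>: "\<beta> \<in> cyc Y Y'" "cls \<beta> = b"
    using hm_rep X X' ab by metis
  have "cls (\<beta> * f) = cls (f' * \<alpha>)"
    using ab \<alpha> \<beta> X X' by (simp add: cls_mult)
  then obtain h where h: "h \<in> chain (-1) X Y'" "\<beta> * f + f' * \<alpha> = D * h + h * D"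
    using cls_eq[OF X(1) X'(2) cyc_mult[OF \<beta>(1) X(3)] cyc_mult[OF X'(3) \<alpha>(1)]] by blast
  note c = cone[OF X] and c' = cone[OF X']
  let ?i = "ci X Y f" and ?p = "cp X Y f" and ?j = "cj X Y f" and ?q = "cq X Y f"
  let ?i' = "ci X' Y' f'" and ?p' = "cp X' Y' f'" and ?j' = "cj X' Y' f'" and ?q' = "cq X' Y' f'"
  have "D * h = h * D + (D * h + h * D)" by (simp add: ac_simps)
  then have Dh: "D * h = h * D + \<beta> * f + f' * \<alpha>" unfolding h(2)[symmetric] by (simp only: ac_simps)
  \<comment> \<open>As a matrix on \<open>X[1] + Y\<close>, the diagonal is \<alpha>, \<beta> and
    the off-diagonal entry is the homotopy. The relation \<open>Dh\<close> makes the two twists of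
    the differentials cancel against the commutator of \<open>h\<close>.\<close>
  define \<gamma> where "\<gamma> = ?i' * (\<alpha> * ?p) + ?j' * (\<beta> * ?q) + ?j' * (h * ?p)"
  have mem: "?i' * (\<alpha> * ?p) \<in> chain 0 (cn X Y f) (cn X' Y' f')"
    "?j' * (\<beta> * ?q) \<in> chain 0 (cn X Y f) (cn X' Y' f')"
    "?j' * (h * ?p) \<in> chain 0 (cn X Y f) (cn X' Y' f')"
    using chain_mult[of ?i' "-1" X' "cn X' Y' f'" "\<alpha> * ?p" 1] chain_mult[of \<alpha> 0 X X' ?p 1]
     chain_mult[of ?j' 0 Y' "cn X' Y' f'" "\<beta> * ?q" 0] chain_mult[of \<beta> 0 Y Y' ?q 0]
     chain_mult[of ?j' 0 Y' "cn X' Y' f'" "h * ?p" 0] chain_mult[of h "-1" X Y' ?p 1]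
     c c' h cyc_chain[OF \<alpha>(1)] cyc_chain[OF \<beta>(1)] by simp_all
  have "D * \<gamma> = \<gamma> * D"
    unfolding \<gamma>_def
    by (simp add: algebra_simps rw2[OF cyc_D[OF \<alpha>(1)]] rw2[OF cyc_D[OF \<beta>(1)]] rw2[OF Dh]
        cone_simps[OF X] cone_simps[OF X'])
  then have \<gamma>: "\<gamma> \<in> cyc (cn X Y f) (cn X' Y' f')"
    using mem by (auto intro!: cycI chain_add simp: \<gamma>_def)
  have "\<gamma> * ?j = ?j' * \<beta>"
    unfolding \<gamma>_def by (simp add: algebra_simps cone_simps[OF X] cyc_right[OF \<beta>(1)])
  moreover have "s X' * ?p' * \<gamma> = s X' * \<alpha> * t X * (s X * ?p)"
    unfolding \<gamma>_def
    by (simp add: algebra_simps rw2[OF ts[OF X(1)]] cone_simps[OF X] cone_simps[OF X'] rw2[OF cyc_left[OF \<alpha>(1)]])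
  ultimately have "cls \<gamma> * J X Y f = J X' Y' f' * b" "P X' Y' f' * cls \<gamma> = ShM X X' a * P X Y f"
    using cls_mult[OF \<gamma> cone_cyc(1)[OF X]] cls_mult[OF cone_cyc(1)[OF X'] \<beta>(1)]
      cls_mult[OF cone_cyc(2)[OF X'] \<gamma>] cls_mult[OF shift_cyc[OF X(1) X'(1) \<alpha>(1)] cone_cyc(2)[OF X]]
      ShM_cls[OF X(1) X'(1) \<alpha>(1)] \<alpha> \<beta> by simp_all
  moreover have "cls \<gamma> \<in> hm (cn X Y f) (cn X' Y' f')" using \<gamma> c c' by (intro cls_hm) auto
  ultimately show ?thesis by blast
qed

text \<open>Exactness of the maps into \<open>W\<close> at the middle of
  \<open>Y -> C(f) -> X[1]\<close>.\<close>

lemma cone_exact: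
  assumes X: "X \<in> Ob" "Y \<in> Ob" "f \<in> cyc X Y" and W: "W \<in> Ob"
    and g: "g \<in> hm (cn X Y f) W" "g * J X Y f = 0"
  shows "\<exists>\<phi> \<in> hm (sh X) W. g = \<phi> * P X Y f"
proof -
  note c = cone[OF X]
  let ?i = "ci X Y f" and ?p = "cp X Y f" and ?j = "cj X Y f" and ?q = "cq X Y f"
  obtain \<gamma> where \<gamma>: "\<gamma> \<in> cyc (cn X Y f) W" "cls \<gamma> = g" using hm_rep c W g by metis
  then have "cls (\<gamma> * ?j) = 0" using g cls_mult[OF \<gamma>(1) cone_cyc(1)[OF X]] by simp
  then obtain h where h: "h \<in> chain (-1) Y W" "\<gamma> * ?j = D * h + h * D"
    using cls_eq_0[OF X(2) W cyc_mult[OF \<gamma>(1) cone_cyc(1)[OF X]]] by blast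
  have "D * h = h * D + (D * h + h * D)" by (simp add: ac_simps)
  then have Dh: "D * h = h * D + \<gamma> * ?j" unfolding h(2)[symmetric] .
  \<comment> \<open>Restricting \<gamma> along \<open>?i\<close> does not give a cocycle, because
    \<open>D * ?i\<close> has the extra term \<open>?j * f\<close>. The null homotopy
    \<open>h\<close> of \<open>\<gamma> * ?j\<close>, composed with \<open>f\<close>, compensates
    for it.\<close>
  define \<phi> where "\<phi> = \<gamma> * (?i * t X) + h * (f * t X)"
  have "\<gamma> * (?i * t X) \<in> chain 0 (sh X) W" "h * (f * t X) \<in> chain 0 (sh X) W"
    using chain_mult[of \<gamma> 0 "cn X Y f" W "?i * t X" 0] chain_mult[of ?i "-1" X _ "t X" 1]
      chain_mult[of h "-1" Y W "f * t X" 1] chain_mult[of f 0 X Y "t X" 1]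
      c h t_chain[OF X(1)] cyc_chain[OF X(3)] cyc_chain[OF \<gamma>(1)] by simp_all
  moreover have "D * \<phi> = \<phi> * D"
    unfolding \<phi>_def
    by (simp add: algebra_simps rw2[OF cyc_D[OF \<gamma>(1)]] rw2[OF Dh] cone_simps[OF X] t_D[OF X(1)])
  ultimately have \<phi>: "\<phi> \<in> cyc (sh X) W" by (auto intro!: cycI chain_add simp: \<phi>_def)
  \<comment> \<open>The homotopy between \<gamma> and the factored map: \<open>h\<close>, extended
    to the whole cone through the projection to \<open>Y\<close>.\<close>
  have m: "h * ?q \<in> chain (-1) (cn X Y f) W"
    using chain_mult[of h "-1" Y W ?q 0] c h by simp
  have "\<gamma> * ?j * ?q = \<gamma> * (?i * ?p) + \<gamma>"
  proof -
    have "\<gamma> = \<gamma> * (?i * ?p + ?j * ?q)" using c cyc_right[OF \<gamma>(1)] by simp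
    then have "\<gamma> = \<gamma> * (?i * ?p) + \<gamma> * ?j * ?q" by (simp add: algebra_simps)
    then show ?thesis by (metis dbl_left)
  qed
  then have "\<gamma> + \<phi> * (s X * ?p) = D * (h * ?q) + h * ?q * D"
    unfolding \<phi>_def
    by (simp add: algebra_simps rw2[OF Dh] cone_simps[OF X] rw2[OF ts[OF X(1)]])
  then have "g = \<phi>' * P X Y f" if "\<phi>' = cls \<phi>" for \<phi>'
    using cls_eq[OF _ W \<gamma>(1) cyc_mult[OF \<phi> cone_cyc(2)[OF X]]] m c that \<gamma>
      cls_mult[OF \<phi> cone_cyc(2)[OF X]] by auto
  with cls_hm[OF sh_Ob[OF X(1)] W \<phi>] show ?thesis by blast
qed

text \<open>A substitute for the five lemma. Write \<open>c = E + n\<close>. Then \<open>n\<close>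
  vanishes after \<open>J\<close>, so by exactness \<open>n = \<phi> * P\<close>; also
  \<open>P * n = 0\<close>, hence \<open>n * n = 0\<close>, and in characteristic 2 the map
  \<open>c\<close> is its own inverse.\<close>

lemma cone_unipotent:
  assumes X: "X \<in> Ob" "Y \<in> Ob" "f \<in> cyc X Y"
    and c: "c \<in> hm (cn X Y f) (cn X Y f)" "c * J X Y f = J X Y f" "P X Y f * c = P X Y f"
  shows "hiso (cn X Y f) (cn X Y f) c"
proof -
  let ?C = "cn X Y f"
  have C: "?C \<in> Ob" using cone[OF X] by simp
  note hmC = hm_left[OF cone_hm(1)[OF X]] hm_right[OF cone_hm(2)[OF X]]
  define n where "n = c + E ?C"
  have n: "n \<in> hm ?C ?C" using c C by (simp add: n_def hm_add hm_E)
  have "n * J X Y f = 0" using c hmC by (simp add: n_def algebra_simps)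
  then obtain \<phi> where "n = \<phi> * P X Y f" using cone_exact[OF X C n] by blast
  moreover have "P X Y f * n = 0" using c hmC by (simp add: n_def algebra_simps)
  ultimately have nn: "n * n = 0" by (metis mult.assoc mult_zero_right)
  have E: "E ?C * E ?C = E ?C" using hm_E[OF C] hm_left by blast
  have "c * c = n * n + E ?C"
    using c(1) by (simp add: n_def algebra_simps E hm_left hm_right)
  then show ?thesis using nn c by (auto simp: hiso_def)
qed

text \<open>The cone maps over \<open>a\<close>, \<open>b\<close> and over their inverses need not
  be mutually inverse, since each depends on a homotopy. Their composites are however compatible
  with \<open>J\<close> and \<open>P\<close>, hence invertible by \<open>cone_unipotent\<close>, and
  that suffices by \<open>hiso_two_sided\<close>.\<close>

lemma cone_iso:
  assumes X: "X \<in> Ob" "Y \<in> Ob" "f \<in> cyc X Y" and X': "X' \<in> Ob" "Y' \<in> Ob" "f' \<in> cyc X' Y'"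
    and ab: "hiso X X' a" "hiso Y Y' b" "b * cls f = cls f' * a"
  shows "\<exists>c. hiso (cn X Y f) (cn X' Y' f') c \<and> c * J X Y f = J X' Y' f' * b \<and>
    P X' Y' f' * c = ShM X X' a * P X Y f"
proof -
  obtain a' where a': "hiso X' X a'" "a' * a = E X" "a * a' = E X'" using hiso_inv ab by blast
  obtain b' where b': "hiso Y' Y b'" "b' * b = E Y" "b * b' = E Y'" using hiso_inv ab by blast
  note hh = hiso_hm[OF a'(1)] hiso_hm[OF b'(1)] hiso_hm[OF ab(1)] hiso_hm[OF ab(2)]
  obtain c where c: "c \<in> hm (cn X Y f) (cn X' Y' f')" "c * J X Y f = J X' Y' f' * b"
    "P X' Y' f' * c = ShM X X' a * P X Y f"
    using cone_map[OF X X' hh(3,4) ab(3)] by blast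
  have "b' * cls f' = cls f * a'"
  proof -
    have "b' * cls f' = b' * (cls f' * a) * a'"
      using a' cls_hm[OF X'] by (simp add: mult.assoc hm_right)
    also have "\<dots> = b' * b * cls f * a'" by (simp add: ab(3)[symmetric] mult.assoc)
    finally show ?thesis using b' cls_hm[OF X] by (simp add: hm_left)
  qed
  then obtain c' where c': "c' \<in> hm (cn X' Y' f') (cn X Y f)" "c' * J X' Y' f' = J X Y f * b'"
    "P X Y f * c' = ShM X' X a' * P X' Y' f'"
    using cone_map[OF X' X hh(1,2)] by blast
  have sa: "ShM X' X a' * ShM X X' a = E (sh X)" "ShM X X' a * ShM X' X a' = E (sh X')"
    using hh X X' a' by (simp_all add: ShM_E flip: ShM_mult)
  have "hiso (cn X Y f) (cn X Y f) (c' * c)"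
  proof (rule cone_unipotent[OF X hm_mult[OF c'(1) c(1)]])
    have "c' * c * J X Y f = (c' * J X' Y' f') * b" using c by (simp add: mult.assoc)
    also have "\<dots> = J X Y f * (b' * b)" using c' by (simp add: mult.assoc)
    finally show "c' * c * J X Y f = J X Y f" using b' cone_hm[OF X] by (simp add: hm_right)
    have "P X Y f * (c' * c) = ShM X' X a' * (P X' Y' f' * c)" using c' by (simp flip: mult.assoc)
    also have "\<dots> = ShM X' X a' * ShM X X' a * P X Y f" using c by (simp flip: mult.assoc)
    finally show "P X Y f * (c' * c) = P X Y f" using sa cone_hm[OF X] by (simp add: hm_left)
  qed
  moreover have "hiso (cn X' Y' f') (cn X' Y' f') (c * c')"
  proof (rule cone_unipotent[OF X' hm_mult[OF c(1) c'(1)]])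
    have "c * c' * J X' Y' f' = (c * J X Y f) * b'" using c' by (simp add: mult.assoc)
    also have "\<dots> = J X' Y' f' * (b * b')" using c by (simp add: mult.assoc)
    finally show "c * c' * J X' Y' f' = J X' Y' f'" using b' cone_hm[OF X'] by (simp add: hm_right)
    have "P X' Y' f' * (c * c') = ShM X X' a * (P X Y f * c')" using c by (simp flip: mult.assoc)
    also have "\<dots> = ShM X X' a * ShM X' X a' * P X' Y' f'" using c' by (simp flip: mult.assoc)
    finally show "P X' Y' f' * (c * c') = P X' Y' f'" using sa cone_hm[OF X'] by (simp add: hm_left)
  qed
  ultimately show ?thesis using hiso_two_sided c c' by blast
qed


section \<open>Distinguished triangles and Verdier's axioms\<close>

definition dist :: "'o \<Rightarrow> 'o \<Rightarrow> 'o \<Rightarrow> 'h \<Rightarrow> 'h \<Rightarrow> 'h \<Rightarrow> bool" where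
  "dist X Y Z u v w \<longleftrightarrow> X \<in> Ob \<and> Y \<in> Ob \<and> Z \<in> Ob \<and>
     u \<in> hm X Y \<and> v \<in> hm Y Z \<and> w \<in> hm Z (sh X) \<and>
     (\<exists>M \<in> Ob. \<exists>N \<in> Ob. \<exists>f \<in> cyc M N. \<exists>a b c. hiso X M a \<and> hiso Y N b \<and> hiso Z (cn M N f) c \<and>
        b * u = cls f * a \<and> c * v = J M N f * b \<and> ShM X M a * w = P M N f * c)"

lemma dist_iso:
  assumes d: "dist X Y Z u v w"
    and "X' \<in> Ob" "Y' \<in> Ob" "Z' \<in> Ob" "u' \<in> hm X' Y'" "v' \<in> hm Y' Z'" "w' \<in> hm Z' (sh X')"
    and i: "hiso X' X a" "hiso Y' Y b" "hiso Z' Z c" "b * u' = u * a" "c * v' = v * b" "ShM X' X a * w' = w * c"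
  shows "dist X' Y' Z' u' v' w'"
proof -
  from d obtain M N f a' b' c' where h: "X \<in> Ob" "M \<in> Ob" "N \<in> Ob" "f \<in> cyc M N"
    "hiso X M a'" "hiso Y N b'" "hiso Z (cn M N f) c'"
    "b' * u = cls f * a'" "c' * v = J M N f * b'" "ShM X M a' * w = P M N f * c'"
    by (auto simp: dist_def)
  have "b' * b * u' = b' * u * a" using i by (simp add: mult.assoc)
  then have 1: "b' * b * u' = cls f * (a' * a)" using h by (simp add: mult.assoc)
  have "c' * c * v' = c' * v * b" using i by (simp add: mult.assoc)
  then have 2: "c' * c * v' = J M N f * (b' * b)" using h by (simp add: mult.assoc)
  have "ShM X' M (a' * a) * w' = ShM X M a' * w * c"
    by (simp add: ShM_mult[OF assms(2) h(1,2) hiso_hm[OF i(1)] hiso_hm[OF h(5)]] mult.assoc i(6))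
  then have "ShM X' M (a' * a) * w' = P M N f * (c' * c)" by (simp only: h mult.assoc)
  with 1 2 h assms(2-7) hiso_mult[OF h(5) i(1)] hiso_mult[OF h(6) i(2)] hiso_mult[OF h(7) i(3)]
  show ?thesis unfolding dist_def by blast
qed

text \<open>Normal form of a triangle: for any chosen representative of \<open>u\<close>, the third
  object is identified with its cone while \<open>X\<close> and \<open>Y\<close> stay fixed. It
  arises by carrying the cone along the given isomorphisms with \<open>cone_iso\<close>; the axioms
  below start from it.\<close>

lemma dist_strict:
  assumes d: "dist X Y Z u v w" and f: "f \<in> cyc X Y" "cls f = u"
  shows "\<exists>c. hiso Z (cn X Y f) c \<and> c * v = J X Y f \<and> P X Y f * c = w"
proof -
  from d obtain M N g a b c where h: "X \<in> Ob" "Y \<in> Ob" "M \<in> Ob" "N \<in> Ob" "g \<in> cyc M N"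
    "hiso X M a" "hiso Y N b" "hiso Z (cn M N g) c"
    "b * u = cls g * a" "c * v = J M N g * b" "ShM X M a * w = P M N g * c"
    and hm: "v \<in> hm Y Z" "w \<in> hm Z (sh X)"
    by (auto simp: dist_def)
  obtain k where k: "hiso (cn X Y f) (cn M N g) k" "k * J X Y f = J M N g * b"
    "P M N g * k = ShM X M a * P X Y f"
    using cone_iso[OF h(1,2) f(1) h(3-7)] h(9) f(2) by blast
  obtain k' where k': "hiso (cn M N g) (cn X Y f) k'" "k' * k = E (cn X Y f)" "k * k' = E (cn M N g)"
    using hiso_inv[OF k(1)] by blast
  obtain a' where a': "hiso (sh M) (sh X) a'" "a' * ShM X M a = E (sh X)"
    using hiso_inv[OF hiso_ShM[OF h(1,3,6)]] by blast
  have "k' * c * v = k' * (k * J X Y f)" using h k by (simp add: mult.assoc)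
  then have 1: "k' * c * v = J X Y f"
    using k' cone_hm[OF h(1,2) f(1)] by (simp add: hm_left flip: mult.assoc)
  have "P X Y f * (k' * c) = a' * (ShM X M a * P X Y f) * k' * c"
    using a' cone_hm[OF h(1,2) f(1)] by (simp add: hm_left flip: mult.assoc)
  also have "\<dots> = a' * P M N g * (k * k') * c" by (simp add: k(3)[symmetric] mult.assoc)
  also have "\<dots> = a' * (P M N g * c)" using k' hiso_hm[OF h(8)] by (simp add: hm_left mult.assoc)
  also have "\<dots> = w" using a' hm by (simp add: h(11)[symmetric] hm_left flip: mult.assoc)
  finally show ?thesis using 1 hiso_mult[OF k'(1) h(8)] by blast
qed

lemma strict_dist:
  assumes X: "X \<in> Ob" "Y \<in> Ob" "f \<in> cyc X Y" and Z: "Z \<in> Ob" "v \<in> hm Y Z" "w \<in> hm Z (sh X)"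
    and c: "hiso Z (cn X Y f) c" "c * v = J X Y f" "P X Y f * c = w"
  shows "dist X Y Z (cls f) v w"
proof -
  have "hiso X X (E X)" "hiso Y Y (E Y)" using X by (simp_all add: hiso_E)
  moreover have "E Y * cls f = cls f * E X" using cls_hm[OF X] by (simp add: hm_left hm_right)
  moreover have "c * v = J X Y f * E Y" using c cone_hm[OF X] by (simp add: hm_right)
  moreover have "ShM X X (E X) * w = P X Y f * c" using c X Z by (simp add: ShM_E hm_left)
  ultimately show ?thesis
    unfolding dist_def using X Z c(1) cls_hm[OF X] by blast
qed

lemma cone_dist:
  assumes "X \<in> Ob" "Y \<in> Ob" "f \<in> cyc X Y"
  shows "dist X Y (cn X Y f) (cls f) (J X Y f) (P X Y f)"
  using cone[OF assms] cone_hm[OF assms] assms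
  by (intro strict_dist[OF assms _ _ _ hiso_E]) (auto simp: hm_left hm_right)

lemma dist_rep:
  assumes "dist X Y Z u v w"
  obtains f c where "f \<in> cyc X Y" "cls f = u" "hiso Z (cn X Y f) c" "c * v = J X Y f" "P X Y f * c = w"
  using assms dist_strict hm_rep dist_def by metis

text \<open>On \<open>X[1] + X\<close> the map \<open>i q\<close>, sending the second copy of
  \<open>X\<close> to the first, is a contraction.\<close>

lemma cone_E_zero:
  assumes "X \<in> Ob" shows "E (cn X X (e X)) = 0"
proof -
  note X = assms assms cyc_e[OF assms]
  note c = cone[OF X]
  have "ci X X (e X) * cq X X (e X) \<in> chain (-1) (cn X X (e X)) (cn X X (e X))"
    using chain_mult[of "ci X X (e X)" "-1" X _ "cq X X (e X)" 0] c by simp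
  moreover have "e (cn X X (e X)) = D * (ci X X (e X) * cq X X (e X)) + (ci X X (e X) * cq X X (e X)) * D"
    using c by (simp add: algebra_simps cone_simps[OF X])
  ultimately show ?thesis
    unfolding E_def using cls_eq_0[OF _ _ cyc_e] c by blast
qed

lemma dist_ident:
  assumes "X \<in> Ob" "Z \<in> Ob" "E Z = 0" shows "dist X X Z (E X) 0 0"
proof -
  note X = assms(1,1) cyc_e[OF assms(1)]
  have "E (cn X X (e X)) = 0" by (rule cone_E_zero) fact
  moreover from this have "J X X (e X) = 0" "P X X (e X) = 0"
    using hm_left[OF cone_hm(1)[OF X]] hm_right[OF cone_hm(2)[OF X]] by simp_all
  moreover from this have "hiso Z (cn X X (e X)) 0"
    using assms \<open>E (cn X X (e X)) = 0\<close> unfolding hiso_def by (auto intro!: exI[of _ 0])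
  ultimately show ?thesis
    using strict_dist[OF X assms(2), of 0 0 0] by (simp add: E_def)
qed

text \<open>By the normal form it is enough to rotate a cone triangle. The cone of \<open>J\<close>
  is homotopy equivalent to \<open>X[1]\<close>, because it consists of \<open>X[1]\<close> and two
  copies of \<open>Y\<close> that cancel.\<close>

lemma dist_rotate:
  assumes d: "dist X Y Z u v w" shows "dist Y Z (sh X) v w (ShM X Y u)"
proof -
  from d have Ob: "X \<in> Ob" "Y \<in> Ob" "Z \<in> Ob" and hm: "u \<in> hm X Y" "v \<in> hm Y Z" "w \<in> hm Z (sh X)"
    by (auto simp: dist_def)
  from d obtain f k where f: "f \<in> cyc X Y" "cls f = u" and k: "hiso Z (cn X Y f) k" "k * v = J X Y f" "P X Y f * k = w"
    by (rule dist_rep)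
  let ?C = "cn X Y f"
  let ?i = "ci X Y f" and ?p = "cp X Y f" and ?j = "cj X Y f" and ?q = "cq X Y f"
  note X = Ob(1,2) f(1)
  note c = cone[OF X] and cs = cone_simps[OF X]
  have C: "Y \<in> Ob" "?C \<in> Ob" "?j \<in> cyc Y ?C" using c Ob cone_cyc[OF X] by auto
  let ?K = "cn Y ?C ?j"
  let ?i' = "ci Y ?C ?j" and ?p' = "cp Y ?C ?j" and ?j' = "cj Y ?C ?j" and ?q' = "cq Y ?C ?j"
  note c' = cone[OF C] and cs' = cone_simps[OF C]
  note sx = s_chain[OF Ob(1)] t_chain[OF Ob(1)]
  note sX = ts[OF Ob(1)] st[OF Ob(1)] rw2[OF ts[OF Ob(1)]] rw2[OF st[OF Ob(1)]] s_D[OF Ob(1)] t_D[OF Ob(1)]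
    rw2[OF s_D[OF Ob(1)]] rw2[OF t_D[OF Ob(1)]] chain_left[OF sx(1)] chain_right[OF sx(1)]
    chain_left[OF sx(2)] chain_right[OF sx(2)] rw2[OF chain_right[OF sx(1)]] rw2[OF chain_left[OF sx(2)]]
  \<comment> \<open>The inclusion of \<open>X[1]\<close> into the inner cone is not a cocycle; its
    defect \<open>?j' * ?j * f\<close> is cancelled by the twist of \<open>?i'\<close> when the
    component \<open>f\<close> into the summand \<open>Y[1]\<close> is added.\<close>
  define \<kappa> where "\<kappa> = ?i' * (f * t X) + ?j' * (?i * t X)"
  define \<mu> where "\<mu> = s X * (?p * ?q')"
  have \<kappa>: "\<kappa> \<in> cyc (sh X) ?K"
  proof (rule cycI)
    show "\<kappa> \<in> chain 0 (sh X) ?K"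
      unfolding \<kappa>_def
      using chain_mult[of ?i' "-1" Y ?K "f * t X" 1] chain_mult[of f 0 X Y "t X" 1]
        chain_mult[of ?j' 0 ?C ?K "?i * t X" 0] chain_mult[of ?i "-1" X ?C "t X" 1] c c' sx cyc_chain[OF X(3)]
      by (auto intro!: chain_add)
    show "D * \<kappa> = \<kappa> * D"
      unfolding \<kappa>_def by (simp add: algebra_simps cs cs' sX)
  qed
  have \<mu>: "\<mu> \<in> cyc ?K (sh X)"
  proof (rule cycI)
    show "\<mu> \<in> chain 0 ?K (sh X)"
      unfolding \<mu>_def
      using chain_mult[of "s X" "-1" X "sh X" "?p * ?q'" 1] chain_mult[of ?p 1 ?C X ?q' 0] c c' sx by auto
    show "D * \<mu> = \<mu> * D"
      unfolding \<mu>_def by (simp add: algebra_simps cs cs' sX)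
  qed
  have K: "?K \<in> Ob" using c' by simp
  have "\<mu> * \<kappa> = e (sh X)"
    unfolding \<kappa>_def \<mu>_def by (simp add: algebra_simps cs cs' sX)
  then have 1: "cls \<mu> * cls \<kappa> = E (sh X)" using cls_mult[OF \<mu> \<kappa>] by (simp add: E_def)
  \<comment> \<open>The homotopy takes the copy of \<open>Y\<close> in the inner cone to the summand
    \<open>Y[1]\<close> of the outer one, contracting the two copies of \<open>Y\<close>.\<close>
  have "?i' * (?q * ?q') \<in> chain (-1) ?K ?K"
    using chain_mult[of ?i' "-1" Y ?K "?q * ?q'" 0] chain_mult[of ?q 0 ?C Y ?q' 0] c c' by auto
  moreover have "\<kappa> * \<mu> + e ?K = D * (?i' * (?q * ?q')) + (?i' * (?q * ?q')) * D"
  proof (rule cone_ext[OF C])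
    show "(\<kappa> * \<mu> + e ?K) * ?j' = (D * (?i' * (?q * ?q')) + (?i' * (?q * ?q')) * D) * ?j'"
      unfolding \<kappa>_def \<mu>_def by (simp add: algebra_simps cs cs' sX cone_ip[OF X])
    show "(\<kappa> * \<mu> + e ?K) * ?i' = (D * (?i' * (?q * ?q')) + (?i' * (?q * ?q')) * D) * ?i'"
      unfolding \<kappa>_def \<mu>_def by (simp add: algebra_simps cs cs' sX)
  qed (use e_idem[OF K] e_D[OF K] in \<open>simp_all add: algebra_simps \<kappa>_def \<mu>_def cs cs'\<close>)
  ultimately have 2: "cls \<kappa> * cls \<mu> = E ?K"
    using cls_eq[OF K K cyc_mult[OF \<kappa> \<mu>] cyc_e[OF K]] cls_mult[OF \<kappa> \<mu>] by (auto simp: E_def)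
  have i\<kappa>: "hiso (sh X) ?K (cls \<kappa>)"
    using 1 2 cls_hm[OF _ _ \<kappa>] cls_hm[OF _ _ \<mu>] K sh_Ob[OF Ob(1)] unfolding hiso_def by blast
  \<comment> \<open>The square with \<open>P\<close> commutes only up to homotopy; the same map
    between the copies of \<open>Y\<close>, restricted to the inner cone, provides it.\<close>
  have "?i' * ?q \<in> chain (-1) ?C ?K"
    using chain_mult[of ?i' "-1" Y ?K "?q" 0] c c' by auto
  moreover have "\<kappa> * (s X * ?p) + ?j' = D * (?i' * ?q) + (?i' * ?q) * D"
    by (rule cone_ext[OF X])
      (use e_idem[OF C(2)] e_D[OF C(2)] in \<open>simp_all add: algebra_simps \<kappa>_def cs cs' sX\<close>)
  ultimately have \<kappa>P: "cls \<kappa> * P X Y f = J Y ?C ?j"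
    using cls_eq[OF C(2) K cyc_mult[OF \<kappa> cone_cyc(2)[OF X]] cone_cyc(1)[OF C]]
     cls_mult[OF \<kappa> cone_cyc(2)[OF X]] by auto
  have "s Y * ?p' * \<kappa> = s Y * f * t X"
    unfolding \<kappa>_def by (simp add: algebra_simps cs cs' sX)
  then have P\<kappa>: "P Y ?C ?j * cls \<kappa> = ShM X Y u"
    using cls_mult[OF cone_cyc(2)[OF C] \<kappa>] ShM_cls[OF X] f by simp
  show ?thesis
  proof (rule dist_iso[OF cone_dist[OF C] Ob(2,3) sh_Ob[OF Ob(1)] hm(2,3) ShM_hm[OF Ob(1,2) hm(1)] hiso_E[OF Ob(2)] k(1) i\<kappa>])
    show "k * v = J X Y f * E Y" using k cone_hm[OF X] by (simp add: hm_right)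
    show "cls \<kappa> * w = J Y ?C ?j * k" using k \<kappa>P by (metis mult.assoc)
    show "ShM Y Y (E Y) * ShM X Y u = P Y ?C ?j * cls \<kappa>"
      using P\<kappa> Ob by (simp add: ShM_E hm_left[OF ShM_hm[OF Ob(1,2) hm(1)]])
  qed
qed

text \<open>The cone of a shifted map is isomorphic to the shifted cone, and the shift is bijective
  on morphisms, so the comparison isomorphism and its equations can be pulled back along
  \<open>ShM\<close>.\<close>

lemma dist_unshift:
  assumes Ob: "X \<in> Ob" "Y \<in> Ob" "Z \<in> Ob" and hm: "u \<in> hm X Y" "v \<in> hm Y Z" "w \<in> hm Z (sh X)"
    and d: "dist (sh X) (sh Y) (sh Z) (ShM X Y u) (ShM Y Z v) (ShM Z (sh X) w)"
  shows "dist X Y Z u v w"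
proof -
  obtain f where f: "f \<in> cyc X Y" "cls f = u" using hm_rep[OF Ob(1,2) hm(1)] by blast
  let ?C = "cn X Y f"
  let ?i = "ci X Y f" and ?p = "cp X Y f" and ?j = "cj X Y f" and ?q = "cq X Y f"
  note X = Ob(1,2) f(1)
  note c = cone[OF X] and cs = cone_simps[OF X]
  have C: "?C \<in> Ob" using c by simp
  define f1 where "f1 = s Y * f * t X"
  have "f1 \<in> cyc (sh X) (sh Y)" unfolding f1_def by (rule shift_cyc[OF X])
  note X1 = sh_Ob[OF Ob(1)] sh_Ob[OF Ob(2)] this
  have tf: "t Y * (f1 * x) = f * (t X * x)" "f1 * (s X * x) = s Y * (f * x)" for x
    using Ob by (simp_all add: f1_def mult.assoc rw2[OF ts] rw2[OF cyc_left[OF f(1)]] rw2[OF cyc_right[OF f(1)]])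
  let ?C1 = "cn (sh X) (sh Y) f1"
  let ?i1 = "ci (sh X) (sh Y) f1" and ?p1 = "cp (sh X) (sh Y) f1" and ?j1 = "cj (sh X) (sh Y) f1" and ?q1 = "cq (sh X) (sh Y) f1"
  note c1 = cone[OF X1] and cs1 = cone_simps[OF X1]
  note st' = ts st rw2[OF ts] rw2[OF st] s_D t_D rw2[OF s_D] rw2[OF t_D]
    chain_left[OF s_chain] chain_right[OF s_chain] chain_left[OF t_chain] chain_right[OF t_chain]
    rw2[OF chain_right[OF s_chain]] rw2[OF chain_left[OF t_chain]] rw2[OF chain_left[OF s_chain]]
    rw2[OF chain_right[OF t_chain]]
  obtain k where k: "hiso (sh Z) ?C1 k" "k * ShM Y Z v = J (sh X) (sh Y) f1" "P (sh X) (sh Y) f1 * k = ShM Z (sh X) w"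
    using dist_strict[OF d X1(3)] ShM_cls[OF X] f by (auto simp: f1_def)
  \<comment> \<open>Componentwise, both objects consist of \<open>X[2]\<close> and
    \<open>Y[1]\<close>; \<kappa> and \<mu> match these summands and are strictly inverse.\<close>
  define \<kappa> where "\<kappa> = s ?C * (?i * (t X * ?p1)) + s ?C * (?j * (t Y * ?q1))"
  define \<mu> where "\<mu> = ?i1 * (s X * (?p * t ?C)) + ?j1 * (s Y * (?q * t ?C))"
  note ch = s_chain[OF Ob(1)] t_chain[OF Ob(1)] s_chain[OF Ob(2)] t_chain[OF Ob(2)] s_chain[OF C] t_chain[OF C]
  have \<kappa>: "\<kappa> \<in> cyc ?C1 (sh ?C)"
  proof (rule cycI)
    show "\<kappa> \<in> chain 0 ?C1 (sh ?C)"
      unfolding \<kappa>_def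
      using chain_mult[of "s ?C" "-1" ?C "sh ?C" "?i * (t X * ?p1)" 1] chain_mult[of ?i "-1" X ?C "t X * ?p1" 2]
        chain_mult[of "t X" 1 "sh X" X ?p1 1]
        chain_mult[of "s ?C" "-1" ?C "sh ?C" "?j * (t Y * ?q1)" 1] chain_mult[of ?j 0 Y ?C "t Y * ?q1" 1]
        chain_mult[of "t Y" 1 "sh Y" Y ?q1 0] c c1 ch
      by (auto intro!: chain_add)
    show "D * \<kappa> = \<kappa> * D"
      unfolding \<kappa>_def using Ob C by (simp add: algebra_simps cs cs1 st' tf)
  qed
  have \<mu>: "\<mu> \<in> cyc (sh ?C) ?C1"
  proof (rule cycI)
    show "\<mu> \<in> chain 0 (sh ?C) ?C1"
      unfolding \<mu>_def
      using chain_mult[of ?i1 "-1" "sh X" ?C1 "s X * (?p * t ?C)" 1] chain_mult[of "s X" "-1" X "sh X" "?p * t ?C" 2]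
        chain_mult[of ?p 1 ?C X "t ?C" 1]
        chain_mult[of ?j1 0 "sh Y" ?C1 "s Y * (?q * t ?C)" 0] chain_mult[of "s Y" "-1" Y "sh Y" "?q * t ?C" 1]
        chain_mult[of ?q 0 ?C Y "t ?C" 1] c c1 ch
      by (auto intro!: chain_add)
    show "D * \<mu> = \<mu> * D"
      unfolding \<mu>_def using Ob C by (simp add: algebra_simps cs cs1 st' tf)
  qed
  have shC: "sh ?C \<in> Ob" "?C1 \<in> Ob" using sh_Ob C c1 by auto
  have "\<mu> * \<kappa> = ?i1 * ?p1 + ?j1 * ?q1"
    unfolding \<kappa>_def \<mu>_def using Ob C by (simp add: algebra_simps cs cs1 st' tf)
  then have 1: "cls \<mu> * cls \<kappa> = E ?C1" using cls_mult[OF \<mu> \<kappa>] c1 by (simp add: E_def)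
  have "\<kappa> * \<mu> = s ?C * ((?i * ?p + ?j * ?q) * t ?C)"
    unfolding \<kappa>_def \<mu>_def using Ob C by (simp add: algebra_simps cs cs1 st' tf)
  then have "\<kappa> * \<mu> = e (sh ?C)" using c st[OF C] chain_left[OF t_chain[OF C]] by simp
  then have 2: "cls \<kappa> * cls \<mu> = E (sh ?C)" using cls_mult[OF \<kappa> \<mu>] by (simp add: E_def)
  have i\<kappa>: "hiso ?C1 (sh ?C) (cls \<kappa>)"
    using 1 2 cls_hm[OF shC(2,1) \<kappa>] cls_hm[OF shC \<mu>] unfolding hiso_def by blast
  have k\<kappa>: "hiso (sh Z) (sh ?C) (cls \<kappa> * k)" by (rule hiso_mult[OF i\<kappa> k(1)])
  then obtain l where l: "hiso (sh ?C) (sh Z) l" "l * (cls \<kappa> * k) = E (sh Z)" "cls \<kappa> * k * l = E (sh ?C)"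
    using hiso_inv by blast
  obtain k0 where k0: "k0 \<in> hm Z ?C" "ShM Z ?C k0 = cls \<kappa> * k"
    using ShM_surj[OF Ob(3) C hiso_hm[OF k\<kappa>]] by blast
  obtain l0 where l0: "l0 \<in> hm ?C Z" "ShM ?C Z l0 = l"
    using ShM_surj[OF C Ob(3) hiso_hm[OF l(1)]] by blast
  have "hiso Z ?C k0"
    unfolding hiso_def
  proof (intro conjI k0 bexI[OF _ l0(1)])
    show "l0 * k0 = E Z"
      by (rule ShM_inj[OF Ob(3,3) hm_mult[OF l0(1) k0(1)] hm_E[OF Ob(3)]])
        (simp add: ShM_mult[OF Ob(3) C Ob(3) k0(1) l0(1)] ShM_E Ob k0 l0 l)
    show "k0 * l0 = E ?C"
      by (rule ShM_inj[OF C C hm_mult[OF k0(1) l0(1)] hm_E[OF C]])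
        (simp add: ShM_mult[OF C Ob(3) C l0(1) k0(1)] ShM_E C k0 l0 l)
  qed
  moreover have "k0 * v = J X Y f"
  proof (rule ShM_inj[OF Ob(2) C hm_mult[OF k0(1) hm(2)] cone_hm(1)[OF X]])
    have "\<kappa> * ?j1 = s ?C * ?j * t Y"
      unfolding \<kappa>_def using Ob C by (simp add: algebra_simps cs cs1 st' tf)
    then have "cls \<kappa> * J (sh X) (sh Y) f1 = ShM Y ?C (J X Y f)"
      using cls_mult[OF \<kappa> cone_cyc(1)[OF X1]] ShM_cls[OF Ob(2) C cone_cyc(1)[OF X]] by simp
    then show "ShM Y ?C (k0 * v) = ShM Y ?C (J X Y f)"
      by (simp add: ShM_mult[OF Ob(2,3) C hm(2) k0(1)] k0 k mult.assoc)
  qed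
  moreover have "P X Y f * k0 = w"
  proof (rule ShM_inj[OF Ob(3) X1(1) hm_mult[OF cone_hm(2)[OF X] k0(1)] hm(3)])
    have "s (sh X) * (s X * ?p) * t ?C * \<kappa> = s (sh X) * ?p1"
      unfolding \<kappa>_def using Ob C by (simp add: algebra_simps cs cs1 st' tf)
    then have "ShM ?C (sh X) (P X Y f) * cls \<kappa> = P (sh X) (sh Y) f1"
      using cls_mult[OF shift_cyc[OF C X1(1) cone_cyc(2)[OF X]] \<kappa>] ShM_cls[OF C X1(1) cone_cyc(2)[OF X]] by simp
    then show "ShM Z (sh X) (P X Y f * k0) = ShM Z (sh X) w"
      using k by (simp add: ShM_mult[OF Ob(3) C X1(1) k0(1) cone_hm(2)[OF X]] k0 flip: mult.assoc)
  qed
  ultimately show ?thesis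
    using strict_dist[OF X Ob(3) hm(2,3)] f by simp
qed

text \<open>Two more rotations turn the hypothesis into the shift of the wanted triangle, which
  \<open>dist_unshift\<close> undoes.\<close>

lemma dist_unrotate:
  assumes Ob: "X \<in> Ob" "Y \<in> Ob" "Z \<in> Ob" and hm: "u \<in> hm X Y" "v \<in> hm Y Z" "w \<in> hm Z (sh X)"
    and d: "dist Y Z (sh X) v w (ShM X Y u)"
  shows "dist X Y Z u v w"
  using dist_unshift[OF Ob hm dist_rotate[OF dist_rotate[OF d]]] .

lemma dist_TR3:
  assumes d: "dist X Y Z u v w" "dist X' Y' Z' u' v' w'" and ab: "a \<in> hm X X'" "b \<in> hm Y Y'" "b * u = u' * a"
  shows "\<exists>c \<in> hm Z Z'. c * v = v' * b \<and> ShM X X' a * w = w' * c"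
proof -
  from d have Ob: "X \<in> Ob" "Y \<in> Ob" "Z \<in> Ob" "X' \<in> Ob" "Y' \<in> Ob" "Z' \<in> Ob"
    and hm: "v' \<in> hm Y' Z'"
    by (auto simp: dist_def)
  from d(1) obtain f k where f: "f \<in> cyc X Y" "cls f = u" and k: "hiso Z (cn X Y f) k" "k * v = J X Y f" "P X Y f * k = w"
    by (rule dist_rep)
  from d(2) obtain f' k' where f': "f' \<in> cyc X' Y'" "cls f' = u'" and k': "hiso Z' (cn X' Y' f') k'" "k' * v' = J X' Y' f'" "P X' Y' f' * k' = w'"
    by (rule dist_rep)
  obtain c where c: "c \<in> hm (cn X Y f) (cn X' Y' f')" "c * J X Y f = J X' Y' f' * b" "P X' Y' f' * c = ShM X X' a * P X Y f"
    using cone_map[OF Ob(1,2) f(1) Ob(4,5) f'(1) ab(1,2)] ab(3) f f' by blast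
  obtain l where l: "hiso (cn X' Y' f') Z' l" "l * k' = E Z'" "k' * l = E (cn X' Y' f')"
    using hiso_inv k' by blast
  have "l * c * k * v = l * (c * J X Y f)" using k by (simp add: mult.assoc)
  also have "\<dots> = l * k' * v' * b" using c by (simp add: k'(2)[symmetric] mult.assoc)
  finally have 1: "l * c * k * v = v' * b" using l hm by (simp add: hm_left)
  have "w' * (l * c * k) = P X' Y' f' * (k' * l) * c * k" by (simp add: k'(3)[symmetric] mult.assoc)
  also have "\<dots> = P X' Y' f' * c * k" using l cone_hm[OF Ob(4,5) f'(1)] by (simp add: hm_right)
  also have "\<dots> = ShM X X' a * w" using c k by (simp add: mult.assoc)
  finally show ?thesis
    using 1 hm_mult[OF hm_mult[OF hiso_hm[OF l(1)] c(1)] hiso_hm[OF k(1)]] by auto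
qed

text \<open>For representatives \<open>f\<close> and \<open>g\<close> there are strict maps of cones
  \<open>C(f) -> C(g f) -> C(g)\<close>, and the cone of the first is homotopy equivalent to
  \<open>C(g)\<close>. The general case follows by conjugating with the isomorphisms of the normal
  form.\<close>

lemma dist_TR4:
  assumes d: "dist X Y Z' u j k" "dist Y Z X' v l i" "dist X Z Y' (v * u) m n"
  shows "\<exists>f g. dist Z' Y' X' f g (ShM Y Z' j * i) \<and> l = g * m \<and> k = n * f \<and>
    ShM X Y u * n = i * g \<and> m * v = f * j"
proof -
  from d have Ob: "X \<in> Ob" "Y \<in> Ob" "Z \<in> Ob" and Ob': "Z' \<in> Ob" "X' \<in> Ob" "Y' \<in> Ob"
    and hm: "u \<in> hm X Y" "v \<in> hm Y Z" "j \<in> hm Y Z'" "l \<in> hm Z X'" "m \<in> hm Z Y'"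
      "k \<in> hm Z' (sh X)" "i \<in> hm X' (sh Y)" "n \<in> hm Y' (sh X)"
    by (auto simp: dist_def)
  from d(1) obtain f c1 where f: "f \<in> cyc X Y" "cls f = u" and c1: "hiso Z' (cn X Y f) c1" "c1 * j = J X Y f" "P X Y f * c1 = k"
    by (rule dist_rep)
  from d(2) obtain g c3 where g: "g \<in> cyc Y Z" "cls g = v" and c3: "hiso X' (cn Y Z g) c3" "c3 * l = J Y Z g" "P Y Z g * c3 = i"
    by (rule dist_rep)
  have gf: "g * f \<in> cyc X Z" "cls (g * f) = v * u" using cyc_mult[OF g(1) f(1)] cls_mult[OF g(1) f(1)] f g by auto
  obtain c2 where c2: "hiso Y' (cn X Z (g * f)) c2" "c2 * m = J X Z (g * f)" "P X Z (g * f) * c2 = n"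
    using dist_strict[OF d(3) gf] by blast
  note X1 = Ob(1,2) f(1) and X2 = Ob(1,3) gf(1) and X3 = Ob(2,3) g(1)
  let ?C1 = "cn X Y f" and ?C2 = "cn X Z (g * f)" and ?C3 = "cn Y Z g"
  let ?i1 = "ci X Y f" and ?p1 = "cp X Y f" and ?j1 = "cj X Y f" and ?q1 = "cq X Y f"
  let ?i2 = "ci X Z (g * f)" and ?p2 = "cp X Z (g * f)" and ?j2 = "cj X Z (g * f)" and ?q2 = "cq X Z (g * f)"
  let ?i3 = "ci Y Z g" and ?p3 = "cp Y Z g" and ?j3 = "cj Y Z g" and ?q3 = "cq Y Z g"
  note a1 = cone[OF X1] and a2 = cone[OF X2] and a3 = cone[OF X3]
  note b1 = cone_simps[OF X1] and b2 = cone_simps[OF X2] and b3 = cone_simps[OF X3]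
  have C: "?C1 \<in> Ob" "?C2 \<in> Ob" "?C3 \<in> Ob" using a1 a2 a3 by auto
  \<comment> \<open>On summands, \<open>F\<close> is the identity of \<open>X[1]\<close> and
    \<open>g\<close> on \<open>Y\<close>, while \<open>H\<close> is \<open>f\<close> on
    \<open>X[1]\<close> and the identity of \<open>Z\<close>.\<close>
  define F where "F = ?i2 * ?p1 + ?j2 * (g * ?q1)"
  define H where "H = ?i3 * (f * ?p2) + ?j3 * ?q2"
  have F: "F \<in> cyc ?C1 ?C2"
  proof (rule cycI)
    show "F \<in> chain 0 ?C1 ?C2"
      unfolding F_def using chain_mult[of ?i2 "-1" X ?C2 ?p1 1] chain_mult[of ?j2 0 Z ?C2 "g * ?q1" 0]
        chain_mult[of g 0 Y Z ?q1 0] a1 a2 cyc_chain[OF g(1)] by (auto intro!: chain_add)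
    show "D * F = F * D" unfolding F_def by (simp add: algebra_simps b1 b2 b3)
  qed
  have H: "H \<in> cyc ?C2 ?C3"
  proof (rule cycI)
    show "H \<in> chain 0 ?C2 ?C3"
      unfolding H_def using chain_mult[of ?i3 "-1" Y ?C3 "f * ?p2" 1] chain_mult[of f 0 X Y ?p2 1]
        chain_mult[of ?j3 0 Z ?C3 ?q2 0] a2 a3 cyc_chain[OF f(1)] by (auto intro!: chain_add)
    show "D * H = H * D" unfolding H_def by (simp add: algebra_simps b1 b2 b3)
  qed
  note X4 = C(1,2) F
  let ?C4 = "cn ?C1 ?C2 F"
  let ?i4 = "ci ?C1 ?C2 F" and ?p4 = "cp ?C1 ?C2 F" and ?j4 = "cj ?C1 ?C2 F" and ?q4 = "cq ?C1 ?C2 F"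
  note a4 = cone[OF X4] and b4 = cone_simps[OF X4]
  have C4: "?C4 \<in> Ob" using a4 by simp
  have Fr: "F * ?i1 = ?i2" "F * ?j1 = ?j2 * g" "F * (?i1 * x) = ?i2 * x" "F * (?j1 * x) = ?j2 * (g * x)"
    "?p2 * F = ?p1" "?q2 * F = g * ?q1" "?p2 * (F * x) = ?p1 * x" "?q2 * (F * x) = g * (?q1 * x)" for x
    unfolding F_def by (simp_all add: algebra_simps b1 b2 b3)
  \<comment> \<open>The cone of \<open>F\<close> has the summands \<open>X[2]\<close>,
    \<open>Y[1]\<close>, \<open>X[1]\<close> and \<open>Z\<close>. The map \<kappa> includes
    \<open>C(g)\<close> as \<open>Y[1]\<close> and \<open>Z\<close>; \<mu> is a strict left inverse
    whose middle term makes it a cocycle.\<close>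
  define \<kappa> where "\<kappa> = ?i4 * (?j1 * ?p3) + ?j4 * (?j2 * ?q3)"
  define \<mu> where "\<mu> = ?i3 * (?q1 * ?p4) + ?i3 * (f * (?p2 * ?q4)) + ?j3 * (?q2 * ?q4)"
  have \<kappa>: "\<kappa> \<in> cyc ?C3 ?C4"
  proof (rule cycI)
    show "\<kappa> \<in> chain 0 ?C3 ?C4"
      unfolding \<kappa>_def using chain_mult[of ?i4 "-1" ?C1 ?C4 "?j1 * ?p3" 1] chain_mult[of ?j1 0 Y ?C1 ?p3 1]
        chain_mult[of ?j4 0 ?C2 ?C4 "?j2 * ?q3" 0] chain_mult[of ?j2 0 Z ?C2 ?q3 0] a1 a2 a3 a4
      by (auto intro!: chain_add)
    show "D * \<kappa> = \<kappa> * D" unfolding \<kappa>_def by (simp add: algebra_simps b1 b2 b3 b4 Fr)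
  qed
  have \<mu>: "\<mu> \<in> cyc ?C4 ?C3"
  proof (rule cycI)
    show "\<mu> \<in> chain 0 ?C4 ?C3"
      unfolding \<mu>_def using chain_mult[of ?i3 "-1" Y ?C3 "?q1 * ?p4" 1] chain_mult[of ?q1 0 ?C1 Y ?p4 1]
        chain_mult[of ?i3 "-1" Y ?C3 "f * (?p2 * ?q4)" 1] chain_mult[of f 0 X Y "?p2 * ?q4" 1] chain_mult[of ?p2 1 ?C2 X ?q4 0]
        chain_mult[of ?j3 0 Z ?C3 "?q2 * ?q4" 0] chain_mult[of ?q2 0 ?C2 Z ?q4 0] a1 a2 a3 a4 cyc_chain[OF f(1)]
      by (auto intro!: chain_add)
    show "D * \<mu> = \<mu> * D" unfolding \<mu>_def by (simp add: algebra_simps b1 b2 b3 b4 Fr)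
  qed
  have "\<mu> * \<kappa> = ?i3 * ?p3 + ?j3 * ?q3"
    unfolding \<kappa>_def \<mu>_def by (simp add: algebra_simps b1 b2 b3 b4)
  then have 1: "cls \<mu> * cls \<kappa> = E ?C3" using cls_mult[OF \<mu> \<kappa>] a3 by (simp add: E_def)
  \<comment> \<open>It contracts the remaining two summands, sending \<open>X[1]\<close> to
    \<open>X[2]\<close>.\<close>
  let ?h = "?i4 * (?i1 * (?p2 * ?q4))"
  have "?h \<in> chain (-1) ?C4 ?C4"
    using chain_mult[of ?i4 "-1" ?C1 ?C4 "?i1 * (?p2 * ?q4)" 0] chain_mult[of ?i1 "-1" X ?C1 "?p2 * ?q4" 1]
      chain_mult[of ?p2 1 ?C2 X ?q4 0] a1 a2 a4 by auto
  moreover have "\<kappa> * \<mu> + e ?C4 = D * ?h + ?h * D"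
  proof (rule cone_ext[OF X4])
    show "(\<kappa> * \<mu> + e ?C4) * ?i4 = (D * ?h + ?h * D) * ?i4"
      unfolding \<kappa>_def \<mu>_def by (simp add: algebra_simps b1 b2 b3 b4 Fr cone_ip[OF X1])
    show "(\<kappa> * \<mu> + e ?C4) * ?j4 = (D * ?h + ?h * D) * ?j4"
      unfolding \<kappa>_def \<mu>_def by (simp add: algebra_simps b1 b2 b3 b4 Fr cone_ip[OF X2])
  qed (use e_idem[OF C4] e_D[OF C4] in \<open>simp_all add: algebra_simps \<kappa>_def \<mu>_def b4\<close>)
  ultimately have 2: "cls \<kappa> * cls \<mu> = E ?C4"
    using cls_eq[OF C4 C4 cyc_mult[OF \<kappa> \<mu>] cyc_e[OF C4]] cls_mult[OF \<kappa> \<mu>] by (auto simp: E_def)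
  have i\<kappa>: "hiso ?C3 ?C4 (cls \<kappa>)"
    using 1 2 cls_hm[OF C(3) C4 \<kappa>] cls_hm[OF C4 C(3) \<mu>] unfolding hiso_def by blast
  have "?i4 * (?i1 * ?p2) \<in> chain (-1) ?C2 ?C4"
    using chain_mult[of ?i4 "-1" ?C1 ?C4 "?i1 * ?p2" 0] chain_mult[of ?i1 "-1" X ?C1 ?p2 1] a1 a2 a4 by auto
  moreover have "\<kappa> * H + ?j4 = D * (?i4 * (?i1 * ?p2)) + (?i4 * (?i1 * ?p2)) * D"
    by (rule cone_ext[OF X2])
     (use e_idem[OF C(2)] e_D[OF C(2)] in \<open>simp_all add: algebra_simps \<kappa>_def H_def b1 b2 b3 b4 Fr\<close>)
  ultimately have \<kappa>H: "cls \<kappa> * cls H = J ?C1 ?C2 F"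
    using cls_eq[OF C(2) C4 cyc_mult[OF \<kappa> H] cone_cyc(1)[OF X4]] cls_mult[OF \<kappa> H] by auto
  have sj: "s ?C1 * ?j1 * t Y * (s Y * ?p3) = s ?C1 * ?p4 * \<kappa>"
    unfolding \<kappa>_def by (simp add: algebra_simps b1 b2 b3 b4 rw2[OF ts[OF Ob(2)]])
  have P\<kappa>: "P ?C1 ?C2 F * cls \<kappa> = ShM Y ?C1 (J X Y f) * P Y Z g"
    using cls_mult[OF cone_cyc(2)[OF X4] \<kappa>] ShM_cls[OF Ob(2) C(1) cone_cyc(1)[OF X1]] sj
      cls_mult[OF shift_cyc[OF Ob(2) C(1) cone_cyc(1)[OF X1]] cone_cyc(2)[OF X3]] by simp
  have "H * ?j2 = ?j3" "s X * ?p2 * F = s X * ?p1" "s Y * f * t X * (s X * ?p2) = s Y * ?p3 * H" "F * ?j1 = ?j2 * g"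
    unfolding H_def by (simp_all add: algebra_simps b1 b2 b3 Fr rw2[OF ts[OF Ob(1)]])
  then have r: "cls H * J X Z (g * f) = J Y Z g" "P X Z (g * f) * cls F = P X Y f"
    "ShM X Y u * P X Z (g * f) = P Y Z g * cls H" "cls F * J X Y f = J X Z (g * f) * v"
    using cls_mult[OF H cone_cyc(1)[OF X2]] cls_mult[OF cone_cyc(2)[OF X2] F]
      cls_mult[OF cone_cyc(2)[OF X3] H] cls_mult[OF shift_cyc[OF X1] cone_cyc(2)[OF X2]] ShM_cls[OF X1]
      cls_mult[OF F cone_cyc(1)[OF X1]] cls_mult[OF cone_cyc(1)[OF X2] g(1)] f g by simp_all
  have FH: "cls F \<in> hm ?C1 ?C2" "cls H \<in> hm ?C2 ?C3"
    using cls_hm[OF C(1,2) F] cls_hm[OF C(2,3) H] by auto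
  obtain d2 where d2: "hiso ?C2 Y' d2" "d2 * c2 = E Y'" "c2 * d2 = E ?C2" using hiso_inv c2 by blast
  obtain d3 where d3: "hiso ?C3 X' d3" "d3 * c3 = E X'" "c3 * d3 = E ?C3" using hiso_inv c3 by blast
  define \<phi> where "\<phi> = d2 * cls F * c1"
  define \<psi> where "\<psi> = d3 * cls H * c2"
  have \<phi>: "\<phi> \<in> hm Z' Y'" unfolding \<phi>_def
    using hm_mult[OF hm_mult[OF hiso_hm[OF d2(1)] FH(1)] hiso_hm[OF c1(1)]] .
  have \<psi>: "\<psi> \<in> hm Y' X'" unfolding \<psi>_def
    using hm_mult[OF hm_mult[OF hiso_hm[OF d3(1)] FH(2)] hiso_hm[OF c2(1)]] .
  have c\<phi>: "c2 * \<phi> = cls F * c1"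
  proof -
    have "c2 * \<phi> = c2 * d2 * (cls F * c1)" unfolding \<phi>_def by (simp add: mult.assoc)
    then show ?thesis using d2 FH by (simp add: hm_left flip: mult.assoc)
  qed
  have c\<psi>: "c3 * \<psi> = cls H * c2"
  proof -
    have "c3 * \<psi> = c3 * d3 * (cls H * c2)" unfolding \<psi>_def by (simp add: mult.assoc)
    then show ?thesis using d3 FH by (simp add: hm_left flip: mult.assoc)
  qed
  \<comment> \<open>Equations between maps into \<open>Y'\<close> are checked after composing with
    the isomorphism to the cone, which can be cancelled.\<close>
  have c2': "x = y" if "c2 * x = c2 * y" "x \<in> hm W Y'" "y \<in> hm W Y'" for x y W
    using that d2 by (metis hm_left mult.assoc)
  have c3': "x = y" if "c3 * x = c3 * y" "x \<in> hm W X'" "y \<in> hm W X'" for x y W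
    using that d3 by (metis hm_left mult.assoc)
  have "l = \<psi> * m"
  proof (rule c3'[OF _ hm(4) hm_mult[OF \<psi> hm(5)]])
    have "c3 * (\<psi> * m) = cls H * (c2 * m)" by (simp add: c\<psi> flip: mult.assoc)
    then show "c3 * l = c3 * (\<psi> * m)" using c2 c3 r by simp
  qed
  moreover have "k = n * \<phi>"
  proof -
    have "n * \<phi> = P X Z (g * f) * cls F * c1" by (simp add: c2(3)[symmetric] mult.assoc c\<phi>)
    then show ?thesis using r c1 by simp
  qed
  moreover have "ShM X Y u * n = i * \<psi>"
  proof -
    have "i * \<psi> = P Y Z g * cls H * c2" by (simp add: c3(3)[symmetric] mult.assoc c\<psi>)
    then show ?thesis using c2(3) r(3) by (simp flip: mult.assoc) (metis mult.assoc)
  qed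
  moreover have "m * v = \<phi> * j"
  proof (rule c2'[OF _ hm_mult[OF hm(5,2)] hm_mult[OF \<phi> hm(3)]])
    have "c2 * (\<phi> * j) = cls F * (c1 * j)" by (simp add: c\<phi> flip: mult.assoc)
    moreover have "c2 * (m * v) = J X Z (g * f) * v" using c2 by (simp flip: mult.assoc)
    ultimately show "c2 * (m * v) = c2 * (\<phi> * j)" using c1 r by simp
  qed
  moreover have "dist Z' Y' X' \<phi> \<psi> (ShM Y Z' j * i)"
  proof (rule dist_iso[OF cone_dist[OF X4] Ob'(1,3,2) \<phi> \<psi> _ c1(1) c2(1) hiso_mult[OF i\<kappa> c3(1)]])
    show "ShM Y Z' j * i \<in> hm X' (sh Z')"
      using hm_mult[OF ShM_hm[OF Ob(2) Ob'(1) hm(3)] hm(7)] .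
    show "c2 * \<phi> = cls F * c1" by (rule c\<phi>)
    show "cls \<kappa> * c3 * \<psi> = J ?C1 ?C2 F * c2"
      using \<kappa>H c\<psi> by (metis mult.assoc)
    have "ShM Z' ?C1 c1 * (ShM Y Z' j * i) = ShM Y ?C1 (J X Y f) * i"
      using ShM_mult[OF Ob(2) Ob'(1) C(1) hm(3) hiso_hm[OF c1(1)]] c1 by (simp flip: mult.assoc)
    also have "\<dots> = P ?C1 ?C2 F * cls \<kappa> * c3"
      using P\<kappa> c3 by (simp add: mult.assoc)
    finally show "ShM Z' ?C1 c1 * (ShM Y Z' j * i) = P ?C1 ?C2 F * (cls \<kappa> * c3)"
      by (simp add: mult.assoc)
  qed
  ultimately show ?thesis by blast
qed

end


subsection \<open>DG functors are exact\<close>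

text \<open>Compatibility with shifts and cones is a consequence: both are described by equations
  between structure maps, and every DG functor preserves these.\<close>

locale dg_functor = dg_ring G D Ob e sh s t cn ci cp cj cq cls
  for G :: "int \<Rightarrow> 'r::ring set" and D :: 'r and Ob :: "'o set" and e :: "'o \<Rightarrow> 'r"
    and sh :: "'o \<Rightarrow> 'o" and s t :: "'o \<Rightarrow> 'r"
    and cn :: "'o \<Rightarrow> 'o \<Rightarrow> 'r \<Rightarrow> 'o" and ci cp cj cq :: "'o \<Rightarrow> 'o \<Rightarrow> 'r \<Rightarrow> 'r"
    and cls :: "'r \<Rightarrow> 'h::ring" +
  fixes F :: "'o \<Rightarrow> 'o" and Fm :: "'o \<Rightarrow> 'o \<Rightarrow> 'r \<Rightarrow> 'r"
  assumes F_Ob: "X \<in> Ob \<Longrightarrow> F X \<in> Ob"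
    and F_chain: "X \<in> Ob \<Longrightarrow> Y \<in> Ob \<Longrightarrow> r \<in> chain k X Y \<Longrightarrow> Fm X Y r \<in> chain k (F X) (F Y)"
    and F_add: "X \<in> Ob \<Longrightarrow> Y \<in> Ob \<Longrightarrow> r \<in> chain k X Y \<Longrightarrow> r' \<in> chain k X Y \<Longrightarrow>
      Fm X Y (r + r') = Fm X Y r + Fm X Y r'"
    and F_mult: "X \<in> Ob \<Longrightarrow> Y \<in> Ob \<Longrightarrow> Z \<in> Ob \<Longrightarrow> r \<in> chain k X Y \<Longrightarrow> r' \<in> chain l Y Z \<Longrightarrow>
      Fm X Z (r' * r) = Fm Y Z r' * Fm X Y r"
    and F_e: "X \<in> Ob \<Longrightarrow> Fm X X (e X) = e (F X)"
    and F_D: "X \<in> Ob \<Longrightarrow> Y \<in> Ob \<Longrightarrow> r \<in> chain k X Y \<Longrightarrow>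
      Fm X Y (D * r + r * D) = D * Fm X Y r + Fm X Y r * D"
begin

lemma F_zero: assumes "X \<in> Ob" "Y \<in> Ob" shows "Fm X Y 0 = 0"
  using F_add[OF assms cyc_chain[OF cyc_zero[OF assms(1)]] cyc_chain[OF cyc_zero[OF assms(1)]]] by simp

lemma F_cyc: assumes "X \<in> Ob" "Y \<in> Ob" "f \<in> cyc X Y" shows "Fm X Y f \<in> cyc (F X) (F Y)"
  using F_D[OF assms(1,2) cyc_chain[OF assms(3)]] F_zero[OF assms(1,2)] cyc_D[OF assms(3)]
    F_chain[OF assms(1,2) cyc_chain[OF assms(3)]]
  by (auto intro!: cycI simp: add_zero_iff)

definition hF :: "'o \<Rightarrow> 'o \<Rightarrow> 'h \<Rightarrow> 'h" where
  "hF X Y \<eta> = cls (Fm X Y (SOME x. x \<in> cyc X Y \<and> cls x = \<eta>))"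

lemma hF_cls:
  assumes "X \<in> Ob" "Y \<in> Ob" "x \<in> cyc X Y"
  shows "hF X Y (cls x) = cls (Fm X Y x)"
proof -
  define y where "y = (SOME y. y \<in> cyc X Y \<and> cls y = cls x)"
  have y: "y \<in> cyc X Y" "cls y = cls x"
    using someI[of "\<lambda>y. y \<in> cyc X Y \<and> cls y = cls x" x] assms by (auto simp: y_def)
  then obtain h where h: "h \<in> chain (-1) X Y" "y + x = D * h + h * D"
    using cls_eq assms by blast
  have "Fm X Y y + Fm X Y x = D * Fm X Y h + Fm X Y h * D"
    unfolding F_add[OF assms(1,2) cyc_chain[OF y(1)] cyc_chain[OF assms(3)], symmetric] h(2)
    by (rule F_D[OF assms(1,2) h(1)])
  then have "cls (Fm X Y y) = cls (Fm X Y x)"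
    using cls_eq[OF F_Ob F_Ob F_cyc F_cyc] F_chain[OF assms(1,2) h(1)] assms y by blast
  then show ?thesis unfolding hF_def y_def[symmetric] .
qed

lemma hF_hm: "X \<in> Ob \<Longrightarrow> Y \<in> Ob \<Longrightarrow> \<eta> \<in> hm X Y \<Longrightarrow> hF X Y \<eta> \<in> hm (F X) (F Y)"
  by (metis hm_rep hF_cls cls_hm F_cyc F_Ob)

lemma hF_add:
  assumes "X \<in> Ob" "Y \<in> Ob" "f \<in> hm X Y" "g \<in> hm X Y"
  shows "hF X Y (g + f) = hF X Y g + hF X Y f"
proof -
  obtain x y where x: "x \<in> cyc X Y" "cls x = f" "y \<in> cyc X Y" "cls y = g" using hm_rep assms by metis
  then show ?thesis
    using hF_cls[OF assms(1,2) cyc_add[OF x(3,1)]] F_add[OF assms(1,2) cyc_chain[OF x(3)] cyc_chain[OF x(1)]]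
      cls_plus[OF F_cyc[OF assms(1,2) x(3)] F_cyc[OF assms(1,2) x(1)]] assms
    by (auto simp: hF_cls cls_plus)
qed

lemma hF_mult:
  assumes "X \<in> Ob" "Y \<in> Ob" "Z \<in> Ob" "f \<in> hm X Y" "g \<in> hm Y Z"
  shows "hF X Z (g * f) = hF Y Z g * hF X Y f"
proof -
  obtain x y where x: "x \<in> cyc X Y" "cls x = f" "y \<in> cyc Y Z" "cls y = g" using hm_rep assms by metis
  then show ?thesis
    using hF_cls[OF assms(1,3) cyc_mult[OF x(3,1)]] F_mult[OF assms(1-3) cyc_chain[OF x(1)] cyc_chain[OF x(3)]]
      cls_mult[OF F_cyc[OF assms(2,3) x(3)] F_cyc[OF assms(1,2) x(1)]] assms
    by (auto simp: hF_cls cls_mult)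
qed

lemma hF_E: "X \<in> Ob \<Longrightarrow> hF X X (E X) = E (F X)"
  by (simp add: E_def hF_cls cyc_e F_e)

text \<open>The comparison of \<open>F (X[1])\<close> with \<open>F(X)[1]\<close>: the image of the
  degree 1 map \<open>t\<close>, brought back to degree 0 by \<open>s\<close>.\<close>

definition shF :: "'o \<Rightarrow> 'h" where
  "shF X = cls (s (F X) * Fm (sh X) X (t X))"

lemma shF_hiso:
  assumes X: "X \<in> Ob" shows "hiso (F (sh X)) (sh (F X)) (shF X)"
    and "s (F X) * Fm (sh X) X (t X) \<in> cyc (F (sh X)) (sh (F X))"
    and "Fm X (sh X) (s X) * t (F X) \<in> cyc (sh (F X)) (F (sh X))"
proof -
  note Ob = sh_Ob[OF X] F_Ob[OF X] F_Ob[OF sh_Ob[OF X]] sh_Ob[OF F_Ob[OF X]]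
  have m: "Fm (sh X) X (t X) \<in> chain 1 (F (sh X)) (F X)" "Fm X (sh X) (s X) \<in> chain (-1) (F X) (F (sh X))"
    using F_chain t_chain s_chain X Ob by auto
  have D: "D * Fm (sh X) X (t X) = Fm (sh X) X (t X) * D" "D * Fm X (sh X) (s X) = Fm X (sh X) (s X) * D"
    using F_D[OF Ob(1) X t_chain[OF X]] F_D[OF X Ob(1) s_chain[OF X]] X F_zero Ob
    by (simp_all add: t_D s_D add_zero_iff)
  have ts': "Fm (sh X) X (t X) * Fm X (sh X) (s X) = e (F X)" "Fm X (sh X) (s X) * Fm (sh X) X (t X) = e (F (sh X))"
    using F_mult[OF X Ob(1) X s_chain[OF X] t_chain[OF X]] F_mult[OF Ob(1) X Ob(1) t_chain[OF X] s_chain[OF X]]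
    by (simp_all add: ts st F_e X Ob)
  show 1: "s (F X) * Fm (sh X) X (t X) \<in> cyc (F (sh X)) (sh (F X))"
    using chain_mult[OF s_chain[OF Ob(2)] m(1)] D
    by (intro cycI) (simp_all add: mult.assoc rw2[OF s_D[OF Ob(2)]])
  show 2: "Fm X (sh X) (s X) * t (F X) \<in> cyc (sh (F X)) (F (sh X))"
    using chain_mult[OF m(2) t_chain[OF Ob(2)]] D
    by (intro cycI) (simp_all add: mult.assoc rw2[OF D(2)] t_D[OF Ob(2)])
  have "(s (F X) * Fm (sh X) X (t X)) * (Fm X (sh X) (s X) * t (F X)) = e (sh (F X))"
    using chain_left[OF t_chain[OF Ob(2)]] by (simp add: mult.assoc rw2[OF ts'(1)] st Ob)
  moreover have "(Fm X (sh X) (s X) * t (F X)) * (s (F X) * Fm (sh X) X (t X)) = e (F (sh X))"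
    using chain_left[OF m(1)] ts' by (simp add: mult.assoc rw2[OF ts[OF Ob(2)]])
  ultimately show "hiso (F (sh X)) (sh (F X)) (shF X)"
    using cls_hm[OF Ob(3,4) 1] cls_hm[OF Ob(4,3) 2] cls_mult[OF 1 2] cls_mult[OF 2 1]
    unfolding hiso_def shF_def E_def by (metis (no_types, lifting))
qed

lemma shF_natural:
  assumes "X \<in> Ob" "Y \<in> Ob" "f \<in> hm X Y"
  shows "shF Y * hF (sh X) (sh Y) (ShM X Y f) = ShM (F X) (F Y) (hF X Y f) * shF X"
proof -
  obtain x where x: "x \<in> cyc X Y" "cls x = f" using hm_rep assms by metis
  note Ob = sh_Ob[OF assms(1)] sh_Ob[OF assms(2)] F_Ob[OF assms(1)] F_Ob[OF assms(2)]
  note x1 = shift_cyc[OF assms(1,2) x(1)] and x2 = F_cyc[OF assms(1,2) x(1)]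
  have xt: "x * t X \<in> chain 1 (sh X) Y"
    using chain_mult[OF cyc_chain[OF x(1)] t_chain[OF assms(1)]] by simp
  have "Fm (sh Y) Y (t Y) * Fm (sh X) (sh Y) (s Y * x * t X) = Fm (sh X) Y (t Y * (s Y * x * t X))"
    using F_mult[OF Ob(1,2) assms(2) cyc_chain[OF x1] t_chain[OF assms(2)]] by simp
  also have "t Y * (s Y * x * t X) = x * t X"
    using assms by (simp add: mult.assoc rw2[OF ts] rw2[OF cyc_left[OF x(1)]])
  also have "Fm (sh X) Y (x * t X) = Fm X Y x * Fm (sh X) X (t X)"
    using F_mult[OF Ob(1) assms(1,2) t_chain[OF assms(1)] cyc_chain[OF x(1)]] .
  finally have *: "Fm (sh Y) Y (t Y) * Fm (sh X) (sh Y) (s Y * x * t X) = Fm X Y x * Fm (sh X) X (t X)" .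
  have "s (F Y) * Fm (sh Y) Y (t Y) * Fm (sh X) (sh Y) (s Y * x * t X)
      = s (F Y) * Fm X Y x * t (F X) * (s (F X) * Fm (sh X) X (t X))"
    using * cyc_right[OF x2] chain_left[OF F_chain[OF Ob(1) assms(1) t_chain[OF assms(1)]]]
    by (simp add: mult.assoc rw2[OF ts[OF Ob(3)]])
  then show ?thesis
    using cls_mult[OF shF_hiso(2)[OF assms(2)] F_cyc[OF Ob(1,2) x1]]
      cls_mult[OF shift_cyc[OF Ob(3,4) x2] shF_hiso(2)[OF assms(1)]]
      ShM_cls[OF assms(1,2) x(1)] ShM_cls[OF Ob(3,4) x2] hF_cls[OF assms(1,2) x(1)] hF_cls[OF Ob(1,2) x1] x
    by (simp add: shF_def)
qed

lemma hF_hiso: "X \<in> Ob \<Longrightarrow> Y \<in> Ob \<Longrightarrow> hiso X Y a \<Longrightarrow> hiso (F X) (F Y) (hF X Y a)"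
  unfolding hiso_def
proof (elim conjE bexE, intro conjI)
  fix a' assume h: "X \<in> Ob" "Y \<in> Ob" "a \<in> hm X Y" "a' \<in> hm Y X" "a' * a = E X" "a * a' = E Y"
  then show "\<exists>a'\<in>hm (F Y) (F X). a' * hF X Y a = E (F X) \<and> hF X Y a * a' = E (F Y)"
    by (intro bexI[of _ "hF Y X a'"]) (simp_all add: hF_hm hF_E flip: hF_mult)
qed (rule hF_hm)

text \<open>The images of the four structure maps satisfy the equations of a cone over
  \<open>Fm X Y f\<close>. Matching summands therefore gives strictly inverse cocycles between the
  image of the cone and the cone of the image.\<close>

lemma hF_cone:
  assumes X: "X \<in> Ob" "Y \<in> Ob" "f \<in> cyc X Y"
  shows "dist (F X) (F Y) (F (cn X Y f)) (hF X Y (cls f)) (hF Y (cn X Y f) (J X Y f))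
    (shF X * hF (cn X Y f) (sh X) (P X Y f))"
proof -
  let ?C = "cn X Y f"
  let ?i = "ci X Y f" and ?p = "cp X Y f" and ?j = "cj X Y f" and ?q = "cq X Y f"
  note c = cone[OF X] and cs = cone_simps[OF X]
  have C: "?C \<in> Ob" using c by simp
  let ?f = "Fm X Y f"
  note X' = F_Ob[OF X(1)] F_Ob[OF X(2)] F_cyc[OF X]
  let ?C' = "cn (F X) (F Y) ?f"
  let ?i' = "ci (F X) (F Y) ?f" and ?p' = "cp (F X) (F Y) ?f" and ?j' = "cj (F X) (F Y) ?f" and ?q' = "cq (F X) (F Y) ?f"
  note c' = cone[OF X'] and cs' = cone_simps[OF X']
  have C': "?C' \<in> Ob" using c' by simp
  let ?Fi = "Fm X ?C ?i" and ?Fp = "Fm ?C X ?p" and ?Fj = "Fm Y ?C ?j" and ?Fq = "Fm ?C Y ?q"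
  have ch: "?i \<in> chain (-1) X ?C" "?p \<in> chain 1 ?C X" "?j \<in> chain 0 Y ?C" "?q \<in> chain 0 ?C Y" using c by auto
  have Fch: "?Fi \<in> chain (-1) (F X) (F ?C)" "?Fp \<in> chain 1 (F ?C) (F X)" "?Fj \<in> chain 0 (F Y) (F ?C)" "?Fq \<in> chain 0 (F ?C) (F Y)"
    using ch F_chain X C by auto
  note FM = F_mult[OF X(1) C X(1) ch(1) ch(2)] F_mult[OF X(2) C X(2) ch(3) ch(4)] F_mult[OF X(2) C X(1) ch(3) ch(2)]
      F_mult[OF X(1) C X(2) ch(1) ch(4)]
  have Fm1: "?Fp * ?Fi = e (F X)" "?Fq * ?Fj = e (F Y)" "?Fp * ?Fj = 0" "?Fq * ?Fi = 0"
    using FM X F_e F_zero by (simp_all add: cs)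
  have fq: "f * ?p \<in> chain 1 ?C Y" "?j * f \<in> chain 0 X ?C"
    using chain_mult[OF cyc_chain[OF X(3)] ch(2)] chain_mult[OF ch(3) cyc_chain[OF X(3)]] by simp_all
  have "D * ?q + ?q * D = f * ?p" "D * ?i + ?i * D = ?j * f" by (simp_all add: cs add.commute)
  with F_D[OF C X(2) ch(4)] F_D[OF X(1) C ch(1)]
    F_mult[OF C X(1,2) ch(2) cyc_chain[OF X(3)]] F_mult[OF X(1,2) C cyc_chain[OF X(3)] ch(3)]
  have "D * ?Fq + ?Fq * D = ?f * ?Fp" "D * ?Fi + ?Fi * D = ?Fj * ?f" by simp_all
  then have "?Fq * D + (D * ?Fq + ?Fq * D) = ?Fq * D + ?f * ?Fp" "?Fi * D + (D * ?Fi + ?Fi * D) = ?Fi * D + ?Fj * ?f" by simp_all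
  then have FD: "D * ?Fq = ?Fq * D + ?f * ?Fp" "D * ?Fi = ?Fi * D + ?Fj * ?f" by (simp_all add: ac_simps)
  have FD': "D * ?Fp = ?Fp * D" "D * ?Fj = ?Fj * D"
    using F_D[OF C X(1) ch(2)] F_D[OF X(2) C ch(3)] F_zero X C by (simp_all add: cs add_zero_iff)
  note Fr = Fm1 rw2[OF Fm1(1)] rw2[OF Fm1(2)] rw2[OF Fm1(3)] rw2[OF Fm1(4)] FD FD' rw2[OF FD(1)] rw2[OF FD(2)]
    rw2[OF FD'(1)] rw2[OF FD'(2)] chain_left[OF Fch(2)] chain_left[OF Fch(4)] rw2[OF chain_left[OF Fch(2)]] rw2[OF chain_left[OF Fch(4)]]
    chain_right[OF Fch(1)] chain_right[OF Fch(3)] rw2[OF chain_right[OF Fch(1)]] rw2[OF chain_right[OF Fch(3)]]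
    chain_right[OF Fch(2)] chain_right[OF Fch(4)] chain_left[OF Fch(1)] chain_left[OF Fch(3)]
  define \<kappa> where "\<kappa> = ?i' * ?Fp + ?j' * ?Fq"
  define \<mu> where "\<mu> = ?Fi * ?p' + ?Fj * ?q'"
  note FC = F_Ob[OF C]
  have \<kappa>: "\<kappa> \<in> cyc (F ?C) ?C'"
  proof (rule cycI)
    show "\<kappa> \<in> chain 0 (F ?C) ?C'"
      unfolding \<kappa>_def using chain_mult[of ?i' "-1" "F X" ?C' ?Fp 1] chain_mult[of ?j' 0 "F Y" ?C' ?Fq 0] Fch c'
      by (auto intro!: chain_add)
    show "D * \<kappa> = \<kappa> * D" unfolding \<kappa>_def by (simp add: algebra_simps cs' Fr)
  qed
  have \<mu>: "\<mu> \<in> cyc ?C' (F ?C)"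
  proof (rule cycI)
    show "\<mu> \<in> chain 0 ?C' (F ?C)"
      unfolding \<mu>_def using chain_mult[of ?Fi "-1" "F X" "F ?C" ?p' 1] chain_mult[of ?Fj 0 "F Y" "F ?C" ?q' 0] Fch c'
      by (auto intro!: chain_add)
    show "D * \<mu> = \<mu> * D" unfolding \<mu>_def by (simp add: algebra_simps cs' Fr)
  qed
  have "\<kappa> * \<mu> = e ?C'"
    unfolding \<kappa>_def \<mu>_def by (simp add: algebra_simps cs' Fr cone_ip[OF X'])
  then have 1: "cls \<kappa> * cls \<mu> = E ?C'" using cls_mult[OF \<kappa> \<mu>] by (simp add: E_def)
  have "\<mu> * \<kappa> = ?Fi * ?Fp + ?Fj * ?Fq"
    unfolding \<kappa>_def \<mu>_def by (simp add: algebra_simps cs' Fr)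
  also have "\<dots> = Fm ?C ?C (?i * ?p + ?j * ?q)"
    using F_mult[OF C X(1) C ch(2,1)] F_mult[OF C X(2) C ch(4,3)] 
      F_add[OF C C chain_mult[OF ch(1,2)], of "?j * ?q"] chain_mult[OF ch(3,4)] by simp
  finally have 2: "cls \<mu> * cls \<kappa> = E (F ?C)" using cls_mult[OF \<mu> \<kappa>] c F_e[OF C] by (simp add: E_def)
  have i\<kappa>: "hiso (F ?C) ?C' (cls \<kappa>)"
    using 1 2 cls_hm[OF FC C' \<kappa>] cls_hm[OF C' FC \<mu>] unfolding hiso_def by blast
  note cj = cone_cyc[OF X] and cj' = cone_cyc[OF X']
  have "\<kappa> * ?Fj = ?j'" unfolding \<kappa>_def by (simp add: algebra_simps cs' Fr)
  then have "cls \<kappa> * hF Y ?C (J X Y f) = J (F X) (F Y) ?f"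
    using cls_mult[OF \<kappa> F_cyc[OF X(2) C cj(1)]] hF_cls[OF X(2) C cj(1)] by simp
  moreover have "s (F X) * ?p' * \<kappa> = s (F X) * Fm (sh X) X (t X) * Fm ?C (sh X) (s X * ?p)"
  proof -
    have "Fm (sh X) X (t X) * Fm ?C (sh X) (s X * ?p) = Fm ?C X (t X * (s X * ?p))"
      using F_mult[OF C sh_Ob[OF X(1)] X(1) cyc_chain[OF cj(2)] t_chain[OF X(1)]] by simp
    then show ?thesis
      unfolding \<kappa>_def using X by (simp add: algebra_simps cs cs' Fr rw2[OF ts])
  qed
  then have "P (F X) (F Y) ?f * cls \<kappa> = shF X * hF ?C (sh X) (P X Y f)"
    using cls_mult[OF cj'(2) \<kappa>] cls_mult[OF shF_hiso(2)[OF X(1)] F_cyc[OF C sh_Ob[OF X(1)] cj(2)]]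
      hF_cls[OF C sh_Ob[OF X(1)] cj(2)] by (simp add: shF_def)
  ultimately show ?thesis
    using strict_dist[OF X' FC hF_hm[OF X(2) C cone_hm(1)[OF X]]
        hm_mult[OF hiso_hm[OF shF_hiso(1)[OF X(1)]] hF_hm[OF C sh_Ob[OF X(1)] cone_hm(2)[OF X]]] i\<kappa>]
      hF_cls[OF X] by simp
qed

lemma hF_dist:
  assumes d: "dist X Y Z u v w"
  shows "dist (F X) (F Y) (F Z) (hF X Y u) (hF Y Z v) (shF X * hF Z (sh X) w)"
proof -
  from d obtain M N f a b c where Ob: "X \<in> Ob" "Y \<in> Ob" "Z \<in> Ob"
    and hm: "u \<in> hm X Y" "v \<in> hm Y Z" "w \<in> hm Z (sh X)"
    and M: "M \<in> Ob" "N \<in> Ob" "f \<in> cyc M N" and i: "hiso X M a" "hiso Y N b" "hiso Z (cn M N f) c"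
    and e: "b * u = cls f * a" "c * v = J M N f * b" "ShM X M a * w = P M N f * c"
    by (auto simp: dist_def)
  have C: "cn M N f \<in> Ob" using cone[OF M] by simp
  note ih = hiso_hm[OF i(1)] hiso_hm[OF i(2)] hiso_hm[OF i(3)]
  show ?thesis
  proof (rule dist_iso[OF hF_cone[OF M] F_Ob[OF Ob(1)] F_Ob[OF Ob(2)] F_Ob[OF Ob(3)]
        hF_hm[OF Ob(1,2) hm(1)] hF_hm[OF Ob(2,3) hm(2)] _
        hF_hiso[OF Ob(1) M(1) i(1)] hF_hiso[OF Ob(2) M(2) i(2)] hF_hiso[OF Ob(3) C i(3)]])
    show "shF X * hF Z (sh X) w \<in> hm (F Z) (sh (F X))"
      using hm_mult[OF hiso_hm[OF shF_hiso(1)[OF Ob(1)]] hF_hm[OF Ob(3) sh_Ob[OF Ob(1)] hm(3)]] .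
    show "hF Y N b * hF X Y u = hF M N (cls f) * hF X M a"
      using e(1) hF_mult[OF Ob(1,2) M(2) hm(1) ih(2)] hF_mult[OF Ob(1) M(1,2) ih(1) cls_hm[OF M]] by simp
    show "hF Z (cn M N f) c * hF Y Z v = hF N (cn M N f) (J M N f) * hF Y N b"
      using e(2) hF_mult[OF Ob(2,3) C hm(2) ih(3)] hF_mult[OF Ob(2) M(2) C ih(2) cone_hm(1)[OF M]] by simp
    have "ShM (F X) (F M) (hF X M a) * (shF X * hF Z (sh X) w)
      = shF M * hF (sh X) (sh M) (ShM X M a) * hF Z (sh X) w"
      using shF_natural[OF Ob(1) M(1) ih(1)] by (simp flip: mult.assoc)
    also have "\<dots> = shF M * hF Z (sh M) (ShM X M a * w)"
      using hF_mult[OF Ob(3) sh_Ob[OF Ob(1)] sh_Ob[OF M(1)] hm(3) ShM_hm[OF Ob(1) M(1) ih(1)]]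
      by (simp add: mult.assoc)
    also have "\<dots> = shF M * hF (cn M N f) (sh M) (P M N f) * hF Z (cn M N f) c"
      using e(3) hF_mult[OF Ob(3) C sh_Ob[OF M(1)] ih(3) cone_hm(2)[OF M]] by (simp add: mult.assoc)
    finally show "ShM (F X) (F M) (hF X M a) * (shF X * hF Z (sh X) w) =
      shF M * hF (cn M N f) (sh M) (P M N f) * hF Z (cn M N f) c" .
  qed
qed

end

section \<open>\<open>HP(A)\<close> is triangulated\<close>

definition vs :: "amod \<Rightarrow> vend" where
  "vs M = emb M (dg_shift 1 0 M) (\<lambda>x \<in> carrier M. x)"
definition vt :: "amod \<Rightarrow> vend" where
  "vt M = emb (dg_shift 1 0 M) M (\<lambda>x \<in> carrier M. x)"
definition vcn :: "amod \<Rightarrow> amod \<Rightarrow> vend \<Rightarrow> amod" where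
  "vcn M N r = mcone M N (fn M N r)"
definition vci :: "amod \<Rightarrow> amod \<Rightarrow> vend \<Rightarrow> vend" where
  "vci M N r = emb M (vcn M N r) (\<lambda>x \<in> carrier M. Pr x \<zero>\<^bsub>N\<^esub>)"
definition vcp :: "amod \<Rightarrow> amod \<Rightarrow> vend \<Rightarrow> vend" where
  "vcp M N r = emb (vcn M N r) M (\<lambda>p \<in> carrier (vcn M N r). pr1 p)"
definition vcj :: "amod \<Rightarrow> amod \<Rightarrow> vend \<Rightarrow> vend" where
  "vcj M N r = emb N (vcn M N r) (\<lambda>y \<in> carrier N. Pr \<zero>\<^bsub>M\<^esub> y)"
definition vcq :: "amod \<Rightarrow> amod \<Rightarrow> vend \<Rightarrow> vend" where
  "vcq M N r = emb (vcn M N r) N (\<lambda>p \<in> carrier (vcn M N r). pr2 p)"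

interpretation HPr: dg_ring_base vdeg vD DGP ve "dg_shift 1 0" vs vt vcn vci vcp vcj vcq vcls .

lemma emb_chain:
  "M \<in> DGP \<Longrightarrow> N \<in> DGP \<Longrightarrow> f \<in> carrier (dg_hom k M N) \<Longrightarrow> emb M N f \<in> HPr.chain k M N"
  using emb_vdeg emb_corner by (auto simp: HPr.chain_def dg_hom_iff)

lemma chain_fn:
  assumes "M \<in> DGP" "N \<in> DGP" "r \<in> HPr.chain k M N"
  shows "fn M N r \<in> carrier (dg_hom k M N)" "emb M N (fn M N r) = r"
  using corner_emb[OF assms(1,2), of r] emb_vdeg[OF assms(1,2), of "fn M N r" k] assms(3)
  by (auto simp: HPr.chain_def)

lemma dg_hom_addmap: "f \<in> carrier (dg_hom k M N) \<Longrightarrow> f \<in> addmap M N"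
  by (simp add: dg_hom_iff)

lemma cocycles0_dg_hom: "f \<in> cocycles0 M N \<Longrightarrow> f \<in> carrier (dg_hom 0 M N)"
  by (simp add: cocycles0_def)

lemma cocycles0_addmap: "f \<in> cocycles0 M N \<Longrightarrow> f \<in> addmap M N"
  using cocycles0_dg_hom dg_hom_addmap by blast

lemma emb_D_iff:
  assumes "M \<in> DGP" "N \<in> DGP" "f \<in> addmap M N"
  shows "vD * emb M N f = emb M N f * vD \<longleftrightarrow> dg_hom_diff M N f = (\<lambda>x \<in> carrier M. \<zero>\<^bsub>N\<^esub>)"
proof -
  have "vD * emb M N f = emb M N f * vD \<longleftrightarrow> vD * emb M N f + emb M N f * vD = 0"
    by (metis add.right_neutral add.assoc add_cancel_left_right vend_add_self)
  also have "\<dots> \<longleftrightarrow> emb M N (dg_hom_diff M N f) = emb M N (\<lambda>x \<in> carrier M. \<zero>\<^bsub>N\<^esub>)"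
    using emb_diff[OF assms] emb_zero[OF assms(1,2)] by simp
  finally show ?thesis
    using emb_inject[OF assms(1,2) addmap_diff[OF assms] emb_zero(2)[OF assms(1,2)]] by blast
qed

lemma emb_cyc: "M \<in> DGP \<Longrightarrow> N \<in> DGP \<Longrightarrow> f \<in> cocycles0 M N \<Longrightarrow> emb M N f \<in> HPr.cyc M N"
  using emb_D_iff[of M N f] emb_chain[of M N f 0] dg_hom_addmap[of f 0 M N] by (simp add: HPr.cyc_def cocycles0_def dg_hom_addmap)

lemma cyc_fn: "M \<in> DGP \<Longrightarrow> N \<in> DGP \<Longrightarrow> r \<in> HPr.cyc M N \<Longrightarrow> fn M N r \<in> cocycles0 M N"
  using chain_fn[of M N r 0] emb_D_iff[of M N "fn M N r"]
  by (simp add: HPr.cyc_def cocycles0_def dg_hom_addmap)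

lemma DGP_carrier_dg_homI:
  fixes M N :: amod
  assumes "\<And>x. x \<in> carrier M \<Longrightarrow> f x \<in> carrier N"
    and "\<And>x y. x \<in> carrier M \<Longrightarrow> y \<in> carrier M \<Longrightarrow> f (x \<oplus>\<^bsub>M\<^esub> y) = f x \<oplus>\<^bsub>N\<^esub> f y"
    and "\<And>r x. x \<in> carrier M \<Longrightarrow> f (r \<odot>\<^bsub>M\<^esub> x) = r \<odot>\<^bsub>N\<^esub> f x"
    and "\<And>i j x. x \<in> homog M (i, j) \<Longrightarrow> f x \<in> homog N (i + k, j)"
    and "M \<in> DGP"
  shows "(\<lambda>x \<in> carrier M. f x) \<in> carrier (dg_hom k M N)"
proof -
  interpret M: dgmod M using assms dgmod_DGP by blast
  show ?thesis using assms(1-4) M.homog_closed by (auto simp: dg_hom_iff addmap_def)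
qed

lemma mcone_DGP:
  assumes "M \<in> DGP" "N \<in> DGP" "r \<in> HPr.cyc M N"
  shows "vcn M N r \<in> DGP"
  unfolding vcn_def using assms cyc_fn by (intro DGP_cone) auto

lemma homog_cone:
  "p \<in> homog (mcone M N f) (i, j) \<longleftrightarrow> (\<exists>x y. p = Pr x y \<and> x \<in> homog M (i + 1, j) \<and> y \<in> homog N (i, j))"
  by (simp add: cone_sel)

lemma cone_maps:
  assumes "M \<in> DGP" "N \<in> DGP" "f \<in> cocycles0 M N"
  defines "C \<equiv> mcone M N f"
  shows "(\<lambda>x \<in> carrier M. Pr x \<zero>\<^bsub>N\<^esub>) \<in> carrier (dg_hom (-1) M C)"
    "(\<lambda>p \<in> carrier C. pr1 p) \<in> carrier (dg_hom 1 C M)"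
    "(\<lambda>y \<in> carrier N. Pr \<zero>\<^bsub>M\<^esub> y) \<in> carrier (dg_hom 0 N C)"
    "(\<lambda>p \<in> carrier C. pr2 p) \<in> carrier (dg_hom 0 C N)"
proof -
  interpret M: dgmod M using assms dgmod_DGP by blast
  interpret N: dgmod N using assms dgmod_DGP by blast
  have C: "C \<in> DGP" using assms by (simp add: C_def DGP_cone)
  show "(\<lambda>x \<in> carrier M. Pr x \<zero>\<^bsub>N\<^esub>) \<in> carrier (dg_hom (-1) M C)"
    "(\<lambda>y \<in> carrier N. Pr \<zero>\<^bsub>M\<^esub> y) \<in> carrier (dg_hom 0 N C)"
    by (rule DGP_carrier_dg_homI; use assms in \<open>auto simp: C_def cone_sel homog_cone\<close>)+
  show "(\<lambda>p \<in> carrier C. pr1 p) \<in> carrier (dg_hom 1 C M)"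
    "(\<lambda>p \<in> carrier C. pr2 p) \<in> carrier (dg_hom 0 C N)"
    by (rule DGP_carrier_dg_homI[OF _ _ _ _ C]; auto simp: C_def cone_sel homog_cone)+
qed

text \<open>All equations are read off componentwise on pairs. The inclusion of \<open>X\<close>
  fails to be a cocycle exactly by the term \<open>f (pr1 p)\<close> in the differential of
  \<open>mcone\<close>.\<close>

lemma vcone:
  assumes X: "X \<in> DGP" "Y \<in> DGP" "f \<in> HPr.cyc X Y"
  shows "vcn X Y f \<in> DGP \<and>
      vci X Y f \<in> HPr.chain (-1) X (vcn X Y f) \<and> vcp X Y f \<in> HPr.chain 1 (vcn X Y f) X \<and>
      vcj X Y f \<in> HPr.chain 0 Y (vcn X Y f) \<and> vcq X Y f \<in> HPr.chain 0 (vcn X Y f) Y \<and>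
      vcp X Y f * vci X Y f = ve X \<and> vcq X Y f * vcj X Y f = ve Y \<and>
      vcp X Y f * vcj X Y f = 0 \<and> vcq X Y f * vci X Y f = 0 \<and>
      vci X Y f * vcp X Y f + vcj X Y f * vcq X Y f = ve (vcn X Y f) \<and>
      vD * vcj X Y f = vcj X Y f * vD \<and> vD * vcp X Y f = vcp X Y f * vD \<and>
      vD * vci X Y f = vci X Y f * vD + vcj X Y f * f"
proof -
  interpret M: dgmod X using assms dgmod_DGP by blast
  interpret N: dgmod Y using assms dgmod_DGP by blast
  have C: "vcn X Y f \<in> DGP" using mcone_DGP X by blast
  have f: "fn X Y f \<in> cocycles0 X Y" "emb X Y (fn X Y f) = f"
    using cyc_fn[OF X] chain_fn[OF X(1,2), of f 0] X(3) by (auto simp: HPr.cyc_def)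
  note m = cone_maps[OF X(1,2) f(1), folded vcn_def]
  note fa = cocycles0_addmap[OF f(1)]
  note ma = m(1)[THEN dg_hom_addmap] m(2)[THEN dg_hom_addmap] m(3)[THEN dg_hom_addmap] m(4)[THEN dg_hom_addmap]
  have zz: "vnth v X \<in> carrier X" "vnth v Y \<in> carrier Y" "vnth v (vcn X Y f) \<in> carrier (vcn X Y f)" for v
    using vnth_closed[of v X] vnth_closed[of v Y] vnth_closed[of v "vcn X Y f"] X C by simp_all
  have cc: "\<exists>x y. vnth v (vcn X Y f) = Pr x y \<and> x \<in> carrier X \<and> y \<in> carrier Y" for v
    using zz(3)[of v] by (simp add: vcn_def cone_sel)
  note emb = vnth_emb[OF X(1) C ma(1)] vnth_emb[OF C X(1) ma(2)] vnth_emb[OF X(2) C ma(3)] vnth_emb[OF C X(2) ma(4)]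
    vnth_emb[OF X(1,2) fa]
  note sel = cone_sel[where M = X and N = Y and f = "fn X Y f", folded vcn_def]
  have 1: "vcp X Y f * vci X Y f = ve X" "vcq X Y f * vcj X Y f = ve Y"
      "vcp X Y f * vcj X Y f = 0" "vcq X Y f * vci X Y f = 0"
    unfolding vci_def vcp_def vcj_def vcq_def
    using zz X by (auto intro!: vend_eqI vec_eqI simp: emb vapp_ve sel)
  have 2: "vci X Y f * vcp X Y f + vcj X Y f * vcq X Y f = ve (vcn X Y f)"
    unfolding vci_def vcp_def vcj_def vcq_def
  proof (intro vend_eqI vec_eqI, goal_cases)
    case (1 v M)
    show ?case using cc[of v] zz[of v] C X by (auto simp: emb vapp_ve sel)
  qed
  have 3: "vD * vcj X Y f = vcj X Y f * vD" "vD * vcp X Y f = vcp X Y f * vD"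
    unfolding vci_def vcp_def vcj_def vcq_def
    unfolding emb_D_iff[OF X(2) C ma(3)] emb_D_iff[OF C X(1) ma(2)] dg_hom_diff_def
    using addmap_zero[OF X(1,2) fa] addmap_closed[OF fa] C
    by (auto simp: sel intro!: restrict_ext)
  have 4: "vD * vci X Y f = vci X Y f * vD + vcj X Y f * f"
  proof -
    have "dg_hom_diff X (vcn X Y f) (\<lambda>x\<in>carrier X. Pr x \<zero>\<^bsub>Y\<^esub>)
       = compose (carrier X) (\<lambda>y \<in> carrier Y. Pr \<zero>\<^bsub>X\<^esub> y) (fn X Y f)"
      using addmap_closed[OF fa] by (auto simp: dg_hom_diff_def compose_def sel intro!: restrict_ext)
    then have "vD * vci X Y f + vci X Y f * vD = vcj X Y f * f"
      using emb_diff[OF X(1) C ma(1)] emb_mult[OF X(1,2) C fa ma(3)] f by (simp add: vci_def vcj_def)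
    then show ?thesis by (metis add.right_neutral add.assoc add.commute vend_add_self)
  qed
  show ?thesis
    using 1 2 3 4 C m emb_chain[OF X(1) C m(1)] emb_chain[OF C X(1) m(2)] emb_chain[OF X(2) C m(3)] emb_chain[OF C X(2) m(4)]
    by (simp add: vci_def vcp_def vcj_def vcq_def)
qed

lemma shift_shift: "dg_shift k m (dg_shift k' m' M) = dg_shift (k + k') (m + m') M"
  by (simp add: dg_shift_def ac_simps fun_eq_iff)

lemma shift_zero: "dg_shift 0 0 M = M"
  by (simp add: dg_shift_def)

lemma dg_hom_shift: "dg_hom k (dg_shift a b M) (dg_shift a' b N) = dg_hom (k + a' - a) M N"
proof -
  have "(\<forall>i j. \<forall>x \<in> homog M (i + a, j + b). f x \<in> homog N (i + k + a', j + b)) \<longleftrightarrow>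
     (\<forall>i j. \<forall>x \<in> homog M (i, j). f x \<in> homog N (i + (k + a' - a), j))" for f
  proof safe
    fix i j x assume *: "\<forall>i j. \<forall>x \<in> homog M (i + a, j + b). f x \<in> homog N (i + k + a', j + b)" and "x \<in> homog M (i, j)"
    then show "f x \<in> homog N (i + (k + a' - a), j)"
      using *[rule_format, of x "i - a" "j - b"] by (simp add: algebra_simps)
  next
    fix i j x assume *: "\<forall>i j. \<forall>x \<in> homog M (i, j). f x \<in> homog N (i + (k + a' - a), j)" and "x \<in> homog M (i + a, j + b)"
    then show "f x \<in> homog N (i + k + a', j + b)"
      using *[rule_format, of x "i + a" "j + b"] by (simp add: algebra_simps)
  qed
  then show ?thesis by (simp add: dg_hom_def shift_sel)
qed

lemma dg_hom_diff_shift: "dg_hom_diff (dg_shift a b M) (dg_shift a' b' N) = dg_hom_diff M N"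
  by (simp add: dg_hom_diff_def fun_eq_iff shift_sel)

lemma vshift:
  assumes "X \<in> DGP"
  shows "vs X \<in> HPr.chain (-1) X (dg_shift 1 0 X)" "vt X \<in> HPr.chain 1 (dg_shift 1 0 X) X"
    "vt X * vs X = ve X" "vs X * vt X = ve (dg_shift 1 0 X)"
    "vD * vs X = vs X * vD" "vD * vt X = vt X * vD"
proof -
  interpret M: dgmod X using assms dgmod_DGP by blast
  have S: "dg_shift 1 0 X \<in> DGP" using assms by (rule DGP_shift)
  have id: "(\<lambda>x \<in> carrier X. x) \<in> carrier (dg_hom 0 X X)" by (rule dg_hom_id) fact
  have h: "(\<lambda>x \<in> carrier X. x) \<in> carrier (dg_hom (-1) X (dg_shift 1 0 X))"
    "(\<lambda>x \<in> carrier X. x) \<in> carrier (dg_hom 1 (dg_shift 1 0 X) X)"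
    using id dg_hom_shift[of "-1" 0 0 X 1 X] dg_hom_shift[of 1 1 0 X 0 X] by (simp_all add: shift_zero)
  note a = h(1)[THEN dg_hom_addmap] h(2)[THEN dg_hom_addmap]
  show "vs X \<in> HPr.chain (-1) X (dg_shift 1 0 X)" "vt X \<in> HPr.chain 1 (dg_shift 1 0 X) X"
    unfolding vs_def vt_def using emb_chain[OF assms S h(1)] emb_chain[OF S assms h(2)] .
  have i: "(\<lambda>x \<in> carrier X. x) \<in> addmap X X" using id dg_hom_addmap by blast
  show "vt X * vs X = ve X" "vs X * vt X = ve (dg_shift 1 0 X)"
    using emb_mult[OF assms S assms a] emb_mult[OF S assms S a(2,1)]
    by (simp_all add: vs_def vt_def ve_def compose_def shift_sel cong: restrict_cong)
  show "vD * vs X = vs X * vD" "vD * vt X = vt X * vD"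
    unfolding vs_def vt_def emb_D_iff[OF assms S a(1)] emb_D_iff[OF S assms a(2)]
    by (auto simp: dg_hom_diff_def shift_sel intro!: restrict_ext)
qed

interpretation HPr: dg_ring vdeg vD DGP ve "dg_shift 1 0" vs vt vcn vci vcp vcj vcq vcls
proof unfold_locales
  show "X \<in> DGP \<Longrightarrow> \<exists>X'\<in>DGP. dg_shift 1 0 X' = X" for X
    by (intro bexI[of _ "dg_shift (-1) 0 X"]) (simp_all add: shift_shift shift_zero DGP_shift)
  show "x \<in> vdeg 0 \<Longrightarrow> vD * x = x * vD \<Longrightarrow> vcls x = 0 \<longleftrightarrow> (\<exists>h\<in>vdeg (- 1). x = vD * h + h * vD)" for x
    using vcls_zero[of x] by (auto simp: vZ_def vB_def)
  show "\<exists>x\<in>vdeg 0. vD * x = x * vD \<and> vcls x = \<eta>" for \<eta>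
    using vcls_surj[of \<eta>] by (auto simp: vZ_def)
qed (use vcone vshift in \<open>auto simp: vend_add_self vdeg_add vdeg_mult vdeg_D vD_square ve_vdeg ve_idem ve_D
   DGP_shift vZ_def intro: DGP_proj vcls_add vcls_mult\<close>)


section \<open>Translation of the category \<open>HP\<close> into the homology ring\<close>

lemma HP_simps [simp]: "Obj HP = DGP" "Hom HP = hom_H0" "Sh HP = dg_shift 1 0" "ShMor HP = (\<lambda>X Y F. F)"
  "Ident HP = (\<lambda>X. hclass X X (\<lambda>x \<in> carrier X. x))"
  "Comp HP = (\<lambda>X Y Z G F. \<Union>g \<in> G. \<Union>f \<in> F. hclass X Z (compose (carrier X) g f))"
  "Dist HP = {t. is_triangle HP_cat t \<and>
        (\<exists>M \<in> DGP. \<exists>N \<in> DGP. \<exists>f \<in> cocycles0 M N. tri_iso HP_cat t (cone_triangle M N f))}"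
  by (simp_all add: HP_def HP_cat_def tri_cat.defs shift_cat.defs)

lemma HP_cat_simps [simp]: "Obj HP_cat = Obj HP" "Hom HP_cat = Hom HP" "Sh HP_cat = Sh HP" "ShMor HP_cat = ShMor HP"
  "Ident HP_cat = Ident HP" "Comp HP_cat = Comp HP"
  by (simp_all add: HP_cat_def)

declare HP_simps(5-7) [simp del]

abbreviation hc :: "amod \<Rightarrow> amod \<Rightarrow> (elt \<Rightarrow> elt) \<Rightarrow> hring" where
  "hc M N f \<equiv> vcls (emb M N f)"

lemma dg_hom_diff_addmap: "M \<in> DGP \<Longrightarrow> N \<in> DGP \<Longrightarrow> f \<in> carrier (dg_hom k M N) \<Longrightarrow> dg_hom_diff M N f \<in> addmap M N"
  by (simp add: addmap_diff dg_hom_addmap)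

text \<open>The bridge between the two forms of a morphism, a coset of functions and an element of
  the homology ring. Through it sums, composites and isomorphisms in \<open>HP\<close> become
  identities in \<open>hring\<close>.\<close>

lemma hclass_iff:
  assumes "M \<in> DGP" "N \<in> DGP" "f \<in> cocycles0 M N"
  shows "g \<in> hclass M N f \<longleftrightarrow> g \<in> cocycles0 M N \<and> hc M N g = hc M N f"
proof -
  interpret M: dgmod M using assms dgmod_DGP by blast
  interpret N: dgmod N using assms dgmod_DGP by blast
  note fa = cocycles0_addmap[OF assms(3)]
  have g_iff: "g \<in> hclass M N f \<longleftrightarrow> (\<exists>h \<in> carrier (dg_hom (-1) M N). g = (\<lambda>x \<in> carrier M. dg_hom_diff M N h x \<oplus>\<^bsub>N\<^esub> f x))"
    by (auto simp: hclass_def coboundaries0_def r_coset_def dg_hom_def)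
  show ?thesis
  proof
    assume "g \<in> hclass M N f"
    then obtain h where h: "h \<in> carrier (dg_hom (-1) M N)" "g = (\<lambda>x \<in> carrier M. dg_hom_diff M N h x \<oplus>\<^bsub>N\<^esub> f x)"
      using g_iff by blast
    note ha = dg_hom_addmap[OF h(1)] and hd = dg_hom_diff_addmap[OF assms(1,2) h(1)]
    have ga: "g \<in> addmap M N" unfolding h(2) by (rule addmap_plus) (fact assms hd fa)+
    have eg: "emb M N g = (vD * emb M N h + emb M N h * vD) + emb M N f"
      using emb_plus[OF assms(1,2) hd fa] emb_diff[OF assms(1,2) ha] by (simp add: h(2))
    have "emb M N h \<in> HPr.chain (-1) M N" using emb_chain[OF assms(1,2) h(1)] .
    then have hv: "emb M N h \<in> vdeg (-1)" by (simp add: HPr.chain_def)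
    have fZ: "emb M N f \<in> vZ" using emb_cyc[OF assms] by (simp add: HPr.cyc_def HPr.chain_def vZ_def)
    have dh: "vD * emb M N h + emb M N h * vD \<in> vdeg 0"
      using vdeg_mult[OF vdeg_D hv] vdeg_mult[OF hv vdeg_D] by (auto intro: vdeg_add)
    have "vD * (vD * emb M N h + emb M N h * vD) = (vD * emb M N h + emb M N h * vD) * vD"
      by (simp add: algebra_simps vD_square) (simp add: mult.assoc[symmetric] vD_square)
    with dh have "vD * emb M N h + emb M N h * vD \<in> vZ" by (simp add: vZ_def)
    then have gZ: "emb M N g \<in> vZ" unfolding eg using fZ vZ_ring by blast
    then have "emb M N g \<in> HPr.cyc M N"
      using emb_corner[OF assms(1,2) ga] by (simp add: vZ_def HPr.cyc_def HPr.chain_def)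
    then have gc: "g \<in> cocycles0 M N" using cyc_fn[OF assms(1,2)] fn_emb[OF assms(1,2) ga] by metis
    moreover have "hc M N g = hc M N f"
      using HPr.cls_eq[OF assms(1,2) emb_cyc[OF assms(1,2) gc] emb_cyc[OF assms]] emb_chain[OF assms(1,2) h(1)]
      unfolding eg by (auto simp: add.assoc vend_add_self)
    ultimately show "g \<in> cocycles0 M N \<and> hc M N g = hc M N f" ..
  next
    assume g: "g \<in> cocycles0 M N \<and> hc M N g = hc M N f"
    note ga = cocycles0_addmap[OF conjunct1[OF g]]
    obtain h where h: "h \<in> HPr.chain (-1) M N" "emb M N g + emb M N f = vD * h + h * vD"
      using g HPr.cls_eq[OF assms(1,2) emb_cyc[OF assms(1,2)] emb_cyc[OF assms(1,2)]] assms(3) by blast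
    note hf = chain_fn[OF assms(1,2) h(1)]
    note hd = dg_hom_diff_addmap[OF assms(1,2) hf(1)]
    have "emb M N g = (vD * h + h * vD) + emb M N f"
      unfolding h(2)[symmetric] by (simp add: add.assoc vend_add_self)
    also have "\<dots> = emb M N (\<lambda>x \<in> carrier M. dg_hom_diff M N (fn M N h) x \<oplus>\<^bsub>N\<^esub> f x)"
      using emb_plus[OF assms(1,2) hd fa] emb_diff[OF assms(1,2) dg_hom_addmap[OF hf(1)]] hf(2) by simp
    finally have "g = (\<lambda>x \<in> carrier M. dg_hom_diff M N (fn M N h) x \<oplus>\<^bsub>N\<^esub> f x)"
      using emb_inject[OF assms(1,2) ga addmap_plus[OF assms(2,1) hd fa]] by blast
    then show "g \<in> hclass M N f" using g_iff hf(1) by blast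
  qed
qed

lemma hclass_eq_iff:
  assumes "M \<in> DGP" "N \<in> DGP" "f \<in> cocycles0 M N" "g \<in> cocycles0 M N"
  shows "hclass M N f = hclass M N g \<longleftrightarrow> hc M N f = hc M N g"
  using hclass_iff[OF assms(1-3), of f] hclass_iff[OF assms(1,2,4), of f] assms(3)
  by (auto simp: hclass_iff[OF assms(1-3)] hclass_iff[OF assms(1,2,4)])

lemma hom_H0_carrier: "F \<in> carrier (hom_H0 M N) \<longleftrightarrow> (\<exists>f \<in> cocycles0 M N. F = hclass M N f)"
  by (auto simp: hom_H0_def FactGroup_def RCOSETS_def hclass_def r_coset_def)

lemma hclass_mor: "f \<in> cocycles0 M N \<Longrightarrow> hclass M N f \<in> carrier (hom_H0 M N)"
  using hom_H0_carrier by blast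

lemma cocycles0_ex: "M \<in> DGP \<Longrightarrow> N \<in> DGP \<Longrightarrow> \<eta> \<in> HPr.hm M N \<Longrightarrow> \<exists>f \<in> cocycles0 M N. hc M N f = \<eta>"
  by (metis HPr.hm_rep cyc_fn chain_fn(2) HPr.cyc_chain)

definition hcl :: "amod \<Rightarrow> amod \<Rightarrow> (elt \<Rightarrow> elt) set \<Rightarrow> hring" where
  "hcl M N F = hc M N (SOME f. f \<in> F)"

lemma hcl_hclass [simp]:
  assumes "M \<in> DGP" "N \<in> DGP" "f \<in> cocycles0 M N" shows "hcl M N (hclass M N f) = hc M N f"
  using hclass_iff[OF assms, of "SOME g. g \<in> hclass M N f"] hclass_iff[OF assms, of f]
    someI[of "\<lambda>g. g \<in> hclass M N f" f] assms(3) by (simp add: hcl_def)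

lemma hcl_inject:
  assumes "M \<in> DGP" "N \<in> DGP" "F \<in> carrier (hom_H0 M N)" "F' \<in> carrier (hom_H0 M N)"
  shows "F = F' \<longleftrightarrow> hcl M N F = hcl M N F'"
  by (metis assms hom_H0_carrier hcl_hclass hclass_eq_iff)

lemma hcl_hm: "M \<in> DGP \<Longrightarrow> N \<in> DGP \<Longrightarrow> F \<in> carrier (hom_H0 M N) \<Longrightarrow> hcl M N F \<in> HPr.hm M N"
  unfolding hom_H0_carrier using HPr.cls_hm[OF _ _ emb_cyc] by auto

lemma hcl_surj:
  assumes "M \<in> DGP" "N \<in> DGP" "\<eta> \<in> HPr.hm M N"
  obtains F where "F \<in> carrier (hom_H0 M N)" "hcl M N F = \<eta>"
  using cocycles0_ex[OF assms] hclass_mor hcl_hclass[OF assms(1,2)] by metis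

lemma cocycles0_compose:
  assumes "X \<in> DGP" "Y \<in> DGP" "Z \<in> DGP" "f \<in> cocycles0 X Y" "g \<in> cocycles0 Y Z"
  shows "compose (carrier X) g f \<in> cocycles0 X Z" "hc X Z (compose (carrier X) g f) = hc Y Z g * hc X Y f"
proof -
  note a = cocycles0_addmap[OF assms(4)] cocycles0_addmap[OF assms(5)]
  note c = emb_cyc[OF assms(1,2,4)] emb_cyc[OF assms(2,3,5)]
  have e: "emb X Z (compose (carrier X) g f) = emb Y Z g * emb X Y f"
    using emb_mult[OF assms(1-3) a] by simp
  then show "hc X Z (compose (carrier X) g f) = hc Y Z g * hc X Y f"
    using HPr.cls_mult[OF c(2,1)] by simp
  have "emb X Z (compose (carrier X) g f) \<in> HPr.cyc X Z" unfolding e by (rule HPr.cyc_mult[OF c(2,1)])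
  then show "compose (carrier X) g f \<in> cocycles0 X Z"
    using cyc_fn[OF assms(1,3)] fn_emb[OF assms(1,3) addmap_compose[OF assms(1) a]] by metis
qed

lemma cocycles0_plus:
  assumes "X \<in> DGP" "Y \<in> DGP" "f \<in> cocycles0 X Y" "g \<in> cocycles0 X Y"
  shows "(\<lambda>x \<in> carrier X. f x \<oplus>\<^bsub>Y\<^esub> g x) \<in> cocycles0 X Y"
    "hc X Y (\<lambda>x \<in> carrier X. f x \<oplus>\<^bsub>Y\<^esub> g x) = hc X Y f + hc X Y g"
proof -
  note a = cocycles0_addmap[OF assms(3)] cocycles0_addmap[OF assms(4)]
  note c = emb_cyc[OF assms(1,2,3)] emb_cyc[OF assms(1,2,4)]
  note e = emb_plus[OF assms(1,2) a]
  then show "hc X Y (\<lambda>x \<in> carrier X. f x \<oplus>\<^bsub>Y\<^esub> g x) = hc X Y f + hc X Y g"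
    using HPr.cls_plus[OF c] by simp
  have "emb X Y (\<lambda>x \<in> carrier X. f x \<oplus>\<^bsub>Y\<^esub> g x) \<in> HPr.cyc X Y" unfolding e by (rule HPr.cyc_add[OF c])
  then show "(\<lambda>x \<in> carrier X. f x \<oplus>\<^bsub>Y\<^esub> g x) \<in> cocycles0 X Y"
    using cyc_fn[OF assms(1,2)] fn_emb[OF assms(1,2) addmap_plus[OF assms(2,1) a]] by metis
qed

lemma cocycles0_id: assumes "X \<in> DGP"
  shows "(\<lambda>x \<in> carrier X. x) \<in> cocycles0 X X" "hc X X (\<lambda>x \<in> carrier X. x) = HPr.E X"
proof -
  show "hc X X (\<lambda>x \<in> carrier X. x) = HPr.E X" by (simp add: HPr.E_def ve_def)
  show "(\<lambda>x \<in> carrier X. x) \<in> cocycles0 X X"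
    using cyc_fn[OF assms assms HPr.cyc_e[OF assms]] fn_emb[OF assms assms addmap_id[OF assms]] by (simp add: ve_def)
qed

lemma cocycles0_zero: assumes "X \<in> DGP" "Y \<in> DGP"
  shows "(\<lambda>x \<in> carrier X. \<zero>\<^bsub>Y\<^esub>) \<in> cocycles0 X Y" "hc X Y (\<lambda>x \<in> carrier X. \<zero>\<^bsub>Y\<^esub>) = 0"
  using cyc_fn[OF assms HPr.cyc_zero[OF assms(1)]] fn_emb[OF assms emb_zero(2)[OF assms]] emb_zero(1)[OF assms] HPr.cls_0
  by simp_all

text \<open>All representatives yield the same coset, so the union that defines composition
  collapses to a single term.\<close>

lemma Comp_hclass:
  assumes "X \<in> DGP" "Y \<in> DGP" "Z \<in> DGP" "f \<in> cocycles0 X Y" "g \<in> cocycles0 Y Z"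
  shows "Comp HP X Y Z (hclass Y Z g) (hclass X Y f) = hclass X Z (compose (carrier X) g f)"
proof -
  have *: "hclass X Z (compose (carrier X) g' f') = hclass X Z (compose (carrier X) g f)"
    if "g' \<in> hclass Y Z g" "f' \<in> hclass X Y f" for g' f'
    using that cocycles0_compose assms by (subst hclass_eq_iff) (auto simp: hclass_iff)
  have "hclass Y Z g \<noteq> {}" "hclass X Y f \<noteq> {}" using assms hclass_iff by blast+
  then show ?thesis
    unfolding HP_simps(6) by (intro SUP_eq_const *) simp_all
qed

lemma hcl_Comp:
  assumes "X \<in> DGP" "Y \<in> DGP" "Z \<in> DGP" "F \<in> carrier (hom_H0 X Y)" "F' \<in> carrier (hom_H0 Y Z)"
  shows "Comp HP X Y Z F' F \<in> carrier (hom_H0 X Z)" "hcl X Z (Comp HP X Y Z F' F) = hcl Y Z F' * hcl X Y F"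
  using assms cocycles0_compose[OF assms(1-3)]
  by (auto simp: hom_H0_carrier Comp_hclass intro!: bexI)

lemma hom_H0_mult:
  assumes "X \<in> DGP" "Y \<in> DGP" "f \<in> cocycles0 X Y" "g \<in> cocycles0 X Y"
  shows "hclass X Y f \<otimes>\<^bsub>hom_H0 X Y\<^esub> hclass X Y g = hclass X Y (\<lambda>x \<in> carrier X. f x \<oplus>\<^bsub>Y\<^esub> g x)"
proof -
  interpret Y: dgmod Y using assms dgmod_DGP by blast
  have m: "F \<otimes>\<^bsub>hom_H0 X Y\<^esub> G = (\<Union>f \<in> F. \<Union>g \<in> G. {\<lambda>x \<in> carrier X. f x \<oplus>\<^bsub>Y\<^esub> g x})" for F G
    by (simp add: hom_H0_def FactGroup_def set_mult_def dg_hom_def)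
  show ?thesis
  proof (intro equalityI subsetI)
    fix h assume "h \<in> hclass X Y f \<otimes>\<^bsub>hom_H0 X Y\<^esub> hclass X Y g"
    then show "h \<in> hclass X Y (\<lambda>x \<in> carrier X. f x \<oplus>\<^bsub>Y\<^esub> g x)"
      using assms cocycles0_plus[OF assms(1,2)] by (auto simp: m hclass_iff)
  next
    fix h assume "h \<in> hclass X Y (\<lambda>x \<in> carrier X. f x \<oplus>\<^bsub>Y\<^esub> g x)"
    then have h: "h \<in> cocycles0 X Y" "hc X Y h = hc X Y f + hc X Y g"
      using assms cocycles0_plus[OF assms] by (auto simp: hclass_iff)
    \<comment> \<open>In characteristic 2 adding \<open>g\<close> also subtracts it:
      \<open>h + g\<close> represents the class of \<open>f\<close>, and
      \<open>h = (h + g) + g\<close> is the required decomposition.\<close>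
    have "(\<lambda>x \<in> carrier X. h x \<oplus>\<^bsub>Y\<^esub> g x) \<in> hclass X Y f"
      using assms h cocycles0_plus[OF assms(1,2) h(1) assms(4)] by (simp add: hclass_iff add.assoc)
    moreover have "h = (\<lambda>x \<in> carrier X. (\<lambda>x \<in> carrier X. h x \<oplus>\<^bsub>Y\<^esub> g x) x \<oplus>\<^bsub>Y\<^esub> g x)"
      using addmap_closed[OF cocycles0_addmap[OF h(1)]] addmap_closed[OF cocycles0_addmap[OF assms(4)]]
        cocycles0_addmap[OF h(1)]
      by (auto simp: Y.a_assoc addmap_def PiE_def extensional_def restrict_def)
    moreover have "g \<in> hclass X Y g" using assms by (simp add: hclass_iff)
    ultimately show "h \<in> hclass X Y f \<otimes>\<^bsub>hom_H0 X Y\<^esub> hclass X Y g" unfolding m by blast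
  qed
qed

lemma hcl_mult:
  assumes "X \<in> DGP" "Y \<in> DGP" "F \<in> carrier (hom_H0 X Y)" "F' \<in> carrier (hom_H0 X Y)"
  shows "F \<otimes>\<^bsub>hom_H0 X Y\<^esub> F' \<in> carrier (hom_H0 X Y)" "hcl X Y (F \<otimes>\<^bsub>hom_H0 X Y\<^esub> F') = hcl X Y F + hcl X Y F'"
  using assms cocycles0_plus[OF assms(1,2)]
  by (auto simp: hom_H0_carrier hom_H0_mult intro!: bexI)

lemma hom_H0_one:
  assumes "X \<in> DGP" "Y \<in> DGP" shows "\<one>\<^bsub>hom_H0 X Y\<^esub> = hclass X Y (\<lambda>x \<in> carrier X. \<zero>\<^bsub>Y\<^esub>)"
proof -
  interpret Y: dgmod Y using assms dgmod_DGP by blast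
  have "h = (\<lambda>x \<in> carrier X. h x \<oplus>\<^bsub>Y\<^esub> \<zero>\<^bsub>Y\<^esub>)" if "h \<in> coboundaries0 X Y" for h
  proof -
    have "h \<in> addmap X Y" using that dg_hom_diff_addmap[OF assms] by (auto simp: coboundaries0_def)
    then show ?thesis by (auto simp: addmap_def PiE_def extensional_def restrict_def Pi_def)
  qed
  then show ?thesis
    by (auto simp: hom_H0_def FactGroup_def hclass_def r_coset_def dg_hom_def cong: restrict_cong)
qed

lemma hcl_one:
  assumes "X \<in> DGP" "Y \<in> DGP"
  shows "\<one>\<^bsub>hom_H0 X Y\<^esub> \<in> carrier (hom_H0 X Y)" "hcl X Y \<one>\<^bsub>hom_H0 X Y\<^esub> = 0"
  using cocycles0_zero[OF assms] hclass_mor by (auto simp: hom_H0_one assms)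

lemma hcl_Ident:
  assumes "X \<in> DGP" shows "Ident HP X \<in> carrier (hom_H0 X X)" "hcl X X (Ident HP X) = HPr.E X"
  using cocycles0_id[OF assms] hclass_mor assms by (auto simp: HP_simps(5))

lemma hom_H0_comm_group:
  assumes "X \<in> DGP" "Y \<in> DGP" shows "comm_group (hom_H0 X Y)"
proof (rule comm_groupI)
  fix F assume "F \<in> carrier (hom_H0 X Y)"
  then show "\<exists>F' \<in> carrier (hom_H0 X Y). F' \<otimes>\<^bsub>hom_H0 X Y\<^esub> F = \<one>\<^bsub>hom_H0 X Y\<^esub>"
    using hcl_mult[OF assms] hcl_one[OF assms] by (intro bexI[of _ F]) (simp_all add: hcl_inject[OF assms])
qed (use hcl_mult[OF assms] hcl_one[OF assms] in \<open>simp_all add: hcl_inject[OF assms] add_ac\<close>)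

text \<open>Characteristic 2 again; this removes the sign from the rotation axiom.\<close>

lemma hom_H0_inv:
  assumes "X \<in> DGP" "Y \<in> DGP" "F \<in> carrier (hom_H0 X Y)" shows "inv\<^bsub>hom_H0 X Y\<^esub> F = F"
proof -
  interpret comm_group "hom_H0 X Y" using hom_H0_comm_group assms by blast
  show ?thesis
    by (rule inv_equality) (use hcl_mult[OF assms(1,2)] hcl_one[OF assms(1,2)] assms in \<open>simp_all add: hcl_inject[OF assms(1,2)]\<close>)
qed

text \<open>The shift leaves the coset unchanged as a set of functions, yet its ring class moves to
  another corner. Conjugation by \<open>vs\<close> and \<open>vt\<close> performs that move, since
  both have the identity as underlying function.\<close>

lemma hcl_shift:
  assumes "X \<in> DGP" "Y \<in> DGP" "F \<in> carrier (hom_H0 X Y)"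
  shows "F \<in> carrier (hom_H0 (dg_shift 1 0 X) (dg_shift 1 0 Y))"
    "hcl (dg_shift 1 0 X) (dg_shift 1 0 Y) F = HPr.ShM X Y (hcl X Y F)"
proof -
  note S = DGP_shift[OF assms(1), of 1 0] DGP_shift[OF assms(2), of 1 0]
  obtain f where f: "f \<in> cocycles0 X Y" "F = hclass X Y f" using assms by (auto simp: hom_H0_carrier)
  have c: "cocycles0 (dg_shift 1 0 X) (dg_shift 1 0 Y) = cocycles0 X Y"
    by (simp add: cocycles0_def dg_hom_shift dg_hom_diff_shift shift_sel)
  have "hclass (dg_shift 1 0 X) (dg_shift 1 0 Y) f = hclass X Y f"
    by (simp add: hclass_def coboundaries0_def dg_hom_shift dg_hom_diff_shift r_coset_def)
  with f c show F: "F \<in> carrier (hom_H0 (dg_shift 1 0 X) (dg_shift 1 0 Y))"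
    by (auto simp: hom_H0_carrier)
  note fa = cocycles0_addmap[OF f(1)]
  have id: "(\<lambda>x \<in> carrier X. x) \<in> addmap (dg_shift 1 0 X) X" "(\<lambda>x \<in> carrier Y. x) \<in> addmap Y (dg_shift 1 0 Y)"
    using addmap_id[OF assms(1)] addmap_id[OF assms(2)] by (simp_all add: addmap_def shift_sel)
  have fs: "f \<in> cocycles0 (dg_shift 1 0 X) (dg_shift 1 0 Y)" using f c by simp
  have "vs Y * emb X Y f * vt X = emb (dg_shift 1 0 X) (dg_shift 1 0 Y)
      (compose (carrier X) (compose (carrier X) (\<lambda>x \<in> carrier Y. x) f) (\<lambda>x \<in> carrier X. x))"
    unfolding vs_def vt_def
    using emb_mult[OF assms(1,2) S(2) fa id(2)]
      emb_mult[OF S(1) assms(1) S(2) id(1) addmap_compose[OF assms(1) fa id(2)]]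
    by (simp add: shift_sel)
  also have "compose (carrier X) (compose (carrier X) (\<lambda>x \<in> carrier Y. x) f) (\<lambda>x \<in> carrier X. x) = f"
    using addmap_closed[OF fa] fa by (auto simp: compose_def addmap_def PiE_def extensional_def restrict_def)
  finally have "vs Y * emb X Y f * vt X = emb (dg_shift 1 0 X) (dg_shift 1 0 Y) f" .
  then have "HPr.ShM X Y (hc X Y f) = hc (dg_shift 1 0 X) (dg_shift 1 0 Y) f"
    using HPr.ShM_cls[OF assms(1,2) emb_cyc[OF assms(1,2) f(1)]] by simp
  moreover have "hcl (dg_shift 1 0 X) (dg_shift 1 0 Y) F = hc (dg_shift 1 0 X) (dg_shift 1 0 Y) f"
    using hcl_hclass[OF S fs] \<open>hclass (dg_shift 1 0 X) (dg_shift 1 0 Y) f = hclass X Y f\<close> f by simp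
  ultimately show "hcl (dg_shift 1 0 X) (dg_shift 1 0 Y) F = HPr.ShM X Y (hcl X Y F)"
    using assms f by simp
qed

lemma iso_mor_HP:
  assumes "X \<in> DGP" "Y \<in> DGP"
  shows "iso_mor HP X Y F \<longleftrightarrow> F \<in> carrier (hom_H0 X Y) \<and> HPr.hiso X Y (hcl X Y F)"
proof (cases "F \<in> carrier (hom_H0 X Y)")
  case True
  have "Comp HP X Y X F' F = Ident HP X \<longleftrightarrow> hcl Y X F' * hcl X Y F = HPr.E X"
    "Comp HP Y X Y F F' = Ident HP Y \<longleftrightarrow> hcl X Y F * hcl Y X F' = HPr.E Y"
    if "F' \<in> carrier (hom_H0 Y X)" for F'
    using hcl_Comp[OF assms(1,2,1) True that] hcl_Comp[OF assms(2,1,2) that True] hcl_Ident assms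
    by (simp_all add: hcl_inject[OF assms(1,1)] hcl_inject[OF assms(2,2)])
  then have "iso_mor HP X Y F \<longleftrightarrow> (\<exists>F' \<in> carrier (hom_H0 Y X). hcl Y X F' * hcl X Y F = HPr.E X \<and> hcl X Y F * hcl Y X F' = HPr.E Y)"
    using True by (auto simp: iso_mor_def)
  also have "\<dots> \<longleftrightarrow> (\<exists>a' \<in> HPr.hm Y X. a' * hcl X Y F = HPr.E X \<and> hcl X Y F * a' = HPr.E Y)"
  proof
    assume "\<exists>a' \<in> HPr.hm Y X. a' * hcl X Y F = HPr.E X \<and> hcl X Y F * a' = HPr.E Y"
    then obtain a' where "a' \<in> HPr.hm Y X" "a' * hcl X Y F = HPr.E X \<and> hcl X Y F * a' = HPr.E Y" by blast
    moreover from this(1) obtain F' where "F' \<in> carrier (hom_H0 Y X)" "hcl Y X F' = a'"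
      by (rule hcl_surj[OF assms(2,1)])
    ultimately show "\<exists>F' \<in> carrier (hom_H0 Y X). hcl Y X F' * hcl X Y F = HPr.E X \<and> hcl X Y F * hcl Y X F' = HPr.E Y"
      by blast
  qed (use hcl_hm[OF assms(2,1)] in blast)
  finally show ?thesis using True hcl_hm[OF assms True] by (simp add: HPr.hiso_def)
qed (simp add: iso_mor_def)

lemma iso_mor_HP_cat [simp]: "iso_mor HP_cat = iso_mor HP"
  by (simp add: iso_mor_def fun_eq_iff)

lemma cone_triangle_hcl:
  assumes "M \<in> DGP" "N \<in> DGP" "f \<in> cocycles0 M N"
  obtains v w where "cone_triangle M N f = (M, N, vcn M N (emb M N f), hclass M N f, v, w)"
    "v \<in> carrier (hom_H0 N (vcn M N (emb M N f)))" "w \<in> carrier (hom_H0 (vcn M N (emb M N f)) (dg_shift 1 0 M))"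
    "hcl N (vcn M N (emb M N f)) v = HPr.J M N (emb M N f)"
    "hcl (vcn M N (emb M N f)) (dg_shift 1 0 M) w = HPr.P M N (emb M N f)"
proof -
  let ?C = "mcone M N f"
  interpret M: dgmod M using assms dgmod_DGP by blast
  have C: "vcn M N (emb M N f) = ?C" using fn_emb[OF assms(1,2) cocycles0_addmap[OF assms(3)]] by (simp add: vcn_def)
  have CD: "?C \<in> DGP" and SD: "dg_shift 1 0 M \<in> DGP" using assms by (auto intro: DGP_cone DGP_shift)
  note X = assms(1,2) emb_cyc[OF assms]
  note cc = HPr.cone_cyc[OF X]
  note m = cone_maps[OF assms]
  have j: "emb N ?C (\<lambda>y \<in> carrier N. Pr \<zero>\<^bsub>M\<^esub> y) = vcj M N (emb M N f)" by (simp add: vcj_def C)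
  have id: "(\<lambda>x \<in> carrier M. x) \<in> addmap M (dg_shift 1 0 M)"
    using addmap_id[OF assms(1)] by (simp add: addmap_def shift_sel)
  have "compose (carrier ?C) (\<lambda>x \<in> carrier M. x) (\<lambda>p \<in> carrier ?C. pr1 p) = (\<lambda>p \<in> carrier ?C. pr1 p)"
    by (auto simp: compose_def cone_sel fun_eq_iff)
  then have p: "emb ?C (dg_shift 1 0 M) (\<lambda>p \<in> carrier ?C. pr1 p) = vs M * vcp M N (emb M N f)"
    using emb_mult[OF CD assms(1) SD dg_hom_addmap[OF m(2)] id] by (simp add: vcp_def vs_def C)
  have pa: "(\<lambda>p \<in> carrier ?C. pr1 p) \<in> addmap ?C (dg_shift 1 0 M)"
    using dg_hom_addmap[OF m(2)] by (simp add: addmap_def shift_sel)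
  have j': "(\<lambda>y \<in> carrier N. Pr \<zero>\<^bsub>M\<^esub> y) \<in> cocycles0 N ?C"
    using cyc_fn[OF assms(2) CD, of "vcj M N (emb M N f)"] cc(1) fn_emb[OF assms(2) CD dg_hom_addmap[OF m(3)]] j C by simp
  have p': "(\<lambda>p \<in> carrier ?C. pr1 p) \<in> cocycles0 ?C (dg_shift 1 0 M)"
    using cyc_fn[OF CD SD, of "vs M * vcp M N (emb M N f)"] cc(2) fn_emb[OF CD SD pa] p C by simp
  show ?thesis
    using that[of "hclass N ?C (\<lambda>y \<in> carrier N. Pr \<zero>\<^bsub>M\<^esub> y)" "hclass ?C (dg_shift 1 0 M) (\<lambda>p \<in> carrier ?C. pr1 p)"]
     hclass_mor[OF j'] hclass_mor[OF p'] hcl_hclass[OF assms(2) CD j'] hcl_hclass[OF CD SD p']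
    by (simp add: C cone_triangle_def j p)
qed

section \<open>Distinguished triangles of \<open>HP\<close>\<close>

definition htriangle :: "amod \<Rightarrow> amod \<Rightarrow> amod \<Rightarrow> (elt \<Rightarrow> elt) set \<Rightarrow> (elt \<Rightarrow> elt) set \<Rightarrow> (elt \<Rightarrow> elt) set \<Rightarrow> bool" where
  "htriangle X Y Z u v w \<longleftrightarrow> X \<in> DGP \<and> Y \<in> DGP \<and> Z \<in> DGP \<and>
     u \<in> carrier (hom_H0 X Y) \<and> v \<in> carrier (hom_H0 Y Z) \<and> w \<in> carrier (hom_H0 Z (dg_shift 1 0 X))"

lemma is_triangle_HP: "is_triangle HP (X, Y, Z, u, v, w) \<longleftrightarrow> htriangle X Y Z u v w"
  "is_triangle HP_cat (X, Y, Z, u, v, w) \<longleftrightarrow> htriangle X Y Z u v w"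
  by (simp_all add: htriangle_def)

lemma tri_morphism_HP_cat: "tri_morphism HP_cat = tri_morphism HP"
  by (intro ext) (auto simp: split_paired_all)

lemma tri_morphism_HP:
  assumes "htriangle X Y Z u v w" "htriangle X' Y' Z' u' v' w'"
  shows "tri_morphism HP (X, Y, Z, u, v, w) (X', Y', Z', u', v', w') a b c \<longleftrightarrow>
    a \<in> carrier (hom_H0 X X') \<and> b \<in> carrier (hom_H0 Y Y') \<and> c \<in> carrier (hom_H0 Z Z') \<and>
    hcl Y Y' b * hcl X Y u = hcl X' Y' u' * hcl X X' a \<and>
    hcl Z Z' c * hcl Y Z v = hcl Y' Z' v' * hcl Y Y' b \<and>
    HPr.ShM X X' (hcl X X' a) * hcl Z (dg_shift 1 0 X) w = hcl Z' (dg_shift 1 0 X') w' * hcl Z Z' c"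
proof (cases "a \<in> carrier (hom_H0 X X') \<and> b \<in> carrier (hom_H0 Y Y') \<and> c \<in> carrier (hom_H0 Z Z')")
  case True
  then have abc: "a \<in> carrier (hom_H0 X X')" "b \<in> carrier (hom_H0 Y Y')" "c \<in> carrier (hom_H0 Z Z')" by auto
  have D: "X \<in> DGP" "Y \<in> DGP" "Z \<in> DGP" "X' \<in> DGP" "Y' \<in> DGP" "Z' \<in> DGP"
    "dg_shift 1 0 X \<in> DGP" "dg_shift 1 0 X' \<in> DGP"
    and m: "u \<in> carrier (hom_H0 X Y)" "v \<in> carrier (hom_H0 Y Z)" "w \<in> carrier (hom_H0 Z (dg_shift 1 0 X))"
     "u' \<in> carrier (hom_H0 X' Y')" "v' \<in> carrier (hom_H0 Y' Z')" "w' \<in> carrier (hom_H0 Z' (dg_shift 1 0 X'))"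
    using assms by (auto simp: htriangle_def DGP_shift)
  note a' = hcl_shift[OF D(1,4) abc(1)]
  show ?thesis
    using hcl_Comp[OF D(1,2,5) m(1) abc(2)] hcl_Comp[OF D(1,4,5) abc(1) m(4)]
      hcl_Comp[OF D(2,3,6) m(2) abc(3)] hcl_Comp[OF D(2,5,6) abc(2) m(5)]
      hcl_Comp[OF D(3,7,8) m(3) a'(1)] hcl_Comp[OF D(3,6,8) abc(3) m(6)] abc a'(2)
    by (simp add: hcl_inject[OF D(1,5)] hcl_inject[OF D(2,6)] hcl_inject[OF D(3,8)])
qed auto

lemma tri_iso_HP_cat: "tri_iso HP_cat = tri_iso HP"
  by (intro ext) (auto simp: split_paired_all tri_morphism_HP_cat simp del: tri_morphism.simps)

lemma tri_iso_HP:
  assumes t: "htriangle X Y Z u v w" "htriangle X' Y' Z' u' v' w'"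
  shows "tri_iso HP (X, Y, Z, u, v, w) (X', Y', Z', u', v', w') \<longleftrightarrow>
    (\<exists>a b c. HPr.hiso X X' a \<and> HPr.hiso Y Y' b \<and> HPr.hiso Z Z' c \<and>
    b * hcl X Y u = hcl X' Y' u' * a \<and> c * hcl Y Z v = hcl Y' Z' v' * b \<and>
    HPr.ShM X X' a * hcl Z (dg_shift 1 0 X) w = hcl Z' (dg_shift 1 0 X') w' * c)"
    (is "_ = ?R")
proof -
  have D: "X \<in> DGP" "Y \<in> DGP" "Z \<in> DGP" "X' \<in> DGP" "Y' \<in> DGP" "Z' \<in> DGP"
    using assms by (auto simp: htriangle_def DGP_shift)
  show ?thesis
  proof
    assume "tri_iso HP (X, Y, Z, u, v, w) (X', Y', Z', u', v', w')"
    then obtain a b c where *: "tri_morphism HP (X, Y, Z, u, v, w) (X', Y', Z', u', v', w') a b c"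
      "iso_mor HP X X' a" "iso_mor HP Y Y' b" "iso_mor HP Z Z' c"
      unfolding tri_iso.simps by blast
    show ?R
      by (intro exI[of _ "hcl X X' a"] exI[of _ "hcl Y Y' b"] exI[of _ "hcl Z Z' c"])
       (use * in \<open>simp add: tri_morphism_HP[OF t] iso_mor_HP D del: tri_morphism.simps\<close>)
  next
    assume ?R
    then obtain a b c where *: "HPr.hiso X X' a \<and> HPr.hiso Y Y' b \<and> HPr.hiso Z Z' c \<and>
      b * hcl X Y u = hcl X' Y' u' * a \<and> c * hcl Y Z v = hcl Y' Z' v' * b \<and>
      HPr.ShM X X' a * hcl Z (dg_shift 1 0 X) w = hcl Z' (dg_shift 1 0 X') w' * c" by blast
    obtain A where A: "A \<in> carrier (hom_H0 X X')" "hcl X X' A = a" using hcl_surj[OF D(1,4)] * HPr.hiso_hm by metis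
    obtain B where B: "B \<in> carrier (hom_H0 Y Y')" "hcl Y Y' B = b" using hcl_surj[OF D(2,5)] * HPr.hiso_hm by metis
    obtain C where C: "C \<in> carrier (hom_H0 Z Z')" "hcl Z Z' C = c" using hcl_surj[OF D(3,6)] * HPr.hiso_hm by metis
    show "tri_iso HP (X, Y, Z, u, v, w) (X', Y', Z', u', v', w')"
      unfolding tri_iso.simps
      by (rule exI[of _ A], rule exI[of _ B], rule exI[of _ C])
        (use * A B C in \<open>simp add: tri_morphism_HP[OF t] iso_mor_HP D del: tri_morphism.simps\<close>)
  qed
qed

lemma htriangle_hm:
  assumes "htriangle X Y Z u v w"
  shows "X \<in> DGP" "Y \<in> DGP" "Z \<in> DGP" "dg_shift 1 0 X \<in> DGP" "hcl X Y u \<in> HPr.hm X Y" "hcl Y Z v \<in> HPr.hm Y Z"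
    "hcl Z (dg_shift 1 0 X) w \<in> HPr.hm Z (dg_shift 1 0 X)"
  using assms by (auto simp: htriangle_def DGP_shift intro: hcl_hm)

lemma Dist_HP:
  "(X, Y, Z, u, v, w) \<in> Dist HP \<longleftrightarrow>
    htriangle X Y Z u v w \<and> HPr.dist X Y Z (hcl X Y u) (hcl Y Z v) (hcl Z (dg_shift 1 0 X) w)"
proof (cases "htriangle X Y Z u v w")
  case True
  have iff: "tri_iso HP (X, Y, Z, u, v, w) (cone_triangle M N f) \<longleftrightarrow>
     (\<exists>a b c. HPr.hiso X M a \<and> HPr.hiso Y N b \<and> HPr.hiso Z (vcn M N (emb M N f)) c \<and>
        b * hcl X Y u = hc M N f * a \<and> c * hcl Y Z v = HPr.J M N (emb M N f) * b \<and>
        HPr.ShM X M a * hcl Z (dg_shift 1 0 X) w = HPr.P M N (emb M N f) * c)"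
    if M: "M \<in> DGP" "N \<in> DGP" "f \<in> cocycles0 M N" for M N f
  proof -
    obtain v' w' where c: "cone_triangle M N f = (M, N, vcn M N (emb M N f), hclass M N f, v', w')"
      "v' \<in> carrier (hom_H0 N (vcn M N (emb M N f)))" "w' \<in> carrier (hom_H0 (vcn M N (emb M N f)) (dg_shift 1 0 M))"
      "hcl N (vcn M N (emb M N f)) v' = HPr.J M N (emb M N f)"
      "hcl (vcn M N (emb M N f)) (dg_shift 1 0 M) w' = HPr.P M N (emb M N f)"
      by (rule cone_triangle_hcl[OF M])
    have "htriangle M N (vcn M N (emb M N f)) (hclass M N f) v' w'"
      using M c hclass_mor[OF M(3)] HPr.cone[OF M(1,2) emb_cyc[OF M]] by (simp add: htriangle_def)
    from tri_iso_HP[OF True this] show ?thesis unfolding c(1) by (simp add: c M)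
  qed
  have "(X, Y, Z, u, v, w) \<in> Dist HP \<longleftrightarrow>
    (\<exists>M \<in> DGP. \<exists>N \<in> DGP. \<exists>f \<in> cocycles0 M N. tri_iso HP (X, Y, Z, u, v, w) (cone_triangle M N f))"
    unfolding HP_simps(7) mem_Collect_eq is_triangle_HP tri_iso_HP_cat using True by simp
  also have "\<dots> \<longleftrightarrow> HPr.dist X Y Z (hcl X Y u) (hcl Y Z v) (hcl Z (dg_shift 1 0 X) w)"
  proof
    assume "\<exists>M \<in> DGP. \<exists>N \<in> DGP. \<exists>f \<in> cocycles0 M N. tri_iso HP (X, Y, Z, u, v, w) (cone_triangle M N f)"
    then obtain M N f where M: "M \<in> DGP" "N \<in> DGP" "f \<in> cocycles0 M N"
      and t: "tri_iso HP (X, Y, Z, u, v, w) (cone_triangle M N f)" by blast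
    from t[unfolded iff[OF M]] emb_cyc[OF M] M
    show "HPr.dist X Y Z (hcl X Y u) (hcl Y Z v) (hcl Z (dg_shift 1 0 X) w)"
      unfolding HPr.dist_def using htriangle_hm[OF True] by blast
  next
    assume "HPr.dist X Y Z (hcl X Y u) (hcl Y Z v) (hcl Z (dg_shift 1 0 X) w)"
    then obtain M N r a b c where M: "M \<in> DGP" "N \<in> DGP" and r: "r \<in> HPr.cyc M N"
      and t: "HPr.hiso X M a \<and> HPr.hiso Y N b \<and> HPr.hiso Z (vcn M N r) c \<and>
        b * hcl X Y u = vcls r * a \<and> c * hcl Y Z v = HPr.J M N r * b \<and>
        HPr.ShM X M a * hcl Z (dg_shift 1 0 X) w = HPr.P M N r * c"
      unfolding HPr.dist_def by blast
    have f: "fn M N r \<in> cocycles0 M N" using cyc_fn[OF M r] .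
    have e: "emb M N (fn M N r) = r" using chain_fn[OF M HPr.cyc_chain[OF r]] by blast
    have "tri_iso HP (X, Y, Z, u, v, w) (cone_triangle M N (fn M N r))"
      unfolding iff[OF M f] e using t by blast
    with M f show "\<exists>M \<in> DGP. \<exists>N \<in> DGP. \<exists>f \<in> cocycles0 M N. tri_iso HP (X, Y, Z, u, v, w) (cone_triangle M N f)"
      by blast
  qed
  finally show ?thesis using True by simp
next
  case False
  then show ?thesis unfolding HP_simps(7) mem_Collect_eq is_triangle_HP by simp
qed

lemma Dist_HP_D:
  assumes "(X, Y, Z, u, v, w) \<in> Dist HP"
  shows "htriangle X Y Z u v w" "HPr.dist X Y Z (hcl X Y u) (hcl Y Z v) (hcl Z (dg_shift 1 0 X) w)"
  using assms Dist_HP by blast+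

text \<open>The cone of the zero map \<open>X[-1] -> Y\<close> is \<open>X + Y\<close> with
  untwisted differential; composing with \<open>vt\<close> and \<open>vs\<close> puts the first
  inclusion and projection into degree 0.\<close>

lemma biproduct_HP:
  assumes "X \<in> DGP" "Y \<in> DGP"
  shows "\<exists>S \<in> DGP. \<exists>i \<in> HPr.hm X S. \<exists>j \<in> HPr.hm Y S. \<exists>p \<in> HPr.hm S X. \<exists>q \<in> HPr.hm S Y.
        p * i = HPr.E X \<and> q * j = HPr.E Y \<and> p * j = 0 \<and> q * i = 0 \<and> i * p + j * q = HPr.E S"
proof -
  define W where "W = dg_shift (-1) 0 X"
  have W: "W \<in> DGP" "dg_shift 1 0 W = X" using assms by (auto simp: W_def DGP_shift shift_shift shift_zero)
  note X = W(1) assms(2) HPr.cyc_zero[OF W(1)]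
  note c = HPr.cone[OF X] and cs = HPr.cone_simps[OF X]
  let ?S = "vcn W Y 0" and ?i = "vci W Y 0 * vt W" and ?p = "vs W * vcp W Y 0" and ?j = "vcj W Y 0" and ?q = "vcq W Y 0"
  have S: "?S \<in> DGP" using c by blast
  note st = HPr.ts[OF W(1)] HPr.st[OF W(1)] HPr.rw2[OF HPr.ts[OF W(1)]] HPr.s_D[OF W(1)] HPr.t_D[OF W(1)]
    HPr.chain_left[OF HPr.t_chain[OF W(1)]] HPr.chain_right[OF HPr.s_chain[OF W(1)]]
  have ch: "?i \<in> HPr.chain 0 X ?S" "?p \<in> HPr.chain 0 ?S X" "?j \<in> HPr.chain 0 Y ?S" "?q \<in> HPr.chain 0 ?S Y"
    using HPr.chain_mult[of "vci W Y 0" "-1" W ?S "vt W" 1 X] HPr.chain_mult[of "vs W" "-1" W X "vcp W Y 0" 1 ?S]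
      c HPr.t_chain[OF W(1)] HPr.s_chain[OF W(1)] W by simp_all
  have i: "?i \<in> HPr.cyc X ?S" using ch(1)
    by (rule HPr.cycI) (simp add: mult.assoc cs st)
  have p: "?p \<in> HPr.cyc ?S X" using ch(2)
    by (rule HPr.cycI) (simp add: mult.assoc cs HPr.rw2[OF HPr.s_D[OF W(1)]])
  have j: "?j \<in> HPr.cyc Y ?S" using ch(3) by (rule HPr.cycI) (simp add: cs)
  have q: "?q \<in> HPr.cyc ?S Y" using ch(4) by (rule HPr.cycI) (simp add: cs)
  have r: "?p * ?i = ve X" "?q * ?j = ve Y" "?p * ?j = 0" "?q * ?i = 0"
    using W by (simp_all add: mult.assoc cs st)
  have "?i * ?p = vci W Y 0 * vcp W Y 0" by (simp add: mult.assoc cs st)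
  then have r2: "?i * ?p + ?j * ?q = ve ?S" using c by simp
  note hm = HPr.cls_hm[OF assms(1) S i] HPr.cls_hm[OF S assms(1) p] HPr.cls_hm[OF assms(2) S j] HPr.cls_hm[OF S assms(2) q]
  show ?thesis
    using S hm HPr.cls_mult[OF p i] HPr.cls_mult[OF q j] HPr.cls_mult[OF p j] HPr.cls_mult[OF q i]
      HPr.cls_mult[OF i p] HPr.cls_mult[OF j q] HPr.cls_plus[OF HPr.cyc_mult[OF i p] HPr.cyc_mult[OF j q]]
    unfolding r r2 HPr.E_def HPr.cls_0 by metis
qed

lemma additive_HP: "additive_category HP"
proof (rule additive_category.intro)
  show "\<exists>Z \<in> Obj HP. Ident HP Z = \<one>\<^bsub>Hom HP Z Z\<^esub>"
  proof -
    let ?X = "projA IxF"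
    \<comment> \<open>The cone of an identity is contractible, hence a zero object.\<close>
    let ?Z = "vcn ?X ?X (ve ?X)"
    have X: "?X \<in> DGP" by (rule DGP_proj)
    have Z: "?Z \<in> DGP" using HPr.cone[OF X X HPr.cyc_e[OF X]] by blast
    have "Ident HP ?Z = \<one>\<^bsub>hom_H0 ?Z ?Z\<^esub>"
      using HPr.cone_E_zero[OF X] hcl_Ident[OF Z] hcl_one[OF Z Z] by (simp add: hcl_inject[OF Z Z])
    with Z show ?thesis by auto
  qed
next
  fix X Y assume "X \<in> Obj HP" "Y \<in> Obj HP"
  then have X: "X \<in> DGP" and Y: "Y \<in> DGP" by auto
  obtain S i j p q where S: "S \<in> DGP" and hm: "i \<in> HPr.hm X S" "j \<in> HPr.hm Y S" "p \<in> HPr.hm S X" "q \<in> HPr.hm S Y"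
    and r: "p * i = HPr.E X" "q * j = HPr.E Y" "p * j = 0" "q * i = 0" "i * p + j * q = HPr.E S"
    using biproduct_HP[OF X Y] by metis
  obtain I where I: "I \<in> carrier (hom_H0 X S)" "hcl X S I = i" using hcl_surj[OF X S hm(1)] .
  obtain J where J: "J \<in> carrier (hom_H0 Y S)" "hcl Y S J = j" using hcl_surj[OF Y S hm(2)] .
  obtain P where P: "P \<in> carrier (hom_H0 S X)" "hcl S X P = p" using hcl_surj[OF S X hm(3)] .
  obtain Q where Q: "Q \<in> carrier (hom_H0 S Y)" "hcl S Y Q = q" using hcl_surj[OF S Y hm(4)] .
  show "\<exists>S \<in> Obj HP. \<exists>i \<in> mor HP X S. \<exists>j \<in> mor HP Y S. \<exists>p \<in> mor HP S X. \<exists>q \<in> mor HP S Y.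
        Comp HP X S X p i = Ident HP X \<and> Comp HP Y S Y q j = Ident HP Y \<and>
        Comp HP Y S X p j = \<one>\<^bsub>Hom HP Y X\<^esub> \<and> Comp HP X S Y q i = \<one>\<^bsub>Hom HP X Y\<^esub> \<and>
        Comp HP S X S i p \<otimes>\<^bsub>Hom HP S S\<^esub> Comp HP S Y S j q = Ident HP S"
    using I J P Q r X Y S
      hcl_Comp[OF X S X I(1) P(1)] hcl_Comp[OF Y S Y J(1) Q(1)] hcl_Comp[OF Y S X J(1) P(1)] hcl_Comp[OF X S Y I(1) Q(1)]
      hcl_Comp[OF S X S P(1) I(1)] hcl_Comp[OF S Y S Q(1) J(1)]
    by (intro bexI[of _ S] bexI[of _ I] bexI[of _ J] bexI[of _ P] bexI[of _ Q])
      (simp_all add: hcl_inject[of X X] hcl_inject[of Y Y] hcl_inject[of Y X] hcl_inject[of X Y] hcl_inject[of S S] hcl_Ident hcl_one hcl_mult)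
qed (simp_all add: hom_H0_comm_group hcl_Comp hcl_Ident hcl_mult hcl_inject HPr.hm_left[OF hcl_hm] HPr.hm_right[OF hcl_hm] algebra_simps)

text \<open>Each axiom is carried to the ring by \<open>hcl\<close>: equations between cosets by
  \<open>hcl_inject\<close>, and the morphisms found in the ring are lifted to cosets by
  \<open>hcl_surj\<close>.\<close>

theorem triangulated_HP: "triangulated_category HP"
proof -
  interpret additive_category HP by (rule additive_HP)
  show ?thesis
  proof
    show "bij_betw (Sh HP) (Obj HP) (Obj HP)"
      by (rule bij_betw_byWitness[where f' = "dg_shift (-1) 0"]) (auto simp: shift_shift shift_zero DGP_shift)
  next
    fix X Y assume "X \<in> Obj HP" "Y \<in> Obj HP"
    then have X: "X \<in> DGP" and Y: "Y \<in> DGP" by auto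
    have "hom_H0 (dg_shift 1 0 X) (dg_shift 1 0 Y) = hom_H0 X Y"
      by (simp add: hom_H0_def cocycles0_def coboundaries0_def dg_hom_shift dg_hom_diff_shift shift_sel)
    then show "ShMor HP X Y \<in> iso (Hom HP X Y) (Hom HP (Sh HP X) (Sh HP Y))"
      by (simp add: iso_def hom_def bij_betw_def)
  next
    fix X assume "X \<in> Obj HP"
    then have X: "X \<in> DGP" and S: "dg_shift 1 0 X \<in> DGP" by (auto intro: DGP_shift)
    show "ShMor HP X X (Ident HP X) = Ident HP (Sh HP X)"
      using hcl_shift[OF X X hcl_Ident(1)[OF X]] hcl_Ident[OF S] hcl_Ident[OF X] HPr.ShM_E[OF X]
      by (simp add: hcl_inject[OF S S])
  next
    fix X Y Z f g assume "X \<in> Obj HP" "Y \<in> Obj HP" "Z \<in> Obj HP" "f \<in> mor HP X Y" "g \<in> mor HP Y Z"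
    then have D: "X \<in> DGP" "Y \<in> DGP" "Z \<in> DGP" and fg: "f \<in> carrier (hom_H0 X Y)" "g \<in> carrier (hom_H0 Y Z)" by auto
    have S: "dg_shift 1 0 X \<in> DGP" "dg_shift 1 0 Y \<in> DGP" "dg_shift 1 0 Z \<in> DGP" using D by (auto intro: DGP_shift)
    note sf = hcl_shift[OF D(1,2) fg(1)] and sg = hcl_shift[OF D(2,3) fg(2)]
    note c = hcl_Comp[OF D fg]
    have "Comp HP X Y Z g f = Comp HP (dg_shift 1 0 X) (dg_shift 1 0 Y) (dg_shift 1 0 Z) g f"
      using hcl_Comp[OF S sf(1) sg(1)] hcl_shift[OF D(1,3) c(1)] c(2) sf(2) sg(2)
        HPr.ShM_mult[OF D hcl_hm[OF D(1,2) fg(1)] hcl_hm[OF D(2,3) fg(2)]]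
      by (simp add: hcl_inject[OF S(1,3)])
    then show "ShMor HP X Z (Comp HP X Y Z g f) = Comp HP (Sh HP X) (Sh HP Y) (Sh HP Z) (ShMor HP Y Z g) (ShMor HP X Y f)"
      by simp
  next
    fix t assume "t \<in> Dist HP"
    then show "is_triangle HP t" by (cases t) (auto simp: is_triangle_HP Dist_HP simp del: is_triangle.simps HP_simps)
  next
    fix t t' assume t: "t \<in> Dist HP" "is_triangle HP t'" "tri_iso HP t' t"
    obtain X Y Z u v w where e: "t = (X, Y, Z, u, v, w)" by (metis prod.collapse)
    obtain X' Y' Z' u' v' w' where e': "t' = (X', Y', Z', u', v', w')" by (metis prod.collapse)
    note d = Dist_HP_D[OF t(1)[unfolded e]]
    have h: "htriangle X' Y' Z' u' v' w'" using t(2) unfolding e' is_triangle_HP .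
    note hh = htriangle_hm[OF h]
    show "t' \<in> Dist HP"
      using t(3) HPr.dist_iso[OF d(2) hh(1-3,5-7)] h unfolding e e' tri_iso_HP[OF h d(1)] Dist_HP by blast
  next
    fix X Z assume "X \<in> Obj HP" "Z \<in> Obj HP" and i: "Ident HP Z = \<one>\<^bsub>Hom HP Z Z\<^esub>"
    then have D: "X \<in> DGP" "Z \<in> DGP" "dg_shift 1 0 X \<in> DGP" by (auto intro: DGP_shift)
    have "HPr.E Z = 0" using i hcl_Ident[OF D(2)] hcl_one[OF D(2,2)] by simp
    then show "(X, X, Z, Ident HP X, \<one>\<^bsub>Hom HP X Z\<^esub>, \<one>\<^bsub>Hom HP Z (Sh HP X)\<^esub>) \<in> Dist HP"
      using HPr.dist_ident[OF D(1,2)] hcl_Ident[OF D(1)] hcl_one[OF D(1,2)] hcl_one[OF D(2,3)] D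
      by (simp add: Dist_HP htriangle_def del: HP_simps(7))
  next
    fix X Y u assume "X \<in> Obj HP" "Y \<in> Obj HP" "u \<in> mor HP X Y"
    then have D: "X \<in> DGP" "Y \<in> DGP" and u: "u \<in> carrier (hom_H0 X Y)" by auto
    then obtain f where f: "f \<in> cocycles0 X Y" "u = hclass X Y f" by (auto simp: hom_H0_carrier)
    obtain v w where c: "cone_triangle X Y f = (X, Y, vcn X Y (emb X Y f), hclass X Y f, v, w)"
      "v \<in> carrier (hom_H0 Y (vcn X Y (emb X Y f)))" "w \<in> carrier (hom_H0 (vcn X Y (emb X Y f)) (dg_shift 1 0 X))"
      "hcl Y (vcn X Y (emb X Y f)) v = HPr.J X Y (emb X Y f)"
      "hcl (vcn X Y (emb X Y f)) (dg_shift 1 0 X) w = HPr.P X Y (emb X Y f)"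
      by (rule cone_triangle_hcl[OF D f(1)])
    have "(X, Y, vcn X Y (emb X Y f), u, v, w) \<in> Dist HP"
      using HPr.cone_dist[OF D emb_cyc[OF D f(1)]] c D u f HPr.cone[OF D emb_cyc[OF D f(1)]]
      by (simp add: Dist_HP htriangle_def)
    then show "\<exists>Z v w. (X, Y, Z, u, v, w) \<in> Dist HP" by blast
  next
    fix X Y Z u v w assume "is_triangle HP (X, Y, Z, u, v, w)"
    then have h: "htriangle X Y Z u v w" by (simp only: is_triangle_HP)
    note hh = htriangle_hm[OF h]
    have u: "u \<in> carrier (hom_H0 X Y)" using h by (simp add: htriangle_def)
    note su = hcl_shift[OF hh(1,2) u]
    have S: "dg_shift 1 0 Y \<in> DGP" using hh by (auto intro: DGP_shift)
    have h': "htriangle Y Z (dg_shift 1 0 X) v w u" using h su(1) hh by (simp add: htriangle_def)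
    show "(X, Y, Z, u, v, w) \<in> Dist HP \<longleftrightarrow>
      (Y, Z, Sh HP X, v, w, inv\<^bsub>Hom HP (Sh HP X) (Sh HP Y)\<^esub> (ShMor HP X Y u)) \<in> Dist HP"
      using HPr.dist_rotate[of X Y Z "hcl X Y u" "hcl Y Z v" "hcl Z (dg_shift 1 0 X) w"] HPr.dist_unrotate[OF hh(1-3,5-7)] h h'
        hom_H0_inv[OF hh(4) S su(1)]
      by (simp add: Dist_HP su(2) del: HP_simps(7)) blast
  next
    fix X Y Z u v w X' Y' Z' u' v' w' a b
    assume d: "(X, Y, Z, u, v, w) \<in> Dist HP" "(X', Y', Z', u', v', w') \<in> Dist HP"
      and ab: "a \<in> mor HP X X'" "b \<in> mor HP Y Y'" "Comp HP X Y Y' b u = Comp HP X X' Y' u' a"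
    note d1 = Dist_HP_D[OF d(1)] and d2 = Dist_HP_D[OF d(2)]
    note h1 = htriangle_hm[OF d1(1)] and h2 = htriangle_hm[OF d2(1)]
    have u: "u \<in> carrier (hom_H0 X Y)" "u' \<in> carrier (hom_H0 X' Y')" using d1 d2 by (auto simp: htriangle_def)
    have ab': "a \<in> carrier (hom_H0 X X')" "b \<in> carrier (hom_H0 Y Y')" using ab by auto
    have "hcl Y Y' b * hcl X Y u = hcl X' Y' u' * hcl X X' a"
      using ab(3) hcl_Comp[OF h1(1,2) h2(2) u(1) ab'(2)] hcl_Comp[OF h1(1) h2(1,2) ab'(1) u(2)] by simp
    then obtain c where c: "c \<in> HPr.hm Z Z'" "c * hcl Y Z v = hcl Y' Z' v' * hcl Y Y' b"
       "HPr.ShM X X' (hcl X X' a) * hcl Z (dg_shift 1 0 X) w = hcl Z' (dg_shift 1 0 X') w' * c"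
      using HPr.dist_TR3[OF d1(2) d2(2) hcl_hm[OF h1(1) h2(1) ab'(1)] hcl_hm[OF h1(2) h2(2) ab'(2)]] by blast
    obtain C where C: "C \<in> carrier (hom_H0 Z Z')" "hcl Z Z' C = c" using hcl_surj[OF h1(3) h2(3) c(1)] .
    show "\<exists>c. tri_morphism HP (X, Y, Z, u, v, w) (X', Y', Z', u', v', w') a b c"
      by (rule exI[of _ C], unfold tri_morphism_HP[OF d1(1) d2(1)])
       (use ab' C c \<open>hcl Y Y' b * hcl X Y u = hcl X' Y' u' * hcl X X' a\<close> in auto)
  next
    fix X Y Z' u j k Z X' v l i Y' m n
    assume d: "(X, Y, Z', u, j, k) \<in> Dist HP" "(Y, Z, X', v, l, i) \<in> Dist HP"
      "(X, Z, Y', Comp HP X Y Z v u, m, n) \<in> Dist HP"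
    note d1 = Dist_HP_D[OF d(1)] and d2 = Dist_HP_D[OF d(2)] and d3 = Dist_HP_D[OF d(3)]
    note h1 = htriangle_hm[OF d1(1)] and h2 = htriangle_hm[OF d2(1)] and h3 = htriangle_hm[OF d3(1)]
    have mm: "u \<in> carrier (hom_H0 X Y)" "j \<in> carrier (hom_H0 Y Z')" "k \<in> carrier (hom_H0 Z' (dg_shift 1 0 X))"
      "v \<in> carrier (hom_H0 Y Z)" "l \<in> carrier (hom_H0 Z X')" "i \<in> carrier (hom_H0 X' (dg_shift 1 0 Y))"
      "m \<in> carrier (hom_H0 Z Y')" "n \<in> carrier (hom_H0 Y' (dg_shift 1 0 X))"
      using d1 d2 d3 by (auto simp: htriangle_def)
    note D = h1(1,2) h2(2) h1(3) h2(3) h3(3) h1(4) h2(4)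
    have S: "dg_shift 1 0 Z' \<in> DGP" using D by (auto intro: DGP_shift)
    have "HPr.dist X Z Y' (hcl Y Z v * hcl X Y u) (hcl Z Y' m) (hcl Y' (dg_shift 1 0 X) n)"
      using d3(2) hcl_Comp[OF D(1-3) mm(1,4)] by simp
    from HPr.dist_TR4[OF d1(2) d2(2) this] obtain f g where
      fg: "HPr.dist Z' Y' X' f g (HPr.ShM Y Z' (hcl Y Z' j) * hcl X' (dg_shift 1 0 Y) i)"
      "hcl Z X' l = g * hcl Z Y' m" "hcl Z' (dg_shift 1 0 X) k = hcl Y' (dg_shift 1 0 X) n * f"
      "HPr.ShM X Y (hcl X Y u) * hcl Y' (dg_shift 1 0 X) n = hcl X' (dg_shift 1 0 Y) i * g"
      "hcl Z Y' m * hcl Y Z v = f * hcl Y Z' j" by blast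
    have fgh: "f \<in> HPr.hm Z' Y'" "g \<in> HPr.hm Y' X'" using fg(1) by (auto simp: HPr.dist_def)
    obtain f' where f': "f' \<in> carrier (hom_H0 Z' Y')" "hcl Z' Y' f' = f" using hcl_surj[OF D(4,6) fgh(1)] .
    obtain g' where g': "g' \<in> carrier (hom_H0 Y' X')" "hcl Y' X' g' = g" using hcl_surj[OF D(6,5) fgh(2)] .
    note sj = hcl_shift[OF D(2,4) mm(2)] and su = hcl_shift[OF D(1,2) mm(1)]
    note ji = hcl_Comp[OF D(5,8) S mm(6) sj(1)]
    have "(Z', Y', X', f', g', Comp HP X' (Sh HP Y) (Sh HP Z') (ShMor HP Y Z' j) i) \<in> Dist HP"
      unfolding Dist_HP using fg(1) f' g' ji sj D by (simp add: htriangle_def)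
    moreover have "l = Comp HP Z Y' X' g' m" "k = Comp HP Z' Y' (Sh HP X) n f'"
      using fg mm f' g' hcl_Comp[OF D(3,6,5) mm(7) g'(1)] hcl_Comp[OF D(4,6,7) f'(1) mm(8)]
      by (simp_all add: hcl_inject[OF D(3,5)] hcl_inject[OF D(4,7)])
    moreover have "Comp HP Y' (Sh HP X) (Sh HP Y) (ShMor HP X Y u) n = Comp HP Y' X' (Sh HP Y) i g'"
      "Comp HP Y Z Y' m v = Comp HP Y Z' Y' f' j"
      using fg mm f' g' hcl_Comp[OF D(6,7,8) mm(8) su(1)] hcl_Comp[OF D(6,5,8) g'(1) mm(6)] su(2)
       hcl_Comp[OF D(2,3,6) mm(4,7)] hcl_Comp[OF D(2,4,6) mm(2) f'(1)]
      by (simp_all add: hcl_inject[OF D(6,8)] hcl_inject[OF D(2,6)])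
    ultimately show "\<exists>f g. (Z', Y', X', f, g, Comp HP X' (Sh HP Y) (Sh HP Z') (ShMor HP Y Z' j) i) \<in> Dist HP \<and>
        l = Comp HP Z Y' X' g m \<and>
        k = Comp HP Z' Y' (Sh HP X) n f \<and>
        Comp HP Y' (Sh HP X) (Sh HP Y) (ShMor HP X Y u) n = Comp HP Y' X' (Sh HP Y) i g \<and>
        Comp HP Y Z Y' m v = Comp HP Y Z' Y' f j" by blast
  qed
qed

section \<open>The algebra \<open>U\<^sub>T\<close> as a free module\<close>

abbreviation "utTi \<equiv> ut_of GTinv"

lemma ut_rel_eq: "ut_rel s t \<Longrightarrow> abs_ut s = abs_ut t"
  by (simp add: ut.abs_eq_iff pe_rel)

lemma ut_rels:
  "utE * utE = 0" "utF * utF = 0" "utE * utF + utF * utE = 1 - utT"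
  "utE * utT = utT * utE" "utF * utT = utT * utF" "utT * utTi = 1" "utTi * utT = 1"
  using ut_rel.intros(1-7)[THEN ut_rel_eq]
  by (simp_all add: ut_of_def zero_ut_def one_ut_def times_ut.abs_eq plus_ut.abs_eq minus_ut.abs_eq)

lemma utTi_comm: assumes "x * utT = utT * x" shows "x * utTi = utTi * x"
proof -
  have "x * utTi = utTi * utT * x * utTi" by (simp add: ut_rels)
  also have "\<dots> = utTi * (x * utT) * utTi" by (simp only: assms mult.assoc)
  also have "\<dots> = utTi * x" by (simp only: mult.assoc ut_rels mult_1_right)
  finally show ?thesis .
qed

lemma ut_induct [case_names zero one gen neg add mul]:
  assumes "P 0" "P 1" "\<And>g. P (ut_of g)" "\<And>x. P x \<Longrightarrow> P (- x)" "\<And>x y. P x \<Longrightarrow> P y \<Longrightarrow> P (x + y)"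
    "\<And>x y. P x \<Longrightarrow> P y \<Longrightarrow> P (x * y)"
  shows "P (x::ut)"
proof -
  have "P (abs_ut s)" for s
  proof (induction s)
    case EZero then show ?case using assms(1) by (simp add: zero_ut_def)
  next
    case EOne then show ?case using assms(2) by (simp add: one_ut_def)
  next
    case (EGen g) then show ?case using assms(3)[of g] by (simp add: ut_of_def)
  next
    case (ENeg s) then show ?case using assms(4) by (metis uminus_ut.abs_eq)
  next
    case (EAdd s t) then show ?case using assms(5) by (metis plus_ut.abs_eq)
  next
    case (EMul s t) then show ?case using assms(6) by (metis times_ut.abs_eq)
  qed
  then show ?thesis by (rule ut.abs_induct)
qed

lemma utT_central: "x * utT = utT * x"
proof (induction x rule: ut_induct)
  case (gen g)
  then show ?case by (cases g) (simp_all add: ut_rels)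
next
  case (mul x y)
  then show ?case by (metis mult.assoc)
qed (simp_all add: algebra_simps)

lemmas utTi_central = utTi_comm[OF utT_central]

definition Tpow :: "int \<Rightarrow> ut" where
  "Tpow k = (if k \<ge> 0 then utT ^ nat k else utTi ^ nat (- k))"

lemma Tpow_0 [simp]: "Tpow 0 = 1" by (simp add: Tpow_def)

lemma Tpow_Suc: "Tpow (k + 1) = utT * Tpow k"
proof (cases "k \<ge> 0")
  case True
  then show ?thesis by (simp add: Tpow_def nat_add_distrib)
next
  case False
  then have "nat (- k) = Suc (nat (- (k + 1)))" by simp
  then have "utT * utTi ^ nat (- k) = utTi ^ nat (- (k + 1))"
    by (simp add: ut_rels flip: mult.assoc)
  then show ?thesis using False by (cases "k = -1") (simp_all add: Tpow_def ut_rels)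
qed

lemma Tpow_add: "Tpow (k + l) = Tpow k * Tpow l"
proof (induction k rule: int_induct[of _ 0])
  case (step1 k)
  then show ?case using Tpow_Suc[of k] Tpow_Suc[of "k + l"] by (simp add: ac_simps)
next
  case (step2 k)
  have "utT * Tpow (k - 1 + l) = utT * (Tpow (k - 1) * Tpow l)"
    using step2 Tpow_Suc[of "k - 1"] Tpow_Suc[of "k - 1 + l"] by (simp add: mult.assoc algebra_simps)
  then have "utTi * utT * Tpow (k - 1 + l) = utTi * utT * (Tpow (k - 1) * Tpow l)" by (simp only: mult.assoc)
  then show ?case by (simp add: ut_rels)
qed simp

lemma Tpow_central: "x * Tpow k = Tpow k * x"
proof -
  have "x * y ^ n = y ^ n * x" if "x * y = y * x" for y n
    using that by (rule power_commuting_commutes[symmetric, OF sym])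
  then show ?thesis by (simp add: Tpow_def utT_central utTi_central)
qed

text \<open>The additive span of the claimed basis. It turns out to be a left ideal containing 1,
  hence everything.\<close>

inductive_set ut_span :: "ut set" where
  us_gen: "Tpow k * ut_basis \<Gamma> \<in> ut_span"
| us_zero: "0 \<in> ut_span"
| us_neg: "x \<in> ut_span \<Longrightarrow> - x \<in> ut_span"
| us_add: "x \<in> ut_span \<Longrightarrow> y \<in> ut_span \<Longrightarrow> x + y \<in> ut_span"

lemma ut_span_diff: "x \<in> ut_span \<Longrightarrow> y \<in> ut_span \<Longrightarrow> x - y \<in> ut_span"
  using us_add[of x "- y"] us_neg by simp

lemma ut_span_Tpow: "x \<in> ut_span \<Longrightarrow> Tpow k * x \<in> ut_span"
proof (induction rule: ut_span.induct)
  case (us_gen l \<Gamma>)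
  show ?case using ut_span.us_gen[of "k + l" \<Gamma>] by (simp add: Tpow_add mult.assoc)
qed (simp_all add: distrib_left ut_span.intros)

lemma FE: "utF * utE = 1 - utT - utE * utF"
  using ut_rels(3) by (metis add_diff_cancel_left')

lemma ut_span_basis: "ut_basis \<Gamma> \<in> ut_span"
  using us_gen[of 0 \<Gamma>] by simp

text \<open>Apart from \<open>T\<close> and its inverse, the products that do not vanish or give a
  basis element at once are \<open>F E = 1 - T - E F\<close> and
  \<open>F (E F) = F - T F\<close>.\<close>

lemma ut_span_gen_basis: "ut_of g * ut_basis \<Gamma> \<in> ut_span"
proof -
  have T: "utT * x \<in> ut_span" if "x \<in> ut_span" for x
    using ut_span_Tpow[OF that, of 1] Tpow_Suc[of 0] by simp
  have Ti: "utTi * x \<in> ut_span" if "x \<in> ut_span" for x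
    using ut_span_Tpow[OF that, of "-1"] by (simp add: Tpow_def)
  note b = ut_span_basis[of IxF] ut_span_basis[of IxI] ut_span_basis[of IxEF] ut_span_basis[of IxE]
  have 1: "utE * (utE * utF) = 0" "utE * utE = 0" "utF * utF = 0" by (simp_all add: ut_rels flip: mult.assoc)
  have 2: "utF * utE \<in> ut_span" unfolding FE
    using b T[OF b(2)] by (auto intro: ut_span_diff)
  have "utF * (utE * utF) = (1 - utT - utE * utF) * utF" by (simp add: FE flip: mult.assoc)
  also have "\<dots> = utF - utT * utF" using 1 by (simp add: algebra_simps)
  finally have 3: "utF * (utE * utF) \<in> ut_span"
    using b T[OF b(1)] by (auto intro: ut_span_diff)
  show ?thesis
  proof (cases g)
    case GE
    then show ?thesis using b 1 by (cases \<Gamma>) (simp_all add: us_zero)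
  next
    case GF
    then show ?thesis using b 1 2 3 by (cases \<Gamma>) (simp_all add: us_zero)
  next
    case GT
    then show ?thesis using T ut_span_basis by simp
  next
    case GTinv
    then show ?thesis using Ti ut_span_basis by simp
  qed
qed

lemma ut_span_mult_left: "y \<in> ut_span \<Longrightarrow> x * y \<in> ut_span"
proof (induction x arbitrary: y rule: ut_induct)
  case (gen g)
  then show ?case
  proof (induction rule: ut_span.induct)
    case (us_gen k \<Gamma>)
    have "ut_of g * (Tpow k * ut_basis \<Gamma>) = Tpow k * (ut_of g * ut_basis \<Gamma>)"
      by (metis Tpow_central mult.assoc)
    then show ?case using ut_span_Tpow[OF ut_span_gen_basis] by simp
  qed (simp_all add: distrib_left ut_span.intros)
next
  case (mul x x')
  then show ?case by (simp add: mult.assoc)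
qed (simp_all add: distrib_right ut_span.intros)

lemma ut_span_UNIV: "x \<in> ut_span"
  using ut_span_mult_left[OF ut_span_basis[of IxI], of x] by simp

subsection \<open>Linear independence\<close>

text \<open>A datatype of fixed size is an instance of \<open>ring_1\<close>, so a presented algebra
  can be evaluated in it by \<open>expr_eval\<close>.\<close>

datatype 'a mat2 = Mat2 'a 'a 'a 'a

instantiation mat2 :: (comm_ring_1) ring_1
begin
definition "0 = Mat2 0 0 0 0"
definition "1 = Mat2 1 0 0 1"
fun uminus_mat2 where "- Mat2 a b c d = Mat2 (- a) (- b) (- c) (- d)"
fun plus_mat2 where "Mat2 a b c d + Mat2 a' b' c' d' = Mat2 (a + a') (b + b') (c + c') (d + d')"
fun minus_mat2 where "Mat2 a b c d - Mat2 a' b' c' d' = Mat2 (a - a') (b - b') (c - c') (d - d')"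
fun times_mat2 where "Mat2 a b c d * Mat2 a' b' c' d' =
  Mat2 (a * a' + b * c') (a * b' + b * d') (c * a' + d * c') (c * b' + d * d')"
instance
proof
  fix x y z :: "'a mat2"
  show "x + y + z = x + (y + z)" "x + y = y + x" "0 + x = x" "- x + x = 0" "x - y = x + - y"
    "x * y * z = x * (y * z)" "1 * x = x" "x * 1 = x" "(x + y) * z = x * z + y * z" "x * (y + z) = x * y + x * z"
    by (cases x; cases y; cases z; simp add: zero_mat2_def one_mat2_def algebra_simps)+
qed (simp add: zero_mat2_def one_mat2_def)
end

text \<open>\<open>E\<close> and \<open>F\<close> are the two off-diagonal matrix units, one scaled
  by \<open>1 - T\<close>, so that \<open>E F + F E\<close> is the scalar \<open>1 - T\<close>. The
  images of \<open>1\<close>, \<open>E\<close>, \<open>F\<close> and \<open>E F\<close> are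
  independent over Laurent series, as \<open>1 - T\<close> is nonzero in a domain.\<close>

fun ut_mat_gen :: "ut_gen \<Rightarrow> int fls mat2" where
  "ut_mat_gen GE = Mat2 0 1 0 0"
| "ut_mat_gen GF = Mat2 0 0 (1 - fls_X) 0"
| "ut_mat_gen GT = Mat2 fls_X 0 0 fls_X"
| "ut_mat_gen GTinv = Mat2 fls_X_inv 0 0 fls_X_inv"

lift_definition ut_mat :: "ut \<Rightarrow> int fls mat2" is "expr_eval ut_mat_gen"
proof -
  fix s t assume "pres_eq ut_rel s t"
  then show "expr_eval ut_mat_gen s = expr_eval ut_mat_gen t"
    by (rule pres_eq_eval) (auto elim!: ut_rel.cases simp: zero_mat2_def one_mat2_def fls_X_times_conv_shift fls_X_inv_times_conv_shift simp flip: fls_X_conv_shift_1)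
qed

lemma ut_mat_simps [simp]:
  "ut_mat 0 = 0" "ut_mat 1 = 1" "ut_mat (x + y) = ut_mat x + ut_mat y" "ut_mat (- x) = - ut_mat x"
  "ut_mat (x * y) = ut_mat x * ut_mat y" "ut_mat (ut_of g) = ut_mat_gen g"
  by (transfer, simp)+

definition scal2 :: "'a::comm_ring_1 \<Rightarrow> 'a mat2" where "scal2 a = Mat2 a 0 0 a"

lemma scal2_simps: "scal2 0 = 0" "scal2 1 = 1" "scal2 (a + b) = scal2 a + scal2 b" "scal2 (- a) = - scal2 a"
  "scal2 (a * b) = scal2 a * scal2 b" "scal2 a * Mat2 x y z w = Mat2 (a * x) (a * y) (a * z) (a * w)"
  by (simp_all add: scal2_def zero_mat2_def one_mat2_def)

lemma ut_mat_Tpow: "ut_mat (Tpow k) = scal2 (fls_X_intpow k)"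
proof -
  have p: "ut_mat (x ^ n) = ut_mat x ^ n" for x n by (induction n) simp_all
  have s: "scal2 (a ^ n) = scal2 a ^ n" for a :: "int fls" and n by (induction n) (simp_all add: scal2_simps)
  show ?thesis
  proof (cases "k \<ge> 0")
    case True
    then obtain n where "k = int n" by (metis nonneg_int_cases)
    then show ?thesis using s[of fls_X n] by (simp add: Tpow_def p fls_X_power_conv_shift_1 scal2_def flip: fls_X_conv_shift_1)
  next
    case False
    then obtain n where "k = - int n" "n > 0" by (metis linorder_not_le neg_int_cases)
    then show ?thesis using s[of fls_X_inv n] by (simp add: Tpow_def p fls_X_inv_power_conv_shift_1 scal2_def)
  qed
qed

lemma ut_mat_of_int: "ut_mat (of_int n) = scal2 (of_int n)"
proof (induction n rule: int_induct[of _ 0])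
  case (step2 n)
  have "of_int (n - 1) = of_int n + - (1::ut)" "of_int (n - 1) = of_int n + - (1::int fls)" by simp_all
  with step2 show ?case by (simp only: ut_mat_simps scal2_simps)
qed (simp_all add: scal2_simps)

text \<open>The coefficient vectors are indexed by \<open>(m, \<Gamma>)\<close>, standing for the basis element \<open>T\<^sup>m \<Gamma>\<close>.\<close>

definition ut_comb :: "(int \<times> idx \<Rightarrow>\<^sub>0 int) \<Rightarrow> ut" where
  "ut_comb n = (\<Sum>(m, \<Gamma>)\<in>Poly_Mapping.keys n. of_int (Poly_Mapping.lookup n (m, \<Gamma>)) * (Tpow m * ut_basis \<Gamma>))"

text \<open>In the matrix of a combination the off-diagonal entries determine the coefficients of
  \<open>E\<close> and \<open>F\<close>, the lower diagonal entry is that of \<open>I\<close>, and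
  the upper one then determines that of \<open>EF\<close>.\<close>

lemma ut_comb_inj: assumes "ut_comb n = 0" shows "n = 0"
proof -
  let ?K = "Poly_Mapping.keys n"
  \<comment> \<open>The coefficient of \<Gamma>, a Laurent polynomial in \<open>T\<close>. Summing
    over a common set of exponents for all \<Gamma> makes the index set a product.\<close>
  define a where "a \<Gamma> = (\<Sum>m\<in>fst ` ?K. of_int (Poly_Mapping.lookup n (m, \<Gamma>)) * fls_X_intpow m :: int fls)" for \<Gamma>
  define bm where "bm \<Gamma> = ut_mat (ut_basis \<Gamma>)" for \<Gamma>
  have fin: "finite (fst ` ?K)" by simp
  have UN: "(UNIV :: idx set) = {IxF, IxI, IxEF, IxE}"
    using idx.exhaust by blast
  have finU: "finite (UNIV :: idx set)" unfolding UN by simp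
  have sum: "ut_mat (sum g S) = (\<Sum>s\<in>S. ut_mat (g s))" for g and S :: "(int \<times> idx) set"
    by (induction S rule: infinite_finite_induct) simp_all
  have sum_s: "scal2 (sum g S) = (\<Sum>s\<in>S. scal2 (g s))" for g :: "int \<Rightarrow> int fls" and S
    by (induction S rule: infinite_finite_induct) (simp_all add: scal2_simps)
  have "ut_comb n = (\<Sum>p\<in>fst ` ?K \<times> UNIV. of_int (Poly_Mapping.lookup n p) * (Tpow (fst p) * ut_basis (snd p)))"
    unfolding ut_comb_def case_prod_unfold
    by (rule sum.mono_neutral_cong_left) (use fin finU in \<open>force simp: in_keys_iff image_iff\<close>)+
  then have "ut_mat (ut_comb n) = (\<Sum>p\<in>fst ` ?K \<times> UNIV. scal2 (of_int (Poly_Mapping.lookup n p) * fls_X_intpow (fst p)) * bm (snd p))"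
    by (simp add: sum ut_mat_of_int ut_mat_Tpow scal2_simps bm_def mult.assoc)
  also have "\<dots> = (\<Sum>\<Gamma>\<in>UNIV. \<Sum>m\<in>fst ` ?K. scal2 (of_int (Poly_Mapping.lookup n (m, \<Gamma>)) * fls_X_intpow m) * bm \<Gamma>)"
    by (subst sum.swap) (simp add: sum.cartesian_product case_prod_unfold)
  also have "\<dots> = (\<Sum>\<Gamma>\<in>UNIV. scal2 (a \<Gamma>) * bm \<Gamma>)"
    by (simp add: a_def sum_s sum_distrib_right)
  finally have "(\<Sum>\<Gamma>\<in>UNIV. scal2 (a \<Gamma>) * bm \<Gamma>) = 0" using assms by simp
  moreover have "(\<Sum>\<Gamma>\<in>UNIV. scal2 (a \<Gamma>) * bm \<Gamma>) =
      Mat2 (a IxI + a IxEF * (1 - fls_X)) (a IxE) (a IxF * (1 - fls_X)) (a IxI)"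
    by (simp add: UN bm_def scal2_simps one_mat2_def zero_mat2_def algebra_simps)
  ultimately have "Mat2 (a IxI + a IxEF * (1 - fls_X)) (a IxE) (a IxF * (1 - fls_X)) (a IxI) = Mat2 0 0 0 0"
    by (simp only: zero_mat2_def)
  then have eqs: "a IxI + a IxEF * (1 - fls_X) = 0" "a IxE = 0" "a IxF * (1 - fls_X) = 0" "a IxI = 0"
    unfolding mat2.inject by blast+
  have nz: "1 - fls_X \<noteq> (0::int fls)"
  proof
    assume "1 - fls_X = (0::int fls)"
    then have "fls_nth (1 - fls_X) 0 = (0::int)" by simp
    then show False by simp
  qed
  have "a IxEF * (1 - fls_X) = 0" using eqs(1,4) by (simp only: add_0_left)
  with eqs nz have a0: "a \<Gamma> = 0" for \<Gamma> by (cases \<Gamma>) (simp_all only: mult_eq_0_iff simp_thms)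
  have "Poly_Mapping.lookup n (m, \<Gamma>) = 0" for m \<Gamma>
  proof (cases "m \<in> fst ` ?K")
    case True
    have "fls_nth (a \<Gamma>) m = (\<Sum>k\<in>fst ` ?K. Poly_Mapping.lookup n (k, \<Gamma>) * (if m = k then 1 else 0))"
    proof -
      have s: "fls_nth (sum g S) m = (\<Sum>k\<in>S. fls_nth (g k) m)" for g :: "int \<Rightarrow> int fls" and S
        by (induction S rule: infinite_finite_induct) simp_all
      have "fls_nth (of_int c * fls_X_intpow k) m = c * (if m = k then 1 else 0)" for c k :: int
        by (simp add: fls_of_int)
      then show ?thesis by (simp add: a_def s)
    qed
    also have "\<dots> = Poly_Mapping.lookup n (m, \<Gamma>)"
      using True fin by (simp add: if_distrib[of "(*) _"] sum.delta cong: if_cong)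
    finally show ?thesis using a0 by simp
  next
    case False
    then show ?thesis by (force simp: in_keys_iff image_iff)
  qed
  then show ?thesis by (intro poly_mapping_eqI) (auto simp: split_paired_all)
qed

section \<open>Graded dimensions of \<open>S\<^sub>\<Gamma> \<otimes>\<^sub>A X\<close>\<close>

text \<open>The only generator outside degree \<open>(0, 0)\<close> is \<open>GRho2\<close>, which
  every character kills. So the simple modules are concentrated in one degree and the grading passes
  to \<open>S\<^sub>\<Gamma> \<otimes>\<^sub>A X\<close>.\<close>

lemma eps_homog:
  assumes "a \<in> alg_homog d" "d \<noteq> (0, 0)" shows "eps \<Gamma> a = 0"
proof -
  have "(d, a) \<in> alg_homog_rel" using assms by (simp add: alg_homog_def)
  then have "d = (0, 0) \<or> eps \<Gamma> a = 0"
  proof induction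
    case (ah_gen g)
    show ?case by (cases g) auto
  qed auto
  with assms show ?thesis by simp
qed

text \<open>\<open>dual \<Gamma> X d\<close> is the dual of the degree \<open>d\<close> part of \<open>S\<^sub>\<Gamma> \<otimes>\<^sub>A X\<close>, and \<open>nd \<Gamma> X d\<close> its dimension over \<open>\<bbbF>\<^sub>2\<close>.\<close>

definition dual :: "idx \<Rightarrow> amod \<Rightarrow> int \<times> int \<Rightarrow> (elt \<Rightarrow> bit) set" where
  "dual \<Gamma> X d = {g \<in> extensional (carrier X).
     (\<forall>x \<in> carrier X. \<forall>y \<in> carrier X. g (x \<oplus>\<^bsub>X\<^esub> y) = g x + g y) \<and>
     (\<forall>a. \<forall>x \<in> carrier X. g (a \<odot>\<^bsub>X\<^esub> x) = eps \<Gamma> a * g x) \<and>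
     (\<forall>d'. d' \<noteq> d \<longrightarrow> (\<forall>x \<in> homog X d'. g x = 0))}"

definition nd :: "idx \<Rightarrow> amod \<Rightarrow> int \<times> int \<Rightarrow> nat" where
  "nd \<Gamma> X d = multiplicity 2 (card (dual \<Gamma> X d))"

lemma dualI:
  assumes "g \<in> extensional (carrier X)"
    "\<And>x y. x \<in> carrier X \<Longrightarrow> y \<in> carrier X \<Longrightarrow> g (x \<oplus>\<^bsub>X\<^esub> y) = g x + g y"
    "\<And>a x. x \<in> carrier X \<Longrightarrow> g (a \<odot>\<^bsub>X\<^esub> x) = eps \<Gamma> a * g x"
    "\<And>i' j' x. (i', j') \<noteq> (i, j) \<Longrightarrow> x \<in> homog X (i', j') \<Longrightarrow> g x = 0"
  shows "g \<in> dual \<Gamma> X (i, j)"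
  using assms by (auto simp: dual_def)

lemma dualD:
  assumes "g \<in> dual \<Gamma> X (i, j)"
  shows "g \<in> extensional (carrier X)"
    "x \<in> carrier X \<Longrightarrow> y \<in> carrier X \<Longrightarrow> g (x \<oplus>\<^bsub>X\<^esub> y) = g x + g y"
    "x \<in> carrier X \<Longrightarrow> g (a \<odot>\<^bsub>X\<^esub> x) = eps \<Gamma> a * g x"
    "(i', j') \<noteq> (i, j) \<Longrightarrow> x \<in> homog X (i', j') \<Longrightarrow> g x = 0"
  using assms by (auto simp: dual_def simp del: Product_Type.prod.inject)

lemma dual_zero: "X \<in> DGP \<Longrightarrow> (\<lambda>x \<in> carrier X. 0) \<in> dual \<Gamma> X d"
proof -
  assume "X \<in> DGP"
  then interpret X: dgmod X by (rule dgmod_DGP)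
  show ?thesis using X.homog_closed by (auto simp: dual_def)
qed

lemma dual_add:
  assumes "X \<in> DGP" "g \<in> dual \<Gamma> X (i, j)" "h \<in> dual \<Gamma> X (i, j)"
  shows "(\<lambda>x \<in> carrier X. g x + h x) \<in> dual \<Gamma> X (i, j)"
proof -
  interpret X: dgmod X using assms dgmod_DGP by blast
  show ?thesis
    by (rule dualI) (use dualD[OF assms(2)] dualD[OF assms(3)] X.homog_closed in
      \<open>auto simp: algebra_simps\<close>)
qed

text \<open>Functionals pull back along morphisms. One supported in degree \<open>i\<close> of the
  target sees only degree \<open>i - k\<close> of the source.\<close>

lemma dual_comp:
  assumes "X \<in> DGP" "Y \<in> DGP" "f \<in> carrier (dg_hom k X Y)" "g \<in> dual \<Gamma> Y (i, j)"
  shows "(\<lambda>x \<in> carrier X. g (f x)) \<in> dual \<Gamma> X (i - k, j)"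
proof -
  interpret X: dgmod X using assms dgmod_DGP by blast
  interpret Y: dgmod Y using assms dgmod_DGP by blast
  have f: "f \<in> addmap X Y" "\<And>r x. x \<in> carrier X \<Longrightarrow> f (r \<odot>\<^bsub>X\<^esub> x) = r \<odot>\<^bsub>Y\<^esub> f x"
    "\<And>i j x. x \<in> homog X (i, j) \<Longrightarrow> f x \<in> homog Y (i + k, j)"
    using assms(3) by (auto simp: dg_hom_iff)
  note g = dualD[OF assms(4)]
  show ?thesis
  proof (rule dualI)
    fix i' j' x assume x: "(i', j') \<noteq> (i - k, j)" "x \<in> homog X (i', j')"
    then have "(i' + k, j') \<noteq> (i, j)" by auto
    from g(4)[OF this f(3)[OF x(2)]] show "(\<lambda>x \<in> carrier X. g (f x)) x = 0" using x X.homog_closed by simp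
  qed (use f g addmap_closed[OF f(1)] addmap_add[OF f(1)] in auto)
qed

text \<open>A functional on \<open>P(\<Gamma>')\<close> is determined by its value on the generator
  \<open>e(\<Gamma>')\<close>. This generator is idempotent, so a nonzero value forces the character
  to be 1 on it.\<close>

lemma dual_proj:
  assumes "g \<in> dual \<Gamma> (projA \<Gamma>') (i, j)"
  shows "g = (\<lambda>x \<in> carrier (projA \<Gamma>'). 0) \<or>
    (\<Gamma> = \<Gamma>' \<and> (i, j) = (0, 0) \<and> g = (\<lambda>x \<in> carrier (projA \<Gamma>'). eps \<Gamma> (the_alg x)))"
proof -
  let ?e = "Elt (alg_of (GId \<Gamma>'))"
  note g = dualD[OF assms]
  have e: "?e \<in> carrier (projA \<Gamma>')" by (simp add: proj_carrier idem_mult)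
  have ga: "g x = eps \<Gamma> (the_alg x) * g ?e" if "x \<in> carrier (projA \<Gamma>')" for x
  proof -
    from that obtain a where a: "x = Elt a" "a * alg_of (GId \<Gamma>') = a" unfolding proj_carrier by blast
    then have "x = a \<odot>\<^bsub>projA \<Gamma>'\<^esub> ?e" by (simp add: projA_sel)
    with g(3)[OF e, of a] a show ?thesis by simp
  qed
  show ?thesis
  proof (cases "g ?e = 0")
    case True
    then have "g = (\<lambda>x \<in> carrier (projA \<Gamma>'). 0)"
      using ga g(1) by (intro extensionalityI[of g "carrier (projA \<Gamma>')"]) auto
    then show ?thesis ..
  next
    case False
    then have 1: "g ?e = 1" by simp
    have "g ?e = eps \<Gamma> (alg_of (GId \<Gamma>')) * g ?e" using ga[OF e] by simp
    then have "\<Gamma> = \<Gamma>'" using False by (auto split: if_splits)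
    moreover have "?e \<in> homog (projA \<Gamma>') (0, 0)"
      using alg_homog_gen[of "GId \<Gamma>'"] by (simp add: proj_homog idem_mult)
    then have "(i, j) = (0, 0)" using g(4)[of 0 0 ?e] False by blast
    moreover have "g = (\<lambda>x \<in> carrier (projA \<Gamma>'). eps \<Gamma> (the_alg x))"
      using ga g(1) 1 by (intro extensionalityI[of g "carrier (projA \<Gamma>')"]) auto
    ultimately show ?thesis by blast
  qed
qed

lemma eps_dual: "(\<lambda>x \<in> carrier (projA \<Gamma>). eps \<Gamma> (the_alg x)) \<in> dual \<Gamma> (projA \<Gamma>) (0, 0)"
proof -
  interpret X: dgmod "projA \<Gamma>" by (rule dgmod_DGP) (rule DGP_proj)
  show ?thesis
  proof (rule dualI)
    fix x y assume xy: "x \<in> carrier (projA \<Gamma>)" "y \<in> carrier (projA \<Gamma>)"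
    then have "x \<oplus>\<^bsub>projA \<Gamma>\<^esub> y \<in> carrier (projA \<Gamma>)" by simp
    with xy show "(\<lambda>x\<in>carrier (projA \<Gamma>). eps \<Gamma> (the_alg x)) (x \<oplus>\<^bsub>projA \<Gamma>\<^esub> y) =
      (\<lambda>x\<in>carrier (projA \<Gamma>). eps \<Gamma> (the_alg x)) x + (\<lambda>x\<in>carrier (projA \<Gamma>). eps \<Gamma> (the_alg x)) y"
      by (simp add: projA_sel(3))
  next
    fix a x assume x: "x \<in> carrier (projA \<Gamma>)"
    then have "a \<odot>\<^bsub>projA \<Gamma>\<^esub> x \<in> carrier (projA \<Gamma>)" by simp
    with x show "(\<lambda>x\<in>carrier (projA \<Gamma>). eps \<Gamma> (the_alg x)) (a \<odot>\<^bsub>projA \<Gamma>\<^esub> x) =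
      eps \<Gamma> a * (\<lambda>x\<in>carrier (projA \<Gamma>). eps \<Gamma> (the_alg x)) x"
      by (simp add: projA_sel(4))
  next
    fix i' j' x assume x: "(i', j') \<noteq> (0, 0)" "x \<in> homog (projA \<Gamma>) (i', j')"
    then have "the_alg x \<in> alg_homog (i', j')" by (auto simp: proj_homog)
    then show "(\<lambda>x\<in>carrier (projA \<Gamma>). eps \<Gamma> (the_alg x)) x = 0"
      using x eps_homog X.homog_closed by auto
  qed simp
qed

lemma dual_projA:
  "dual \<Gamma> (projA \<Gamma>') d = (if \<Gamma> = \<Gamma>' \<and> d = (0, 0)
     then {(\<lambda>x \<in> carrier (projA \<Gamma>'). 0), (\<lambda>x \<in> carrier (projA \<Gamma>'). eps \<Gamma> (the_alg x))}
     else {(\<lambda>x \<in> carrier (projA \<Gamma>'). 0)})"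
proof (cases d)
  case (Pair i j)
  then show ?thesis
    using dual_zero[OF DGP_proj, of \<Gamma>' \<Gamma> d] eps_dual[of \<Gamma>] dual_proj[of _ \<Gamma> \<Gamma>' i j] by auto
qed

lemma nd_proj: "nd \<Gamma> (projA \<Gamma>') d = (if \<Gamma> = \<Gamma>' \<and> d = (0, 0) then 1 else 0)"
proof -
  let ?e = "Elt (alg_of (GId \<Gamma>'))"
  have e: "?e \<in> carrier (projA \<Gamma>')" by (simp add: proj_carrier idem_mult)
  then have "(\<lambda>x \<in> carrier (projA \<Gamma>'). 0) ?e \<noteq> (\<lambda>x \<in> carrier (projA \<Gamma>'). eps \<Gamma>' (the_alg x)) ?e" by simp
  then have "(\<lambda>x \<in> carrier (projA \<Gamma>'). 0::bit) \<noteq> (\<lambda>x \<in> carrier (projA \<Gamma>'). eps \<Gamma>' (the_alg x))" by metis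
  moreover have "multiplicity 2 (2::nat) = 1" by (rule multiplicity_self) simp_all
  ultimately show ?thesis by (auto simp: nd_def dual_projA simp flip: numeral_2_eq_2)
qed

lemma dual_shift: "dual \<Gamma> (dg_shift k m X) (i, j) = dual \<Gamma> X (i + k, j + m)"
proof -
  have "(\<forall>d'. d' \<noteq> (i, j) \<longrightarrow> (\<forall>x \<in> homog (dg_shift k m X) d'. g x = 0)) \<longleftrightarrow>
    (\<forall>d'. d' \<noteq> (i + k, j + m) \<longrightarrow> (\<forall>x \<in> homog X d'. g x = 0))" for g :: "elt \<Rightarrow> bit"
  proof (intro iffI allI impI ballI)
    fix d' x assume *: "\<forall>d'. d' \<noteq> (i, j) \<longrightarrow> (\<forall>x \<in> homog (dg_shift k m X) d'. g x = 0)"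
      and d: "d' \<noteq> (i + k, j + m)" "x \<in> homog X d'"
    have "(fst d' - k, snd d' - m) \<noteq> (i, j)" "x \<in> homog (dg_shift k m X) (fst d' - k, snd d' - m)"
      using d by (auto simp: shift_sel prod_eq_iff)
    then show "g x = 0" using * by blast
  next
    fix d' x assume *: "\<forall>d'. d' \<noteq> (i + k, j + m) \<longrightarrow> (\<forall>x \<in> homog X d'. g x = 0)"
      and d: "d' \<noteq> (i, j)" "x \<in> homog (dg_shift k m X) d'"
    have "(fst d' + k, snd d' + m) \<noteq> (i + k, j + m)" "x \<in> homog X (fst d' + k, snd d' + m)"
      using d by (cases d'; auto simp: shift_sel)+
    then show "g x = 0" using * by blast
  qed
  then show ?thesis by (simp add: dual_def shift_sel)
qed

text \<open>As a graded module the cone is the direct sum \<open>M[1] + N\<close>, so functionals on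
  it are pairs; the shift accounts for \<open>i + 1\<close>.\<close>

lemma dual_cone:
  assumes "M \<in> DGP" "N \<in> DGP" "f \<in> cocycles0 M N"
  shows "bij_betw (\<lambda>g. (\<lambda>x \<in> carrier M. g (Pr x \<zero>\<^bsub>N\<^esub>), \<lambda>y \<in> carrier N. g (Pr \<zero>\<^bsub>M\<^esub> y)))
    (dual \<Gamma> (mcone M N f) (i, j)) (dual \<Gamma> M (i + 1, j) \<times> dual \<Gamma> N (i, j))"
proof -
  let ?C = "mcone M N f"
  interpret M: dgmod M using assms dgmod_DGP by blast
  interpret N: dgmod N using assms dgmod_DGP by blast
  have CD: "?C \<in> DGP" using assms by (rule DGP_cone)
  interpret C: dgmod ?C using CD dgmod_DGP by blast
  note m = cone_maps[OF assms]
  have Pr: "Pr x y \<in> carrier ?C \<longleftrightarrow> x \<in> carrier M \<and> y \<in> carrier N" for x y by (auto simp: cone_sel)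
  show ?thesis
  proof (rule bij_betw_byWitness[where f' = "\<lambda>(a, b). \<lambda>p \<in> carrier ?C. a (pr1 p) + b (pr2 p)"])
    show "\<forall>g \<in> dual \<Gamma> ?C (i, j). (\<lambda>(a, b). \<lambda>p \<in> carrier ?C. a (pr1 p) + b (pr2 p))
       (\<lambda>x \<in> carrier M. g (Pr x \<zero>\<^bsub>N\<^esub>), \<lambda>y \<in> carrier N. g (Pr \<zero>\<^bsub>M\<^esub> y)) = g"
    proof
      fix g assume "g \<in> dual \<Gamma> ?C (i, j)"
      note g = dualD[OF this]
      show "(\<lambda>(a, b). \<lambda>p \<in> carrier ?C. a (pr1 p) + b (pr2 p))
       (\<lambda>x \<in> carrier M. g (Pr x \<zero>\<^bsub>N\<^esub>), \<lambda>y \<in> carrier N. g (Pr \<zero>\<^bsub>M\<^esub> y)) = g"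
      proof (rule extensionalityI[of _ "carrier ?C"])
        fix p assume "p \<in> carrier ?C"
        then obtain x y where p: "p = Pr x y" "x \<in> carrier M" "y \<in> carrier N" by (auto simp: cone_sel)
        have "g (Pr x \<zero>\<^bsub>N\<^esub> \<oplus>\<^bsub>?C\<^esub> Pr \<zero>\<^bsub>M\<^esub> y) = g (Pr x \<zero>\<^bsub>N\<^esub>) + g (Pr \<zero>\<^bsub>M\<^esub> y)"
          using p by (intro g(2)) (simp_all add: Pr)
        then show "(\<lambda>(a, b). \<lambda>p \<in> carrier ?C. a (pr1 p) + b (pr2 p))
          (\<lambda>x \<in> carrier M. g (Pr x \<zero>\<^bsub>N\<^esub>), \<lambda>y \<in> carrier N. g (Pr \<zero>\<^bsub>M\<^esub> y)) p = g p"
          using p by (simp add: Pr cone_sel(3))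
      qed (use g in auto)
    qed
    show "\<forall>ab \<in> dual \<Gamma> M (i + 1, j) \<times> dual \<Gamma> N (i, j).
        (\<lambda>g. (\<lambda>x \<in> carrier M. g (Pr x \<zero>\<^bsub>N\<^esub>), \<lambda>y \<in> carrier N. g (Pr \<zero>\<^bsub>M\<^esub> y)))
         ((\<lambda>(a, b). \<lambda>p \<in> carrier ?C. a (pr1 p) + b (pr2 p)) ab) = ab"
    proof (clarify, intro conjI)
      fix a b assume "a \<in> dual \<Gamma> M (i + 1, j)" "b \<in> dual \<Gamma> N (i, j)"
      note a = dualD[OF this(1)] and b = dualD[OF this(2)]
      have "a \<zero>\<^bsub>M\<^esub> = 0" "b \<zero>\<^bsub>N\<^esub> = 0" using a(2)[of "\<zero>\<^bsub>M\<^esub>" "\<zero>\<^bsub>M\<^esub>"] b(2)[of "\<zero>\<^bsub>N\<^esub>" "\<zero>\<^bsub>N\<^esub>"] by simp_all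
      then show "(\<lambda>x\<in>carrier M. (\<lambda>p\<in>carrier ?C. a (pr1 p) + b (pr2 p)) (Pr x \<zero>\<^bsub>N\<^esub>)) = a"
        "(\<lambda>y\<in>carrier N. (\<lambda>p\<in>carrier ?C. a (pr1 p) + b (pr2 p)) (Pr \<zero>\<^bsub>M\<^esub> y)) = b"
        using a(1) b(1) by (auto simp: Pr extensional_def restrict_def)
    qed
    show "(\<lambda>g. (\<lambda>x \<in> carrier M. g (Pr x \<zero>\<^bsub>N\<^esub>), \<lambda>y \<in> carrier N. g (Pr \<zero>\<^bsub>M\<^esub> y))) ` dual \<Gamma> ?C (i, j)
       \<subseteq> dual \<Gamma> M (i + 1, j) \<times> dual \<Gamma> N (i, j)"
    proof clarify
      fix g assume g: "g \<in> dual \<Gamma> ?C (i, j)"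
      show "(\<lambda>x \<in> carrier M. g (Pr x \<zero>\<^bsub>N\<^esub>)) \<in> dual \<Gamma> M (i + 1, j) \<and> (\<lambda>y \<in> carrier N. g (Pr \<zero>\<^bsub>M\<^esub> y)) \<in> dual \<Gamma> N (i, j)"
        using dual_comp[OF assms(1) CD m(1) g] dual_comp[OF assms(2) CD m(3) g] by (simp cong: restrict_cong)
    qed
    show "(\<lambda>(a, b). \<lambda>p \<in> carrier ?C. a (pr1 p) + b (pr2 p)) ` (dual \<Gamma> M (i + 1, j) \<times> dual \<Gamma> N (i, j))
      \<subseteq> dual \<Gamma> ?C (i, j)"
    proof clarify
      fix a b assume "a \<in> dual \<Gamma> M (i + 1, j)" "b \<in> dual \<Gamma> N (i, j)"
      then have "(\<lambda>p \<in> carrier ?C. a ((\<lambda>p \<in> carrier ?C. pr1 p) p)) \<in> dual \<Gamma> ?C (i, j)"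
        "(\<lambda>p \<in> carrier ?C. b ((\<lambda>p \<in> carrier ?C. pr2 p) p)) \<in> dual \<Gamma> ?C (i, j)"
        using dual_comp[OF CD assms(1) m(2), of a \<Gamma> "i + 1" j] dual_comp[OF CD assms(2) m(4), of b \<Gamma> i j] by simp_all
      from dual_add[OF CD this] show "(\<lambda>p \<in> carrier ?C. a (pr1 p) + b (pr2 p)) \<in> dual \<Gamma> ?C (i, j)"
        by (simp cong: restrict_cong)
    qed
  qed
qed

text \<open>A finite vector space over the field of two elements has as many elements as 2 to its
  dimension. Reading dimensions off as exponents of 2 turns direct sums into products of
  cardinalities.\<close>

lemma multiplicity_card_Times:
  assumes "finite A" "finite B" "A \<noteq> {}" "B \<noteq> {}"
  shows "multiplicity 2 (card (A \<times> B)) = multiplicity 2 (card A) + multiplicity (2::nat) (card B)"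
  using assms by (simp add: card_cartesian_product prime_elem_multiplicity_mult_distrib)

lemma dual_finite: "X \<in> DGP \<Longrightarrow> finite (dual \<Gamma> X d)"
proof (induction X arbitrary: d rule: DGP.induct)
  case (DGP_proj \<Gamma>')
  show ?case by (simp add: dual_projA)
next
  case (DGP_shift M k m)
  then show ?case by (cases d) (simp add: dual_shift)
next
  case (DGP_cone M N f)
  then show ?case
    using bij_betw_finite[OF dual_cone[OF DGP_cone.hyps, of \<Gamma> "fst d" "snd d"]] by simp
qed

lemma nd_shift: "nd \<Gamma> (dg_shift k m X) (i, j) = nd \<Gamma> X (i + k, j + m)"
  by (simp add: nd_def dual_shift)

lemma nd_cone:
  assumes "M \<in> DGP" "N \<in> DGP" "f \<in> cocycles0 M N"
  shows "nd \<Gamma> (mcone M N f) (i, j) = nd \<Gamma> M (i + 1, j) + nd \<Gamma> N (i, j)"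
  using bij_betw_same_card[OF dual_cone[OF assms, of \<Gamma> i j]]
    multiplicity_card_Times[of "dual \<Gamma> M (i + 1, j)" "dual \<Gamma> N (i, j)"] dual_finite dual_zero assms
  unfolding nd_def by fastforce

lemma nd_support: "X \<in> DGP \<Longrightarrow> finite {d. nd \<Gamma> X d \<noteq> 0}"
proof (induction X rule: DGP.induct)
  case (DGP_proj \<Gamma>')
  show ?case by (rule finite_subset[of _ "{(0, 0)}"]) (auto simp: nd_proj)
next
  case (DGP_shift M k m)
  have "{d. nd \<Gamma> (dg_shift k m M) d \<noteq> 0} \<subseteq> (\<lambda>(i, j). (i - k, j - m)) ` {d. nd \<Gamma> M d \<noteq> 0}"
    by (auto simp: nd_shift intro!: image_eqI[of _ _ "(_ + k, _ + m)"])
  then show ?case using DGP_shift.IH finite_surj by blast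
next
  case (DGP_cone M N f)
  have "{d. nd \<Gamma> (mcone M N f) d \<noteq> 0} \<subseteq> (\<lambda>(i, j). (i - 1, j)) ` {d. nd \<Gamma> M d \<noteq> 0} \<union> {d. nd \<Gamma> N d \<noteq> 0}"
  proof
    fix d assume "d \<in> {d. nd \<Gamma> (mcone M N f) d \<noteq> 0}"
    then obtain i j where "d = (i, j)" "nd \<Gamma> M (i + 1, j) \<noteq> 0 \<or> nd \<Gamma> N (i, j) \<noteq> 0"
      by (cases d) (auto simp: nd_cone[OF DGP_cone.hyps])
    then show "d \<in> (\<lambda>(i, j). (i - 1, j)) ` {d. nd \<Gamma> M d \<noteq> 0} \<union> {d. nd \<Gamma> N d \<noteq> 0}"
      by (auto intro!: image_eqI[of _ _ "(i + 1, j)"])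
  qed
  then show ?case using DGP_cone.IH by (meson finite_UnI finite_imageI finite_subset)
qed



section \<open>The Euler characteristic with values in \<open>U\<^sub>T\<close>\<close>

definition sg :: "int \<Rightarrow> int" where "sg i = (if even i then 1 else - 1)"

lemma sg_add: "sg (i + j) = sg i * sg j" by (simp add: sg_def)
lemma sg_sq: "sg i * sg i = 1" by (simp add: sg_def)

text \<open>The sign of the exponent reflects that the generator of \<open>P{m}\<close> has \<open>t\<close>-degree \<open>-m\<close>.\<close>

definition chi_term :: "(int \<times> int \<Rightarrow> nat) \<Rightarrow> int \<times> int \<Rightarrow> ut" where
  "chi_term n d = of_int (sg (fst d) * int (n d)) * Tpow (- snd d)"

definition chi_sum :: "(int \<times> int \<Rightarrow> nat) \<Rightarrow> ut" where
  "chi_sum n = (\<Sum>d | n d \<noteq> 0. chi_term n d)"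

lemma chi_sum_superset: "finite S \<Longrightarrow> {d. n d \<noteq> 0} \<subseteq> S \<Longrightarrow> chi_sum n = (\<Sum>d\<in>S. chi_term n d)"
  unfolding chi_sum_def by (rule sum.mono_neutral_left) (auto simp: chi_term_def)

lemma chi_sum_add:
  assumes "finite {d. n d \<noteq> 0}" "finite {d. n' d \<noteq> 0}"
  shows "chi_sum (\<lambda>d. n d + n' d) = chi_sum n + chi_sum n'"
proof -
  let ?S = "{d. n d \<noteq> 0} \<union> {d. n' d \<noteq> 0}"
  have fin: "finite ?S" using assms by (rule finite_UnI)
  have "{d. n d + n' d \<noteq> 0} \<subseteq> ?S" by auto
  with fin have "chi_sum (\<lambda>d. n d + n' d) = (\<Sum>d\<in>?S. chi_term (\<lambda>d. n d + n' d) d)"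
    by (rule chi_sum_superset)
  also have "\<dots> = (\<Sum>d\<in>?S. chi_term n d) + (\<Sum>d\<in>?S. chi_term n' d)"
    by (simp add: chi_term_def algebra_simps flip: sum.distrib)
  also have "\<dots> = chi_sum n + chi_sum n'"
    using chi_sum_superset[OF fin Un_upper1] chi_sum_superset[OF fin Un_upper2] by simp
  finally show ?thesis .
qed

text \<open>Reindexing gives the factors because \<open>sg i = sg k * sg (i + k)\<close> and
  \<open>T^(-j) = T^m * T^(-(j + m))\<close>.\<close>

lemma chi_sum_shift:
  "chi_sum (\<lambda>(i, j). n (i + k, j + m)) = of_int (sg k) * (Tpow m * chi_sum n)"
proof -
  have b: "bij_betw (\<lambda>(i, j). (i + k, j + m)) {d. (\<lambda>(i, j). n (i + k, j + m)) d \<noteq> 0} {d. n d \<noteq> 0}"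
    by (rule bij_betw_byWitness[where f' = "\<lambda>(i, j). (i - k, j - m)"]) auto
  have "chi_sum (\<lambda>(i, j). n (i + k, j + m)) =
    (\<Sum>d | (\<lambda>(i, j). n (i + k, j + m)) d \<noteq> 0. of_int (sg k) * (Tpow m * chi_term n ((\<lambda>(i, j). (i + k, j + m)) d)))"
    unfolding chi_sum_def
  proof (rule sum.cong[OF refl])
    fix d :: "int \<times> int"
    obtain i j where d: "d = (i, j)" by (cases d)
    have T: "Tpow (- j) = Tpow m * Tpow (- (j + m))" by (simp flip: Tpow_add)
    have "sg i = sg k * sg (i + k)" by (simp add: sg_add mult.left_commute[of "sg k"] sg_sq)
    then have "of_int (sg i * int (n (i + k, j + m))) = (of_int (sg k) * of_int (sg (i + k) * int (n (i + k, j + m))) :: ut)"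
      by (simp only: mult.assoc flip: of_int_mult)
    then show "chi_term (\<lambda>(i, j). n (i + k, j + m)) d = of_int (sg k) * (Tpow m * chi_term n ((\<lambda>(i, j). (i + k, j + m)) d))"
      unfolding d chi_term_def using T
      by (simp only: fst_conv snd_conv case_prod_conv mult.assoc) (metis Tpow_central mult.assoc)
  qed
  also have "\<dots> = (\<Sum>d | n d \<noteq> 0. of_int (sg k) * (Tpow m * chi_term n d))"
    by (rule sum.reindex_bij_betw[OF b])
  finally show ?thesis by (simp add: chi_sum_def sum_distrib_left)
qed

definition chi :: "idx \<Rightarrow> amod \<Rightarrow> ut" where
  "chi \<Gamma> X = chi_sum (nd \<Gamma> X)"

lemma chi_proj: "chi \<Gamma> (projA \<Gamma>') = (if \<Gamma> = \<Gamma>' then 1 else 0)"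
  by (cases "\<Gamma> = \<Gamma>'") (simp_all add: chi_def chi_sum_def nd_proj chi_term_def sg_def)

lemma chi_shift: "chi \<Gamma> (dg_shift k m X) = of_int (sg k) * (Tpow m * chi \<Gamma> X)"
proof -
  have "nd \<Gamma> (dg_shift k m X) = (\<lambda>(i, j). nd \<Gamma> X (i + k, j + m))"
    by (auto simp: nd_shift fun_eq_iff)
  then show ?thesis by (simp add: chi_def chi_sum_shift)
qed

lemma chi_cone:
  assumes "M \<in> DGP" "N \<in> DGP" "f \<in> cocycles0 M N"
  shows "chi \<Gamma> (mcone M N f) = chi \<Gamma> N - chi \<Gamma> M"
proof -
  have "nd \<Gamma> (mcone M N f) = (\<lambda>d. nd \<Gamma> (dg_shift 1 0 M) d + nd \<Gamma> N d)"
    by (auto simp: nd_cone[OF assms] nd_shift fun_eq_iff)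
  then have "chi \<Gamma> (mcone M N f) = chi \<Gamma> (dg_shift 1 0 M) + chi \<Gamma> N"
    unfolding chi_def by (simp only: chi_sum_add[OF nd_support[OF DGP_shift[OF assms(1)]] nd_support[OF assms(2)]])
  then show ?thesis by (simp add: chi_shift sg_def)
qed

text \<open>The Euler characteristic is an integer combination of powers of \<open>T\<close>. This
  allows \<open>chi\<close> of the second argument to pass the left basis element in the product
  formula.\<close>

lemma chi_central: "x * chi \<Gamma> X = chi \<Gamma> X * x"
proof -
  have "x * chi_term n d = chi_term n d * x" for n d
    unfolding chi_term_def by (metis Tpow_central mult.assoc mult_of_int_commute)
  then show ?thesis by (simp add: chi_def chi_sum_def sum_distrib_left sum_distrib_right)
qed

text \<open>A contraction splits the dual complex. If \<open>K\<close> denotes the functionals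
  vanishing on boundaries, the dual in degree \<open>(i, j)\<close> is
  \<open>K (i, j) \<times> K (i - 1, j)\<close>, so each dimension of \<open>K\<close> is counted
  twice with opposite signs.\<close>

lemma chi_contractible:
  assumes X: "X \<in> DGP" and E: "HPr.E X = 0"
  shows "chi \<Gamma> X = 0"
proof -
  interpret X: dgmod X using X by (rule dgmod_DGP)
  obtain h' where h': "h' \<in> HPr.chain (-1) X X" "ve X = vD * h' + h' * vD"
    using HPr.cls_eq_0[OF X X HPr.cyc_e[OF X]] E by (auto simp: HPr.E_def)
  define h where "h = fn X X h'"
  have h: "h \<in> carrier (dg_hom (-1) X X)" "emb X X h = h'" using chain_fn[OF X X h'(1)] by (auto simp: h_def)
  note ha = dg_hom_addmap[OF h(1)]
  have "emb X X (dg_hom_diff X X h) = emb X X (\<lambda>x \<in> carrier X. x)"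
    using emb_diff[OF X X ha] h h' by (simp add: ve_def)
  then have hid: "dg_hom_diff X X h = (\<lambda>x \<in> carrier X. x)"
    using emb_inject[OF X X addmap_diff[OF X X ha] addmap_id[OF X]] by blast
  have hd: "diff X (h x) \<oplus>\<^bsub>X\<^esub> h (diff X x) = x" if "x \<in> carrier X" for x
    using fun_cong[OF hid, of x] that unfolding dg_hom_diff_def restrict_apply by simp
  have hc: "h x \<in> carrier X" if "x \<in> carrier X" for x using addmap_closed[OF ha that] .
  have dm: "(\<lambda>x \<in> carrier X. diff X x) \<in> carrier (dg_hom 1 X X)"
    by (rule DGP_carrier_dg_homI) (auto simp: X X.diff_add X.diff_smult X.diff_homog)
  define K where "K d = {g \<in> dual \<Gamma> X d. \<forall>x \<in> carrier X. g (diff X x) = 0}" for d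
  have K_sub: "K d \<subseteq> dual \<Gamma> X d" for d by (auto simp: K_def)
  have K_fin: "finite (K d)" for d using K_sub dual_finite[OF X] finite_subset by blast
  have K_zero: "(\<lambda>x \<in> carrier X. 0) \<in> K d" for d using dual_zero[OF X] by (simp add: K_def)
  define k where "k d = multiplicity 2 (card (K d))" for d
  \<comment> \<open>Since \<open>d h + h d\<close> is the identity, \<open>g + g d h\<close> equals
    \<open>g h d\<close>, which vanishes on boundaries; the second component is \<open>g d\<close>.
    Conversely \<open>g\<close> is recovered as \<open>a + b h\<close>.\<close>
  let ?\<Phi> = "\<lambda>g. (\<lambda>x \<in> carrier X. g x + g (diff X (h x)), \<lambda>x \<in> carrier X. g (diff X x))"
  let ?\<Psi> = "\<lambda>(a, b). \<lambda>x \<in> carrier X. a x + b (h x) :: bit"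
  have bij: "bij_betw ?\<Phi> (dual \<Gamma> X (i, j)) (K (i, j) \<times> K (i - 1, j))" for i j
  proof (rule bij_betw_byWitness[where f' = ?\<Psi>])
    have dgd: "(\<lambda>x \<in> carrier X. g (diff X x)) \<in> dual \<Gamma> X (i - 1, j)" if "g \<in> dual \<Gamma> X (i, j)" for g i j
      using dual_comp[OF X X dm that] by (simp cong: restrict_cong)
    have dgh: "(\<lambda>x \<in> carrier X. g (h x)) \<in> dual \<Gamma> X (i + 1, j)" if "g \<in> dual \<Gamma> X (i, j)" for g i j
      using dual_comp[OF X X h(1) that] by simp
    have g0: "g \<zero>\<^bsub>X\<^esub> = 0" if "g \<in> dual \<Gamma> X (i, j)" for g i j
      using dualD(2)[OF that, of "\<zero>\<^bsub>X\<^esub>" "\<zero>\<^bsub>X\<^esub>"] by simp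
    have ghd: "g (diff X (h x)) + g (h (diff X x)) = g x" if "g \<in> dual \<Gamma> X (i, j)" "x \<in> carrier X" for g x i j
      using dualD(2)[OF that(1), of "diff X (h x)" "h (diff X x)"] hd[OF that(2)] hc that(2) by simp
    show "\<forall>g \<in> dual \<Gamma> X (i, j). ?\<Psi> (?\<Phi> g) = g"
    proof
      fix g assume g: "g \<in> dual \<Gamma> X (i, j)"
      show "?\<Psi> (?\<Phi> g) = g"
        by (rule extensionalityI[of _ "carrier X"]) (use dualD(1)[OF g] hc in \<open>auto simp: add.assoc\<close>)
    qed
    show "?\<Phi> ` dual \<Gamma> X (i, j) \<subseteq> K (i, j) \<times> K (i - 1, j)"
    proof clarify
      fix g assume g: "g \<in> dual \<Gamma> X (i, j)"
      have "(\<lambda>x \<in> carrier X. g (diff X (h x))) \<in> dual \<Gamma> X (i, j)"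
        using dgh[OF dgd[OF g]] hc by (simp cong: restrict_cong)
      from dual_add[OF X g this] have 1: "(\<lambda>x \<in> carrier X. g x + g (diff X (h x))) \<in> dual \<Gamma> X (i, j)"
        by (simp cong: restrict_cong)
      have "g (diff X x) + g (diff X (h (diff X x))) = 0" if "x \<in> carrier X" for x
      proof -
        have "g (diff X (h (diff X x))) = g (diff X x)"
          using ghd[OF g X.diff_closed[OF that]]
          unfolding X.diff_diff[OF that] addmap_zero[OF X X ha] g0[OF g] by (simp only: add_0_right)
        then show ?thesis by simp
      qed
      with 1 dgd[OF g] g0[OF g] show "(\<lambda>x \<in> carrier X. g x + g (diff X (h x))) \<in> K (i, j) \<and>
         (\<lambda>x \<in> carrier X. g (diff X x)) \<in> K (i - 1, j)"
        by (simp add: K_def X.diff_diff)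
    qed
    show "?\<Psi> ` (K (i, j) \<times> K (i - 1, j)) \<subseteq> dual \<Gamma> X (i, j)"
    proof clarify
      fix a b assume "a \<in> K (i, j)" "b \<in> K (i - 1, j)"
      then have "a \<in> dual \<Gamma> X (i, j)" "(\<lambda>x \<in> carrier X. b (h x)) \<in> dual \<Gamma> X (i, j)"
        using dgh[of b "i - 1" j] by (auto simp: K_def)
      from dual_add[OF X this] show "(\<lambda>x \<in> carrier X. a x + b (h x)) \<in> dual \<Gamma> X (i, j)"
        by (simp cong: restrict_cong)
    qed
    show "\<forall>ab \<in> K (i, j) \<times> K (i - 1, j). ?\<Phi> (?\<Psi> ab) = ab"
    proof (clarify, intro conjI)
      fix a b assume "a \<in> K (i, j)" "b \<in> K (i - 1, j)"
      then have a: "a \<in> dual \<Gamma> X (i, j)" "\<And>x. x \<in> carrier X \<Longrightarrow> a (diff X x) = 0"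
        and b: "b \<in> dual \<Gamma> X (i - 1, j)" "\<And>x. x \<in> carrier X \<Longrightarrow> b (diff X x) = 0" by (auto simp: K_def)
      have bd: "b (h (diff X x)) = b x" if "x \<in> carrier X" for x
        using ghd[OF b(1) that] unfolding b(2)[OF hc[OF that]] by (simp only: add_0_left)
      show "(\<lambda>x\<in>carrier X. (\<lambda>x\<in>carrier X. a x + b (h x)) x + (\<lambda>x\<in>carrier X. a x + b (h x)) (diff X (h x))) = a"
        by (rule extensionalityI[of _ "carrier X"]) (use dualD(1)[OF a(1)] a b bd hc in \<open>auto simp: add.assoc\<close>)
      show "(\<lambda>x\<in>carrier X. (\<lambda>x\<in>carrier X. a x + b (h x)) (diff X x)) = b"
        by (rule extensionalityI[of _ "carrier X"]) (use dualD(1)[OF b(1)] a b bd hc in auto)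
    qed
  qed
  have nk: "nd \<Gamma> X (i, j) = k (i, j) + k (i - 1, j)" for i j
    using bij_betw_same_card[OF bij[of i j]] multiplicity_card_Times[of "K (i, j)" "K (i - 1, j)"] K_fin K_zero
    unfolding nd_def k_def by fastforce
  have kfin: "finite {d. k d \<noteq> 0}"
    by (rule finite_subset[OF _ nd_support[OF X, of \<Gamma>]]) (auto simp: nk)
  have k'fin: "finite {d. (\<lambda>(i, j). k (i + (- 1), j + 0)) d \<noteq> 0}"
    by (rule finite_subset[OF _ nd_support[OF X, of \<Gamma>]]) (auto simp: nk)
  \<comment> \<open>The second summand is \<open>k\<close> shifted by -1 in the cohomological
    degree, so by \<open>chi_sum_shift\<close> it contributes the negative of the first.\<close>
  have "nd \<Gamma> X = (\<lambda>d. k d + (\<lambda>(i, j). k (i + (- 1), j + 0)) d)" by (auto simp: nk fun_eq_iff)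
  then have "chi \<Gamma> X = chi_sum k + chi_sum (\<lambda>(i, j). k (i + (- 1), j + 0))"
    unfolding chi_def using chi_sum_add[OF kfin k'fin] by simp
  then show ?thesis unfolding chi_sum_shift by (simp add: sg_def)
qed

definition phi0 :: "amod \<Rightarrow> ut" where
  "phi0 X = (\<Sum>\<Gamma>\<in>{IxF, IxI, IxEF, IxE}. chi \<Gamma> X * ut_basis \<Gamma>)"

lemma phi0_proj: "phi0 (projA \<Gamma>) = ut_basis \<Gamma>"
  by (cases \<Gamma>) (simp_all add: phi0_def chi_proj)

lemma phi0_shift: "phi0 (dg_shift k m X) = of_int (sg k) * (Tpow m * phi0 X)"
  unfolding phi0_def sum_distrib_left by (simp add: chi_shift mult.assoc)

lemma phi0_cone: "M \<in> DGP \<Longrightarrow> N \<in> DGP \<Longrightarrow> f \<in> cocycles0 M N \<Longrightarrow> phi0 (mcone M N f) = phi0 N - phi0 M"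
  by (simp add: phi0_def chi_cone algebra_simps)

lemma phi0_contractible: "X \<in> DGP \<Longrightarrow> HPr.E X = 0 \<Longrightarrow> phi0 X = 0"
  by (simp add: phi0_def chi_contractible)

lemma phi0_vcn:
  assumes "X \<in> DGP" "Y \<in> DGP" "r \<in> HPr.cyc X Y" shows "phi0 (vcn X Y r) = phi0 Y - phi0 X"
  unfolding vcn_def using phi0_cone[OF assms(1,2) cyc_fn[OF assms]] .

text \<open>\<open>cone r\<close> is isomorphic to the contractible \<open>cone e\<^sub>X\<close>, on which \<open>phi0\<close> vanishes.\<close>

lemma phi0_hiso:
  assumes "X \<in> DGP" "Y \<in> DGP" "HPr.hiso X Y a" shows "phi0 X = phi0 Y"
proof -
  obtain r where r: "r \<in> HPr.cyc X Y" "vcls r = a" using HPr.hm_rep[OF assms(1,2) HPr.hiso_hm[OF assms(3)]] by blast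
  note X = assms(1,1) HPr.cyc_e[OF assms(1)] and Y = assms(1,2) r(1)
  have "a * vcls (ve X) = vcls r * HPr.E X" using r by (simp add: HPr.E_def)
  then obtain c where c: "HPr.hiso (vcn X X (ve X)) (vcn X Y r) c"
    using HPr.cone_iso[OF X Y HPr.hiso_E[OF assms(1)] assms(3)] by blast
  obtain c' where "c * c' = HPr.E (vcn X Y r)" "HPr.hiso (vcn X Y r) (vcn X X (ve X)) c'"
    using HPr.hiso_inv[OF c] by blast
  moreover from this(2) have "c' = HPr.E (vcn X X (ve X)) * c'" using HPr.hm_left[OF HPr.hiso_hm] by metis
  ultimately have "HPr.E (vcn X Y r) = 0"
    using HPr.cone_E_zero[OF assms(1)] by (metis mult_zero_left mult_zero_right)
  then have "phi0 (vcn X Y r) = 0" using phi0_contractible HPr.cone[OF Y] by blast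
  then show ?thesis by (simp add: phi0_vcn[OF Y])
qed

lemma phi0_Dist:
  assumes "(X, Y, Z, u, v, w) \<in> Dist HP" shows "phi0 Y = phi0 X + phi0 Z"
proof -
  from Dist_HP_D(2)[OF assms] obtain M N f a b c where M: "M \<in> DGP" "N \<in> DGP" "f \<in> HPr.cyc M N"
    and i: "HPr.hiso X M a" "HPr.hiso Y N b" "HPr.hiso Z (vcn M N f) c" and D: "X \<in> DGP" "Y \<in> DGP" "Z \<in> DGP"
    by (auto simp: HPr.dist_def)
  have "vcn M N f \<in> DGP" using HPr.cone[OF M] by blast
  then show ?thesis
    using phi0_hiso[OF D(1) M(1) i(1)] phi0_hiso[OF D(2) M(2) i(2)] phi0_hiso[OF D(3) _ i(3)] phi0_vcn[OF M] by simp
qed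

section \<open>DG functors on modules\<close>

text \<open>The data of a DG functor on actual functions between carriers, the form in which tensor
  products supply it; \<open>Fr\<close> transports it to the endomorphism ring.\<close>

locale model_functor =
  fixes F :: "amod \<Rightarrow> amod" and T :: "amod \<Rightarrow> amod \<Rightarrow> (elt \<Rightarrow> elt) \<Rightarrow> elt \<Rightarrow> elt"
  assumes F_DGP: "X \<in> DGP \<Longrightarrow> F X \<in> DGP"
    and T_hom: "X \<in> DGP \<Longrightarrow> Y \<in> DGP \<Longrightarrow> f \<in> carrier (dg_hom k X Y) \<Longrightarrow> T X Y f \<in> carrier (dg_hom k (F X) (F Y))"
    and T_plus: "X \<in> DGP \<Longrightarrow> Y \<in> DGP \<Longrightarrow> f \<in> carrier (dg_hom k X Y) \<Longrightarrow> g \<in> carrier (dg_hom k X Y) \<Longrightarrow>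
      T X Y (\<lambda>x \<in> carrier X. f x \<oplus>\<^bsub>Y\<^esub> g x) = (\<lambda>x \<in> carrier (F X). T X Y f x \<oplus>\<^bsub>F Y\<^esub> T X Y g x)"
    and T_compose: "X \<in> DGP \<Longrightarrow> Y \<in> DGP \<Longrightarrow> Z \<in> DGP \<Longrightarrow> f \<in> carrier (dg_hom k X Y) \<Longrightarrow> g \<in> carrier (dg_hom l Y Z) \<Longrightarrow>
      T X Z (compose (carrier X) g f) = compose (carrier (F X)) (T Y Z g) (T X Y f)"
    and T_id: "X \<in> DGP \<Longrightarrow> T X X (\<lambda>x \<in> carrier X. x) = (\<lambda>x \<in> carrier (F X). x)"
    and T_diff: "X \<in> DGP \<Longrightarrow> Y \<in> DGP \<Longrightarrow> f \<in> carrier (dg_hom k X Y) \<Longrightarrow>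
      T X Y (dg_hom_diff X Y f) = dg_hom_diff (F X) (F Y) (T X Y f)"
begin

definition Fr :: "amod \<Rightarrow> amod \<Rightarrow> vend \<Rightarrow> vend" where
  "Fr X Y r = emb (F X) (F Y) (T X Y (fn X Y r))"

lemma fn_plus:
  assumes "X \<in> DGP" "Y \<in> DGP" "r \<in> HPr.chain k X Y" "r' \<in> HPr.chain k X Y"
  shows "fn X Y (r + r') = (\<lambda>x \<in> carrier X. fn X Y r x \<oplus>\<^bsub>Y\<^esub> fn X Y r' x)"
proof -
  note f = chain_fn[OF assms(1-3)] and f' = chain_fn[OF assms(1,2,4)]
  note a = dg_hom_addmap[OF f(1)] dg_hom_addmap[OF f'(1)]
  show ?thesis
    using fn_emb[OF assms(1,2) addmap_plus[OF assms(2,1) a]] emb_plus[OF assms(1,2) a] f f' by simp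
qed

lemma fn_mult:
  assumes "X \<in> DGP" "Y \<in> DGP" "Z \<in> DGP" "r \<in> HPr.chain k X Y" "r' \<in> HPr.chain l Y Z"
  shows "fn X Z (r' * r) = compose (carrier X) (fn Y Z r') (fn X Y r)"
proof -
  note f = chain_fn[OF assms(1,2,4)] and f' = chain_fn[OF assms(2,3,5)]
  note a = dg_hom_addmap[OF f(1)] dg_hom_addmap[OF f'(1)]
  show ?thesis
    using fn_emb[OF assms(1,3) addmap_compose[OF assms(1) a]] emb_mult[OF assms(1-3) a] f f' by simp
qed

lemma fn_D:
  assumes "X \<in> DGP" "Y \<in> DGP" "r \<in> HPr.chain k X Y"
  shows "fn X Y (vD * r + r * vD) = dg_hom_diff X Y (fn X Y r)"
proof -
  note f = chain_fn[OF assms]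
  note a = dg_hom_addmap[OF f(1)]
  show ?thesis
    using fn_emb[OF assms(1,2) addmap_diff[OF assms(1,2) a]] emb_diff[OF assms(1,2) a] f by simp
qed

sublocale dg: dg_functor vdeg vD DGP ve "dg_shift 1 0" vs vt vcn vci vcp vcj vcq vcls F Fr
proof unfold_locales
  fix X assume X: "X \<in> DGP"
  show "F X \<in> DGP" using F_DGP[OF X] .
  show "Fr X X (ve X) = ve (F X)"
    using fn_emb[OF X X addmap_id[OF X]] by (simp add: Fr_def ve_def T_id[OF X])
next
  fix X Y r k assume X: "X \<in> DGP" "Y \<in> DGP" and r: "r \<in> HPr.chain k X Y"
  note f = chain_fn[OF X r]
  note Th = T_hom[OF X f(1)]
  show "Fr X Y r \<in> HPr.chain k (F X) (F Y)"
    unfolding Fr_def using emb_chain[OF F_DGP F_DGP Th] X by blast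
  show "Fr X Y (vD * r + r * vD) = vD * Fr X Y r + Fr X Y r * vD"
    unfolding Fr_def fn_D[OF X r] T_diff[OF X f(1)]
    using emb_diff[OF F_DGP F_DGP dg_hom_addmap[OF Th]] X by blast
  fix r' assume r': "r' \<in> HPr.chain k X Y"
  note f' = chain_fn[OF X r']
  show "Fr X Y (r + r') = Fr X Y r + Fr X Y r'"
    unfolding Fr_def fn_plus[OF X r r'] T_plus[OF X f(1) f'(1)]
    using emb_plus[OF F_DGP F_DGP dg_hom_addmap[OF Th] dg_hom_addmap[OF T_hom[OF X f'(1)]]] X by blast
next
  fix X Y Z r r' k l assume X: "X \<in> DGP" "Y \<in> DGP" "Z \<in> DGP" and r: "r \<in> HPr.chain k X Y" "r' \<in> HPr.chain l Y Z"
  note f = chain_fn[OF X(1,2) r(1)] chain_fn[OF X(2,3) r(2)]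
  show "Fr X Z (r' * r) = Fr Y Z r' * Fr X Y r"
    unfolding Fr_def fn_mult[OF X r] T_compose[OF X f(1,3)]
    using emb_mult[OF F_DGP[OF X(1)] F_DGP[OF X(2)] F_DGP[OF X(3)] dg_hom_addmap[OF T_hom[OF X(1,2) f(1)]] dg_hom_addmap[OF T_hom[OF X(2,3) f(3)]]]
    by simp
qed

lemma T_cocycles0:
  assumes "X \<in> DGP" "Y \<in> DGP" "f \<in> cocycles0 X Y"
  shows "T X Y f \<in> cocycles0 (F X) (F Y)" "hc (F X) (F Y) (T X Y f) = dg.hF X Y (hc X Y f)"
proof -
  note f = cocycles0_dg_hom[OF assms(3)]
  have e: "Fr X Y (emb X Y f) = emb (F X) (F Y) (T X Y f)"
    by (simp add: Fr_def fn_emb[OF assms(1,2) dg_hom_addmap[OF f]])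
  show "hc (F X) (F Y) (T X Y f) = dg.hF X Y (hc X Y f)"
    using dg.hF_cls[OF assms(1,2) emb_cyc[OF assms]] e by simp
  show "T X Y f \<in> cocycles0 (F X) (F Y)"
    using dg.F_cyc[OF assms(1,2) emb_cyc[OF assms]] cyc_fn[OF F_DGP[OF assms(1)] F_DGP[OF assms(2)]]
      fn_emb[OF F_DGP[OF assms(1)] F_DGP[OF assms(2)] dg_hom_addmap[OF T_hom[OF assms(1,2) f]]] e by metis
qed

text \<open>Any map on cosets that induces \<open>hF\<close> on ring classes is exact. Leaving
  \<open>Tm\<close> free allows the bifunctor with one argument fixed to an identity to be
  inserted.\<close>

lemma exact_functor_of_hF:
  assumes m: "\<And>X Y \<phi>. X \<in> DGP \<Longrightarrow> Y \<in> DGP \<Longrightarrow> \<phi> \<in> carrier (hom_H0 X Y) \<Longrightarrow>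
      Tm X Y \<phi> \<in> carrier (hom_H0 (F X) (F Y)) \<and> hcl (F X) (F Y) (Tm X Y \<phi>) = dg.hF X Y (hcl X Y \<phi>)"
  shows "exact_functor HP HP F Tm"
proof -
  have hm: "X \<in> DGP \<Longrightarrow> Y \<in> DGP \<Longrightarrow> \<phi> \<in> carrier (hom_H0 X Y) \<Longrightarrow> Tm X Y \<phi> \<in> carrier (hom_H0 (F X) (F Y))"
    and he: "X \<in> DGP \<Longrightarrow> Y \<in> DGP \<Longrightarrow> \<phi> \<in> carrier (hom_H0 X Y) \<Longrightarrow> hcl (F X) (F Y) (Tm X Y \<phi>) = dg.hF X Y (hcl X Y \<phi>)"
    for X Y \<phi> using m by blast+
  have ad: "additive_functor HP HP F Tm"
    unfolding additive_functor_def HP_simps(1,2)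
  proof (intro conjI ballI)
    fix X Y assume X: "X \<in> DGP" "Y \<in> DGP"
    note FX = F_DGP[OF X(1)] F_DGP[OF X(2)]
    show "Tm X Y \<in> hom (hom_H0 X Y) (hom_H0 (F X) (F Y))"
      by (rule homI) (use hm[OF X] he[OF X] hcl_mult[OF X] hcl_mult[OF FX] hcl_hm[OF X] dg.hF_add[OF X] in
        \<open>simp_all add: hcl_inject[OF FX]\<close>)
  next
    fix X assume X: "X \<in> DGP"
    note FX = F_DGP[OF X]
    show "Tm X X (Ident HP X) = Ident HP (F X)"
      using hm[OF X X] he[OF X X] hcl_Ident[OF X] hcl_Ident[OF FX] dg.hF_E[OF X] by (simp add: hcl_inject[OF FX FX])
  next
    fix X Y Z \<phi> \<psi> assume X: "X \<in> DGP" "Y \<in> DGP" "Z \<in> DGP" and f: "\<phi> \<in> carrier (hom_H0 X Y)" "\<psi> \<in> carrier (hom_H0 Y Z)"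
    note FX = F_DGP[OF X(1)] F_DGP[OF X(2)] F_DGP[OF X(3)]
    show "Tm X Z (Comp HP X Y Z \<psi> \<phi>) = Comp HP (F X) (F Y) (F Z) (Tm Y Z \<psi>) (Tm X Y \<phi>)"
      using hcl_Comp[OF X f] hcl_Comp[OF FX hm[OF X(1,2) f(1)] hm[OF X(2,3) f(2)]] hm[OF X(1,3)] he[OF X(1,3)]
        he[OF X(1,2) f(1)] he[OF X(2,3) f(2)] dg.hF_mult[OF X hcl_hm[OF X(1,2) f(1)] hcl_hm[OF X(2,3) f(2)]]
      by (simp add: hcl_inject[OF FX(1,3)])
  qed (rule F_DGP)
  \<comment> \<open>The comparison \<open>shF\<close> lives in the ring; a coset lying over it is
    chosen.\<close>
  define \<theta> where "\<theta> X = (SOME \<theta>. \<theta> \<in> carrier (hom_H0 (F (dg_shift 1 0 X)) (dg_shift 1 0 (F X))) \<and>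
    hcl (F (dg_shift 1 0 X)) (dg_shift 1 0 (F X)) \<theta> = dg.shF X)" for X
  have \<theta>: "\<theta> X \<in> carrier (hom_H0 (F (dg_shift 1 0 X)) (dg_shift 1 0 (F X)))"
    "hcl (F (dg_shift 1 0 X)) (dg_shift 1 0 (F X)) (\<theta> X) = dg.shF X" if X: "X \<in> DGP" for X
  proof -
    have S: "F (dg_shift 1 0 X) \<in> DGP" "dg_shift 1 0 (F X) \<in> DGP" using X by (auto intro: F_DGP DGP_shift)
    obtain t where "t \<in> carrier (hom_H0 (F (dg_shift 1 0 X)) (dg_shift 1 0 (F X)))"
      "hcl (F (dg_shift 1 0 X)) (dg_shift 1 0 (F X)) t = dg.shF X"
      using hcl_surj[OF S HPr.hiso_hm[OF dg.shF_hiso(1)[OF X]]] .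
    then show "\<theta> X \<in> carrier (hom_H0 (F (dg_shift 1 0 X)) (dg_shift 1 0 (F X)))"
      "hcl (F (dg_shift 1 0 X)) (dg_shift 1 0 (F X)) (\<theta> X) = dg.shF X"
      unfolding \<theta>_def by (metis (mono_tags, lifting) someI_ex)+
  qed
  show ?thesis
    unfolding exact_functor_def HP_simps(1-4)
  proof (intro conjI ad exI[of _ \<theta>] ballI allI impI)
    fix X assume X: "X \<in> DGP"
    have S: "F (dg_shift 1 0 X) \<in> DGP" "dg_shift 1 0 (F X) \<in> DGP" using X by (auto intro: F_DGP DGP_shift)
    show "iso_mor HP (F (dg_shift 1 0 X)) (dg_shift 1 0 (F X)) (\<theta> X)"
      using \<theta>[OF X] dg.shF_hiso(1)[OF X] by (simp add: iso_mor_HP[OF S])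
  next
    fix X Y \<phi> assume X: "X \<in> DGP" "Y \<in> DGP" and f: "\<phi> \<in> carrier (hom_H0 X Y)"
    note S = DGP_shift[OF X(1), of 1 0] DGP_shift[OF X(2), of 1 0]
    note FX = F_DGP[OF X(1)] F_DGP[OF X(2)]
    note SF = DGP_shift[OF FX(1), of 1 0] DGP_shift[OF FX(2), of 1 0]
    note FS = F_DGP[OF S(1)] F_DGP[OF S(2)]
    note sf = hcl_shift[OF X f] and sF = hcl_shift[OF FX hm[OF X f]]
    show "Comp HP (F (dg_shift 1 0 X)) (F (dg_shift 1 0 Y)) (dg_shift 1 0 (F Y)) (\<theta> Y) (Tm (dg_shift 1 0 X) (dg_shift 1 0 Y) \<phi>)
      = Comp HP (F (dg_shift 1 0 X)) (dg_shift 1 0 (F X)) (dg_shift 1 0 (F Y)) (Tm X Y \<phi>) (\<theta> X)"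
      using hcl_Comp[OF FS SF(2) hm[OF S sf(1)] \<theta>(1)[OF X(2)]] hcl_Comp[OF FS(1) SF \<theta>(1)[OF X(1)] sF(1)]
        he[OF S sf(1)] sf(2) sF(2) \<theta>(2)[OF X(1)] \<theta>(2)[OF X(2)] he[OF X f] dg.shF_natural[OF X hcl_hm[OF X f]]
      by (simp add: hcl_inject[OF FS(1) SF(2)])
  next
    fix X Y Z u v w assume d: "(X, Y, Z, u, v, w) \<in> Dist HP"
    note d' = Dist_HP_D[OF d]
    note X = htriangle_hm[OF d'(1)]
    have m: "u \<in> carrier (hom_H0 X Y)" "v \<in> carrier (hom_H0 Y Z)" "w \<in> carrier (hom_H0 Z (dg_shift 1 0 X))"
      using d'(1) by (auto simp: htriangle_def)
    note FX = F_DGP[OF X(1)] F_DGP[OF X(2)] F_DGP[OF X(3)] F_DGP[OF X(4)]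
    have SF: "dg_shift 1 0 (F X) \<in> DGP" using FX(1) by (rule DGP_shift)
    note w = hcl_Comp[OF FX(3,4) SF hm[OF X(3,4) m(3)] \<theta>(1)[OF X(1)]]
    show "(F X, F Y, F Z, Tm X Y u, Tm Y Z v, Comp HP (F Z) (F (dg_shift 1 0 X)) (dg_shift 1 0 (F X)) (\<theta> X) (Tm Z (dg_shift 1 0 X) w)) \<in> Dist HP"
      unfolding Dist_HP htriangle_def
      using FX hm[OF X(1,2) m(1)] hm[OF X(2,3) m(2)] w dg.hF_dist[OF d'(2)] he[OF X(1,2) m(1)] he[OF X(2,3) m(2)]
       he[OF X(3,4) m(3)] \<theta>(2)[OF X(1)] by simp
  qed
qed

end

section \<open>Tensor products over the semisimple quotient of \<open>A\<close>\<close>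

text \<open>\<open>Ten X Q\<close> is \<open>\<Oplus>\<^sub>\<Gamma> (S\<^sub>\<Gamma> \<otimes>\<^sub>A X) \<otimes> Q \<Gamma>\<close>, where \<open>S\<^sub>\<Gamma>\<close> is the simple right \<open>A\<close>-module \<open>\<bbbF>\<^sub>2\<close> on
  which \<open>A\<close> acts through the character \<open>eps \<Gamma>\<close>.  It is characterised by the balanced maps out of it, and
  exists inside \<open>DGP(A)\<close> because \<open>S\<^sub>\<Gamma> \<otimes>\<^sub>A P(\<Gamma>') = \<delta>\<^sub>\<Gamma>\<^sub>\<Gamma>\<^sub>' \<bbbF>\<^sub>2\<close>.\<close>

definition balanced :: "amod \<Rightarrow> (idx \<Rightarrow> amod) \<Rightarrow> amod \<Rightarrow> (idx \<Rightarrow> elt \<Rightarrow> elt \<Rightarrow> elt) \<Rightarrow> bool" where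
  "balanced X Q W s \<longleftrightarrow> (\<forall>\<Gamma>. \<forall>x \<in> carrier X. \<forall>q \<in> carrier (Q \<Gamma>). s \<Gamma> x q \<in> carrier W \<and>
     (\<forall>x' \<in> carrier X. s \<Gamma> (x \<oplus>\<^bsub>X\<^esub> x') q = s \<Gamma> x q \<oplus>\<^bsub>W\<^esub> s \<Gamma> x' q) \<and>
     (\<forall>q' \<in> carrier (Q \<Gamma>). s \<Gamma> x (q \<oplus>\<^bsub>Q \<Gamma>\<^esub> q') = s \<Gamma> x q \<oplus>\<^bsub>W\<^esub> s \<Gamma> x q') \<and>
     (\<forall>a. s \<Gamma> (a \<odot>\<^bsub>X\<^esub> x) q = (if eps \<Gamma> a = 1 then s \<Gamma> x q else \<zero>\<^bsub>W\<^esub>)) \<and>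
     (\<forall>a. s \<Gamma> x (a \<odot>\<^bsub>Q \<Gamma>\<^esub> q) = a \<odot>\<^bsub>W\<^esub> s \<Gamma> x q))"

definition lin :: "amod \<Rightarrow> amod \<Rightarrow> (elt \<Rightarrow> elt) set" where
  "lin M N = {f \<in> addmap M N. \<forall>r. \<forall>x \<in> carrier M. f (r \<odot>\<^bsub>M\<^esub> x) = r \<odot>\<^bsub>N\<^esub> f x}"

definition ten_degree :: "amod \<Rightarrow> (idx \<Rightarrow> amod) \<Rightarrow> amod \<Rightarrow> (idx \<Rightarrow> elt \<Rightarrow> elt \<Rightarrow> elt) \<Rightarrow> bool" where
  "ten_degree X Q B t \<longleftrightarrow>
     (\<forall>\<Gamma> i j i' j'. \<forall>x \<in> homog X (i, j). \<forall>q \<in> homog (Q \<Gamma>) (i', j'). t \<Gamma> x q \<in> homog B (i + i', j + j'))"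

definition ten_leibniz :: "amod \<Rightarrow> (idx \<Rightarrow> amod) \<Rightarrow> amod \<Rightarrow> (idx \<Rightarrow> elt \<Rightarrow> elt \<Rightarrow> elt) \<Rightarrow> bool" where
  "ten_leibniz X Q B t \<longleftrightarrow> (\<forall>\<Gamma>. \<forall>x \<in> carrier X. \<forall>q \<in> carrier (Q \<Gamma>).
     diff B (t \<Gamma> x q) = t \<Gamma> (diff X x) q \<oplus>\<^bsub>B\<^esub> t \<Gamma> x (diff (Q \<Gamma>) q))"

text \<open>Generation by elementary tensors of homogeneous elements, phrased as an induction
  principle in each bidegree separately. Both the uniqueness of maps and the control of their degree
  follow from it.\<close>

definition ten_generated :: "amod \<Rightarrow> (idx \<Rightarrow> amod) \<Rightarrow> amod \<Rightarrow> (idx \<Rightarrow> elt \<Rightarrow> elt \<Rightarrow> elt) \<Rightarrow> bool" where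
  "ten_generated X Q B t \<longleftrightarrow>
     (\<forall>i j S. \<zero>\<^bsub>B\<^esub> \<in> S \<longrightarrow> (\<forall>b \<in> S. \<forall>b' \<in> S. b \<oplus>\<^bsub>B\<^esub> b' \<in> S) \<longrightarrow>
        (\<forall>\<Gamma> i' j' i'' j''. i = i' + i'' \<longrightarrow> j = j' + j'' \<longrightarrow>
          (\<forall>x \<in> homog X (i', j'). \<forall>q \<in> homog (Q \<Gamma>) (i'', j''). t \<Gamma> x q \<in> S)) \<longrightarrow>
        homog B (i, j) \<subseteq> S)"

text \<open>Only linearity is asked of the universal map. Its degree comes from
  \<open>ten_generated\<close>, its behaviour under the differential from
  \<open>ten_leibniz\<close>.\<close>

definition ten_universal :: "amod \<Rightarrow> (idx \<Rightarrow> amod) \<Rightarrow> amod \<Rightarrow> (idx \<Rightarrow> elt \<Rightarrow> elt \<Rightarrow> elt) \<Rightarrow> bool" where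
  "ten_universal X Q B t \<longleftrightarrow> (\<forall>W s. W \<in> DGP \<longrightarrow> balanced X Q W s \<longrightarrow>
        (\<exists>h \<in> lin B W. \<forall>\<Gamma>. \<forall>x \<in> carrier X. \<forall>q \<in> carrier (Q \<Gamma>). h (t \<Gamma> x q) = s \<Gamma> x q))"

definition is_ten :: "amod \<Rightarrow> (idx \<Rightarrow> amod) \<Rightarrow> amod \<Rightarrow> (idx \<Rightarrow> elt \<Rightarrow> elt \<Rightarrow> elt) \<Rightarrow> bool" where
  "is_ten X Q B t \<longleftrightarrow> B \<in> DGP \<and> balanced X Q B t \<and> ten_degree X Q B t \<and> ten_leibniz X Q B t \<and>
     ten_generated X Q B t \<and> ten_universal X Q B t"

lemma balancedD:
  assumes "balanced X Q W s" "x \<in> carrier X" "q \<in> carrier (Q \<Gamma>)"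
  shows "s \<Gamma> x q \<in> carrier W"
    "x' \<in> carrier X \<Longrightarrow> s \<Gamma> (x \<oplus>\<^bsub>X\<^esub> x') q = s \<Gamma> x q \<oplus>\<^bsub>W\<^esub> s \<Gamma> x' q"
    "q' \<in> carrier (Q \<Gamma>) \<Longrightarrow> s \<Gamma> x (q \<oplus>\<^bsub>Q \<Gamma>\<^esub> q') = s \<Gamma> x q \<oplus>\<^bsub>W\<^esub> s \<Gamma> x q'"
    "s \<Gamma> (a \<odot>\<^bsub>X\<^esub> x) q = (if eps \<Gamma> a = 1 then s \<Gamma> x q else \<zero>\<^bsub>W\<^esub>)"
    "s \<Gamma> x (a \<odot>\<^bsub>Q \<Gamma>\<^esub> q) = a \<odot>\<^bsub>W\<^esub> s \<Gamma> x q"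
  using assms unfolding balanced_def by blast+

lemma is_tenD:
  assumes "is_ten X Q B t"
  shows "B \<in> DGP" "balanced X Q B t"
    "x \<in> homog X (i, j) \<Longrightarrow> q \<in> homog (Q \<Gamma>) (i', j') \<Longrightarrow> t \<Gamma> x q \<in> homog B (i + i', j + j')"
    "x \<in> carrier X \<Longrightarrow> q \<in> carrier (Q \<Gamma>) \<Longrightarrow>
       diff B (t \<Gamma> x q) = t \<Gamma> (diff X x) q \<oplus>\<^bsub>B\<^esub> t \<Gamma> x (diff (Q \<Gamma>) q)"
    "W \<in> DGP \<Longrightarrow> balanced X Q W s \<Longrightarrow>
       \<exists>h \<in> lin B W. \<forall>\<Gamma>. \<forall>x \<in> carrier X. \<forall>q \<in> carrier (Q \<Gamma>). h (t \<Gamma> x q) = s \<Gamma> x q"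
proof -
  show "B \<in> DGP" "balanced X Q B t" using assms by (simp_all add: is_ten_def)
  show "x \<in> homog X (i, j) \<Longrightarrow> q \<in> homog (Q \<Gamma>) (i', j') \<Longrightarrow> t \<Gamma> x q \<in> homog B (i + i', j + j')"
    using assms by (simp add: is_ten_def ten_degree_def)
  show "x \<in> carrier X \<Longrightarrow> q \<in> carrier (Q \<Gamma>) \<Longrightarrow>
       diff B (t \<Gamma> x q) = t \<Gamma> (diff X x) q \<oplus>\<^bsub>B\<^esub> t \<Gamma> x (diff (Q \<Gamma>) q)"
    using assms by (simp add: is_ten_def ten_leibniz_def)
  show "W \<in> DGP \<Longrightarrow> balanced X Q W s \<Longrightarrow>
       \<exists>h \<in> lin B W. \<forall>\<Gamma>. \<forall>x \<in> carrier X. \<forall>q \<in> carrier (Q \<Gamma>). h (t \<Gamma> x q) = s \<Gamma> x q"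
    using assms unfolding is_ten_def ten_universal_def by simp
qed

lemma is_ten_generated:
  assumes "is_ten X Q B t" "\<zero>\<^bsub>B\<^esub> \<in> S" "\<And>b b'. b \<in> S \<Longrightarrow> b' \<in> S \<Longrightarrow> b \<oplus>\<^bsub>B\<^esub> b' \<in> S"
    "\<And>\<Gamma> i' j' i'' j'' x q. i = i' + i'' \<Longrightarrow> j = j' + j'' \<Longrightarrow>
          x \<in> homog X (i', j') \<Longrightarrow> q \<in> homog (Q \<Gamma>) (i'', j'') \<Longrightarrow> t \<Gamma> x q \<in> S"
  shows "homog B (i, j) \<subseteq> S"
proof -
  have "ten_generated X Q B t" using assms(1) by (simp add: is_ten_def)
  note this[unfolded ten_generated_def, rule_format, of S i j]
  from this[OF assms(2,3,4)] show ?thesis by simp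
qed

lemma lin_addmap: "f \<in> lin M N \<Longrightarrow> f \<in> addmap M N"
  by (simp add: lin_def)

lemma dg_hom_lin: "f \<in> carrier (dg_hom k M N) \<Longrightarrow> f \<in> lin M N"
  by (simp add: lin_def dg_hom_iff)

lemma linD: "f \<in> lin M N \<Longrightarrow> x \<in> carrier M \<Longrightarrow> f (r \<odot>\<^bsub>M\<^esub> x) = r \<odot>\<^bsub>N\<^esub> f x"
  by (simp add: lin_def)

text \<open>The set where two additive maps agree is closed under addition and contains the
  elementary tensors, hence each homogeneous part and then everything.\<close>

lemma ten_unique:
  assumes t: "is_ten X Q B t" and XQ: "X \<in> DGP" "\<And>\<Gamma>. Q \<Gamma> \<in> DGP"
    and W: "W \<in> DGP" and h: "h \<in> addmap B W" "h' \<in> addmap B W"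
    and eq: "\<And>\<Gamma> x q. x \<in> carrier X \<Longrightarrow> q \<in> carrier (Q \<Gamma>) \<Longrightarrow> h (t \<Gamma> x q) = h' (t \<Gamma> x q)"
  shows "h = h'"
proof (rule addmap_eqI[OF h])
  note B = is_tenD(1)[OF t]
  interpret B: dgmod B using B by (rule dgmod_DGP)
  interpret X: dgmod X using XQ by (intro dgmod_DGP) simp
  interpret Q: dgmod "Q \<Gamma>" for \<Gamma> using XQ by (intro dgmod_DGP) simp
  let ?S = "{b \<in> carrier B. h b = h' b}"
  have z: "h \<zero>\<^bsub>B\<^esub> = h' \<zero>\<^bsub>B\<^esub>" using addmap_zero[OF B W h(1)] addmap_zero[OF B W h(2)] by simp
  have a: "b \<oplus>\<^bsub>B\<^esub> b' \<in> ?S" if "b \<in> ?S" "b' \<in> ?S" for b b'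
    using that h by (simp add: addmap_add)
  have hs: "homog B (i, j) \<subseteq> ?S" for i j
    by (rule is_ten_generated[OF t _ a])
      (use z eq balancedD(1)[OF is_tenD(2)[OF t]] X.homog_closed Q.homog_closed in auto)
  fix b assume "b \<in> carrier B"
  then have "b \<in> ?S"
  proof (induction b rule: B.homog_induct)
    case (homog d x)
    then show ?case using hs[of "fst d" "snd d"] by auto
  qed (use z a in auto)
  then show "h b = h' b" by simp
qed

text \<open>The pairing of the target, composed with \<open>f\<close> and the
  \<open>g \<Gamma>\<close>, is balanced, so the universal property applies; generation then shows
  that the degrees add.\<close>

lemma ten_map:
  assumes t: "is_ten X Q B t" and XQ: "X \<in> DGP" "\<And>\<Gamma>. Q \<Gamma> \<in> DGP"
    and t': "is_ten X' Q' B' t'" and XQ': "X' \<in> DGP" "\<And>\<Gamma>. Q' \<Gamma> \<in> DGP"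
    and f: "f \<in> carrier (dg_hom k X X')" and g: "\<And>\<Gamma>. g \<Gamma> \<in> carrier (dg_hom l (Q \<Gamma>) (Q' \<Gamma>))"
  shows "\<exists>h \<in> carrier (dg_hom (k + l) B B'). \<forall>\<Gamma>. \<forall>x \<in> carrier X. \<forall>q \<in> carrier (Q \<Gamma>).
    h (t \<Gamma> x q) = t' \<Gamma> (f x) (g \<Gamma> q)"
proof -
  note B = is_tenD(1)[OF t] is_tenD(1)[OF t']
  interpret B: dgmod B using B by (intro dgmod_DGP) simp
  interpret B': dgmod B' using B by (intro dgmod_DGP) simp
  interpret X: dgmod X using XQ by (intro dgmod_DGP) simp
  interpret Q: dgmod "Q \<Gamma>" for \<Gamma> using XQ by (intro dgmod_DGP) simp
  note fa = dg_hom_addmap[OF f] and ga = dg_hom_addmap[OF g]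
  note fl = linD[OF dg_hom_lin[OF f]] and gl = linD[OF dg_hom_lin[OF g]]
  note b' = balancedD[OF is_tenD(2)[OF t']]
  have "balanced X Q B' (\<lambda>\<Gamma> x q. t' \<Gamma> (f x) (g \<Gamma> q))"
    unfolding balanced_def
    using addmap_closed[OF fa] addmap_closed[OF ga] addmap_add[OF fa] addmap_add[OF ga] fl gl b' by simp
  from is_tenD(5)[OF t B(2) this] obtain h where h: "h \<in> lin B B'"
    "\<And>\<Gamma> x q. x \<in> carrier X \<Longrightarrow> q \<in> carrier (Q \<Gamma>) \<Longrightarrow> h (t \<Gamma> x q) = t' \<Gamma> (f x) (g \<Gamma> q)" by blast
  note ha = lin_addmap[OF h(1)]
  have "h b \<in> homog B' (i + (k + l), j)" if "b \<in> homog B (i, j)" for b i j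
  proof -
    let ?S = "{b \<in> carrier B. h b \<in> homog B' (i + (k + l), j)}"
    have "homog B (i, j) \<subseteq> ?S"
    proof (rule is_ten_generated[OF t])
      fix \<Gamma> i' j' i'' j'' x q assume d: "i = i' + i''" "j = j' + j''" and xq: "x \<in> homog X (i', j')" "q \<in> homog (Q \<Gamma>) (i'', j'')"
      have "f x \<in> homog X' (i' + k, j')" "g \<Gamma> q \<in> homog (Q' \<Gamma>) (i'' + l, j'')"
        using f g[of \<Gamma>] xq by (auto simp: dg_hom_iff)
      from is_tenD(3)[OF t' this] have "t' \<Gamma> (f x) (g \<Gamma> q) \<in> homog B' (i + (k + l), j)"
        by (simp add: d ac_simps)
      then show "t \<Gamma> x q \<in> ?S"
        using h(2) X.homog_closed[OF xq(1)] Q.homog_closed[OF xq(2)] balancedD(1)[OF is_tenD(2)[OF t]] by simp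
    qed (use addmap_zero[OF B ha] addmap_add[OF ha] B'.homog_add in auto)
    with that show ?thesis by blast
  qed
  with h have "h \<in> carrier (dg_hom (k + l) B B')" by (auto simp: dg_hom_iff lin_def)
  with h(2) show ?thesis by blast
qed


lemma ten_generatedI:
  assumes "\<And>i j S. \<zero>\<^bsub>B\<^esub> \<in> S \<Longrightarrow> (\<And>b b'. b \<in> S \<Longrightarrow> b' \<in> S \<Longrightarrow> b \<oplus>\<^bsub>B\<^esub> b' \<in> S) \<Longrightarrow>
     (\<And>\<Gamma> i' j' i'' j'' x q. i = i' + i'' \<Longrightarrow> j = j' + j'' \<Longrightarrow>
          x \<in> homog X (i', j') \<Longrightarrow> q \<in> homog (Q \<Gamma>) (i'', j'') \<Longrightarrow> t \<Gamma> x q \<in> S) \<Longrightarrow> homog B (i, j) \<subseteq> S"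
  shows "ten_generated X Q B t"
  unfolding ten_generated_def by (intro allI impI assms) blast+

lemma ten_universalI:
  assumes "\<And>W s. W \<in> DGP \<Longrightarrow> balanced X Q W s \<Longrightarrow>
        \<exists>h \<in> lin B W. \<forall>\<Gamma>. \<forall>x \<in> carrier X. \<forall>q \<in> carrier (Q \<Gamma>). h (t \<Gamma> x q) = s \<Gamma> x q"
  shows "ten_universal X Q B t"
  unfolding ten_universal_def by (intro allI impI assms)

lemma linI:
  assumes "M \<in> DGP" "\<And>x. x \<in> carrier M \<Longrightarrow> h x \<in> carrier N"
    "\<And>x y. x \<in> carrier M \<Longrightarrow> y \<in> carrier M \<Longrightarrow> h (x \<oplus>\<^bsub>M\<^esub> y) = h x \<oplus>\<^bsub>N\<^esub> h y"
    "\<And>r x. x \<in> carrier M \<Longrightarrow> h (r \<odot>\<^bsub>M\<^esub> x) = r \<odot>\<^bsub>N\<^esub> h x"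
  shows "(\<lambda>x \<in> carrier M. h x) \<in> lin M N"
proof -
  interpret M: dgmod M using assms by (intro dgmod_DGP) simp
  show ?thesis using assms by (auto simp: lin_def addmap_def)
qed

text \<open>As \<open>S\<^sub>\<Gamma> \<otimes>\<^sub>A P(\<Gamma>0)\<close> is one-dimensional for
  \<open>\<Gamma> = \<Gamma>0\<close> and zero otherwise, the tensor product is
  \<open>Q \<Gamma>0\<close> itself. A balanced \<open>s\<close> is determined by its values on the
  generator \<open>e(\<Gamma>0)\<close>, and these give the universal map.\<close>

lemma is_ten_proj:
  fixes \<Gamma>0 :: idx
  assumes Q: "\<And>\<Gamma>. Q \<Gamma> \<in> DGP"
  defines "t \<equiv> \<lambda>\<Gamma> x q. if \<Gamma> = \<Gamma>0 \<and> eps \<Gamma> (the_alg x) = 1 then q else \<zero>\<^bsub>Q \<Gamma>0\<^esub>"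
  shows "is_ten (projA \<Gamma>0) Q (Q \<Gamma>0) t"
proof -
  interpret Q: dgmod "Q \<Gamma>" for \<Gamma> using Q by (rule dgmod_DGP)
  interpret X: dgmod "projA \<Gamma>0" by (rule dgmod_DGP) (rule DGP_proj)
  let ?e = "Elt (alg_of (GId \<Gamma>0))"
  have e: "?e \<in> carrier (projA \<Gamma>0)" "?e \<in> homog (projA \<Gamma>0) (0, 0)"
    using alg_homog_gen[of "GId \<Gamma>0"] by (simp_all add: proj_carrier proj_homog idem_mult)
  have hom0: "eps \<Gamma> (the_alg x) = 0" if "x \<in> homog (projA \<Gamma>0) d" "d \<noteq> (0, 0)" for \<Gamma> x d
    using that eps_homog[of _ d \<Gamma>] unfolding proj_homog by force
  have bal: "balanced (projA \<Gamma>0) Q (Q \<Gamma>0) t"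
    unfolding balanced_def
  proof (intro allI ballI conjI)
    fix \<Gamma> x x' q a assume "x \<in> carrier (projA \<Gamma>0)" "q \<in> carrier (Q \<Gamma>)"
    then show "t \<Gamma> (x \<oplus>\<^bsub>projA \<Gamma>0\<^esub> x') q = t \<Gamma> x q \<oplus>\<^bsub>Q \<Gamma>0\<^esub> t \<Gamma> x' q"
      unfolding t_def projA_sel by (cases "\<Gamma> = \<Gamma>0") auto
  qed (auto simp: t_def projA_sel)
  have "ten_degree (projA \<Gamma>0) Q (Q \<Gamma>0) t"
    unfolding ten_degree_def
  proof (intro allI ballI)
    fix \<Gamma> i j i' j' x q assume x: "x \<in> homog (projA \<Gamma>0) (i, j)" and q: "q \<in> homog (Q \<Gamma>) (i', j')"
    show "t \<Gamma> x q \<in> homog (Q \<Gamma>0) (i + i', j + j')"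
    proof (cases "\<Gamma> = \<Gamma>0 \<and> eps \<Gamma> (the_alg x) = 1")
      case True
      then have "(i, j) = (0, 0)" using hom0[OF x, of \<Gamma>] by (metis zero_neq_one)
      then show ?thesis using True q by (simp add: t_def)
    next
      case False
      then have "t \<Gamma> x q = \<zero>\<^bsub>Q \<Gamma>0\<^esub>" unfolding t_def by (rule if_not_P)
      then show ?thesis by simp
    qed
  qed
  moreover have "ten_leibniz (projA \<Gamma>0) Q (Q \<Gamma>0) t"
    by (auto simp: ten_leibniz_def t_def projA_sel)
  moreover have "ten_generated (projA \<Gamma>0) Q (Q \<Gamma>0) t"
  proof (rule ten_generatedI, rule subsetI)
    fix i j S q assume S: "\<And>\<Gamma> i' j' i'' j'' x q. i = i' + i'' \<Longrightarrow> j = j' + j'' \<Longrightarrow>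
          x \<in> homog (projA \<Gamma>0) (i', j') \<Longrightarrow> q \<in> homog (Q \<Gamma>) (i'', j'') \<Longrightarrow> t \<Gamma> x q \<in> S"
      and q: "q \<in> homog (Q \<Gamma>0) (i, j)"
    have "t \<Gamma>0 ?e q \<in> S" by (rule S[OF _ _ e(2) q]) simp_all
    then show "q \<in> S" by (simp add: t_def)
  qed
  moreover have "ten_universal (projA \<Gamma>0) Q (Q \<Gamma>0) t"
  proof (rule ten_universalI)
    fix W s assume W: "W \<in> DGP" and s: "balanced (projA \<Gamma>0) Q W s"
    note sD = balancedD[OF s e(1)]
    have l: "(\<lambda>q \<in> carrier (Q \<Gamma>0). s \<Gamma>0 ?e q) \<in> lin (Q \<Gamma>0) W"
      by (rule linI[OF Q]) (use sD in simp_all)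
    have "(\<lambda>q \<in> carrier (Q \<Gamma>0). s \<Gamma>0 ?e q) (t \<Gamma> x q) = s \<Gamma> x q"
      if x: "x \<in> carrier (projA \<Gamma>0)" and q: "q \<in> carrier (Q \<Gamma>)" for \<Gamma> x q
    proof -
      from x obtain a where a: "x = Elt a" "a * alg_of (GId \<Gamma>0) = a" unfolding proj_carrier by blast
      then have ax: "a \<odot>\<^bsub>projA \<Gamma>0\<^esub> ?e = x" by (simp add: projA_sel)
      have z: "s \<Gamma>0 ?e \<zero>\<^bsub>Q \<Gamma>0\<^esub> = \<zero>\<^bsub>W\<^esub>"
      proof -
        interpret W: dgmod W using W by (rule dgmod_DGP)
        have "s \<Gamma>0 ?e (0 \<odot>\<^bsub>Q \<Gamma>0\<^esub> \<zero>\<^bsub>Q \<Gamma>0\<^esub>) = 0 \<odot>\<^bsub>W\<^esub> s \<Gamma>0 ?e \<zero>\<^bsub>Q \<Gamma>0\<^esub>" by (rule sD(5)) simp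
        then show ?thesis using sD(1)[of "\<zero>\<^bsub>Q \<Gamma>0\<^esub>" \<Gamma>0] by simp
      qed
      show ?thesis
      proof (cases "eps \<Gamma> a = 1")
        case True
        have "eps \<Gamma> (a * alg_of (GId \<Gamma>0)) = 1" using True a by simp
        then have "\<Gamma> = \<Gamma>0" by (auto split: if_splits)
        then show ?thesis using sD(4)[OF q, of a] True a q ax by (simp add: t_def)
      next
        case False
        then have "s \<Gamma> x q = \<zero>\<^bsub>W\<^esub>" using sD(4)[OF q, of a] ax by simp
        moreover have "t \<Gamma> x q = \<zero>\<^bsub>Q \<Gamma>0\<^esub>" using False a by (simp add: t_def)
        ultimately show ?thesis using z by simp
      qed
    qed
    with l show "\<exists>h \<in> lin (Q \<Gamma>0) W. \<forall>\<Gamma>. \<forall>x \<in> carrier (projA \<Gamma>0). \<forall>q \<in> carrier (Q \<Gamma>). h (t \<Gamma> x q) = s \<Gamma> x q"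
      by blast
  qed
  ultimately show ?thesis using Q bal by (simp add: is_ten_def)
qed

text \<open>The same pairing serves, since the shift only reindexes the degree of the left
  argument.\<close>

lemma is_ten_shift:
  assumes t: "is_ten X Q B t"
  shows "is_ten (dg_shift k m X) Q (dg_shift k m B) t"
proof -
  have bal: "balanced (dg_shift k m X) Q W s \<longleftrightarrow> balanced X Q W s"
    "balanced X Q (dg_shift k m W) s \<longleftrightarrow> balanced X Q W s" for W s
    by (simp_all add: balanced_def shift_sel)
  have "ten_degree (dg_shift k m X) Q (dg_shift k m B) t"
    unfolding ten_degree_def
  proof (intro allI ballI)
    fix \<Gamma> i j i' j' x q assume "x \<in> homog (dg_shift k m X) (i, j)" "q \<in> homog (Q \<Gamma>) (i', j')"
    then have "t \<Gamma> x q \<in> homog B (i + k + i', j + m + j')"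
      by (intro is_tenD(3)[OF t]) (simp_all add: shift_sel)
    then show "t \<Gamma> x q \<in> homog (dg_shift k m B) (i + i', j + j')" by (simp add: shift_sel ac_simps)
  qed
  moreover have "ten_leibniz (dg_shift k m X) Q (dg_shift k m B) t"
    using is_tenD(4)[OF t] by (simp add: ten_leibniz_def shift_sel)
  moreover have "ten_generated (dg_shift k m X) Q (dg_shift k m B) t"
  proof (rule ten_generatedI)
    fix i j S assume S: "\<zero>\<^bsub>dg_shift k m B\<^esub> \<in> S" "\<And>b b'. b \<in> S \<Longrightarrow> b' \<in> S \<Longrightarrow> b \<oplus>\<^bsub>dg_shift k m B\<^esub> b' \<in> S"
      "\<And>\<Gamma> i' j' i'' j'' x q. i = i' + i'' \<Longrightarrow> j = j' + j'' \<Longrightarrow>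
          x \<in> homog (dg_shift k m X) (i', j') \<Longrightarrow> q \<in> homog (Q \<Gamma>) (i'', j'') \<Longrightarrow> t \<Gamma> x q \<in> S"
    have "homog B (i + k, j + m) \<subseteq> S"
    proof (rule is_ten_generated[OF t])
      fix \<Gamma> i' j' i'' j'' x q assume d: "i + k = i' + i''" "j + m = j' + j''" and xq: "x \<in> homog X (i', j')" "q \<in> homog (Q \<Gamma>) (i'', j'')"
      show "t \<Gamma> x q \<in> S"
        by (rule S(3)[of "i' - k" i'' "j' - m" j'']) (use d xq in \<open>simp_all add: shift_sel\<close>)
    qed (use S(1,2) in \<open>simp_all add: shift_sel\<close>)
    then show "homog (dg_shift k m B) (i, j) \<subseteq> S" by (simp add: shift_sel)
  qed
  moreover have "ten_universal (dg_shift k m X) Q (dg_shift k m B) t"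
  proof (rule ten_universalI)
    fix W s assume "W \<in> DGP" "balanced (dg_shift k m X) Q W s"
    then show "\<exists>h \<in> lin (dg_shift k m B) W. \<forall>\<Gamma>. \<forall>x \<in> carrier (dg_shift k m X). \<forall>q \<in> carrier (Q \<Gamma>). h (t \<Gamma> x q) = s \<Gamma> x q"
      using is_tenD(5)[OF t] by (simp add: bal lin_def addmap_def shift_sel)
  qed
  ultimately show ?thesis using is_tenD(1,2)[OF t] by (simp add: is_ten_def bal DGP_shift)
qed

text \<open>The map \<phi> is \<open>f\<close> tensored with identities. As tensoring is additive in
  the left argument, its cone is the tensor product of the cone, with the pairing taken
  componentwise.\<close>

lemma is_ten_cone:
  assumes M: "M \<in> DGP" "N \<in> DGP" "f \<in> cocycles0 M N" and Q: "\<And>\<Gamma>. Q \<Gamma> \<in> DGP"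
    and t1: "is_ten M Q B1 t1" and t2: "is_ten N Q B2 t2"
  shows "\<exists>\<phi> t. \<phi> \<in> cocycles0 B1 B2 \<and> is_ten (mcone M N f) Q (mcone B1 B2 \<phi>) t"
proof -
  note B = is_tenD(1)[OF t1] is_tenD(1)[OF t2]
  interpret M: dgmod M using M by (intro dgmod_DGP) simp
  interpret N: dgmod N using M by (intro dgmod_DGP) simp
  interpret B1: dgmod B1 using B by (intro dgmod_DGP) simp
  interpret B2: dgmod B2 using B by (intro dgmod_DGP) simp
  interpret Q: dgmod "Q \<Gamma>" for \<Gamma> using Q by (rule dgmod_DGP)
  note fa = cocycles0_addmap[OF M(3)]
  have fd: "diff N (f x) = f (diff M x)" if "x \<in> carrier M" for x
  proof -
    have "dg_hom_diff M N f x = \<zero>\<^bsub>N\<^esub>" using M(3) that by (simp add: cocycles0_def)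
    then show ?thesis using that N.add_eq_zero_iff addmap_closed[OF fa] by (simp add: dg_hom_diff_def)
  qed
  obtain \<phi> where \<phi>: "\<phi> \<in> carrier (dg_hom 0 B1 B2)"
    "\<And>\<Gamma> x q. x \<in> carrier M \<Longrightarrow> q \<in> carrier (Q \<Gamma>) \<Longrightarrow> \<phi> (t1 \<Gamma> x q) = t2 \<Gamma> (f x) q"
    using ten_map[OF t1 M(1) Q t2 M(2) Q cocycles0_dg_hom[OF M(3)] dg_hom_id[OF Q]] by auto
  note \<phi>a = dg_hom_addmap[OF \<phi>(1)]
  note b1 = balancedD[OF is_tenD(2)[OF t1]] and b2 = balancedD[OF is_tenD(2)[OF t2]]
  \<comment> \<open>By uniqueness it is enough to compare with zero on elementary tensors, where the
    terms with the differential of \<open>Q\<close> cancel and \<open>f\<close> commutes with the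
    differentials.\<close>
  have "dg_hom_diff B1 B2 \<phi> = (\<lambda>x \<in> carrier B1. \<zero>\<^bsub>B2\<^esub>)"
    by (rule ten_unique[OF t1 M(1) Q B(2) addmap_diff[OF B \<phi>a] emb_zero(2)[OF B]])
      (use \<phi>(2) b1(1) b2(1) is_tenD(4)[OF t1] is_tenD(4)[OF t2] addmap_add[OF \<phi>a] fd addmap_closed[OF fa] in
       \<open>simp add: dg_hom_diff_def\<close>)
  with \<phi>(1) have \<phi>c: "\<phi> \<in> cocycles0 B1 B2" by (simp add: cocycles0_def)
  let ?C = "mcone M N f" and ?B = "mcone B1 B2 \<phi>"
  define t where "t \<Gamma> p q = Pr (t1 \<Gamma> (pr1 p) q) (t2 \<Gamma> (pr2 p) q)" for \<Gamma> p q
  have BD: "?B \<in> DGP" using DGP_cone[OF B \<phi>c] .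
  have CD: "?C \<in> DGP" using DGP_cone[OF M] .
  have t0: "t1 \<Gamma> \<zero>\<^bsub>M\<^esub> q = \<zero>\<^bsub>B1\<^esub>" "t2 \<Gamma> \<zero>\<^bsub>N\<^esub> q = \<zero>\<^bsub>B2\<^esub>" if "q \<in> carrier (Q \<Gamma>)" for \<Gamma> q
    using b1(4)[of "\<zero>\<^bsub>M\<^esub>" q \<Gamma> 0] b2(4)[of "\<zero>\<^bsub>N\<^esub>" q \<Gamma> 0] that by simp_all
  have bal: "balanced ?C Q ?B t"
    unfolding balanced_def
    by (auto simp: t_def cone_sel b1 b2)
  have "ten_degree ?C Q ?B t"
    unfolding ten_degree_def
  proof (intro allI ballI)
    fix \<Gamma> i j i' j' p q assume p: "p \<in> homog ?C (i, j)" and q: "q \<in> homog (Q \<Gamma>) (i', j')"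
    then obtain x y where p: "p = Pr x y" "x \<in> homog M (i + 1, j)" "y \<in> homog N (i, j)" by (auto simp: homog_cone)
    from is_tenD(3)[OF t1 p(2) q] is_tenD(3)[OF t2 p(3) q]
    show "t \<Gamma> p q \<in> homog ?B (i + i', j + j')" by (simp add: homog_cone t_def p(1) ac_simps)
  qed
  moreover have "ten_leibniz ?C Q ?B t"
    unfolding ten_leibniz_def
  proof (intro allI ballI)
    fix \<Gamma> p q assume p: "p \<in> carrier ?C" and q: "q \<in> carrier (Q \<Gamma>)"
    then obtain x y where p: "p = Pr x y" "x \<in> carrier M" "y \<in> carrier N" by (auto simp: cone_sel)
    have "t2 \<Gamma> (f x) q \<oplus>\<^bsub>B2\<^esub> (t2 \<Gamma> (diff N y) q \<oplus>\<^bsub>B2\<^esub> t2 \<Gamma> y (diff (Q \<Gamma>) q)) =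
       t2 \<Gamma> (f x) q \<oplus>\<^bsub>B2\<^esub> t2 \<Gamma> (diff N y) q \<oplus>\<^bsub>B2\<^esub> t2 \<Gamma> y (diff (Q \<Gamma>) q)"
      using p q b2(1) addmap_closed[OF fa] by (simp add: B2.a_assoc)
    then show "diff ?B (t \<Gamma> p q) = t \<Gamma> (diff ?C p) q \<oplus>\<^bsub>?B\<^esub> t \<Gamma> p (diff (Q \<Gamma>) q)"
      using p q \<phi>(2) is_tenD(4)[OF t1] is_tenD(4)[OF t2] addmap_closed[OF fa] by (simp add: cone_sel t_def b2(2))
  qed
  moreover have "ten_generated ?C Q ?B t"
  proof (rule ten_generatedI, rule subsetI)
    fix i j S p assume S: "\<zero>\<^bsub>?B\<^esub> \<in> S" "\<And>b b'. b \<in> S \<Longrightarrow> b' \<in> S \<Longrightarrow> b \<oplus>\<^bsub>?B\<^esub> b' \<in> S"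
      "\<And>\<Gamma> i' j' i'' j'' x q. i = i' + i'' \<Longrightarrow> j = j' + j'' \<Longrightarrow>
          x \<in> homog ?C (i', j') \<Longrightarrow> q \<in> homog (Q \<Gamma>) (i'', j'') \<Longrightarrow> t \<Gamma> x q \<in> S"
      and "p \<in> homog ?B (i, j)"
    then obtain b b' where p: "p = Pr b b'" "b \<in> homog B1 (i + 1, j)" "b' \<in> homog B2 (i, j)" by (auto simp: homog_cone)
    \<comment> \<open>The first component of the cone is shifted, so degree \<open>i\<close> of the
      cone is degree \<open>i + 1\<close> of \<open>B1\<close>.\<close>
    have "homog B1 (i + 1, j) \<subseteq> {b \<in> carrier B1. Pr b \<zero>\<^bsub>B2\<^esub> \<in> S}"
    proof (rule is_ten_generated[OF t1])
      fix \<Gamma> i' j' i'' j'' x q assume d: "i + 1 = i' + i''" "j = j' + j''" and xq: "x \<in> homog M (i', j')" "q \<in> homog (Q \<Gamma>) (i'', j'')"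
      have "t \<Gamma> (Pr x \<zero>\<^bsub>N\<^esub>) q \<in> S"
        by (rule S(3)[of "i' - 1" i'' j' j'']) (use d xq in \<open>simp_all add: homog_cone\<close>)
      then show "t1 \<Gamma> x q \<in> {b \<in> carrier B1. Pr b \<zero>\<^bsub>B2\<^esub> \<in> S}"
        using M.homog_closed[OF xq(1)] Q.homog_closed[OF xq(2)] by (simp add: t_def t0 b1(1))
    next
      fix b b' assume "b \<in> {b \<in> carrier B1. Pr b \<zero>\<^bsub>B2\<^esub> \<in> S}" "b' \<in> {b \<in> carrier B1. Pr b \<zero>\<^bsub>B2\<^esub> \<in> S}"
      then show "b \<oplus>\<^bsub>B1\<^esub> b' \<in> {b \<in> carrier B1. Pr b \<zero>\<^bsub>B2\<^esub> \<in> S}"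
        using S(2)[of "Pr b \<zero>\<^bsub>B2\<^esub>" "Pr b' \<zero>\<^bsub>B2\<^esub>"] by (simp add: cone_sel)
    qed (use S(1) in \<open>simp add: cone_sel\<close>)
    moreover have "homog B2 (i, j) \<subseteq> {b \<in> carrier B2. Pr \<zero>\<^bsub>B1\<^esub> b \<in> S}"
    proof (rule is_ten_generated[OF t2])
      fix \<Gamma> i' j' i'' j'' x q assume d: "i = i' + i''" "j = j' + j''" and xq: "x \<in> homog N (i', j')" "q \<in> homog (Q \<Gamma>) (i'', j'')"
      have "t \<Gamma> (Pr \<zero>\<^bsub>M\<^esub> x) q \<in> S"
        by (rule S(3)[of i' i'' j' j'']) (use d xq in \<open>simp_all add: homog_cone\<close>)
      then show "t2 \<Gamma> x q \<in> {b \<in> carrier B2. Pr \<zero>\<^bsub>B1\<^esub> b \<in> S}"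
        using N.homog_closed[OF xq(1)] Q.homog_closed[OF xq(2)] by (simp add: t_def t0 b2(1))
    next
      fix b b' assume "b \<in> {b \<in> carrier B2. Pr \<zero>\<^bsub>B1\<^esub> b \<in> S}" "b' \<in> {b \<in> carrier B2. Pr \<zero>\<^bsub>B1\<^esub> b \<in> S}"
      then show "b \<oplus>\<^bsub>B2\<^esub> b' \<in> {b \<in> carrier B2. Pr \<zero>\<^bsub>B1\<^esub> b \<in> S}"
        using S(2)[of "Pr \<zero>\<^bsub>B1\<^esub> b" "Pr \<zero>\<^bsub>B1\<^esub> b'"] by (simp add: cone_sel)
    qed (use S(1) in \<open>simp add: cone_sel\<close>)
    ultimately have "Pr b \<zero>\<^bsub>B2\<^esub> \<in> S" "Pr \<zero>\<^bsub>B1\<^esub> b' \<in> S" "b \<in> carrier B1" "b' \<in> carrier B2" using p by blast+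
    then show "p \<in> S" using S(2)[of "Pr b \<zero>\<^bsub>B2\<^esub>" "Pr \<zero>\<^bsub>B1\<^esub> b'"] by (simp add: cone_sel p(1))
  qed
  moreover have "ten_universal ?C Q ?B t"
  proof (rule ten_universalI)
    fix W s assume W: "W \<in> DGP" and s: "balanced ?C Q W s"
    interpret W: dgmod W using W by (rule dgmod_DGP)
    note sD = balancedD[OF s]
    have Pr: "Pr x y \<in> carrier ?C \<longleftrightarrow> x \<in> carrier M \<and> y \<in> carrier N" for x y by (auto simp: cone_sel)
    have s1: "balanced M Q W (\<lambda>\<Gamma> x q. s \<Gamma> (Pr x \<zero>\<^bsub>N\<^esub>) q)"
      unfolding balanced_def
    proof (intro allI ballI conjI)
      fix \<Gamma> x q x' a assume x: "x \<in> carrier M" "q \<in> carrier (Q \<Gamma>)"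
      have P: "Pr x \<zero>\<^bsub>N\<^esub> \<in> carrier ?C" using x by (simp add: Pr)
      show "s \<Gamma> (Pr x \<zero>\<^bsub>N\<^esub>) q \<in> carrier W" by (rule sD(1)[OF P x(2)])
      show "x' \<in> carrier M \<Longrightarrow> s \<Gamma> (Pr (x \<oplus>\<^bsub>M\<^esub> x') \<zero>\<^bsub>N\<^esub>) q = s \<Gamma> (Pr x \<zero>\<^bsub>N\<^esub>) q \<oplus>\<^bsub>W\<^esub> s \<Gamma> (Pr x' \<zero>\<^bsub>N\<^esub>) q"
        using sD(2)[OF P x(2), of "Pr x' \<zero>\<^bsub>N\<^esub>"] by (simp add: Pr cone_sel(3))
      show "s \<Gamma> (Pr (a \<odot>\<^bsub>M\<^esub> x) \<zero>\<^bsub>N\<^esub>) q = (if eps \<Gamma> a = 1 then s \<Gamma> (Pr x \<zero>\<^bsub>N\<^esub>) q else \<zero>\<^bsub>W\<^esub>)"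
        using sD(4)[OF P x(2), of a] by (simp add: cone_sel(4))
      show "s \<Gamma> (Pr x \<zero>\<^bsub>N\<^esub>) (a \<odot>\<^bsub>Q \<Gamma>\<^esub> q) = a \<odot>\<^bsub>W\<^esub> s \<Gamma> (Pr x \<zero>\<^bsub>N\<^esub>) q" by (rule sD(5)[OF P x(2)])
      show "\<And>q'. q' \<in> carrier (Q \<Gamma>) \<Longrightarrow> s \<Gamma> (Pr x \<zero>\<^bsub>N\<^esub>) (q \<oplus>\<^bsub>Q \<Gamma>\<^esub> q') = s \<Gamma> (Pr x \<zero>\<^bsub>N\<^esub>) q \<oplus>\<^bsub>W\<^esub> s \<Gamma> (Pr x \<zero>\<^bsub>N\<^esub>) q'"
        by (rule sD(3)[OF P x(2)])
    qed
    have s2: "balanced N Q W (\<lambda>\<Gamma> x q. s \<Gamma> (Pr \<zero>\<^bsub>M\<^esub> x) q)"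
      unfolding balanced_def
    proof (intro allI ballI conjI)
      fix \<Gamma> x q x' a assume x: "x \<in> carrier N" "q \<in> carrier (Q \<Gamma>)"
      have P: "Pr \<zero>\<^bsub>M\<^esub> x \<in> carrier ?C" using x by (simp add: Pr)
      show "s \<Gamma> (Pr \<zero>\<^bsub>M\<^esub> x) q \<in> carrier W" by (rule sD(1)[OF P x(2)])
      show "x' \<in> carrier N \<Longrightarrow> s \<Gamma> (Pr \<zero>\<^bsub>M\<^esub> (x \<oplus>\<^bsub>N\<^esub> x')) q = s \<Gamma> (Pr \<zero>\<^bsub>M\<^esub> x) q \<oplus>\<^bsub>W\<^esub> s \<Gamma> (Pr \<zero>\<^bsub>M\<^esub> x') q"
        using sD(2)[OF P x(2), of "Pr \<zero>\<^bsub>M\<^esub> x'"] by (simp add: Pr cone_sel(3))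
      show "s \<Gamma> (Pr \<zero>\<^bsub>M\<^esub> (a \<odot>\<^bsub>N\<^esub> x)) q = (if eps \<Gamma> a = 1 then s \<Gamma> (Pr \<zero>\<^bsub>M\<^esub> x) q else \<zero>\<^bsub>W\<^esub>)"
        using sD(4)[OF P x(2), of a] by (simp add: cone_sel(4))
      show "s \<Gamma> (Pr \<zero>\<^bsub>M\<^esub> x) (a \<odot>\<^bsub>Q \<Gamma>\<^esub> q) = a \<odot>\<^bsub>W\<^esub> s \<Gamma> (Pr \<zero>\<^bsub>M\<^esub> x) q" by (rule sD(5)[OF P x(2)])
      show "\<And>q'. q' \<in> carrier (Q \<Gamma>) \<Longrightarrow> s \<Gamma> (Pr \<zero>\<^bsub>M\<^esub> x) (q \<oplus>\<^bsub>Q \<Gamma>\<^esub> q') = s \<Gamma> (Pr \<zero>\<^bsub>M\<^esub> x) q \<oplus>\<^bsub>W\<^esub> s \<Gamma> (Pr \<zero>\<^bsub>M\<^esub> x) q'"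
        by (rule sD(3)[OF P x(2)])
    qed
    obtain h1 where h1: "h1 \<in> lin B1 W" "\<And>\<Gamma> x q. x \<in> carrier M \<Longrightarrow> q \<in> carrier (Q \<Gamma>) \<Longrightarrow> h1 (t1 \<Gamma> x q) = s \<Gamma> (Pr x \<zero>\<^bsub>N\<^esub>) q"
      using is_tenD(5)[OF t1 W s1] by blast
    obtain h2 where h2: "h2 \<in> lin B2 W" "\<And>\<Gamma> x q. x \<in> carrier N \<Longrightarrow> q \<in> carrier (Q \<Gamma>) \<Longrightarrow> h2 (t2 \<Gamma> x q) = s \<Gamma> (Pr \<zero>\<^bsub>M\<^esub> x) q"
      using is_tenD(5)[OF t2 W s2] by blast
    note a1 = lin_addmap[OF h1(1)] and a2 = lin_addmap[OF h2(1)]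
    have l: "(\<lambda>p \<in> carrier ?B. h1 (pr1 p) \<oplus>\<^bsub>W\<^esub> h2 (pr2 p)) \<in> lin ?B W"
      by (rule linI[OF BD])
        (auto simp: cone_sel addmap_closed[OF a1] addmap_closed[OF a2] addmap_add[OF a1] addmap_add[OF a2] W.a_ac
          linD[OF h1(1)] linD[OF h2(1)] W.smult_add)
    have "(\<lambda>p \<in> carrier ?B. h1 (pr1 p) \<oplus>\<^bsub>W\<^esub> h2 (pr2 p)) (t \<Gamma> p q) = s \<Gamma> p q"
      if p: "p \<in> carrier ?C" and q: "q \<in> carrier (Q \<Gamma>)" for \<Gamma> p q
    proof -
      from p obtain x y where xy: "p = Pr x y" "x \<in> carrier M" "y \<in> carrier N" by (auto simp: cone_sel)
      have "Pr x \<zero>\<^bsub>N\<^esub> \<oplus>\<^bsub>?C\<^esub> Pr \<zero>\<^bsub>M\<^esub> y = p" using xy by (simp add: cone_sel)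
      then have "s \<Gamma> p q = s \<Gamma> (Pr x \<zero>\<^bsub>N\<^esub>) q \<oplus>\<^bsub>W\<^esub> s \<Gamma> (Pr \<zero>\<^bsub>M\<^esub> y) q"
        using sD(2)[of "Pr x \<zero>\<^bsub>N\<^esub>" q \<Gamma> "Pr \<zero>\<^bsub>M\<^esub> y"] xy q by (simp add: Pr)
      moreover have "t \<Gamma> p q \<in> carrier ?B" by (rule balancedD(1)[OF bal p q])
      ultimately show ?thesis using xy q by (simp add: t_def h1(2) h2(2))
    qed
    with l show "\<exists>h \<in> lin ?B W. \<forall>\<Gamma>. \<forall>x \<in> carrier ?C. \<forall>q \<in> carrier (Q \<Gamma>). h (t \<Gamma> x q) = s \<Gamma> x q"
      by blast
  qed
  ultimately have "is_ten ?C Q ?B t" using BD bal by (simp add: is_ten_def)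
  with \<phi>c show ?thesis by blast
qed

text \<open>Existence and the formula for the class go through one induction, since both sides of
  the formula react in the same way to shifts and cones.\<close>

lemma is_ten_exists:
  assumes "X \<in> DGP" and Q: "\<And>\<Gamma>. Q \<Gamma> \<in> DGP"
  shows "\<exists>B t. is_ten X Q B t \<and> phi0 B = (\<Sum>\<Gamma>\<in>{IxF, IxI, IxEF, IxE}. chi \<Gamma> X * phi0 (Q \<Gamma>))"
  using assms(1)
proof induction
  case (DGP_proj \<Gamma>0)
  have "phi0 (Q \<Gamma>0) = (\<Sum>\<Gamma>\<in>{IxF, IxI, IxEF, IxE}. chi \<Gamma> (projA \<Gamma>0) * phi0 (Q \<Gamma>))"
    by (cases \<Gamma>0) (simp_all add: chi_proj)
  then show ?case using is_ten_proj[of Q \<Gamma>0, OF Q] by blast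
next
  case (DGP_shift M k m)
  then obtain B t where B: "is_ten M Q B t" "phi0 B = (\<Sum>\<Gamma>\<in>{IxF, IxI, IxEF, IxE}. chi \<Gamma> M * phi0 (Q \<Gamma>))" by blast
  have "phi0 (dg_shift k m B) = (\<Sum>\<Gamma>\<in>{IxF, IxI, IxEF, IxE}. chi \<Gamma> (dg_shift k m M) * phi0 (Q \<Gamma>))"
    unfolding phi0_shift B(2) sum_distrib_left by (simp add: chi_shift mult.assoc)
  then show ?case using is_ten_shift[OF B(1)] by blast
next
  case (DGP_cone M N f)
  then obtain B1 t1 B2 t2 where t1: "is_ten M Q B1 t1" "phi0 B1 = (\<Sum>\<Gamma>\<in>{IxF, IxI, IxEF, IxE}. chi \<Gamma> M * phi0 (Q \<Gamma>))"
    and t2: "is_ten N Q B2 t2" "phi0 B2 = (\<Sum>\<Gamma>\<in>{IxF, IxI, IxEF, IxE}. chi \<Gamma> N * phi0 (Q \<Gamma>))" by blast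
  obtain \<phi> t where t: "\<phi> \<in> cocycles0 B1 B2" "is_ten (mcone M N f) Q (mcone B1 B2 \<phi>) t"
    using is_ten_cone[OF DGP_cone.hyps Q t1(1) t2(1)] by blast
  have "phi0 (mcone B1 B2 \<phi>) = (\<Sum>\<Gamma>\<in>{IxF, IxI, IxEF, IxE}. chi \<Gamma> (mcone M N f) * phi0 (Q \<Gamma>))"
    unfolding phi0_cone[OF is_tenD(1)[OF t1(1)] is_tenD(1)[OF t2(1)] t(1)] t1(2) t2(2) sum_subtractf[symmetric]
    by (simp only: chi_cone[OF DGP_cone.hyps] left_diff_distrib)
  then show ?case using t(2) by blast
qed


text \<open>The object and its pairing are chosen together, and with the class formula, because
  existence was shown for all three at once.\<close>

definition Ten_pair :: "amod \<Rightarrow> (idx \<Rightarrow> amod) \<Rightarrow> amod \<times> (idx \<Rightarrow> elt \<Rightarrow> elt \<Rightarrow> elt)" where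
  "Ten_pair X Q = (SOME p. is_ten X Q (fst p) (snd p) \<and>
     phi0 (fst p) = (\<Sum>\<Gamma>\<in>{IxF, IxI, IxEF, IxE}. chi \<Gamma> X * phi0 (Q \<Gamma>)))"

definition Ten :: "amod \<Rightarrow> (idx \<Rightarrow> amod) \<Rightarrow> amod" where "Ten X Q = fst (Ten_pair X Q)"
definition ten :: "amod \<Rightarrow> (idx \<Rightarrow> amod) \<Rightarrow> idx \<Rightarrow> elt \<Rightarrow> elt \<Rightarrow> elt" where "ten X Q = snd (Ten_pair X Q)"

lemma is_ten_Ten:
  assumes "X \<in> DGP" "\<And>\<Gamma>. Q \<Gamma> \<in> DGP"
  shows "is_ten X Q (Ten X Q) (ten X Q)"
    "phi0 (Ten X Q) = (\<Sum>\<Gamma>\<in>{IxF, IxI, IxEF, IxE}. chi \<Gamma> X * phi0 (Q \<Gamma>))"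
proof -
  have "\<exists>p. is_ten X Q (fst p) (snd p) \<and> phi0 (fst p) = (\<Sum>\<Gamma>\<in>{IxF, IxI, IxEF, IxE}. chi \<Gamma> X * phi0 (Q \<Gamma>))"
    using is_ten_exists[OF assms] by auto
  from someI_ex[OF this] show "is_ten X Q (Ten X Q) (ten X Q)"
    "phi0 (Ten X Q) = (\<Sum>\<Gamma>\<in>{IxF, IxI, IxEF, IxE}. chi \<Gamma> X * phi0 (Q \<Gamma>))"
    unfolding Ten_def ten_def Ten_pair_def by blast+
qed

text \<open>The map \<open>f \<otimes> g\<close>, with one \<open>g \<Gamma>\<close> for each index.
  It is singled out among merely additive maps, where uniqueness already holds, so one definition
  serves all degrees.\<close>

definition tmp :: "amod \<Rightarrow> amod \<Rightarrow> (idx \<Rightarrow> amod) \<Rightarrow> (idx \<Rightarrow> amod) \<Rightarrow> (elt \<Rightarrow> elt) \<Rightarrow> (idx \<Rightarrow> elt \<Rightarrow> elt) \<Rightarrow> elt \<Rightarrow> elt" where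
  "tmp X X' Q Q' f g = (SOME h. h \<in> addmap (Ten X Q) (Ten X' Q') \<and>
     (\<forall>\<Gamma>. \<forall>x \<in> carrier X. \<forall>q \<in> carrier (Q \<Gamma>). h (ten X Q \<Gamma> x q) = ten X' Q' \<Gamma> (f x) (g \<Gamma> q)))"

abbreviation "idm X \<equiv> (\<lambda>x \<in> carrier X. x)"
abbreviation "idf Q \<equiv> (\<lambda>\<Gamma>. idm (Q \<Gamma>))"

locale ten_objects =
  fixes X X' :: amod and Q Q' :: "idx \<Rightarrow> amod"
  assumes XQ: "X \<in> DGP" "\<And>\<Gamma>. Q \<Gamma> \<in> DGP" "X' \<in> DGP" "\<And>\<Gamma>. Q' \<Gamma> \<in> DGP"
begin

lemmas T = is_ten_Ten(1)[of X Q, OF XQ(1,2)] and T' = is_ten_Ten(1)[of X' Q', OF XQ(3,4)]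
lemmas TD = is_tenD(1)[OF T] and TD' = is_tenD(1)[OF T']

lemma tmp_eqI:
  assumes "h \<in> addmap (Ten X Q) (Ten X' Q')"
    "\<And>\<Gamma> x q. x \<in> carrier X \<Longrightarrow> q \<in> carrier (Q \<Gamma>) \<Longrightarrow> h (ten X Q \<Gamma> x q) = ten X' Q' \<Gamma> (f x) (g \<Gamma> q)"
  shows "tmp X X' Q Q' f g = h"
proof -
  have "\<exists>h. h \<in> addmap (Ten X Q) (Ten X' Q') \<and>
     (\<forall>\<Gamma>. \<forall>x \<in> carrier X. \<forall>q \<in> carrier (Q \<Gamma>). h (ten X Q \<Gamma> x q) = ten X' Q' \<Gamma> (f x) (g \<Gamma> q))"
    using assms by blast
  from someI_ex[OF this] show ?thesis
    unfolding tmp_def[symmetric] using ten_unique[OF T XQ(1,2) TD' _ assms(1)] assms(2) by simp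
qed

lemma tmp_hom:
  assumes f: "f \<in> carrier (dg_hom k X X')" and g: "\<And>\<Gamma>. g \<Gamma> \<in> carrier (dg_hom l (Q \<Gamma>) (Q' \<Gamma>))"
  shows "tmp X X' Q Q' f g \<in> carrier (dg_hom (k + l) (Ten X Q) (Ten X' Q'))"
    "x \<in> carrier X \<Longrightarrow> q \<in> carrier (Q \<Gamma>) \<Longrightarrow> tmp X X' Q Q' f g (ten X Q \<Gamma> x q) = ten X' Q' \<Gamma> (f x) (g \<Gamma> q)"
proof -
  obtain h where h: "h \<in> carrier (dg_hom (k + l) (Ten X Q) (Ten X' Q'))"
    "\<And>\<Gamma> x q. x \<in> carrier X \<Longrightarrow> q \<in> carrier (Q \<Gamma>) \<Longrightarrow> h (ten X Q \<Gamma> x q) = ten X' Q' \<Gamma> (f x) (g \<Gamma> q)"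
    using ten_map[OF T XQ(1,2) T' XQ(3,4) f g] by blast
  have e: "tmp X X' Q Q' f g = h" by (rule tmp_eqI[OF dg_hom_addmap[OF h(1)] h(2)])
  show "tmp X X' Q Q' f g \<in> carrier (dg_hom (k + l) (Ten X Q) (Ten X' Q'))"
    "x \<in> carrier X \<Longrightarrow> q \<in> carrier (Q \<Gamma>) \<Longrightarrow> tmp X X' Q Q' f g (ten X Q \<Gamma> x q) = ten X' Q' \<Gamma> (f x) (g \<Gamma> q)"
    unfolding e using h by blast+
qed

lemmas ten_closed = balancedD(1)[OF is_tenD(2)[OF T]] and ten_closed' = balancedD(1)[OF is_tenD(2)[OF T']]

lemma tmp_plus:
  assumes f: "f \<in> carrier (dg_hom k X X')" "f' \<in> carrier (dg_hom k X X')"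
    and g: "\<And>\<Gamma>. g \<Gamma> \<in> carrier (dg_hom l (Q \<Gamma>) (Q' \<Gamma>))" "\<And>\<Gamma>. g' \<Gamma> \<in> carrier (dg_hom l (Q \<Gamma>) (Q' \<Gamma>))"
  shows "tmp X X' Q Q' (\<lambda>x \<in> carrier X. f x \<oplus>\<^bsub>X'\<^esub> f' x) g =
      (\<lambda>b \<in> carrier (Ten X Q). tmp X X' Q Q' f g b \<oplus>\<^bsub>Ten X' Q'\<^esub> tmp X X' Q Q' f' g b)"
    "tmp X X' Q Q' f (\<lambda>\<Gamma>. \<lambda>q \<in> carrier (Q \<Gamma>). g \<Gamma> q \<oplus>\<^bsub>Q' \<Gamma>\<^esub> g' \<Gamma> q) =
      (\<lambda>b \<in> carrier (Ten X Q). tmp X X' Q Q' f g b \<oplus>\<^bsub>Ten X' Q'\<^esub> tmp X X' Q Q' f g' b)"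
proof -
  note b' = balancedD[OF is_tenD(2)[OF T']]
  note fc = addmap_closed[OF dg_hom_addmap[OF f(1)]] addmap_closed[OF dg_hom_addmap[OF f(2)]]
    addmap_closed[OF dg_hom_addmap[OF g(1)]] addmap_closed[OF dg_hom_addmap[OF g(2)]]
  show "tmp X X' Q Q' (\<lambda>x \<in> carrier X. f x \<oplus>\<^bsub>X'\<^esub> f' x) g =
      (\<lambda>b \<in> carrier (Ten X Q). tmp X X' Q Q' f g b \<oplus>\<^bsub>Ten X' Q'\<^esub> tmp X X' Q Q' f' g b)"
    by (rule tmp_eqI[OF addmap_plus[OF TD' TD dg_hom_addmap[OF tmp_hom(1)[OF f(1) g(1)]] dg_hom_addmap[OF tmp_hom(1)[OF f(2) g(1)]]]])
      (use ten_closed fc tmp_hom(2)[OF f(1) g(1)] tmp_hom(2)[OF f(2) g(1)] b' in simp)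
  show "tmp X X' Q Q' f (\<lambda>\<Gamma>. \<lambda>q \<in> carrier (Q \<Gamma>). g \<Gamma> q \<oplus>\<^bsub>Q' \<Gamma>\<^esub> g' \<Gamma> q) =
      (\<lambda>b \<in> carrier (Ten X Q). tmp X X' Q Q' f g b \<oplus>\<^bsub>Ten X' Q'\<^esub> tmp X X' Q Q' f g' b)"
    by (rule tmp_eqI[OF addmap_plus[OF TD' TD dg_hom_addmap[OF tmp_hom(1)[OF f(1) g(1)]] dg_hom_addmap[OF tmp_hom(1)[OF f(1) g(2)]]]])
      (use ten_closed fc tmp_hom(2)[OF f(1) g(1)] tmp_hom(2)[OF f(1) g(2)] b' in simp)
qed

end

text \<open>Both sides agree on elementary tensors. The interchange carries no sign in
  characteristic 2, whatever the degrees.\<close>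

lemma tmp_compose:
  assumes XQ: "X \<in> DGP" "\<And>\<Gamma>. Q \<Gamma> \<in> DGP" "X' \<in> DGP" "\<And>\<Gamma>. Q' \<Gamma> \<in> DGP" "X'' \<in> DGP" "\<And>\<Gamma>. Q'' \<Gamma> \<in> DGP"
    and f: "f \<in> carrier (dg_hom k X X')" "f' \<in> carrier (dg_hom k' X' X'')"
    and g: "\<And>\<Gamma>. g \<Gamma> \<in> carrier (dg_hom l (Q \<Gamma>) (Q' \<Gamma>))" "\<And>\<Gamma>. g' \<Gamma> \<in> carrier (dg_hom l' (Q' \<Gamma>) (Q'' \<Gamma>))"
  shows "tmp X X'' Q Q'' (compose (carrier X) f' f) (\<lambda>\<Gamma>. compose (carrier (Q \<Gamma>)) (g' \<Gamma>) (g \<Gamma>)) =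
    compose (carrier (Ten X Q)) (tmp X' X'' Q' Q'' f' g') (tmp X X' Q Q' f g)"
proof -
  interpret a: ten_objects X X' Q Q' using XQ by unfold_locales
  interpret b: ten_objects X' X'' Q' Q'' using XQ by unfold_locales
  interpret c: ten_objects X X'' Q Q'' using XQ by unfold_locales
  note fc = addmap_closed[OF dg_hom_addmap[OF f(1)]] addmap_closed[OF dg_hom_addmap[OF g(1)]]
  show ?thesis
    by (rule c.tmp_eqI[OF addmap_compose[OF a.TD dg_hom_addmap[OF a.tmp_hom(1)[OF f(1) g(1)]] dg_hom_addmap[OF b.tmp_hom(1)[OF f(2) g(2)]]]])
      (use a.ten_closed fc a.tmp_hom(2)[OF f(1) g(1)] b.tmp_hom(2)[OF f(2) g(2)] in \<open>simp add: compose_def\<close>)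
qed

lemma tmp_id:
  assumes XQ: "X \<in> DGP" "\<And>\<Gamma>. Q \<Gamma> \<in> DGP"
  shows "tmp X X Q Q (idm X) (idf Q) = idm (Ten X Q)"
proof -
  interpret a: ten_objects X X Q Q using XQ by unfold_locales
  show ?thesis by (rule a.tmp_eqI[OF addmap_id[OF a.TD]]) (simp add: a.ten_closed)
qed

text \<open>On elementary tensors the terms involving the differential of \<open>Q\<close> occur
  twice and cancel.\<close>

lemma tmp_diff_left:
  assumes XQ: "X \<in> DGP" "\<And>\<Gamma>. Q \<Gamma> \<in> DGP" "X' \<in> DGP" and f: "f \<in> carrier (dg_hom k X X')"
  shows "tmp X X' Q Q (dg_hom_diff X X' f) (idf Q) = dg_hom_diff (Ten X Q) (Ten X' Q) (tmp X X' Q Q f (idf Q))"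
proof -
  interpret a: ten_objects X X' Q Q using XQ by unfold_locales
  interpret B': dgmod "Ten X' Q" using a.TD' by (rule dgmod_DGP)
  interpret X: dgmod X using XQ by (intro dgmod_DGP) simp
  interpret X': dgmod X' using XQ by (intro dgmod_DGP) simp
  interpret Q: dgmod "Q \<Gamma>" for \<Gamma> using XQ by (intro dgmod_DGP) simp
  note g = dg_hom_id[OF XQ(2)]
  note h = a.tmp_hom[OF f g]
  note fc = addmap_closed[OF dg_hom_addmap[OF f]] and ha = dg_hom_addmap[OF h(1)]
  note b' = balancedD[OF is_tenD(2)[OF a.T']]
  show ?thesis
  proof (rule a.tmp_eqI[OF addmap_diff[OF a.TD a.TD' ha]])
    fix \<Gamma> x q assume xq: "x \<in> carrier X" "q \<in> carrier (Q \<Gamma>)"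
    let ?t = "ten X' Q \<Gamma>"
    have c: "?t (diff X' (f x)) q \<in> carrier (Ten X' Q)" "?t (f x) (diff (Q \<Gamma>) q) \<in> carrier (Ten X' Q)"
      "?t (f (diff X x)) q \<in> carrier (Ten X' Q)" using xq fc by (simp_all add: b'(1))
    have "dg_hom_diff (Ten X Q) (Ten X' Q) (tmp X X' Q Q f (idf Q)) (ten X Q \<Gamma> x q)
      = (?t (diff X' (f x)) q \<oplus>\<^bsub>Ten X' Q\<^esub> ?t (f x) (diff (Q \<Gamma>) q)) \<oplus>\<^bsub>Ten X' Q\<^esub> (?t (f (diff X x)) q \<oplus>\<^bsub>Ten X' Q\<^esub> ?t (f x) (diff (Q \<Gamma>) q))"
      using xq fc a.ten_closed by (simp add: dg_hom_diff_def h(2) is_tenD(4)[OF a.T] is_tenD(4)[OF a.T'] addmap_add[OF ha])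
    also have "\<dots> = ?t (diff X' (f x)) q \<oplus>\<^bsub>Ten X' Q\<^esub> ?t (f (diff X x)) q"
      using c by (simp add: B'.a_ac)
    finally show "dg_hom_diff (Ten X Q) (Ten X' Q) (tmp X X' Q Q f (idf Q)) (ten X Q \<Gamma> x q) =
      ?t (dg_hom_diff X X' f x) (idf Q \<Gamma> q)"
      using xq fc by (simp add: dg_hom_diff_def b'(2))
  qed
qed

lemma tmp_diff_right:
  assumes XQ: "X \<in> DGP" "\<And>\<Gamma>. Q \<Gamma> \<in> DGP" "\<And>\<Gamma>. Q' \<Gamma> \<in> DGP" and g: "\<And>\<Gamma>. g \<Gamma> \<in> carrier (dg_hom k (Q \<Gamma>) (Q' \<Gamma>))"
  shows "tmp X X Q Q' (idm X) (\<lambda>\<Gamma>. dg_hom_diff (Q \<Gamma>) (Q' \<Gamma>) (g \<Gamma>)) =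
    dg_hom_diff (Ten X Q) (Ten X Q') (tmp X X Q Q' (idm X) g)"
proof -
  interpret a: ten_objects X X Q Q' using XQ by unfold_locales
  interpret B': dgmod "Ten X Q'" using a.TD' by (rule dgmod_DGP)
  interpret X: dgmod X using XQ by (intro dgmod_DGP) simp
  interpret Q: dgmod "Q \<Gamma>" for \<Gamma> using XQ by (intro dgmod_DGP) simp
  interpret Q': dgmod "Q' \<Gamma>" for \<Gamma> using XQ by (intro dgmod_DGP) simp
  note f = dg_hom_id[OF XQ(1)]
  note h = a.tmp_hom[OF f g]
  note gc = addmap_closed[OF dg_hom_addmap[OF g]] and ha = dg_hom_addmap[OF h(1)]
  note b' = balancedD[OF is_tenD(2)[OF a.T']]
  show ?thesis
  proof (rule a.tmp_eqI[OF addmap_diff[OF a.TD a.TD' ha]])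
    fix \<Gamma> x q assume xq: "x \<in> carrier X" "q \<in> carrier (Q \<Gamma>)"
    let ?t = "ten X Q' \<Gamma>"
    have c: "?t (diff X x) (g \<Gamma> q) \<in> carrier (Ten X Q')" "?t x (diff (Q' \<Gamma>) (g \<Gamma> q)) \<in> carrier (Ten X Q')"
      "?t x (g \<Gamma> (diff (Q \<Gamma>) q)) \<in> carrier (Ten X Q')" using xq gc by (simp_all add: b'(1))
    have "dg_hom_diff (Ten X Q) (Ten X Q') (tmp X X Q Q' (idm X) g) (ten X Q \<Gamma> x q)
      = (?t (diff X x) (g \<Gamma> q) \<oplus>\<^bsub>Ten X Q'\<^esub> ?t x (diff (Q' \<Gamma>) (g \<Gamma> q))) \<oplus>\<^bsub>Ten X Q'\<^esub>
        (?t (diff X x) (g \<Gamma> q) \<oplus>\<^bsub>Ten X Q'\<^esub> ?t x (g \<Gamma> (diff (Q \<Gamma>) q)))"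
      using xq gc a.ten_closed by (simp add: dg_hom_diff_def h(2) is_tenD(4)[OF a.T] is_tenD(4)[OF a.T'] addmap_add[OF ha])
    also have "\<dots> = ?t x (diff (Q' \<Gamma>) (g \<Gamma> q)) \<oplus>\<^bsub>Ten X Q'\<^esub> ?t x (g \<Gamma> (diff (Q \<Gamma>) q))"
      using c by (simp add: B'.a_ac)
    finally show "dg_hom_diff (Ten X Q) (Ten X Q') (tmp X X Q Q' (idm X) g) (ten X Q \<Gamma> x q) =
      ?t (idm X x) (dg_hom_diff (Q \<Gamma>) (Q' \<Gamma>) (g \<Gamma>) q)"
      using xq gc by (simp add: dg_hom_diff_def b'(3))
  qed
qed

lemma compose_idm:
  fixes X Y :: amod
  shows "f \<in> carrier (dg_hom k X Y) \<Longrightarrow> compose (carrier X) (idm Y) f = f"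
  "f \<in> carrier (dg_hom k X Y) \<Longrightarrow> compose (carrier X) f (idm X) = f"
  by (auto simp: dg_hom_iff addmap_def compose_def PiE_def extensional_def fun_eq_iff)

lemma compose_idm_idm: "compose (carrier X) (idm X) (idm X) = idm X"
  by (auto simp: compose_def fun_eq_iff)

section \<open>The bifunctor\<close>

text \<open>Surjectivity holds already on objects: shifts give powers of \<open>T\<close> and
  negatives, cones of zero maps give sums.\<close>

lemma phi0_surj: "\<exists>M \<in> DGP. phi0 M = x"
proof -
  have "x \<in> ut_span" by (rule ut_span_UNIV)
  then show ?thesis
  proof induction
    case (us_gen k \<Gamma>)
    show ?case
      by (rule bexI[of _ "dg_shift 0 k (projA \<Gamma>)"]) (simp_all add: phi0_shift phi0_proj sg_def DGP_proj DGP_shift)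
  next
    case us_zero
    let ?P = "projA IxF"
    have "mcone ?P ?P (\<lambda>x \<in> carrier ?P. \<zero>\<^bsub>?P\<^esub>) \<in> DGP" "phi0 (mcone ?P ?P (\<lambda>x \<in> carrier ?P. \<zero>\<^bsub>?P\<^esub>)) = 0"
      using cocycles0_zero(1)[OF DGP_proj DGP_proj, of IxF IxF] by (simp_all add: phi0_cone DGP_cone DGP_proj)
    then show ?case by blast
  next
    case (us_neg x)
    then obtain M where "M \<in> DGP" "phi0 M = x" by blast
    then show ?case
      by (intro bexI[of _ "dg_shift 1 0 M"]) (simp_all add: phi0_shift sg_def DGP_shift)
  next
    case (us_add x y)
    then obtain M N where M: "M \<in> DGP" "phi0 M = x" and N: "N \<in> DGP" "phi0 N = y" by blast
    \<comment> \<open>A cone has the class of its target minus that of its source, so the source is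
      shifted once to obtain a sum.\<close>
    have S: "dg_shift 1 0 M \<in> DGP" using M by (simp add: DGP_shift)
    show ?case
      using cocycles0_zero(1)[OF S N(1)] M N S
      by (intro bexI[of _ "mcone (dg_shift 1 0 M) N (\<lambda>x \<in> carrier (dg_shift 1 0 M). \<zero>\<^bsub>N\<^esub>)"])
        (simp_all add: phi0_cone phi0_shift sg_def DGP_cone)
  qed
qed

text \<open>Any object of the right class serves, since only the effect on classes is prescribed.
  For \<open>F\<close> times \<open>E\<close>, for instance, the class is
  \<open>1 - T - E F\<close>.\<close>

definition QQ :: "idx \<Rightarrow> idx \<Rightarrow> amod" where
  "QQ \<Gamma> \<Gamma>' = (SOME M. M \<in> DGP \<and> phi0 M = ut_basis \<Gamma> * ut_basis \<Gamma>')"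

lemma QQ: "QQ \<Gamma> \<Gamma>' \<in> DGP" "phi0 (QQ \<Gamma> \<Gamma>') = ut_basis \<Gamma> * ut_basis \<Gamma>'"
  using someI_ex[of "\<lambda>M. M \<in> DGP \<and> phi0 M = ut_basis \<Gamma> * ut_basis \<Gamma>'"] phi0_surj
  unfolding QQ_def by blast+

text \<open>The double sum is organised as an iterated tensor product. The inner one absorbs
  \<open>Y\<close> for a fixed left index \<Gamma>; the resulting family is the coefficient family
  of the outer one.\<close>

definition RR :: "amod \<Rightarrow> idx \<Rightarrow> amod" where "RR Y \<Gamma> = Ten Y (QQ \<Gamma>)"
definition BB :: "amod \<Rightarrow> amod \<Rightarrow> amod" where "BB X Y = Ten X (RR Y)"

lemma RR_DGP: "Y \<in> DGP \<Longrightarrow> RR Y \<Gamma> \<in> DGP"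
  unfolding RR_def by (rule is_tenD(1)[OF is_ten_Ten(1)]) (simp_all add: QQ)

lemma BB_DGP: "X \<in> DGP \<Longrightarrow> Y \<in> DGP \<Longrightarrow> BB X Y \<in> DGP"
  unfolding BB_def by (rule is_tenD(1)[OF is_ten_Ten(1)]) (simp_all add: RR_DGP)

text \<open>Both sides expand to the same double sum, once the central \<open>chi\<close> of
  \<open>Y\<close> has been moved past the left basis element.\<close>

lemma phi0_BB:
  assumes "X \<in> DGP" "Y \<in> DGP" shows "phi0 (BB X Y) = phi0 X * phi0 Y"
proof -
  let ?U = "{IxF, IxI, IxEF, IxE}"
  have R: "phi0 (RR Y \<Gamma>) = ut_basis \<Gamma> * phi0 Y" for \<Gamma>
  proof -
    have "phi0 (RR Y \<Gamma>) = (\<Sum>\<Gamma>'\<in>?U. chi \<Gamma>' Y * (ut_basis \<Gamma> * ut_basis \<Gamma>'))"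
      unfolding RR_def using is_ten_Ten(2)[OF assms(2), of "QQ \<Gamma>"] by (simp only: QQ)
    also have "\<dots> = ut_basis \<Gamma> * phi0 Y"
      unfolding phi0_def sum_distrib_left
    proof (rule sum.cong[OF refl])
      fix \<Gamma>' show "chi \<Gamma>' Y * (ut_basis \<Gamma> * ut_basis \<Gamma>') = ut_basis \<Gamma> * (chi \<Gamma>' Y * ut_basis \<Gamma>')"
        by (metis chi_central mult.assoc)
    qed
    finally show ?thesis .
  qed
  have "phi0 (BB X Y) = (\<Sum>\<Gamma>\<in>?U. chi \<Gamma> X * (ut_basis \<Gamma> * phi0 Y))"
    unfolding BB_def using is_ten_Ten(2)[OF assms(1) RR_DGP[OF assms(2)]] by (simp only: R)
  also have "\<dots> = phi0 X * phi0 Y"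
    unfolding phi0_def[of X] sum_distrib_right by (simp only: mult.assoc)
  finally show ?thesis .
qed

section \<open>Action of the bifunctor on morphisms\<close>

definition BL :: "amod \<Rightarrow> amod \<Rightarrow> amod \<Rightarrow> (elt \<Rightarrow> elt) \<Rightarrow> elt \<Rightarrow> elt" where
  "BL Y X X' f = tmp X X' (RR Y) (RR Y) f (idf (RR Y))"

definition RM :: "amod \<Rightarrow> amod \<Rightarrow> (elt \<Rightarrow> elt) \<Rightarrow> idx \<Rightarrow> elt \<Rightarrow> elt" where
  "RM Y Y' g \<Gamma> = tmp Y Y' (QQ \<Gamma>) (QQ \<Gamma>) g (idf (QQ \<Gamma>))"

definition BR :: "amod \<Rightarrow> amod \<Rightarrow> amod \<Rightarrow> (elt \<Rightarrow> elt) \<Rightarrow> elt \<Rightarrow> elt" where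
  "BR X Y Y' g = tmp X X (RR Y) (RR Y') (idm X) (RM Y Y' g)"

lemma model_functor_tmp:
  assumes Q: "\<And>\<Gamma>. Q \<Gamma> \<in> DGP"
  shows "model_functor (\<lambda>X. Ten X Q) (\<lambda>X X' f. tmp X X' Q Q f (idf Q))"
proof
  fix X assume X: "X \<in> DGP"
  show "Ten X Q \<in> DGP" using is_tenD(1)[OF is_ten_Ten(1)[OF X Q]] .
  show "tmp X X Q Q (idm X) (idf Q) = idm (Ten X Q)" using tmp_id[OF X Q] .
next
  fix X Y f k assume X: "X \<in> DGP" "Y \<in> DGP" and f: "f \<in> carrier (dg_hom k X Y)"
  interpret a: ten_objects X Y Q Q using X Q by unfold_locales
  note g = dg_hom_id[OF Q]
  show "tmp X Y Q Q f (idf Q) \<in> carrier (dg_hom k (Ten X Q) (Ten Y Q))" using a.tmp_hom(1)[OF f g] by simp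
  show "tmp X Y Q Q (dg_hom_diff X Y f) (idf Q) = dg_hom_diff (Ten X Q) (Ten Y Q) (tmp X Y Q Q f (idf Q))"
    by (rule tmp_diff_left[OF X(1) Q X(2) f])
  fix f' assume f': "f' \<in> carrier (dg_hom k X Y)"
  show "tmp X Y Q Q (\<lambda>x\<in>carrier X. f x \<oplus>\<^bsub>Y\<^esub> f' x) (idf Q) =
    (\<lambda>x\<in>carrier (Ten X Q). tmp X Y Q Q f (idf Q) x \<oplus>\<^bsub>Ten Y Q\<^esub> tmp X Y Q Q f' (idf Q) x)"
    by (rule a.tmp_plus(1)[OF f f' g g])
next
  fix X Y Z f g k l assume X: "X \<in> DGP" "Y \<in> DGP" "Z \<in> DGP" and f: "f \<in> carrier (dg_hom k X Y)" "g \<in> carrier (dg_hom l Y Z)"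
  show "tmp X Z Q Q (compose (carrier X) g f) (idf Q) =
    compose (carrier (Ten X Q)) (tmp Y Z Q Q g (idf Q)) (tmp X Y Q Q f (idf Q))"
    using tmp_compose[OF X(1) Q X(2) Q X(3) Q f dg_hom_id[OF Q] dg_hom_id[OF Q]] by (simp only: compose_idm_idm)
qed

interpretation RRf: model_functor "\<lambda>Y. Ten Y (QQ \<Gamma>)" "\<lambda>Y Y' g. tmp Y Y' (QQ \<Gamma>) (QQ \<Gamma>) g (idf (QQ \<Gamma>))" for \<Gamma>
  by (rule model_functor_tmp) (rule QQ)

lemma model_functor_BL:
  assumes "Y \<in> DGP" shows "model_functor (\<lambda>X. BB X Y) (BL Y)"
  unfolding BB_def BL_def using model_functor_tmp[of "RR Y", OF RR_DGP[OF assms]] .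

lemma RM_hom:
  "Y \<in> DGP \<Longrightarrow> Y' \<in> DGP \<Longrightarrow> g \<in> carrier (dg_hom k Y Y') \<Longrightarrow> RM Y Y' g \<Gamma> \<in> carrier (dg_hom k (RR Y \<Gamma>) (RR Y' \<Gamma>))"
  unfolding RM_def RR_def by (rule RRf.T_hom)

text \<open>In the second variable the functor is a composite: each axiom holds for the family
  \<open>RM\<close> by the result on the first tensor argument, and is then pushed through the right
  argument of the outer tensor product.\<close>

lemma model_functor_BR:
  assumes X: "X \<in> DGP" shows "model_functor (BB X) (BR X)"
proof
  fix Y assume Y: "Y \<in> DGP"
  show "BB X Y \<in> DGP" using BB_DGP[OF X Y] .
  have "RM Y Y (idm Y) = idf (RR Y)"
    unfolding RM_def RR_def using RRf.T_id[OF Y] by (intro ext) simp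
  then show "BR X Y Y (idm Y) = idm (BB X Y)"
    unfolding BR_def BB_def using tmp_id[OF X RR_DGP[OF Y]] by simp
next
  fix Y Y' g k assume Y: "Y \<in> DGP" "Y' \<in> DGP" and g: "g \<in> carrier (dg_hom k Y Y')"
  interpret a: ten_objects X X "RR Y" "RR Y'" using X Y RR_DGP by unfold_locales auto
  note f = dg_hom_id[OF X] and r = RM_hom[OF Y g]
  show "BR X Y Y' g \<in> carrier (dg_hom k (BB X Y) (BB X Y'))"
    unfolding BR_def BB_def using a.tmp_hom(1)[OF f r] by simp
  have "RM Y Y' (dg_hom_diff Y Y' g) = (\<lambda>\<Gamma>. dg_hom_diff (RR Y \<Gamma>) (RR Y' \<Gamma>) (RM Y Y' g \<Gamma>))"
    unfolding RM_def RR_def using RRf.T_diff[OF Y g] by (intro ext) simp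
  then show "BR X Y Y' (dg_hom_diff Y Y' g) = dg_hom_diff (BB X Y) (BB X Y') (BR X Y Y' g)"
    unfolding BR_def BB_def using tmp_diff_right[OF X RR_DGP[OF Y(1)] RR_DGP[OF Y(2)] r] by simp
  fix g' assume g': "g' \<in> carrier (dg_hom k Y Y')"
  note r' = RM_hom[OF Y g']
  have "RM Y Y' (\<lambda>x\<in>carrier Y. g x \<oplus>\<^bsub>Y'\<^esub> g' x) = (\<lambda>\<Gamma>. \<lambda>q\<in>carrier (RR Y \<Gamma>). RM Y Y' g \<Gamma> q \<oplus>\<^bsub>RR Y' \<Gamma>\<^esub> RM Y Y' g' \<Gamma> q)"
    unfolding RM_def RR_def using RRf.T_plus[OF Y g g'] by (intro ext) simp
  then show "BR X Y Y' (\<lambda>x\<in>carrier Y. g x \<oplus>\<^bsub>Y'\<^esub> g' x) =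
    (\<lambda>x\<in>carrier (BB X Y). BR X Y Y' g x \<oplus>\<^bsub>BB X Y'\<^esub> BR X Y Y' g' x)"
    unfolding BR_def BB_def using a.tmp_plus(2)[OF f f r r'] by simp
next
  fix Y Y' Y'' g g' k l assume Y: "Y \<in> DGP" "Y' \<in> DGP" "Y'' \<in> DGP" and g: "g \<in> carrier (dg_hom k Y Y')" "g' \<in> carrier (dg_hom l Y' Y'')"
  have "RM Y Y'' (compose (carrier Y) g' g) = (\<lambda>\<Gamma>. compose (carrier (RR Y \<Gamma>)) (RM Y' Y'' g' \<Gamma>) (RM Y Y' g \<Gamma>))"
    unfolding RM_def RR_def using RRf.T_compose[OF Y g] by (intro ext) simp
  then show "BR X Y Y'' (compose (carrier Y) g' g) = compose (carrier (BB X Y)) (BR X Y' Y'' g') (BR X Y Y' g)"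
    unfolding BR_def BB_def
    using tmp_compose[OF X RR_DGP[OF Y(1)] X RR_DGP[OF Y(2)] X RR_DGP[OF Y(3)] dg_hom_id[OF X] dg_hom_id[OF X]
        RM_hom[OF Y(1,2) g(1)] RM_hom[OF Y(2,3) g(2)]] by (simp add: compose_idm_idm)
qed

text \<open>Both composites are \<open>f \<otimes> g\<close>. This interchange makes a bifunctor out
  of the two families of one-variable functors.\<close>

lemma BL_BR:
  assumes X: "X \<in> DGP" "X' \<in> DGP" and Y: "Y \<in> DGP" "Y' \<in> DGP"
    and f: "f \<in> carrier (dg_hom k X X')" and g: "g \<in> carrier (dg_hom l Y Y')"
  shows "compose (carrier (BB X Y)) (BL Y' X X' f) (BR X Y Y' g) = compose (carrier (BB X Y)) (BR X' Y Y' g) (BL Y X X' f)"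
proof -
  note R = RR_DGP[OF Y(1)] RR_DGP[OF Y(2)]
  note r = RM_hom[OF Y g]
  have i: "compose (carrier (RR Y \<Gamma>)) (idm (RR Y' \<Gamma>)) (RM Y Y' g \<Gamma>) = RM Y Y' g \<Gamma>"
    "compose (carrier (RR Y \<Gamma>)) (RM Y Y' g \<Gamma>) (idm (RR Y \<Gamma>)) = RM Y Y' g \<Gamma>" for \<Gamma>
    using compose_idm[OF r] by auto
  show ?thesis
    using tmp_compose[OF X(1) R(1) X(1) R(2) X(2) R(2) dg_hom_id[OF X(1)] f r dg_hom_id[OF R(2)]]
      tmp_compose[OF X(1) R(1) X(2) R(1) X(2) R(2) f dg_hom_id[OF X(2)] dg_hom_id[OF R(1)] r]
    unfolding i compose_idm[OF f] by (simp add: BL_def BR_def BB_def)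
qed

abbreviation rp :: "(elt \<Rightarrow> elt) set \<Rightarrow> elt \<Rightarrow> elt" where "rp \<phi> \<equiv> SOME f. f \<in> \<phi>"

lemma rp_cocycles0:
  assumes "X \<in> DGP" "Y \<in> DGP" "\<phi> \<in> carrier (hom_H0 X Y)"
  shows "rp \<phi> \<in> cocycles0 X Y"
proof -
  obtain f where f: "f \<in> cocycles0 X Y" "\<phi> = hclass X Y f" using assms by (auto simp: hom_H0_carrier)
  then have "f \<in> \<phi>" using hclass_iff[OF assms(1,2) f(1)] by blast
  then have "rp \<phi> \<in> \<phi>" using someI[of "\<lambda>f. f \<in> \<phi>" f] by simp
  then show ?thesis using hclass_iff[OF assms(1,2) f(1)] f by blast
qed

context model_functor
begin

abbreviation hT :: "amod \<Rightarrow> amod \<Rightarrow> (elt \<Rightarrow> elt) set \<Rightarrow> hring" where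
  "hT X Y \<phi> \<equiv> hc (F X) (F Y) (T X Y (rp \<phi>))"

lemma hT_hF:
  assumes "X \<in> DGP" "Y \<in> DGP" "\<phi> \<in> carrier (hom_H0 X Y)"
  shows "hT X Y \<phi> = dg.hF X Y (hcl X Y \<phi>)"
  unfolding hcl_def by (rule T_cocycles0(2)[OF assms(1,2) rp_cocycles0[OF assms]])

lemma hT_Comp:
  assumes "X \<in> DGP" "Y \<in> DGP" "Z \<in> DGP" "\<phi> \<in> carrier (hom_H0 X Y)" "\<psi> \<in> carrier (hom_H0 Y Z)"
  shows "hT X Z (Comp HP X Y Z \<psi> \<phi>) = hT Y Z \<psi> * hT X Y \<phi>"
  using hT_hF[OF assms(1,3) hcl_Comp(1)[OF assms]] hcl_Comp(2)[OF assms] hT_hF[OF assms(1,2,4)] hT_hF[OF assms(2,3,5)]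
    dg.hF_mult[OF assms(1-3) hcl_hm[OF assms(1,2,4)] hcl_hm[OF assms(2,3,5)]] by simp

lemma hT_Ident: "X \<in> DGP \<Longrightarrow> hT X X (Ident HP X) = HPr.E (F X)"
  using hT_hF[of X X "Ident HP X"] hcl_Ident[of X] dg.hF_E[of X] by simp

lemma hT_hm: "X \<in> DGP \<Longrightarrow> Y \<in> DGP \<Longrightarrow> \<phi> \<in> carrier (hom_H0 X Y) \<Longrightarrow> hT X Y \<phi> \<in> HPr.hm (F X) (F Y)"
  by (simp add: hT_hF dg.hF_hm hcl_hm)

end

text \<open>A pair of morphisms acts through one variable after the other; the order chosen here is
  immaterial on classes by \<open>BM_hcl\<close>.\<close>

definition BM :: "amod \<Rightarrow> amod \<Rightarrow> amod \<Rightarrow> amod \<Rightarrow> (elt \<Rightarrow> elt) set \<Rightarrow> (elt \<Rightarrow> elt) set \<Rightarrow> (elt \<Rightarrow> elt) set" where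
  "BM X X' Y Y' \<phi> \<psi> = hclass (BB X Y) (BB X' Y') (compose (carrier (BB X Y)) (BL Y' X X' (rp \<phi>)) (BR X Y Y' (rp \<psi>)))"

abbreviation hL :: "amod \<Rightarrow> amod \<Rightarrow> amod \<Rightarrow> (elt \<Rightarrow> elt) set \<Rightarrow> hring" where
  "hL Y X X' \<phi> \<equiv> hc (BB X Y) (BB X' Y) (BL Y X X' (rp \<phi>))"
abbreviation hR :: "amod \<Rightarrow> amod \<Rightarrow> amod \<Rightarrow> (elt \<Rightarrow> elt) set \<Rightarrow> hring" where
  "hR X Y Y' \<psi> \<equiv> hc (BB X Y) (BB X Y') (BR X Y Y' (rp \<psi>))"

lemma BM_hcl:
  assumes X: "X \<in> DGP" "X' \<in> DGP" and Y: "Y \<in> DGP" "Y' \<in> DGP"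
    and \<phi>: "\<phi> \<in> carrier (hom_H0 X X')" and \<psi>: "\<psi> \<in> carrier (hom_H0 Y Y')"
  shows "BM X X' Y Y' \<phi> \<psi> \<in> carrier (hom_H0 (BB X Y) (BB X' Y'))"
    "hcl (BB X Y) (BB X' Y') (BM X X' Y Y' \<phi> \<psi>) = hL Y' X X' \<phi> * hR X Y Y' \<psi>"
    "hL Y' X X' \<phi> * hR X Y Y' \<psi> = hR X' Y Y' \<psi> * hL Y X X' \<phi>"
proof -
  note f = rp_cocycles0[OF X \<phi>] and g = rp_cocycles0[OF Y \<psi>]
  note B = BB_DGP[OF X(1) Y(1)] BB_DGP[OF X(1) Y(2)] BB_DGP[OF X(2) Y(2)] BB_DGP[OF X(2) Y(1)]
  note l = model_functor.T_cocycles0(1)[OF model_functor_BL[OF Y(2)] X f]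
  note r = model_functor.T_cocycles0(1)[OF model_functor_BR[OF X(1)] Y g]
  note l' = model_functor.T_cocycles0(1)[OF model_functor_BL[OF Y(1)] X f]
  note r' = model_functor.T_cocycles0(1)[OF model_functor_BR[OF X(2)] Y g]
  note c = cocycles0_compose[OF B(1,2,3) r l] and c' = cocycles0_compose[OF B(1,4,3) l' r']
  show "BM X X' Y Y' \<phi> \<psi> \<in> carrier (hom_H0 (BB X Y) (BB X' Y'))"
    unfolding BM_def by (rule hclass_mor[OF c(1)])
  show "hcl (BB X Y) (BB X' Y') (BM X X' Y Y' \<phi> \<psi>) = hL Y' X X' \<phi> * hR X Y Y' \<psi>"
    unfolding BM_def using hcl_hclass[OF B(1,3) c(1)] c(2) by simp
  show "hL Y' X X' \<phi> * hR X Y Y' \<psi> = hR X' Y Y' \<psi> * hL Y X X' \<phi>"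
    using c(2) c'(2) BL_BR[OF X Y cocycles0_dg_hom[OF f] cocycles0_dg_hom[OF g]] by simp
qed

lemma bifunctor_BM: "bifunctor HP HP HP BB BM"
  unfolding bifunctor_def HP_simps(1,2)
proof (intro conjI ballI)
  fix X Y assume X: "X \<in> DGP" and Y: "Y \<in> DGP"
  show B: "BB X Y \<in> DGP" using BB_DGP[OF X Y] .
  note I = hcl_Ident(1)[OF X] hcl_Ident(1)[OF Y]
  have "HPr.E (BB X Y) * HPr.E (BB X Y) = HPr.E (BB X Y)" using HPr.hm_left[OF HPr.hm_E[OF B]] .
  then show "BM X X Y Y (Ident HP X) (Ident HP Y) = Ident HP (BB X Y)"
    using BM_hcl(1,2)[OF X X Y Y I] hcl_Ident[OF B] model_functor.hT_Ident[OF model_functor_BL[OF Y] X]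
      model_functor.hT_Ident[OF model_functor_BR[OF X] Y]
    by (simp add: hcl_inject[OF B B])
next
  fix X X' Y Y' \<phi> \<psi>
  assume "X \<in> DGP" "X' \<in> DGP" "Y \<in> DGP" "Y' \<in> DGP" "\<phi> \<in> carrier (hom_H0 X X')" "\<psi> \<in> carrier (hom_H0 Y Y')"
  then show "BM X X' Y Y' \<phi> \<psi> \<in> carrier (hom_H0 (BB X Y) (BB X' Y'))" by (rule BM_hcl(1))
next
  fix X X' X'' Y Y' Y'' \<phi> \<phi>' \<psi> \<psi>'
  assume X: "X \<in> DGP" "X' \<in> DGP" "X'' \<in> DGP" and Y: "Y \<in> DGP" "Y' \<in> DGP" "Y'' \<in> DGP"
    and p: "\<phi> \<in> carrier (hom_H0 X X')" "\<phi>' \<in> carrier (hom_H0 X' X'')"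
    and q: "\<psi> \<in> carrier (hom_H0 Y Y')" "\<psi>' \<in> carrier (hom_H0 Y' Y'')"
  note cp = hcl_Comp(1)[OF X p] and cq = hcl_Comp(1)[OF Y q]
  note B = BB_DGP[OF X(1) Y(1)] BB_DGP[OF X(2) Y(2)] BB_DGP[OF X(3) Y(3)]
  note b = BM_hcl[OF X(1,2) Y(1,2) p(1) q(1)] and b' = BM_hcl[OF X(2,3) Y(2,3) p(2) q(2)]
    and b'' = BM_hcl[OF X(1,3) Y(1,3) cp cq]
  have "hcl (BB X Y) (BB X'' Y'') (BM X X'' Y Y'' (Comp HP X X' X'' \<phi>' \<phi>) (Comp HP Y Y' Y'' \<psi>' \<psi>))
    = hL Y'' X' X'' \<phi>' * (hL Y'' X X' \<phi> * hR X Y' Y'' \<psi>') * hR X Y Y' \<psi>"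
    using b''(2) model_functor.hT_Comp[OF model_functor_BL[OF Y(3)] X p] model_functor.hT_Comp[OF model_functor_BR[OF X(1)] Y q]
    by (simp add: mult.assoc)
  \<comment> \<open>Exchanging the two middle factors regroups the product into the composite of the
    two values of \<open>BM\<close>.\<close>
  also have "hL Y'' X X' \<phi> * hR X Y' Y'' \<psi>' = hR X' Y' Y'' \<psi>' * hL Y' X X' \<phi>"
    by (rule BM_hcl(3)[OF X(1,2) Y(2,3) p(1) q(2)])
  also have "hL Y'' X' X'' \<phi>' * (hR X' Y' Y'' \<psi>' * hL Y' X X' \<phi>) * hR X Y Y' \<psi> =
    hcl (BB X Y) (BB X'' Y'') (Comp HP (BB X Y) (BB X' Y') (BB X'' Y'') (BM X' X'' Y' Y'' \<phi>' \<psi>') (BM X X' Y Y' \<phi> \<psi>))"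
    using hcl_Comp(2)[OF B b(1) b'(1)] b(2) b'(2) by (simp add: mult.assoc)
  finally show "BM X X'' Y Y'' (Comp HP X X' X'' \<phi>' \<phi>) (Comp HP Y Y' Y'' \<psi>' \<psi>) =
    Comp HP (BB X Y) (BB X' Y') (BB X'' Y'') (BM X' X'' Y' Y'' \<phi>' \<psi>') (BM X X' Y Y' \<phi> \<psi>)"
    using b''(1) hcl_Comp(1)[OF B b(1) b'(1)] by (simp add: hcl_inject[OF B(1,3)])
qed

text \<open>With one argument an identity, \<open>BM\<close> induces on classes the one-variable DG
  functor \<open>BL\<close> or \<open>BR\<close>, and DG functors are exact.\<close>

lemma exact_BM: "exact_bifunctor HP HP HP BB BM"
  unfolding exact_bifunctor_def HP_simps(1)
proof (intro conjI ballI bifunctor_BM)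
  fix Y assume Y: "Y \<in> DGP"
  note I = hcl_Ident(1)[OF Y]
  show "exact_functor HP HP (\<lambda>X. BB X Y) (\<lambda>X X' \<phi>. BM X X' Y Y \<phi> (Ident HP Y))"
  proof (rule model_functor.exact_functor_of_hF[OF model_functor_BL[OF Y]], intro conjI)
    fix X X' \<phi> assume X: "X \<in> DGP" "X' \<in> DGP" and p: "\<phi> \<in> carrier (hom_H0 X X')"
    note b = BM_hcl[OF X Y Y p I]
    show "BM X X' Y Y \<phi> (Ident HP Y) \<in> carrier (hom_H0 (BB X Y) (BB X' Y))" by (rule b(1))
    have "hL Y X X' \<phi> * HPr.E (BB X Y) = hL Y X X' \<phi>"
      by (rule HPr.hm_right) (rule model_functor.hT_hm[OF model_functor_BL[OF Y] X p])
    with b(2) model_functor.hT_Ident[OF model_functor_BR[OF X(1)] Y] model_functor.hT_hF[OF model_functor_BL[OF Y] X p]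
    show "hcl (BB X Y) (BB X' Y) (BM X X' Y Y \<phi> (Ident HP Y)) =
      dg_functor.hF vdeg vD ve vcls (model_functor.Fr (\<lambda>X. BB X Y) (BL Y)) X X' (hcl X X' \<phi>)" by simp
  qed
next
  fix X assume X: "X \<in> DGP"
  note I = hcl_Ident(1)[OF X]
  show "exact_functor HP HP (BB X) (\<lambda>Y Y'. BM X X Y Y' (Ident HP X))"
  proof (rule model_functor.exact_functor_of_hF[OF model_functor_BR[OF X]], intro conjI)
    fix Y Y' \<psi> assume Y: "Y \<in> DGP" "Y' \<in> DGP" and q: "\<psi> \<in> carrier (hom_H0 Y Y')"
    note b = BM_hcl[OF X X Y I q]
    show "BM X X Y Y' (Ident HP X) \<psi> \<in> carrier (hom_H0 (BB X Y) (BB X Y'))" by (rule b(1))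
    have "HPr.E (BB X Y') * hR X Y Y' \<psi> = hR X Y Y' \<psi>"
      by (rule HPr.hm_left) (rule model_functor.hT_hm[OF model_functor_BR[OF X] Y q])
    with b(2) model_functor.hT_Ident[OF model_functor_BL[OF Y(2)] X] model_functor.hT_hF[OF model_functor_BR[OF X] Y q]
    show "hcl (BB X Y) (BB X Y') (BM X X Y Y' (Ident HP X) \<psi>) =
      dg_functor.hF vdeg vD ve vcls (model_functor.Fr (BB X) (BR X)) Y Y' (hcl Y Y' \<psi>)" by simp
  qed
qed

section \<open>The Grothendieck group\<close>

text \<open>The counterpart of \<open>frag_extend\<close> for values in \<open>ut\<close> instead of
  formal combinations.\<close>

definition fev :: "('a \<Rightarrow> ut) \<Rightarrow> ('a \<Rightarrow>\<^sub>0 int) \<Rightarrow> ut" where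
  "fev f c = (\<Sum>X\<in>Poly_Mapping.keys c. of_int (Poly_Mapping.lookup c X) * f X)"

lemma fev_superset: "finite S \<Longrightarrow> Poly_Mapping.keys c \<subseteq> S \<Longrightarrow> fev f c = (\<Sum>X\<in>S. of_int (Poly_Mapping.lookup c X) * f X)"
  unfolding fev_def by (rule sum.mono_neutral_left) (auto simp: in_keys_iff)

lemma fev_0 [simp]: "fev f 0 = 0" by (simp add: fev_def)

lemma fev_frag_of [simp]: "fev f (frag_of X) = f X"
  by (simp add: fev_def)

lemma fev_add: "fev f (c + d) = fev f c + fev f d"
proof -
  let ?S = "Poly_Mapping.keys c \<union> Poly_Mapping.keys d"
  have "fev f (c + d) = (\<Sum>X\<in>?S. of_int (Poly_Mapping.lookup (c + d) X) * f X)"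
    by (rule fev_superset) (use keys_add[of c d] in auto)
  also have "\<dots> = (\<Sum>X\<in>?S. of_int (Poly_Mapping.lookup c X) * f X) + (\<Sum>X\<in>?S. of_int (Poly_Mapping.lookup d X) * f X)"
    by (simp add: lookup_add distrib_right sum.distrib)
  finally show ?thesis by (simp add: fev_superset[of ?S c] fev_superset[of ?S d])
qed

lemma fev_minus: "fev f (- c) = - fev f c"
  using fev_add[of f c "- c"] by (simp add: minus_unique)

lemma fev_diff: "fev f (c - d) = fev f c - fev f d"
  using fev_add[of f c "- d"] by (simp add: fev_minus)

abbreviation "FG \<equiv> free_Abelian_group DGP"

lemma fev_group_hom: "group_hom FG ut_add_group (fev phi0)"
proof -
  have "group ut_add_group"
    unfolding ut_add_group_def by (rule groupI) (auto simp: add.assoc intro: exI[of _ "- x" for x])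
  moreover have "fev phi0 \<in> hom FG ut_add_group"
    by (rule homI) (simp_all add: ut_add_group_def fev_add)
  ultimately show ?thesis by (simp add: group_hom_def group_hom_axioms_def)
qed

lemma K0_rel_gens: "{frag_of Y - frag_of X - frag_of Z | X Y Z u v w. (X, Y, Z, u, v, w) \<in> Dist HP} \<subseteq> carrier FG"
proof clarify
  fix X Y Z u v w assume "(X, Y, Z, u, v, w) \<in> Dist HP"
  then have "X \<in> DGP" "Y \<in> DGP" "Z \<in> DGP" using Dist_HP_D(1) by (auto simp: htriangle_def)
  then show "frag_of Y - frag_of X - frag_of Z \<in> carrier FG"
    using keys_diff[of "frag_of Y - frag_of X" "frag_of Z"] keys_diff[of "frag_of Y" "frag_of X"] by fastforce
qed

lemma K0_rel_subgroup: "subgroup (K0_rel HP) FG"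
  unfolding K0_rel_def HP_simps(1) by (rule group.generate_is_subgroup[OF group_free_Abelian_group K0_rel_gens])

lemma K0_rel_0: "0 \<in> K0_rel HP"
  using subgroup.one_closed[OF K0_rel_subgroup] by simp

lemma K0_rel_add: "x \<in> K0_rel HP \<Longrightarrow> y \<in> K0_rel HP \<Longrightarrow> x + y \<in> K0_rel HP"
  using subgroup.m_closed[OF K0_rel_subgroup] by simp

lemma K0_rel_minus: "x \<in> K0_rel HP \<Longrightarrow> - x \<in> K0_rel HP"
  using subgroup.m_inv_closed[OF K0_rel_subgroup] subgroup.mem_carrier[OF K0_rel_subgroup] by fastforce

lemma K0_rel_diff: "x \<in> K0_rel HP \<Longrightarrow> y \<in> K0_rel HP \<Longrightarrow> x - y \<in> K0_rel HP"
  using K0_rel_add[OF _ K0_rel_minus] by fastforce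

lemma K0_rel_dist:
  assumes "HPr.dist X Y Z u v w" shows "frag_of Y - frag_of X - frag_of Z \<in> K0_rel HP"
proof -
  have D: "X \<in> DGP" "Y \<in> DGP" "Z \<in> DGP" "dg_shift 1 0 X \<in> DGP"
    and h: "u \<in> HPr.hm X Y" "v \<in> HPr.hm Y Z" "w \<in> HPr.hm Z (dg_shift 1 0 X)"
    using assms by (auto simp: HPr.dist_def DGP_shift)
  obtain U where U: "U \<in> carrier (hom_H0 X Y)" "hcl X Y U = u" using hcl_surj[OF D(1,2) h(1)] .
  obtain V where V: "V \<in> carrier (hom_H0 Y Z)" "hcl Y Z V = v" using hcl_surj[OF D(2,3) h(2)] .
  obtain W where W: "W \<in> carrier (hom_H0 Z (dg_shift 1 0 X))" "hcl Z (dg_shift 1 0 X) W = w" using hcl_surj[OF D(3,4) h(3)] .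
  have "(X, Y, Z, U, V, W) \<in> Dist HP" using assms U V W D by (simp add: Dist_HP htriangle_def)
  then show ?thesis unfolding K0_rel_def by (blast intro: generate.incl)
qed

lemma K0_rel_cone:
  assumes "M \<in> DGP" "N \<in> DGP" "f \<in> cocycles0 M N"
  shows "frag_of N - frag_of M - frag_of (mcone M N f) \<in> K0_rel HP"
  using K0_rel_dist[OF HPr.cone_dist[OF assms(1,2) emb_cyc[OF assms]]] fn_emb[OF assms(1,2) cocycles0_addmap[OF assms(3)]]
  by (simp add: vcn_def)

text \<open>The triangle \<open>X -> X -> Z\<close> with contractible \<open>Z\<close> gives
  \<open>[Z] = 0\<close>, and its rotation \<open>X -> Z -> X[1]\<close> then gives
  \<open>[X[1]] = -[X]\<close>.\<close>

lemma K0_rel_shift1: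
  assumes "X \<in> DGP" shows "frag_of (dg_shift 1 0 X) + frag_of X \<in> K0_rel HP"
proof -
  let ?Z = "vcn X X (ve X)"
  have Z: "?Z \<in> DGP" "HPr.E ?Z = 0" using HPr.cone[OF assms assms HPr.cyc_e[OF assms]] HPr.cone_E_zero[OF assms] by auto
  note d = HPr.dist_ident[OF assms Z]
  from K0_rel_dist[OF d] have 1: "- frag_of ?Z \<in> K0_rel HP" by simp
  from K0_rel_dist[OF HPr.dist_rotate[OF d]]
  have 2: "frag_of ?Z - frag_of X - frag_of (dg_shift 1 0 X) \<in> K0_rel HP" .
  from K0_rel_minus[OF K0_rel_add[OF 1 2]] show ?thesis by (simp add: add.commute)
qed

lemma K0_rel_shift:
  assumes "X \<in> DGP" shows "frag_of (dg_shift k 0 X) - frag_cmul (sg k) (frag_of X) \<in> K0_rel HP"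
proof (induction k rule: int_induct[of _ 0])
  case base
  then show ?case using K0_rel_0 by (simp add: shift_zero sg_def)
next
  case (step1 k)
  have "frag_of (dg_shift (k + 1) 0 X) + frag_of (dg_shift k 0 X) \<in> K0_rel HP"
    using K0_rel_shift1[OF DGP_shift[OF assms, of k 0]] by (simp add: shift_shift add.commute)
  from K0_rel_diff[OF this step1(2)] show ?case by (cases "even k") (simp_all add: sg_def)
next
  case (step2 k)
  have "frag_of (dg_shift k 0 X) + frag_of (dg_shift (k - 1) 0 X) \<in> K0_rel HP"
    using K0_rel_shift1[OF DGP_shift[OF assms, of "k - 1" 0]] by (simp add: shift_shift)
  from K0_rel_diff[OF this step2(2)] show ?case by (cases "even k") (simp_all add: sg_def)
qed

definition basis_frag :: "int \<times> idx \<Rightarrow> amod \<Rightarrow>\<^sub>0 int" where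
  "basis_frag p = frag_of (dg_shift 0 (fst p) (projA (snd p)))"

text \<open>An equality rather than an isomorphism: shifting touches neither the carrier nor the
  underlying map, and the differential acquires no sign.\<close>

lemma dg_shift_cone: "dg_shift k m (mcone M N f) = mcone (dg_shift k m M) (dg_shift k m N) f"
  by (simp add: dg_shift_def mcone_def fun_eq_iff algebra_simps)

text \<open>Quantifying over all shifts absorbs the shift step of the induction; in the cone step
  the shifted cone is the cone of the shifted objects, and its class is a difference.\<close>

lemma K0_generated_obj:
  assumes "X \<in> DGP"
  shows "\<exists>n. frag_of (dg_shift k m X) - frag_extend basis_frag n \<in> K0_rel HP"
  using assms
proof (induction arbitrary: k m)
  case (DGP_proj \<Gamma>)
  have "frag_of (dg_shift k 0 (dg_shift 0 m (projA \<Gamma>))) - frag_cmul (sg k) (frag_of (dg_shift 0 m (projA \<Gamma>))) \<in> K0_rel HP"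
    by (rule K0_rel_shift) (intro DGP_shift DGP.DGP_proj)
  then show ?case
    by (intro exI[of _ "frag_cmul (sg k) (frag_of (m, \<Gamma>))"]) (simp add: shift_shift frag_extend_cmul basis_frag_def)
next
  case (DGP_shift M k' m')
  then show ?case by (simp add: shift_shift)
next
  case (DGP_cone M N f)
  obtain a b where a: "frag_of (dg_shift k m M) - frag_extend basis_frag a \<in> K0_rel HP"
    and b: "frag_of (dg_shift k m N) - frag_extend basis_frag b \<in> K0_rel HP" using DGP_cone.IH by blast
  have "f \<in> cocycles0 (dg_shift k m M) (dg_shift k m N)"
    using DGP_cone.hyps by (simp add: cocycles0_def dg_hom_shift dg_hom_diff_shift shift_sel)
  from K0_rel_cone[OF _ _ this]
  have "frag_of (dg_shift k m N) - frag_of (dg_shift k m M) - frag_of (dg_shift k m (mcone M N f)) \<in> K0_rel HP"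
    using DGP_cone.hyps by (simp add: DGP_shift dg_shift_cone)
  from K0_rel_diff[OF K0_rel_diff[OF b a] this]
  have "frag_of (dg_shift k m (mcone M N f)) - frag_extend basis_frag (b - a) \<in> K0_rel HP"
    by (simp add: frag_extend_diff algebra_simps)
  then show ?case by blast
qed

lemma K0_generated:
  assumes "Poly_Mapping.keys c \<subseteq> DGP"
  shows "\<exists>n. c - frag_extend basis_frag n \<in> K0_rel HP"
  proof (rule free_Abelian_group_induct[OF assms])
  show "\<exists>n. 0 - frag_extend basis_frag n \<in> K0_rel HP"
    using K0_rel_0 by (intro exI[of _ 0]) simp
next
  fix x y :: "amod \<Rightarrow>\<^sub>0 int"
  assume "\<exists>n. x - frag_extend basis_frag n \<in> K0_rel HP" "\<exists>n. y - frag_extend basis_frag n \<in> K0_rel HP"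
  then obtain a b where "x - frag_extend basis_frag a \<in> K0_rel HP" "y - frag_extend basis_frag b \<in> K0_rel HP" by blast
  from K0_rel_diff[OF this] show "\<exists>n. x - y - frag_extend basis_frag n \<in> K0_rel HP"
    by (intro exI[of _ "a - b"]) (simp add: frag_extend_diff algebra_simps)
next
  fix X assume "X \<in> DGP"
  from K0_generated_obj[OF this, of 0 0] show "\<exists>n. frag_of X - frag_extend basis_frag n \<in> K0_rel HP"
    by (simp add: shift_zero)
qed

lemma fev_basis: "fev phi0 (frag_extend basis_frag n) = ut_comb n"
proof -
  have e: "ut_comb n = fev (\<lambda>(m, \<Gamma>). Tpow m * ut_basis \<Gamma>) n" for n
    unfolding ut_comb_def fev_def by (intro sum.cong refl) auto
  have "Poly_Mapping.keys n \<subseteq> UNIV" by simp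
  then show ?thesis unfolding e
    by (induction rule: free_Abelian_group_induct)
      (auto simp: frag_extend_diff fev_diff basis_frag_def phi0_shift phi0_proj sg_def)
qed

text \<open>Additivity on triangles gives one inclusion. Conversely, an element of the kernel is
  modulo relations a combination of the classes of the \<open>P(\<Gamma>){m}\<close>; its image
  vanishes, and linear independence makes the combination trivial.\<close>

lemma kernel_fev: "kernel FG ut_add_group (fev phi0) = K0_rel HP"
proof
  interpret group_hom FG ut_add_group "fev phi0" by (rule fev_group_hom)
  have "{frag_of Y - frag_of X - frag_of Z | X Y Z u v w. (X, Y, Z, u, v, w) \<in> Dist HP} \<subseteq> kernel FG ut_add_group (fev phi0)"
    using K0_rel_gens phi0_Dist unfolding kernel_def ut_add_group_def
    by (fastforce simp: fev_diff)
  then show "K0_rel HP \<subseteq> kernel FG ut_add_group (fev phi0)"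
    unfolding K0_rel_def HP_simps(1) by (rule G.generate_subgroup_incl[OF _ subgroup_kernel])
  show "kernel FG ut_add_group (fev phi0) \<subseteq> K0_rel HP"
  proof
    fix c assume "c \<in> kernel FG ut_add_group (fev phi0)"
    then have c: "Poly_Mapping.keys c \<subseteq> DGP" "fev phi0 c = 0" by (auto simp: kernel_def ut_add_group_def)
    obtain n where n: "c - frag_extend basis_frag n \<in> K0_rel HP" using K0_generated[OF c(1)] by blast
    then have "fev phi0 (c - frag_extend basis_frag n) = 0"
      using \<open>K0_rel HP \<subseteq> kernel FG ut_add_group (fev phi0)\<close> by (auto simp: kernel_def ut_add_group_def)
    then have "ut_comb n = 0" using c by (simp add: fev_diff fev_basis)
    then have "n = 0" by (rule ut_comb_inj)
    then show "c \<in> K0_rel HP" using n by simp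
  qed
qed

lemma fev_surj: "fev phi0 ` carrier FG = carrier ut_add_group"
proof -
  have "\<exists>c. Poly_Mapping.keys c \<subseteq> DGP \<and> fev phi0 c = x" for x
    proof -
    obtain M where "M \<in> DGP" "phi0 M = x" using phi0_surj[of x] by blast
    then show ?thesis by (intro exI[of _ "frag_of M"]) simp
  qed
  then have "UNIV \<subseteq> fev phi0 ` carrier FG" by (metis (mono_tags) carrier_free_Abelian_group_iff imageI subsetI)
  then show ?thesis by (auto simp: ut_add_group_def)
qed

definition K0_ut :: "(amod \<Rightarrow>\<^sub>0 int) set \<Rightarrow> ut" where
  "K0_ut x = the_elem (fev phi0 ` x)"

lemma K0_ut_iso: "K0_ut \<in> iso (K0 HP) ut_add_group"
  using group_hom.FactGroup_iso_set[OF fev_group_hom fev_surj]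
  unfolding kernel_fev K0_def HP_simps(1) K0_ut_def[abs_def] .

text \<open>Since the relations are the kernel of \<open>fev phi0\<close>, a coset is a fibre of
  that map. Independence of representatives is decided by comparing values in
  \<open>ut\<close>.\<close>

lemma K0_coset_mem:
  assumes "Poly_Mapping.keys c \<subseteq> DGP"
  shows "d \<in> K0_coset HP c \<longleftrightarrow> Poly_Mapping.keys d \<subseteq> DGP \<and> fev phi0 d = fev phi0 c"
proof -
  have "d \<in> K0_coset HP c \<longleftrightarrow> d - c \<in> K0_rel HP"
    unfolding K0_coset_def r_coset_def by (auto intro: bexI[of _ "d - c"])
  also have "\<dots> \<longleftrightarrow> Poly_Mapping.keys (d - c) \<subseteq> DGP \<and> fev phi0 d = fev phi0 c"
    unfolding kernel_fev[symmetric] kernel_def by (simp add: ut_add_group_def fev_diff)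
  also have "Poly_Mapping.keys (d - c) \<subseteq> DGP \<longleftrightarrow> Poly_Mapping.keys d \<subseteq> DGP"
    using keys_diff[of d c] keys_add[of "d - c" c] assms by auto
  finally show ?thesis .
qed

lemma K0_ut_coset:
  assumes "Poly_Mapping.keys c \<subseteq> DGP" shows "K0_ut (K0_coset HP c) = fev phi0 c"
proof -
  have "fev phi0 ` K0_coset HP c = {fev phi0 c}"
    using assms by (auto simp: K0_coset_mem[OF assms] image_iff)
  then show ?thesis by (simp add: K0_ut_def)
qed

lemma K0_carrier:
  assumes "x \<in> carrier (K0 HP)"
  obtains c where "Poly_Mapping.keys c \<subseteq> DGP" "x = K0_coset HP c"
  using assms by (auto simp: K0_def FactGroup_def RCOSETS_def K0_coset_def)

lemma K0_coset_eqI: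
  assumes "Poly_Mapping.keys c \<subseteq> DGP" "Poly_Mapping.keys d \<subseteq> DGP" "fev phi0 c = fev phi0 d"
  shows "K0_coset HP c = K0_coset HP d"
  using assms by (auto simp: K0_coset_mem)

lemma K0_coset_self: "Poly_Mapping.keys c \<subseteq> DGP \<Longrightarrow> c \<in> K0_coset HP c"
  by (simp add: K0_coset_mem)

lemma keys_frag_extend_DGP:
  assumes "Poly_Mapping.keys c \<subseteq> DGP" "\<And>X. X \<in> DGP \<Longrightarrow> Poly_Mapping.keys (b X) \<subseteq> DGP"
  shows "Poly_Mapping.keys (frag_extend b c) \<subseteq> DGP"
  using keys_frag_extend[of b c] assms by blast

text \<open>As \<open>U_T\<close> is not commutative, the constant factor is treated on each side
  separately: on the left when the second argument of the product varies, on the right when the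
  first does.\<close>

lemma fev_extend_left:
  assumes "Poly_Mapping.keys c \<subseteq> DGP" "\<And>X. X \<in> DGP \<Longrightarrow> fev phi0 (b X) = y * phi0 X"
  shows "fev phi0 (frag_extend b c) = y * fev phi0 c"
  by (rule free_Abelian_group_induct[OF assms(1)]) (simp_all add: assms(2) frag_extend_diff fev_diff right_diff_distrib)

lemma fev_extend_right:
  assumes "Poly_Mapping.keys c \<subseteq> DGP" "\<And>X. X \<in> DGP \<Longrightarrow> fev phi0 (b X) = phi0 X * y"
  shows "fev phi0 (frag_extend b c) = fev phi0 c * y"
  by (rule free_Abelian_group_induct[OF assms(1)]) (simp_all add: assms(2) frag_extend_diff fev_diff left_diff_distrib)

lemma K0_ut_map:
  assumes "x \<in> carrier (K0 HP)"
  shows "K0_ut (K0_map HP HP (dg_shift 0 1) x) = utT * K0_ut x"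
proof -
  obtain c where c: "Poly_Mapping.keys c \<subseteq> DGP" "x = K0_coset HP c" using K0_carrier[OF assms] .
  let ?b = "\<lambda>X. frag_of (dg_shift 0 1 X)"
  have k: "Poly_Mapping.keys (frag_extend ?b d) \<subseteq> DGP" if "Poly_Mapping.keys d \<subseteq> DGP" for d
    by (rule keys_frag_extend_DGP[OF that]) (simp add: DGP_shift)
  have v: "fev phi0 (frag_extend ?b d) = utT * fev phi0 d" if "Poly_Mapping.keys d \<subseteq> DGP" for d
    by (rule fev_extend_left[OF that]) (use Tpow_Suc[of 0] in \<open>simp add: phi0_shift sg_def\<close>)
  have "K0_map HP HP (dg_shift 0 1) x = K0_coset HP (frag_extend ?b c)"
    unfolding K0_map_def
  proof (rule SUP_eq_const)
    show "x \<noteq> {}" using K0_coset_self[OF c(1)] c(2) by blast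
    fix d assume "d \<in> x"
    then have "Poly_Mapping.keys d \<subseteq> DGP" "fev phi0 d = fev phi0 c" by (simp_all add: c K0_coset_mem)
    then show "K0_coset HP (frag_extend ?b d) = K0_coset HP (frag_extend ?b c)"
      using k v c(1) by (intro K0_coset_eqI) simp_all
  qed
  then show ?thesis using K0_ut_coset[OF k[OF c(1)]] K0_ut_coset[OF c(1)] v[OF c(1)] c(2) by simp
qed

text \<open>The value of the biadditive extension depends only on the values of the two
  representatives, so the union collapses, and on objects the claim is
  \<open>phi0_BB\<close>.\<close>

lemma K0_ut_bimap:
  assumes "x \<in> carrier (K0 HP)" "y \<in> carrier (K0 HP)"
  shows "K0_ut (K0_bimap HP HP HP BB x y) = K0_ut x * K0_ut y"
proof -
  obtain c where c: "Poly_Mapping.keys c \<subseteq> DGP" "x = K0_coset HP c" using K0_carrier[OF assms(1)] .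
  obtain d where d: "Poly_Mapping.keys d \<subseteq> DGP" "y = K0_coset HP d" using K0_carrier[OF assms(2)] .
  let ?b = "\<lambda>c d. frag_extend (\<lambda>X. frag_extend (\<lambda>Y. frag_of (BB X Y)) d) c"
  have ki: "Poly_Mapping.keys (frag_extend (\<lambda>Y. frag_of (BB X Y)) d) \<subseteq> DGP" if "X \<in> DGP" "Poly_Mapping.keys d \<subseteq> DGP" for X d
    by (rule keys_frag_extend_DGP[OF that(2)]) (simp add: BB_DGP that)
  have k: "Poly_Mapping.keys (?b c d) \<subseteq> DGP" if "Poly_Mapping.keys c \<subseteq> DGP" "Poly_Mapping.keys d \<subseteq> DGP" for c d
    by (rule keys_frag_extend_DGP[OF that(1)]) (rule ki[OF _ that(2)])
  have v: "fev phi0 (?b c d) = fev phi0 c * fev phi0 d" if "Poly_Mapping.keys c \<subseteq> DGP" "Poly_Mapping.keys d \<subseteq> DGP" for c d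
  proof (rule fev_extend_right[OF that(1)])
    fix X assume X: "X \<in> DGP"
    show "fev phi0 (frag_extend (\<lambda>Y. frag_of (BB X Y)) d) = phi0 X * fev phi0 d"
      by (rule fev_extend_left[OF that(2)]) (simp add: phi0_BB X)
  qed
  have ne: "x \<noteq> {}" "y \<noteq> {}" using K0_coset_self[OF c(1)] K0_coset_self[OF d(1)] c(2) d(2) by blast+
  have "K0_coset HP (?b c' d') = K0_coset HP (?b c d)" if "c' \<in> x" "d' \<in> y" for c' d'
  proof -
    have "Poly_Mapping.keys c' \<subseteq> DGP" "fev phi0 c' = fev phi0 c" using that by (simp_all add: c K0_coset_mem)
    moreover have "Poly_Mapping.keys d' \<subseteq> DGP" "fev phi0 d' = fev phi0 d" using that by (simp_all add: d K0_coset_mem)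
    ultimately show ?thesis using k v c(1) d(1) by (intro K0_coset_eqI) simp_all
  qed
  then have "K0_bimap HP HP HP BB x y = K0_coset HP (?b c d)"
    unfolding K0_bimap_def using ne by (intro SUP_eq_const) simp_all
  then show ?thesis
    using K0_ut_coset[OF k[OF c(1) d(1)]] K0_ut_coset[OF c(1)] K0_ut_coset[OF d(1)] v[OF c(1) d(1)] c(2) d(2) by simp
qed

lemma K0_identification_K0_ut: "K0_identification K0_ut"
  unfolding K0_identification_def
proof (intro conjI ballI allI)
  fix \<Gamma>
  have "Poly_Mapping.keys (frag_of (projA \<Gamma>)) \<subseteq> DGP" by (simp add: DGP_proj)
  then show "K0_ut (K0_class HP (projA \<Gamma>)) = ut_basis \<Gamma>"
    unfolding K0_class_def by (simp add: K0_ut_coset phi0_proj)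
qed (simp_all add: K0_ut_iso K0_ut_map)

theorem theorem1p1:
  "triangulated_category HP \<and>
   (\<exists>\<phi>. K0_identification \<phi> \<and>
     (\<exists>M Mm. exact_bifunctor HP HP HP M Mm \<and>
        (\<forall>x \<in> carrier (K0 HP). \<forall>y \<in> carrier (K0 HP).
           \<phi> (K0_bimap HP HP HP M x y) = \<phi> x * \<phi> y)))"
  using triangulated_HP K0_identification_K0_ut exact_BM K0_ut_bimap by blast

end
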